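(* Let $\alpha\in(0,1)$ and assume (in addition to the standing assumptions of the context) that $V_0$ is not almost everywhere zero and that $(1+|\cdot|)V_0,\ (1+|\cdot|)V_1\in L^1(\mathbb{R})$. Then there exists $\varepsilon_0>0$ such that for any $\varepsilon\in(0,\varepsilon_0)$, $\mathcal{L}_{\varepsilon,\alpha}$ has one negative eigenvalue $\lambda_{\varepsilon,\alpha}$ satisfying $$\lambda_{\varepsilon,\alpha}=-\frac14\varepsilon^{4-2\alpha}\left(\int_{\mathbb{R}}V_0\right)^2+\mathcal{O}\big(\varepsilon^{\min\{4,6-4\alpha\}}\big),$$ with corresponding $L^2$-normalized eigenfunction $\psi_{\varepsilon,\alpha}$ (with suitably chosen sign) satisfying $$\big\|\psi_{\varepsilon,\alpha}-\varphi^{\mathsf{eff}}_{\varepsilon,\alpha}\big\|_{L^2(\mathbb{R})}=\mathcal{O}(\varepsilon^{2\alpha}),$$ where $\varphi^{\mathsf{eff}}_{\varepsilon,\alpha}$ is the unique $L^2$-normalized eigenfunction (with suitably chosen sign) of $\mathcal{L}^{\mathsf{eff}}_{\varepsilon,\alpha}$. Moreover $$\left\|\varphi^{\mathsf{eff}}_{\varepsilon,\alpha}(x)-\left(\frac{\varepsilon^{2-\alpha}}{2}\int_{\mathbb{R}}|V_0|\right)^{\frac12}\exp\Big(|x|\frac{\varepsilon^{2-\alpha}}{2}\int_{\mathbb{R}}V_0\Big)\right\|_{L^2(\mathbb{R})}=\mathcal{O}\big(\varepsilon^{\min\{\frac43(1-\alpha),\,1+\alpha\}}\big).$$ If it exists,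 any other negative eigenvalue $\tilde\lambda_{\varepsilon,\alpha}$ of $\mathcal{L}_{\varepsilon,\alpha}$ satisfies $\tilde\lambda_{\varepsilon,\alpha}=\mathcal{O}(\varepsilon^4)$.
   Context: Notation: $\mathbb{T}=\mathbb{R}/\mathbb{Z}$, $D_x=\frac1i\frac{d}{dx}$ (similarly $D_y,D_X$), $\langle X\rangle=(1+|X|^2)^{1/2}$. $W^{\ell,\infty}(\mathbb{R}\times\mathbb{T}):=W^{\ell,\infty}(\mathbb{R};L^\infty(\mathbb{T}))$, with norm $\sup_{0\le l\le \ell}\|\partial_X^l q\|_{L^\infty(\mathbb{R}\times\mathbb{T})}$. The potential $q=q(X,y)$ is real-valued, $1$-periodic in $y$. For fixed $X$, $Q(X,\cdot)$ is the unique solution of $D_y^2Q(X,y)=-q(X,y)$ on $\mathbb{T}$ with $\int_{\mathbb{T}}Q(X,y)\,dy=0$, and $$V_0(X)=-\int_{\mathbb{T}}|\partial_yQ|^2(X,y)\,dy,\qquad V_1(X)=2\int_{\mathbb{T}}(\partial_XQ)(\partial_yQ)(X,y)\,dy .$$ Standing assumptions: $q\in W^{5,\infty}(\mathbb{R}\times\mathbb{T})$, $\int_{\mathbb{T}}q(X,y)\,dy=0$ for all $X$, $\langle\cdot\rangle V_0'\in L^\infty(\mathbb{R})$, $\langle\cdot\rangle V_1'\in L^\infty(\mathbb{R})$, and $V_0(X),V_1(X)\to0$ as $|X|\to\infty$. Operators on $L^2(\mathbb{R})$ (with domain $H^2(\mathbb{R})$): $$\mathcal{L}_{\varepsilon,\alpha}=D_x^2+q(\varepsilon^\alpha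 x,x/\varepsilon),\qquad \mathcal{L}^{\mathsf{eff}}_{\varepsilon,\alpha}=D_x^2+\varepsilon^2V_0(\varepsilon^\alpha x)+\varepsilon^{3+\alpha}V_1(\varepsilon^\alpha x).$$ For $\varepsilon$ small, $\mathcal{L}^{\mathsf{eff}}_{\varepsilon,\alpha}$ has a unique negative eigenvalue, which is simple; "its eigenfunction" refers to this eigenvalue. The $\mathcal{O}(\cdot)$ are as $\varepsilon\to0$, with constants depending on $q$ and $\alpha$ but not on $\varepsilon$. *)

theory Defs
  imports "HOL-Analysis.Analysis"
begin

section \<open>Weak derivatives and function spaces on the real line\<close>

definition test_functions :: "(real \<Rightarrow> real) set" where
  "test_functions =
     {\<phi>. (\<forall>n x. (deriv ^^ n) \<phi> differentiable (at x)) \<and> compact (closure {x. \<phi> x \<noteq> 0})}"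

definition locally_integrable :: "(real \<Rightarrow> 'a::{banach, second_countable_topology}) \<Rightarrow> bool" where
  "locally_integrable f \<longleftrightarrow> (\<forall>a b. set_integrable lborel {a..b} f)"

definition has_weak_deriv ::
    "nat \<Rightarrow> (real \<Rightarrow> 'a::{banach, second_countable_topology}) \<Rightarrow> (real \<Rightarrow> 'a) \<Rightarrow> bool" where
  "has_weak_deriv n f g \<longleftrightarrow>
     locally_integrable f \<and> locally_integrable g \<and>
     (\<forall>\<phi>\<in>test_functions.
        (LINT x|lborel. (deriv ^^ n) \<phi> x *\<^sub>R f x) = (- 1) ^ n *\<^sub>R (LINT x|lborel. \<phi> x *\<^sub>R g x))"

text \<open>Elements of \<open>L\<^sup>2\<close>, \<open>L\<^sup>\<infinity>\<close> and \<open>H\<^sup>2\<close> are given by Borel measurable representatives;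
  equality of elements is equality almost everywhere.\<close>

definition L2 :: "(real \<Rightarrow> 'a::{banach, second_countable_topology}) set" where
  "L2 = {f. f \<in> borel_measurable lborel \<and> integrable lborel (\<lambda>x. (norm (f x))\<^sup>2)}"

definition L2_norm :: "(real \<Rightarrow> 'a::{banach, second_countable_topology}) \<Rightarrow> real" where
  "L2_norm f = sqrt (LINT x|lborel. (norm (f x))\<^sup>2)"

definition Linf :: "('a::euclidean_space \<Rightarrow> real) set" where
  "Linf = {f. f \<in> borel_measurable lborel \<and> (\<exists>C. AE x in lborel. \<bar>f x\<bar> \<le> C)}"

definition H2 :: "(real \<Rightarrow> complex) set" where
  "H2 = {f \<in> L2. (\<exists>g\<in>L2. has_weak_deriv 1 f g) \<and> (\<exists>h\<in>L2. has_weak_deriv 2 f h)}"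


section \<open>Schroedinger operators\<close>

text \<open>Graph of the operator \<open>D\<^sub>x\<^sup>2 + V\<close> on complex \<open>L\<^sup>2\<close> with domain \<open>H\<^sup>2\<close>, where
  \<open>D\<^sub>x = (1/\<i>) d/dx\<close> and hence \<open>D\<^sub>x\<^sup>2 f = - f''\<close>.\<close>

definition schroedinger_op :: "(real \<Rightarrow> real) \<Rightarrow> (real \<Rightarrow> complex) \<Rightarrow> (real \<Rightarrow> complex) \<Rightarrow> bool" where
  "schroedinger_op V f h \<longleftrightarrow>
     f \<in> H2 \<and> h \<in> L2 \<and>
     (\<exists>g. has_weak_deriv 2 f g \<and> (AE x in lborel. h x = - g x + complex_of_real (V x) * f x))"

definition eigenfunction :: "(real \<Rightarrow> real) \<Rightarrow> real \<Rightarrow> (real \<Rightarrow> complex) \<Rightarrow> bool" where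
  "eigenfunction V \<nu> f \<longleftrightarrow>
     \<not> (AE x in lborel. f x = 0) \<and> schroedinger_op V f (\<lambda>x. complex_of_real \<nu> * f x)"

definition eigenvalue :: "(real \<Rightarrow> real) \<Rightarrow> real \<Rightarrow> bool" where
  "eigenvalue V \<nu> \<longleftrightarrow> (\<exists>f. eigenfunction V \<nu> f)"

definition simple_eigenvalue :: "(real \<Rightarrow> real) \<Rightarrow> real \<Rightarrow> bool" where
  "simple_eigenvalue V \<nu> \<longleftrightarrow> eigenvalue V \<nu> \<and>
     (\<forall>f g. eigenfunction V \<nu> f \<and> eigenfunction V \<nu> g \<longrightarrow> (\<exists>c. AE x in lborel. g x = c * f x))"

text \<open>Real-valued, so that for a simple eigenvalue it is unique up to a sign.\<close>

definition normalized_eigenfunction :: "(real \<Rightarrow> real) \<Rightarrow> real \<Rightarrow> (real \<Rightarrow> real) \<Rightarrow> bool" where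
  "normalized_eigenfunction V \<nu> \<psi> \<longleftrightarrow>
     eigenfunction V \<nu> (\<lambda>x. complex_of_real (\<psi> x)) \<and> L2_norm \<psi> = 1"


section \<open>The two-scale potential and the effective potential\<close>

text \<open>The space \<open>W\<^bsup>l,\<infinity>\<^esup>(\<real>; L\<^sup>\<infinity>(\<real>/\<int>))\<close>; functions on \<open>\<real>/\<int>\<close> are 1-periodic
  functions on \<open>\<real>\<close>. The value of \<open>q\<close> along the curve \<open>x \<mapsto> (\<epsilon>\<^sup>\<alpha> x, x/\<epsilon>)\<close>, which is a null set
  of the plane, and its slices at every fixed \<open>X\<close> are meaningful only for the representative of
  \<open>q\<close> that is continuous in \<open>X\<close> for almost every \<open>y\<close>; for \<open>l \<ge> 1\<close> such a representative exists,
  and it is the one used here.\<close>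

definition W_inf :: "nat \<Rightarrow> (real \<Rightarrow> real \<Rightarrow> real) set" where
  "W_inf l = {q.
     (\<lambda>(X, y). q X y) \<in> borel_measurable lborel \<and>
     (\<forall>X y. q X (y + 1) = q X y) \<and>
     (AE y in lborel. continuous_on UNIV (\<lambda>X. q X y)) \<and>
     (\<forall>j\<le>l. \<exists>g. (\<lambda>(X, y). g X y) \<in> Linf \<and>
        (AE y in lborel. has_weak_deriv j (\<lambda>X. q X y) (\<lambda>X. g X y)))}"

text \<open>\<open>cell_solution q X\<close> is the function \<open>Q(X, \<cdot>)\<close>: the equation \<open>D\<^sub>y\<^sup>2 Q = - q\<close> reads
  \<open>\<partial>\<^sub>y\<^sup>2 Q = q\<close>. Continuity selects the representative, which is then continuously differentiable
  in \<open>y\<close>.\<close>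

definition cell_solution :: "(real \<Rightarrow> real \<Rightarrow> real) \<Rightarrow> real \<Rightarrow> real \<Rightarrow> real" where
  "cell_solution q X = (THE u. continuous_on UNIV u \<and> (\<forall>y. u (y + 1) = u y) \<and>
     has_weak_deriv 2 u (q X) \<and> (LINT y:{0..1}|lborel. u y) = 0)"

definition V0 :: "(real \<Rightarrow> real \<Rightarrow> real) \<Rightarrow> real \<Rightarrow> real" where
  "V0 q X = - (LINT y:{0..1}|lborel. \<bar>deriv (cell_solution q X) y\<bar>\<^sup>2)"

definition V1 :: "(real \<Rightarrow> real \<Rightarrow> real) \<Rightarrow> real \<Rightarrow> real" where
  "V1 q X = 2 * (LINT y:{0..1}|lborel.
     deriv (\<lambda>X'. cell_solution q X' y) X * deriv (cell_solution q X) y)"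

definition japanese_bracket :: "real \<Rightarrow> real" where
  "japanese_bracket X = sqrt (1 + \<bar>X\<bar>\<^sup>2)"

text \<open>For \<open>q\<close> in \<open>W_inf 5\<close> with mean zero in \<open>y\<close>, both \<open>V0 q\<close> and \<open>V1 q\<close> are continuously
  differentiable, so the derivatives below are classical ones.\<close>

definition standing_assumptions :: "(real \<Rightarrow> real \<Rightarrow> real) \<Rightarrow> bool" where
  "standing_assumptions q \<longleftrightarrow>
     q \<in> W_inf 5 \<and>
     (\<forall>X. (LINT y:{0..1}|lborel. q X y) = 0) \<and>
     (\<lambda>X. japanese_bracket X * deriv (V0 q) X) \<in> Linf \<and>
     (\<lambda>X. japanese_bracket X * deriv (V1 q) X) \<in> Linf \<and>
     (V0 q \<longlongrightarrow> 0) at_infinity \<and>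
     (V1 q \<longlongrightarrow> 0) at_infinity"

definition osc_potential :: "(real \<Rightarrow> real \<Rightarrow> real) \<Rightarrow> real \<Rightarrow> real \<Rightarrow> real \<Rightarrow> real" where
  "osc_potential q \<alpha> \<epsilon> x = q (\<epsilon> powr \<alpha> * x) (x / \<epsilon>)"

definition eff_potential :: "(real \<Rightarrow> real \<Rightarrow> real) \<Rightarrow> real \<Rightarrow> real \<Rightarrow> real \<Rightarrow> real" where
  "eff_potential q \<alpha> \<epsilon> x =
     \<epsilon>\<^sup>2 * V0 q (\<epsilon> powr \<alpha> * x) + \<epsilon> powr (3 + \<alpha>) * V1 q (\<epsilon> powr \<alpha> * x)"

end

theory Submission
  imports Defs
begin

text \<open>
The operator is treated as an ordinary differential equation; no spectral theory enters. In the
variable \<open>v = x/\<epsilon>\<close>, with \<open>\<tau> = \<epsilon>\<^sup>1\<^sup>+\<^sup>\<alpha>\<close>, the potential becomes \<open>\<epsilon>\<^sup>2 q(\<tau> v, v)\<close>. If \<open>b' + b\<^sup>2\<close> were equal to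
the potential, then \<open>-d\<^sup>2/dv\<^sup>2 + (potential)\<close> would factorize and be nonnegative. A two-scale expansion
gives an explicit bounded \<open>b\<close> for which the potential minus \<open>b' + b\<^sup>2\<close> is \<open>\<epsilon>\<^sup>4(V\<^sub>0 + \<tau> V\<^sub>1)\<close> plus a
remainder \<open>d\<close> of size \<open>\<epsilon>\<^sup>6\<close>, and \<open>b\<close> differs by a small \<open>a\<close> from the derivative of \<open>\<beta> = \<epsilon>\<^sup>2 Q\<close> (lemma
\<open>corrector\<close>). This is where the effective potential comes from: \<open>-V\<^sub>0\<close> and \<open>-V\<^sub>1\<close> are the period
means that have to be removed from \<open>(\<partial>\<^sub>yQ - \<tau> \<partial>\<^sub>XQ)\<^sup>2\<close> to make it integrable in \<open>y\<close>.

The substitution \<open>\<psi> = e\<^sup>\<beta> \<phi>\<close>, \<open>\<pi> = e\<^sup>\<beta> (\<psi>' - b \<psi>)\<close> removes the oscillation: the eigenvalue equation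
becomes a first order system for \<open>(\<phi>, \<pi>)\<close> in which only \<open>a\<close>, \<open>\<beta>\<close>, \<open>d\<close> and the effective potential occur.
In the variable \<open>z = \<kappa> x\<close>, where \<open>\<kappa>\<close> is \<open>\<epsilon>\<^sup>2\<^sup>-\<^sup>\<alpha>/2\<close> times the mass of \<open>-V\<^sub>0\<close>, the effective potential is
within \<open>\<eta> = O(\<epsilon>\<^sup>1\<^sup>+\<^sup>\<alpha> + \<epsilon>\<^sup>2\<^sup>-\<^sup>2\<^sup>\<alpha>)\<close> of the delta well \<open>-2\<delta>\<close> (in mass and in first moment), and \<open>a\<close>, \<open>\<beta>\<close>,
\<open>d\<close> are bounded by \<open>t = O(\<epsilon>\<^sup>2\<^sup>\<alpha>)\<close>. The delta well has the ground state \<open>e\<^sup>-\<^sup>|\<^sup>z\<^sup>|\<close> with energy \<open>-1\<close>. Written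
with the Green function of \<open>-d\<^sup>2/dz\<^sup>2 + 1\<close>, the system, with \<open>\<phi>(0) = 1\<close> and energy \<open>-(1+\<omega>)\<close>, is a fixed
point equation for \<open>(\<phi>, \<pi>, \<omega>)\<close> in a space weighted by \<open>e\<^sup>|\<^sup>z\<^sup>|\<^sup>/\<^sup>2\<close>, and its right hand side is a contraction
(\<open>profile_map_fixed_point\<close>). The fixed point lies within \<open>O(t + \<eta>)\<close> of the delta well ground state, and
the fixed points with and without \<open>(a, \<beta>, d)\<close>, which belong to the oscillating and to the effective
operator, lie within \<open>O(t)\<close> of each other (\<open>fixed_points_close\<close>). Undoing the scaling gives the
estimates, since \<open>\<kappa>\<^sup>2 t = O(\<epsilon>\<^sup>4)\<close> and \<open>\<kappa>\<^sup>2 \<eta> = O(\<epsilon>\<^sup>5\<^sup>-\<^sup>\<alpha> + \<epsilon>\<^sup>6\<^sup>-\<^sup>4\<^sup>\<alpha>)\<close>.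

No other eigenvalue lies below \<open>-2t\<close> in the scaled problem: the well is concentrated at the origin, so
the energy of a function vanishing there is at least \<open>-2t\<close> times its squared norm
(\<open>form_lower_bound\<close>), whereas two independent bound states below \<open>-2t\<close> would have a nonzero combination
vanishing at the origin. For the effective operator \<open>t = 0\<close>.
\<close>

section \<open>Primitives of locally integrable functions\<close>

lemma locally_integrable_measurable:
  fixes f :: "real \<Rightarrow> real"
  assumes "locally_integrable f"
  shows "f \<in> borel_measurable borel"
proof (rule borel_measurable_LIMSEQ_real)
  show "(\<lambda>x. indicator {- real n..real n} x * f x) \<in> borel_measurable borel" for n
    using assms[unfolded locally_integrable_def set_integrable_def, rule_format, of "- real n" "real n", THEN borel_measurable_integrable]
    by simp
  show "(\<lambda>n. indicator {- real n..real n} x * f x) \<longlonglongrightarrow> f x" for x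
  proof (rule tendsto_eventually)
    obtain N where "\<bar>x\<bar> \<le> real N" using real_arch_simple by blast
    then have *: "\<bar>x\<bar> \<le> real n" if "n \<ge> N" for n using that by (meson of_nat_mono order_trans)
    have "indicator {- real n..real n} x * f x = f x" if "n \<ge> N" for n
      using *[OF that] by (simp add: indicator_def abs_le_iff)
    then show "\<forall>\<^sub>F n in sequentially. indicator {- real n..real n} x * f x = f x"
      by (rule eventually_sequentiallyI)
  qed
qed

text \<open>The product rule for primitives needs the derivative of one factor to be bounded on bounded sets.\<close>

definition loc_bounded :: "(real \<Rightarrow> real) \<Rightarrow> bool" where
  "loc_bounded f \<longleftrightarrow> f \<in> borel_measurable borel \<and> (\<forall>R. \<exists>B. \<forall>x. \<bar>x\<bar> \<le> R \<longrightarrow> \<bar>f x\<bar> \<le> B)"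

lemma loc_boundedD:
  assumes "loc_bounded f"
  shows "f \<in> borel_measurable borel" "\<exists>B\<ge>0. \<forall>x. \<bar>x\<bar> \<le> R \<longrightarrow> \<bar>f x\<bar> \<le> B"
proof -
  show "f \<in> borel_measurable borel" using assms by (simp add: loc_bounded_def)
  obtain B where "\<forall>x. \<bar>x\<bar> \<le> R \<longrightarrow> \<bar>f x\<bar> \<le> B" using assms by (auto simp: loc_bounded_def)
  then show "\<exists>B\<ge>0. \<forall>x. \<bar>x\<bar> \<le> R \<longrightarrow> \<bar>f x\<bar> \<le> B" by (intro exI[of _ "\<bar>B\<bar>"]) fastforce
qed

lemma loc_bounded_continuous:
  assumes "continuous_on UNIV f" shows "loc_bounded f"
  unfolding loc_bounded_def
proof safe
  show "f \<in> borel_measurable borel" using assms by (rule borel_measurable_continuous_onI)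
  fix R :: real
  have "bounded (f ` {-R..R})"
    using assms by (intro compact_imp_bounded compact_continuous_image continuous_on_subset[OF assms]) auto
  then obtain B where "\<forall>y\<in>f ` {-R..R}. norm y \<le> B" by (auto simp: bounded_iff)
  then show "\<exists>B. \<forall>x. \<bar>x\<bar> \<le> R \<longrightarrow> \<bar>f x\<bar> \<le> B"
    by (intro exI[of _ B]) (auto simp: abs_le_iff)
qed

lemma loc_bounded_bounded:
  assumes "f \<in> borel_measurable borel" "\<And>x. \<bar>f x\<bar> \<le> B" shows "loc_bounded f"
  using assms by (auto simp: loc_bounded_def)

lemma loc_bounded_mult:
  assumes "loc_bounded f" "loc_bounded g" shows "loc_bounded (\<lambda>x. f x * g x)"
  unfolding loc_bounded_def
proof safe
  show "(\<lambda>x. f x * g x) \<in> borel_measurable borel"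
    using loc_boundedD(1)[OF assms(1)] loc_boundedD(1)[OF assms(2)] by simp
  fix R :: real
  obtain B where B: "B \<ge> 0" "\<forall>x. \<bar>x\<bar> \<le> R \<longrightarrow> \<bar>f x\<bar> \<le> B" using loc_boundedD(2)[OF assms(1)] by blast
  obtain C where C: "C \<ge> 0" "\<forall>x. \<bar>x\<bar> \<le> R \<longrightarrow> \<bar>g x\<bar> \<le> C" using loc_boundedD(2)[OF assms(2)] by blast
  show "\<exists>B. \<forall>x. \<bar>x\<bar> \<le> R \<longrightarrow> \<bar>f x * g x\<bar> \<le> B"
    using B C by (intro exI[of _ "B * C"]) (auto simp: abs_mult intro!: mult_mono)
qed

lemma loc_bounded_add:
  assumes "loc_bounded f" "loc_bounded g" shows "loc_bounded (\<lambda>x. f x + g x)"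
  unfolding loc_bounded_def
proof safe
  show "(\<lambda>x. f x + g x) \<in> borel_measurable borel"
    using loc_boundedD(1)[OF assms(1)] loc_boundedD(1)[OF assms(2)] by simp
  fix R :: real
  obtain B where B: "B \<ge> 0" "\<forall>x. \<bar>x\<bar> \<le> R \<longrightarrow> \<bar>f x\<bar> \<le> B" using loc_boundedD(2)[OF assms(1)] by blast
  obtain C where C: "C \<ge> 0" "\<forall>x. \<bar>x\<bar> \<le> R \<longrightarrow> \<bar>g x\<bar> \<le> C" using loc_boundedD(2)[OF assms(2)] by blast
  have "\<bar>f x + g x\<bar> \<le> B + C" if "\<bar>x\<bar> \<le> R" for x
    using B(2)[rule_format, OF that] C(2)[rule_format, OF that] by linarith
  then show "\<exists>B. \<forall>x. \<bar>x\<bar> \<le> R \<longrightarrow> \<bar>f x + g x\<bar> \<le> B" by blast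
qed

lemma loc_bounded_const: "loc_bounded (\<lambda>x. c)"
  by (rule loc_bounded_continuous) simp

lemma loc_bounded_minus:
  assumes "loc_bounded f" shows "loc_bounded (\<lambda>x. - f x)"
  using loc_bounded_mult[OF loc_bounded_const[of "-1"] assms] by simp

lemma loc_bounded_diff:
  assumes "loc_bounded f" "loc_bounded g" shows "loc_bounded (\<lambda>x. f x - g x)"
  using loc_bounded_add[OF assms(1) loc_bounded_minus[OF assms(2)]] by simp

lemma loc_bounded_power:
  assumes "loc_bounded f" shows "loc_bounded (\<lambda>x. f x ^ n)"
  by (induction n) (auto intro: loc_bounded_const loc_bounded_mult assms)

lemma locally_integrable_mult_bounded:
  fixes f g :: "real \<Rightarrow> real"
  assumes f: "loc_bounded f" and g: "locally_integrable g"
  shows "locally_integrable (\<lambda>x. f x * g x)"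
  unfolding locally_integrable_def
proof safe
  fix a b :: real
  obtain B where B: "B \<ge> 0" "\<forall>x. \<bar>x\<bar> \<le> max \<bar>a\<bar> \<bar>b\<bar> \<longrightarrow> \<bar>f x\<bar> \<le> B"
    using loc_boundedD(2)[OF f] by blast
  have gi: "set_integrable lborel {a..b} g" using g by (simp add: locally_integrable_def)
  show "set_integrable lborel {a..b} (\<lambda>x. f x * g x)"
  proof (rule set_integrable_bound)
    show "set_integrable lborel {a..b} (\<lambda>x. B * g x)" using gi by simp
    show "set_borel_measurable lborel {a..b} (\<lambda>x. f x * g x)"
      unfolding set_borel_measurable_def
      using loc_boundedD(1)[OF f] locally_integrable_measurable[OF g] by simp
    show "AE x in lborel. x \<in> {a..b} \<longrightarrow> norm (f x * g x) \<le> norm (B * g x)"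
    proof (intro AE_I2 impI)
      fix x assume "x \<in> {a..b}"
      then have "\<bar>f x\<bar> \<le> B" using B(2)[rule_format, of x] by auto
      then show "norm (f x * g x) \<le> norm (B * g x)"
        using B(1) by (auto simp: abs_mult intro!: mult_right_mono)
    qed
  qed
qed

lemma locally_integrable_const: "locally_integrable (\<lambda>x. c :: real)"
  by (auto simp: locally_integrable_def intro!: borel_integrable_atLeastAtMost')

lemma locally_integrable_bounded:
  assumes f: "loc_bounded f" shows "locally_integrable f"
  using locally_integrable_mult_bounded[OF f locally_integrable_const[of 1]] by simp

lemma locally_integrable_add:
  fixes f g :: "real \<Rightarrow> real"
  assumes "locally_integrable f" "locally_integrable g" shows "locally_integrable (\<lambda>x. f x + g x)"
  using assms by (auto simp: locally_integrable_def)

lemma locally_integrable_abs: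
  fixes f :: "real \<Rightarrow> real"
  assumes "locally_integrable f" shows "locally_integrable (\<lambda>x. \<bar>f x\<bar>)"
  using assms by (auto simp: locally_integrable_def intro: set_integrable_abs)

lemma integrable_imp_locally_integrable:
  fixes f :: "real \<Rightarrow> real"
  assumes "integrable lborel f" shows "locally_integrable f"
  unfolding locally_integrable_def
proof safe
  fix a b :: real
  have "set_integrable lborel UNIV f" using assms by (simp add: set_integrable_def)
  then show "set_integrable lborel {a..b} f" by (rule set_integrable_subset) auto
qed

text \<open>Absolute continuity with a prescribed derivative, as an integral identity. Potentials are merely
bounded and measurable, so the differential equations below are read in this sense.\<close>

definition primitive :: "(real \<Rightarrow> real) \<Rightarrow> (real \<Rightarrow> real) \<Rightarrow> bool" where
  "primitive F f \<longleftrightarrow> locally_integrable f \<and>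
     (\<forall>a b. a \<le> b \<longrightarrow> F b - F a = (LINT s:{a..b}|lborel. f s))"

lemma primitiveD:
  assumes "primitive F f"
  shows "locally_integrable f" "\<And>a b. a \<le> b \<Longrightarrow> F b - F a = (LINT s:{a..b}|lborel. f s)"
    "\<And>a b. set_integrable lborel {a..b} f"
  using assms by (auto simp: primitive_def locally_integrable_def)

lemma set_integral_split:
  fixes f :: "real \<Rightarrow> real"
  assumes f: "locally_integrable f" and "a \<le> b" "b \<le> c"
  shows "(LINT s:{a..c}|lborel. f s) = (LINT s:{a..b}|lborel. f s) + (LINT s:{b..c}|lborel. f s)"
proof -
  have i: "set_integrable lborel {x..y} f" for x y using f by (simp add: locally_integrable_def)
  have "{a..c} = {a..b} \<union> {b..c}" using assms by auto
  moreover have "(LINT s:{a..b}\<union>{b..c}|lborel. f s) = (LINT s:{a..b}|lborel. f s) + (LINT s:{b..c}|lborel. f s)"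
  proof (rule set_integral_Un_AE[OF _ _ _ i i])
    have "AE x in lborel. x \<noteq> b" by (rule AE_lborel_singleton)
    then show "AE x in lborel. \<not> (x \<in> {a..b} \<and> x \<in> {b..c})" by eventually_elim auto
  qed auto
  ultimately show ?thesis by simp
qed

definition antideriv :: "(real \<Rightarrow> real) \<Rightarrow> real \<Rightarrow> real" where
  "antideriv f x = (if 0 \<le> x then LINT s:{0..x}|lborel. f s else - (LINT s:{x..0}|lborel. f s))"

lemma set_integral_singleton: "(LINT s:{a..a}|lborel. f s) = (0::real)" for a :: real
proof -
  have "(LINT s:{a..a}|lborel. f s) = (LINT s:{a..a}|lborel. f a)"
    by (rule set_lebesgue_integral_cong) auto
  then show ?thesis by (simp add: set_integral_const)
qed

lemma primitive_antideriv:
  assumes "locally_integrable f" shows "primitive (antideriv f) f"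
  unfolding primitive_def
proof (intro conjI allI impI assms)
  fix a b :: real assume "a \<le> b"
  then consider "0 \<le> a" | "a < 0" "0 \<le> b" | "b < 0" by linarith
  then show "antideriv f b - antideriv f a = (LINT s:{a..b}|lborel. f s)"
  proof cases
    case 1 then show ?thesis using set_integral_split[OF assms, of 0 a b] \<open>a \<le> b\<close> by (simp add: antideriv_def)
  next
    case 2 then show ?thesis using set_integral_split[OF assms, of a 0 b] \<open>a \<le> b\<close> by (simp add: antideriv_def)
  next
    case 3 then show ?thesis using set_integral_split[OF assms, of a b 0] \<open>a \<le> b\<close> by (simp add: antideriv_def)
  qed
qed

lemma primitive_add:
  assumes "primitive F f" "primitive G g" shows "primitive (\<lambda>x. F x + G x) (\<lambda>x. f x + g x)"
  unfolding primitive_def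
proof (intro conjI allI impI)
  show "locally_integrable (\<lambda>x. f x + g x)" using assms by (simp add: primitiveD locally_integrable_add)
  fix a b :: real assume "a \<le> b"
  then show "F b + G b - (F a + G a) = (LINT s:{a..b}|lborel. f s + g s)"
    using primitiveD(2)[OF assms(1), of a b] primitiveD(2)[OF assms(2), of a b] primitiveD(3)[OF assms(1)] primitiveD(3)[OF assms(2)]
    by simp
qed

lemma primitive_cmult:
  assumes "primitive F f" shows "primitive (\<lambda>x. c * F x) (\<lambda>x. c * f x)"
  unfolding primitive_def
proof (intro conjI allI impI)
  show "locally_integrable (\<lambda>x. c * f x)" using primitiveD(3)[OF assms] by (simp add: locally_integrable_def)
  fix a b :: real assume "a \<le> b"
  then show "c * F b - c * F a = (LINT s:{a..b}|lborel. c * f s)"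
    using primitiveD(2)[OF assms(1), of a b] by (simp add: algebra_simps)
qed

lemma primitive_minus:
  assumes "primitive F f" shows "primitive (\<lambda>x. - F x) (\<lambda>x. - f x)"
  using primitive_cmult[OF assms, of "-1"] by simp

lemma primitive_diff:
  assumes "primitive F f" "primitive G g" shows "primitive (\<lambda>x. F x - G x) (\<lambda>x. f x - g x)"
  using primitive_add[OF assms(1) primitive_minus[OF assms(2)]] by simp

lemma primitive_const: "primitive (\<lambda>x. c) (\<lambda>x. 0)"
  by (auto simp: primitive_def locally_integrable_const)

lemma primitive_cong_AE:
  assumes "primitive F f" "AE x in lborel. f x = g x" "g \<in> borel_measurable borel"
  shows "primitive F g"
  unfolding primitive_def
proof (intro conjI allI impI)
  have m: "f \<in> borel_measurable borel" using assms locally_integrable_measurable primitiveD(1) by blast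
  show "locally_integrable g"
    unfolding locally_integrable_def
  proof safe
    fix a b
    show "set_integrable lborel {a..b} g"
      using primitiveD(3)[OF assms(1), of a b] assms(2,3) m
      by (subst (asm) set_integrable_cong_AE[where g=g]) auto
  qed
  fix a b :: real assume "a \<le> b"
  have "(LINT s:{a..b}|lborel. f s) = (LINT s:{a..b}|lborel. g s)"
    using assms(2,3) m by (intro set_lebesgue_integral_cong_AE) auto
  then show "F b - F a = (LINT s:{a..b}|lborel. g s)" using primitiveD(2)[OF assms(1) \<open>a \<le> b\<close>] by simp
qed

lemma primitive_continuous_deriv:
  assumes f: "continuous_on UNIV f" and d: "\<And>x. (F has_real_derivative f x) (at x)"
  shows "primitive F f"
  unfolding primitive_def
proof (intro conjI allI impI)
  show "locally_integrable f" by (intro locally_integrable_bounded loc_bounded_continuous f)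
  fix a b :: real assume "a \<le> b"
  have "(LINT s:{a..b}|lborel. f s) = F b - F a"
    unfolding set_lebesgue_integral_def real_scaleR_def
    using \<open>a \<le> b\<close>
    by (subst mult.commute, intro integral_FTC_Icc_real d f)
       (auto intro!: continuous_on_subset[OF f] simp: f[unfolded continuous_on_eq_continuous_at[OF open_UNIV]]) 
  then show "F b - F a = (LINT s:{a..b}|lborel. f s)" by simp
qed

lemma set_integral_nonneg:
  fixes f :: "real \<Rightarrow> real"
  assumes "\<And>x. x \<in> A \<Longrightarrow> 0 \<le> f x" shows "0 \<le> (LINT x:A|M. f x)"
  unfolding set_lebesgue_integral_def
  by (intro Bochner_Integration.integral_nonneg) (simp add: indicator_def assms)

lemma set_integral_abs_le:
  fixes f :: "real \<Rightarrow> real"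
  assumes "set_integrable lborel {a..b} f" "\<And>x. x \<in> {a..b} \<Longrightarrow> \<bar>f x\<bar> \<le> B" "a \<le> b"
  shows "\<bar>LINT s:{a..b}|lborel. f s\<bar> \<le> B * (b - a)"
proof -
  have "\<bar>LINT s:{a..b}|lborel. f s\<bar> \<le> (LINT s:{a..b}|lborel. \<bar>f s\<bar>)"
    using integral_abs_bound[of lborel "\<lambda>x. indicator {a..b} x * f x"]
    by (simp add: set_lebesgue_integral_def abs_mult)
  also have "\<dots> \<le> (LINT s:{a..b}|lborel. B)"
    using assms by (intro set_integral_mono set_integrable_abs) (auto intro!: borel_integrable_atLeastAtMost')
  also have "\<dots> = B * (b - a)" using assms(3) by (simp add: set_integral_const)
  finally show ?thesis .
qed

lemma set_integral_abs_le':
  fixes f g :: "real \<Rightarrow> real"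
  assumes "set_integrable lborel {a..b} f" "set_integrable lborel {a..b} g" "\<And>x. x \<in> {a..b} \<Longrightarrow> \<bar>f x\<bar> \<le> g x"
  shows "\<bar>LINT s:{a..b}|lborel. f s\<bar> \<le> (LINT s:{a..b}|lborel. g s)"
proof -
  have "\<bar>LINT s:{a..b}|lborel. f s\<bar> \<le> (LINT s:{a..b}|lborel. \<bar>f s\<bar>)"
    using integral_abs_bound[of lborel "\<lambda>x. indicator {a..b} x * f x"]
    by (simp add: set_lebesgue_integral_def abs_mult)
  also have "\<dots> \<le> (LINT s:{a..b}|lborel. g s)"
    using assms by (intro set_integral_mono set_integrable_abs) auto
  finally show ?thesis .
qed

lemma primitive_lipschitz:
  assumes "primitive F f" "\<And>x. x \<in> {a..b} \<Longrightarrow> \<bar>f x\<bar> \<le> B" "a \<le> b"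
  shows "\<bar>F b - F a\<bar> \<le> B * (b - a)"
  using set_integral_abs_le[OF primitiveD(3)[OF assms(1)] assms(2,3)] primitiveD(2)[OF assms(1,3)] by simp

lemma primitive_lipschitz_global:
  assumes "primitive F f" "\<And>x. \<bar>f x\<bar> \<le> B"
  shows "\<bar>F b - F a\<bar> \<le> B * \<bar>b - a\<bar>"
proof (cases "a \<le> b")
  case True then show ?thesis using primitive_lipschitz[OF assms(1), of a b B] assms(2) by simp
next
  case False then show ?thesis using primitive_lipschitz[OF assms(1), of b a B] assms(2)
    by (simp add: abs_minus_commute)
qed

lemma set_integral_eq_henstock:
  fixes f :: "real \<Rightarrow> real"
  assumes "set_integrable lborel {a..b} f"
  shows "f integrable_on {a..b}" "(LINT s:{a..b}|lborel. f s) = integral {a..b} f"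
proof -
  show "f integrable_on {a..b}" using assms by (rule set_borel_integral_eq_integral(1))
  show "(LINT s:{a..b}|lborel. f s) = integral {a..b} f"
    using assms by (rule set_borel_integral_eq_integral(2))
qed

lemma primitive_continuous:
  assumes "primitive F f" shows "continuous_on UNIV F"
proof -
  have "isCont F x" for x
  proof -
    have i: "f integrable_on {x-1..x+1}" by (rule set_integral_eq_henstock(1)[OF primitiveD(3)[OF assms]])
    have "continuous_on {x-1..x+1} (\<lambda>y. integral {x-1..y} f)" by (rule indefinite_integral_continuous_1[OF i])
    then have "continuous_on {x-1..x+1} (\<lambda>y. F (x-1) + integral {x-1..y} f)" by (intro continuous_intros)
    also have "?this \<longleftrightarrow> continuous_on {x-1..x+1} F"
    proof (rule continuous_on_cong[OF refl])
      fix y assume "y \<in> {x-1..x+1}"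
      then show "F (x - 1) + integral {x - 1..y} f = F y"
        using primitiveD(2)[OF assms, of "x-1" y] set_integral_eq_henstock(2)[OF primitiveD(3)[OF assms], of "x-1" y] by simp
    qed
    finally show ?thesis by (rule continuous_on_interior) auto
  qed
  then show ?thesis by (simp add: continuous_at_imp_continuous_on)
qed

lemma primitive_measurable: "primitive F f \<Longrightarrow> F \<in> borel_measurable borel"
  by (intro borel_measurable_continuous_onI primitive_continuous)

lemma primitive_loc_bounded: "primitive F f \<Longrightarrow> loc_bounded F"
  by (intro loc_bounded_continuous primitive_continuous)

text \<open>The increments are \<open>o(y - x)\<close>, locally uniformly, because \<open>\<Omega>\<close> is continuous; hence the derivative
is zero everywhere.\<close>

lemma zero_deriv_from_small_increments:
  fixes \<Psi> \<Omega> :: "real \<Rightarrow> real"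
  assumes \<Omega>: "continuous_on UNIV \<Omega>"
    and le: "\<And>R. \<exists>M. \<forall>x y. -R \<le> x \<and> x \<le> y \<and> y \<le> R \<longrightarrow> \<bar>\<Psi> y - \<Psi> x\<bar> \<le> M * (y - x) * \<bar>\<Omega> y - \<Omega> x\<bar>"
  shows "\<Psi> x = \<Psi> y"
proof -
  have "(\<Psi> has_real_derivative 0) (at x)" for x
  proof -
    obtain M where M: "\<And>u v. -(\<bar>x\<bar>+1) \<le> u \<Longrightarrow> u \<le> v \<Longrightarrow> v \<le> \<bar>x\<bar>+1 \<Longrightarrow> \<bar>\<Psi> v - \<Psi> u\<bar> \<le> M * (v - u) * \<bar>\<Omega> v - \<Omega> u\<bar>"
      using le[of "\<bar>x\<bar>+1"] by blast
    have b: "\<bar>(\<Psi> y - \<Psi> x) / (y - x)\<bar> \<le> \<bar>M\<bar> * \<bar>\<Omega> y - \<Omega> x\<bar>" if "\<bar>y - x\<bar> < 1" "y \<noteq> x" for y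
    proof -
      have "\<bar>\<Psi> y - \<Psi> x\<bar> \<le> \<bar>M\<bar> * \<bar>y - x\<bar> * \<bar>\<Omega> y - \<Omega> x\<bar>"
      proof (cases "x \<le> y")
        case True
        have "M * (y - x) * \<bar>\<Omega> y - \<Omega> x\<bar> \<le> \<bar>M\<bar> * \<bar>y - x\<bar> * \<bar>\<Omega> y - \<Omega> x\<bar>"
          using True by (intro mult_right_mono mult_mono) auto
        then show ?thesis using M[of x y] that True by linarith
      next
        case False
        have "M * (x - y) * \<bar>\<Omega> x - \<Omega> y\<bar> \<le> \<bar>M\<bar> * \<bar>x - y\<bar> * \<bar>\<Omega> x - \<Omega> y\<bar>"
          using False by (intro mult_right_mono mult_mono) auto
        moreover have "\<bar>\<Psi> x - \<Psi> y\<bar> \<le> M * (x - y) * \<bar>\<Omega> x - \<Omega> y\<bar>" using M[of y x] that False by linarith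
        ultimately have "\<bar>\<Psi> x - \<Psi> y\<bar> \<le> \<bar>M\<bar> * \<bar>x - y\<bar> * \<bar>\<Omega> x - \<Omega> y\<bar>" by (rule order_trans[rotated])
        then show ?thesis by (simp add: abs_minus_commute)
      qed
      then show ?thesis using that by (simp add: divide_simps mult_ac)
    qed
    have "isCont \<Omega> x" using \<Omega> by (simp add: continuous_on_eq_continuous_at)
    then have "(\<lambda>y. \<bar>M\<bar> * \<bar>\<Omega> y - \<Omega> x\<bar>) \<midarrow>x\<rightarrow> \<bar>M\<bar> * \<bar>\<Omega> x - \<Omega> x\<bar>"
      unfolding isCont_def by (intro tendsto_intros)
    then have lim: "(\<lambda>y. \<bar>M\<bar> * \<bar>\<Omega> y - \<Omega> x\<bar>) \<midarrow>x\<rightarrow> 0" by simp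
    have "(\<lambda>y. (\<Psi> y - \<Psi> x) / (y - x)) \<midarrow>x\<rightarrow> 0"
    proof (rule Lim_null_comparison[OF _ lim])
      show "\<forall>\<^sub>F y in at x. norm ((\<Psi> y - \<Psi> x) / (y - x)) \<le> \<bar>M\<bar> * \<bar>\<Omega> y - \<Omega> x\<bar>"
        unfolding eventually_at using b by (intro exI[of _ 1]) (auto simp: dist_real_def)
    qed
    then show ?thesis by (simp add: has_field_derivative_iff)
  qed
  then show ?thesis by (simp add: DERIV_isconst_all)
qed

text \<open>This criterion replaces differentiation almost everywhere: it suffices to match increments with
integrals up to an error that is small compared with the length of the interval.\<close>

lemma primitiveI_small_increments:
  assumes h: "locally_integrable h" and \<Omega>: "continuous_on UNIV \<Omega>"
    and le: "\<And>R. \<exists>M. \<forall>x y. -R \<le> x \<and> x \<le> y \<and> y \<le> R \<longrightarrow>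
        \<bar>H y - H x - (LINT s:{x..y}|lborel. h s)\<bar> \<le> M * (y - x) * \<bar>\<Omega> y - \<Omega> x\<bar>"
  shows "primitive H h"
proof -
  note A = primitive_antideriv[OF h]
  have "H x - antideriv h x = H y - antideriv h y" for x y
  proof (rule zero_deriv_from_small_increments[OF \<Omega>, of "\<lambda>x. H x - antideriv h x"])
    fix R
    obtain M where M: "\<forall>x y. -R \<le> x \<and> x \<le> y \<and> y \<le> R \<longrightarrow>
        \<bar>H y - H x - (LINT s:{x..y}|lborel. h s)\<bar> \<le> M * (y - x) * \<bar>\<Omega> y - \<Omega> x\<bar>" using le by blast
    show "\<exists>M. \<forall>x y. -R \<le> x \<and> x \<le> y \<and> y \<le> R \<longrightarrow>
        \<bar>H y - antideriv h y - (H x - antideriv h x)\<bar> \<le> M * (y - x) * \<bar>\<Omega> y - \<Omega> x\<bar>"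
    proof (intro exI[of _ M] allI impI)
      fix x y assume xy: "-R \<le> x \<and> x \<le> y \<and> y \<le> R"
      have "H y - antideriv h y - (H x - antideriv h x) = H y - H x - (LINT s:{x..y}|lborel. h s)"
        using primitiveD(2)[OF A, of x y] xy by linarith
      then show "\<bar>H y - antideriv h y - (H x - antideriv h x)\<bar> \<le> M * (y - x) * \<bar>\<Omega> y - \<Omega> x\<bar>"
        using M[rule_format, OF xy] by presburger
    qed
  qed
  then have "H b - H a = antideriv h b - antideriv h a" for a b by (simp add: algebra_simps)
  then show ?thesis using A by (simp add: primitive_def)
qed

text \<open>Here \<open>\<Omega>\<close> is the primitive of \<open>\<bar>g\<bar>\<close>: on a short interval \<open>F\<close> moves by at most a multiple of the
length and \<open>G\<close> by at most the increment of \<open>\<Omega>\<close>, so the error of the linearised product is a product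
of the two.\<close>

lemma primitive_mult:
  assumes F: "primitive F f" and f: "loc_bounded f" and G: "primitive G g"
  shows "primitive (\<lambda>x. F x * G x) (\<lambda>x. f x * G x + F x * g x)"
proof (rule primitiveI_small_increments)
  let ?Om = "antideriv (\<lambda>x. \<bar>g x\<bar>)"
  have ga: "locally_integrable (\<lambda>x. \<bar>g x\<bar>)" by (intro locally_integrable_abs primitiveD(1)[OF G])
  note A = primitive_antideriv[OF ga]
  show "continuous_on UNIV ?Om" by (rule primitive_continuous[OF A])
  have i1: "locally_integrable (\<lambda>x. f x * G x)"
    by (intro locally_integrable_bounded loc_bounded_mult f primitive_loc_bounded[OF G])
  have i2: "locally_integrable (\<lambda>x. F x * g x)"
    by (intro locally_integrable_mult_bounded primitive_loc_bounded[OF F] primitiveD(1)[OF G])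
  show li: "locally_integrable (\<lambda>x. f x * G x + F x * g x)" by (rule locally_integrable_add[OF i1 i2])
  fix R :: real
  obtain B where B: "B \<ge> 0" "\<And>x. \<bar>x\<bar> \<le> R \<Longrightarrow> \<bar>f x\<bar> \<le> B" using loc_boundedD(2)[OF f] by blast
  show "\<exists>M. \<forall>x y. -R \<le> x \<and> x \<le> y \<and> y \<le> R \<longrightarrow>
        \<bar>F y * G y - F x * G x - (LINT s:{x..y}|lborel. f s * G s + F s * g s)\<bar> \<le> M * (y - x) * \<bar>?Om y - ?Om x\<bar>"
  proof (intro exI[of _ "2 * B"] allI impI)
    fix x y :: real assume xy: "-R \<le> x \<and> x \<le> y \<and> y \<le> R"
    have fb: "\<bar>f s\<bar> \<le> B" if "s \<in> {x..y}" for s using B(2)[of s] that xy by auto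
    define T where "T = (LINT s:{x..y}|lborel. \<bar>g s\<bar>)"
    have Tom: "T = ?Om y - ?Om x" using primitiveD(2)[OF A, of x y] xy by (simp add: T_def)
    have T0: "T \<ge> 0" unfolding T_def by (rule set_integral_nonneg) simp
    have Gs: "\<bar>G y - G s\<bar> \<le> T" if s: "s \<in> {x..y}" for s
    proof -
      have "\<bar>G y - G s\<bar> \<le> (LINT s:{s..y}|lborel. \<bar>g s\<bar>)"
        using set_integral_abs_le'[OF primitiveD(3)[OF G] primitiveD(3)[OF A], of s y] primitiveD(2)[OF G, of s y] s by simp
      also have "\<dots> \<le> T"
        unfolding T_def using set_integral_split[OF ga, of x s y] s
          set_integral_nonneg[of "{x..s}" "\<lambda>s. \<bar>g s\<bar>" lborel] by simp
      finally show ?thesis .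
    qed
    have Fs: "\<bar>F s - F x\<bar> \<le> B * (y - x)" if s: "s \<in> {x..y}" for s
    proof -
      have "\<bar>F s - F x\<bar> \<le> B * (s - x)" using primitive_lipschitz[OF F, of x s B] fb s by auto
      also have "\<dots> \<le> B * (y - x)" using s B(1) by (intro mult_left_mono) auto
      finally show ?thesis .
    qed
    have j1: "set_integrable lborel {x..y} (\<lambda>s. f s * (G y - G s))"
      by (intro locally_integrable_bounded[unfolded locally_integrable_def, rule_format] loc_bounded_mult f loc_bounded_diff loc_bounded_const primitive_loc_bounded[OF G])
    have j2: "set_integrable lborel {x..y} (\<lambda>s. (F s - F x) * g s)"
      by (intro locally_integrable_mult_bounded[unfolded locally_integrable_def, rule_format] loc_bounded_diff loc_bounded_const primitive_loc_bounded[OF F] primitiveD(3)[OF G])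
    have "F y * G y - F x * G x - (LINT s:{x..y}|lborel. f s * G s + F s * g s) =
       (LINT s:{x..y}|lborel. f s * (G y - G s)) - (LINT s:{x..y}|lborel. (F s - F x) * g s)"
    proof -
      have "(LINT s:{x..y}|lborel. f s * (G y - G s)) = (LINT s:{x..y}|lborel. f s * G y - f s * G s)"
        by (simp add: algebra_simps)
      also have "\<dots> = (F y - F x) * G y - (LINT s:{x..y}|lborel. f s * G s)"
        using i1 primitiveD(3)[OF F] primitiveD(2)[OF F, of x y] xy
        by (subst set_integral_diff) (auto simp: locally_integrable_def)
      finally have 1: "(LINT s:{x..y}|lborel. f s * (G y - G s)) = (F y - F x) * G y - (LINT s:{x..y}|lborel. f s * G s)" .
      have "(LINT s:{x..y}|lborel. (F s - F x) * g s) = (LINT s:{x..y}|lborel. F s * g s - F x * g s)"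
        by (simp add: algebra_simps)
      also have "\<dots> = (LINT s:{x..y}|lborel. F s * g s) - F x * (G y - G x)"
        using i2 primitiveD(3)[OF G] primitiveD(2)[OF G, of x y] xy
        by (subst set_integral_diff) (auto simp: locally_integrable_def)
      finally have 2: "(LINT s:{x..y}|lborel. (F s - F x) * g s) = (LINT s:{x..y}|lborel. F s * g s) - F x * (G y - G x)" .
      have "(LINT s:{x..y}|lborel. f s * G s + F s * g s) = (LINT s:{x..y}|lborel. f s * G s) + (LINT s:{x..y}|lborel. F s * g s)"
        using i1 i2 by (simp add: locally_integrable_def)
      then show ?thesis unfolding 1 2 by (simp add: algebra_simps)
    qed
    moreover have "\<bar>LINT s:{x..y}|lborel. f s * (G y - G s)\<bar> \<le> B * T * (y - x)"
    proof (rule set_integral_abs_le[OF j1])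
      fix s assume "s \<in> {x..y}"
      then show "\<bar>f s * (G y - G s)\<bar> \<le> B * T" using fb Gs B(1) unfolding abs_mult by (intro mult_mono) auto
    qed (use xy in auto)
    moreover have "\<bar>LINT s:{x..y}|lborel. (F s - F x) * g s\<bar> \<le> (LINT s:{x..y}|lborel. B * (y - x) * \<bar>g s\<bar>)"
    proof (rule set_integral_abs_le'[OF j2])
      show "set_integrable lborel {x..y} (\<lambda>s. B * (y - x) * \<bar>g s\<bar>)" using primitiveD(3)[OF A] by simp
      fix s assume "s \<in> {x..y}"
      then show "\<bar>(F s - F x) * g s\<bar> \<le> B * (y - x) * \<bar>g s\<bar>" using Fs unfolding abs_mult by (intro mult_right_mono) auto
    qed
    moreover have "(LINT s:{x..y}|lborel. B * (y - x) * \<bar>g s\<bar>) = B * (y - x) * T" by (simp add: T_def)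
    ultimately show "\<bar>F y * G y - F x * G x - (LINT s:{x..y}|lborel. f s * G s + F s * g s)\<bar> \<le> 2 * B * (y - x) * \<bar>?Om y - ?Om x\<bar>"
      using T0 unfolding Tom[symmetric] by (simp add: algebra_simps)
  qed
qed

lemma primitive_exp:
  assumes F: "primitive F f" and f: "loc_bounded f"
  shows "primitive (\<lambda>x. exp (F x)) (\<lambda>x. f x * exp (F x))"
proof (rule primitiveI_small_increments)
  show "continuous_on UNIV (\<lambda>x::real. x)" by simp
  have eb: "loc_bounded (\<lambda>x. exp (F x))"
    by (intro loc_bounded_continuous continuous_intros primitive_continuous[OF F])
  show "locally_integrable (\<lambda>x. f x * exp (F x))"
    by (intro locally_integrable_bounded loc_bounded_mult f eb)
  fix R :: real
  obtain B where B: "B \<ge> 0" "\<And>x. \<bar>x\<bar> \<le> R \<Longrightarrow> \<bar>f x\<bar> \<le> B" using loc_boundedD(2)[OF f] by blast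
  obtain K where K: "K \<ge> 0" "\<And>x. \<bar>x\<bar> \<le> R \<Longrightarrow> \<bar>F x\<bar> \<le> K" using loc_boundedD(2)[OF primitive_loc_bounded[OF F]] by blast
  have mvt: "\<exists>w. min u v \<le> w \<and> w \<le> max u v \<and> exp v - exp u = exp w * (v - u)" for u v :: real
  proof -
    have *: "\<exists>w. u \<le> w \<and> w \<le> v \<and> exp v - exp u = exp w * (v - u)" if "u \<le> v" for u v :: real
    proof (cases "u = v")
      case False
      then have "u < v" using that by simp
      then obtain z where "u < z" "z < v" "exp v - exp u = (v - u) * exp z"
        using MVT2[of u v exp exp] by (metis DERIV_exp)
      then show ?thesis by (intro exI[of _ z]) auto
    qed auto
    show ?thesis
    proof (cases "u \<le> v")
      case True then show ?thesis using *[of u v] by auto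
    next
      case False
      then obtain w where "v \<le> w" "w \<le> u" "exp u - exp v = exp w * (u - v)" using *[of v u] by auto
      then show ?thesis using False by (intro exI[of _ w]) (auto simp: algebra_simps)
    qed
  qed
  have el: "\<bar>exp u - exp v\<bar> \<le> exp K * \<bar>u - v\<bar>" if "\<bar>u\<bar> \<le> K" "\<bar>v\<bar> \<le> K" for u v
  proof -
    obtain w where w: "min v u \<le> w" "w \<le> max v u" "exp u - exp v = exp w * (u - v)" using mvt by blast
    then have "exp w \<le> exp K" using that by auto
    then show ?thesis unfolding w(3) by (simp add: abs_mult mult_right_mono)
  qed
  show "\<exists>M. \<forall>x y. -R \<le> x \<and> x \<le> y \<and> y \<le> R \<longrightarrow>
      \<bar>exp (F y) - exp (F x) - (LINT s:{x..y}|lborel. f s * exp (F s))\<bar> \<le> M * (y - x) * \<bar>y - x\<bar>"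
  proof (intro exI[of _ "B * (exp K * (2 * B))"] allI impI)
    fix x y :: real assume xy: "-R \<le> x \<and> x \<le> y \<and> y \<le> R"
    have fb: "\<bar>f s\<bar> \<le> B" if "s \<in> {x..y}" for s using B(2)[of s] that xy by auto
    have Fb: "\<bar>F s\<bar> \<le> K" if "s \<in> {x..y}" for s using K(2)[of s] that xy by auto
    obtain w where w: "min (F x) (F y) \<le> w" "w \<le> max (F x) (F y)" "exp (F y) - exp (F x) = exp w * (F y - F x)"
      using mvt by blast
    have wK: "\<bar>w\<bar> \<le> K" using w(1,2) Fb[of x] Fb[of y] xy by auto
    have i1: "set_integrable lborel {x..y} (\<lambda>s. f s * exp (F s))"
      by (intro locally_integrable_bounded[unfolded locally_integrable_def, rule_format] loc_bounded_mult f eb)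
    have "exp (F y) - exp (F x) - (LINT s:{x..y}|lborel. f s * exp (F s)) = (LINT s:{x..y}|lborel. f s * (exp w - exp (F s)))"
      unfolding right_diff_distrib w(3)
      using i1 primitiveD(3)[OF F] primitiveD(2)[OF F, of x y] xy
      by (subst set_integral_diff) (auto simp: mult.commute algebra_simps)
    also have "\<bar>\<dots>\<bar> \<le> B * (exp K * (2 * B * (y - x))) * (y - x)"
    proof (rule set_integral_abs_le)
      show "set_integrable lborel {x..y} (\<lambda>s. f s * (exp w - exp (F s)))"
        by (intro locally_integrable_bounded[unfolded locally_integrable_def, rule_format] loc_bounded_mult f eb loc_bounded_diff loc_bounded_const)
      fix s assume s: "s \<in> {x..y}"
      have m: "B * (v - u) \<le> B * (y - x)" if "x \<le> u" "v \<le> y" for u v using that B(1) by (intro mult_left_mono) auto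
      have "\<bar>F s - F x\<bar> \<le> B * (s - x)" using primitive_lipschitz[OF F, of x s B] fb s by auto
      moreover have "\<bar>F y - F s\<bar> \<le> B * (y - s)" using primitive_lipschitz[OF F, of s y B] fb s by auto
      moreover have "B * (s - x) + B * (y - s) = B * (y - x)" by (simp add: algebra_simps)
      moreover have "\<bar>w - F s\<bar> \<le> \<bar>F s - F x\<bar> + \<bar>F y - F s\<bar>" using w(1,2) by auto
      ultimately have "\<bar>w - F s\<bar> \<le> 2 * B * (y - x)" using mult_nonneg_nonneg[OF B(1), of "y - x"] xy by (simp only: mult.assoc)
      then have "exp K * \<bar>w - F s\<bar> \<le> exp K * (2 * B * (y - x))" by (intro mult_left_mono) auto
      then have "\<bar>exp w - exp (F s)\<bar> \<le> exp K * (2 * B * (y - x))" using el[OF wK Fb[OF s]] by linarith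
      then show "\<bar>f s * (exp w - exp (F s))\<bar> \<le> B * (exp K * (2 * B * (y - x)))"
        using fb[OF s] B(1) unfolding abs_mult by (intro mult_mono) auto
    qed (use xy in auto)
    also have "\<dots> = B * (exp K * (2 * B)) * (y - x) * \<bar>y - x\<bar>" using xy by (simp add: algebra_simps)
    finally show "\<bar>exp (F y) - exp (F x) - (LINT s:{x..y}|lborel. f s * exp (F s))\<bar> \<le> B * (exp K * (2 * B)) * (y - x) * \<bar>y - x\<bar>" .
  qed
qed

lemma set_integral_affine:
  fixes f :: "real \<Rightarrow> real"
  assumes "c > 0"
  shows "(LINT s:{t + c * a..t + c * b}|lborel. f s) = c * (LINT s:{a..b}|lborel. f (t + c * s))"
proof -
  have "(LINT s:{t + c * a..t + c * b}|lborel. f s) = \<bar>c\<bar> *\<^sub>R (LINT x|lborel. indicator {t + c * a..t + c * b} (t + c * x) *\<^sub>R f (t + c * x))"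
    unfolding set_lebesgue_integral_def by (rule lborel_integral_real_affine) (use assms in auto)
  also have "\<dots> = c * (LINT s:{a..b}|lborel. f (t + c * s))"
    using assms by (auto simp: set_lebesgue_integral_def indicator_def)
  finally show ?thesis .
qed

lemma set_integrable_affine:
  fixes f :: "real \<Rightarrow> real"
  assumes "c > 0" "set_integrable lborel {t + c * a..t + c * b} f"
  shows "set_integrable lborel {a..b} (\<lambda>s. f (t + c * s))"
proof -
  have "integrable lborel (\<lambda>x. indicator {t + c * a..t + c * b} (t + c * x) *\<^sub>R f (t + c * x))"
    using lborel_integrable_real_affine[OF assms(2)[unfolded set_integrable_def], of c t] assms(1) by simp
  also have "(\<lambda>x. indicator {t + c * a..t + c * b} (t + c * x) *\<^sub>R f (t + c * x)) = (\<lambda>x. indicator {a..b} x *\<^sub>R f (t + c * x))"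
    using assms(1) by (auto simp: indicator_def fun_eq_iff)
  finally show ?thesis unfolding set_integrable_def .
qed

lemma primitive_affine:
  assumes "primitive F f" "c > 0"
  shows "primitive (\<lambda>x. F (t + c * x)) (\<lambda>x. c * f (t + c * x))"
  unfolding primitive_def
proof (intro conjI allI impI)
  show "locally_integrable (\<lambda>x. c * f (t + c * x))"
    unfolding locally_integrable_def using set_integrable_affine[OF assms(2) primitiveD(3)[OF assms(1)]] by simp
  fix a b :: real assume "a \<le> b"
  then show "F (t + c * b) - F (t + c * a) = (LINT s:{a..b}|lborel. c * f (t + c * s))"
    using primitiveD(2)[OF assms(1), of "t + c * a" "t + c * b"] set_integral_affine[OF assms(2), of t a b f] assms(2) by simp
qed

lemma primitive_scale:
  assumes "primitive F f" "c > 0"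
  shows "primitive (\<lambda>x. F (c * x)) (\<lambda>x. c * f (c * x))"
  using primitive_affine[OF assms, of 0] by simp

lemma integrable_imp_unit_interval_small:
  fixes F :: "real \<Rightarrow> real"
  assumes "integrable lborel F"
  shows "(\<lambda>n. LINT s:{real n..real n + 1}|lborel. \<bar>F s\<bar>) \<longlonglongrightarrow> 0"
    "(\<lambda>n. LINT s:{- real n - 1..- real n}|lborel. \<bar>F s\<bar>) \<longlonglongrightarrow> 0"
proof -
  have m[measurable]: "F \<in> borel_measurable borel" using assms by auto
  have *: "(\<lambda>n. LINT s|lborel. indicator (A n) s *\<^sub>R \<bar>F s\<bar>) \<longlonglongrightarrow> (LINT s|(lborel::real measure). (0::real))"
    if A: "\<And>n s. real n > \<bar>s\<bar> + 1 \<Longrightarrow> s \<notin> A n" "\<And>n. A n \<in> sets borel" for A :: "nat \<Rightarrow> real set"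
  proof (rule integral_dominated_convergence[where w="\<lambda>s. \<bar>F s\<bar>"])
    show "AE x in lborel. (\<lambda>n. indicator (A n) x *\<^sub>R \<bar>F x\<bar>) \<longlonglongrightarrow> 0"
    proof (intro AE_I2 tendsto_eventually)
      fix x
      obtain N where "\<bar>x\<bar> + 1 < real N" using reals_Archimedean2 by blast
      then have "indicator (A n) x *\<^sub>R \<bar>F x\<bar> = 0" if "n \<ge> N" for n
        using A(1)[of x n] that by (simp add: indicator_def)
      then show "\<forall>\<^sub>F n in sequentially. indicator (A n) x *\<^sub>R \<bar>F x\<bar> = 0" by (rule eventually_sequentiallyI)
    qed
  qed (use A(2) assms in \<open>auto simp: indicator_def\<close>)
  have **: "(\<lambda>n. LINT s|lborel. indicator (A n) s *\<^sub>R \<bar>F s\<bar>) \<longlonglongrightarrow> 0"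
    if "\<And>n s. real n > \<bar>s\<bar> + 1 \<Longrightarrow> s \<notin> A n" "\<And>n. A n \<in> sets borel" for A :: "nat \<Rightarrow> real set"
    using *[of A, OF that] by simp
  show "(\<lambda>n. LINT s:{real n..real n + 1}|lborel. \<bar>F s\<bar>) \<longlonglongrightarrow> 0"
    unfolding set_lebesgue_integral_def by (rule **) auto
  show "(\<lambda>n. LINT s:{- real n - 1..- real n}|lborel. \<bar>F s\<bar>) \<longlonglongrightarrow> 0"
    unfolding set_lebesgue_integral_def by (rule **) auto
qed

lemma exists_below_mean:
  fixes F :: "real \<Rightarrow> real"
  assumes "set_integrable lborel {a..a+1} F"
  shows "\<exists>x\<in>{a..a+1}. F x \<le> (LINT s:{a..a+1}|lborel. F s)"
proof (rule ccontr)
  let ?I = "LINT s:{a..a+1}|lborel. F s"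
  assume "\<not> (\<exists>x\<in>{a..a+1}. F x \<le> ?I)"
  then have gt: "\<And>x. x \<in> {a..a+1} \<Longrightarrow> F x - ?I > 0" by force
  have i: "set_integrable lborel {a..a+1} (\<lambda>x. F x - ?I)"
    using assms by (intro set_integral_diff) (auto intro!: borel_integrable_atLeastAtMost')
  have "(LINT s:{a..a+1}|lborel. F s - ?I) = ?I - (LINT s:{a..a+1}|lborel. ?I)"
    using assms by (intro set_integral_diff) (auto intro!: borel_integrable_atLeastAtMost')
  also have "\<dots> = 0" by (simp add: set_integral_const)
  finally have "AE x in lborel. indicator {a..a+1} x *\<^sub>R (F x - ?I) = 0"
    using i gt unfolding set_lebesgue_integral_def set_integrable_def
    by (subst (asm) integral_nonneg_eq_0_iff_AE) (auto simp: indicator_def less_imp_le)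
  then have "AE x in lborel. x \<notin> {a..a+1}" by eventually_elim (use gt in \<open>force simp: indicator_def split: if_splits\<close>)
  then have "emeasure lborel {a..a+1} = 0" by (subst (asm) AE_iff_measurable[of "{a..a+1}"]) auto
  then show False by simp
qed

text \<open>An integrable primitive need not tend to zero, but on each unit interval it takes a value below its
mean there, and these means tend to zero.\<close>

lemma primitive_integral_zero:
  assumes F: "primitive F f" and Fi: "integrable lborel F" and fi: "integrable lborel f"
  shows "(LINT x|lborel. f x) = 0"
proof -
  have li: "set_integrable lborel {a..b} (\<lambda>x. \<bar>F x\<bar>)" for a b
    using integrable_imp_locally_integrable[OF integrable_abs[OF Fi]] by (simp add: locally_integrable_def)
  have "\<exists>x. x \<in> {real n..real n+1} \<and> \<bar>F x\<bar> \<le> (LINT s:{real n..real n+1}|lborel. \<bar>F s\<bar>)" for n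
    using exists_below_mean[OF li, of "real n"] by blast
  then obtain X where X: "\<And>n. X n \<in> {real n..real n+1}" "\<And>n. \<bar>F (X n)\<bar> \<le> (LINT s:{real n..real n+1}|lborel. \<bar>F s\<bar>)" by metis
  have "\<exists>x. x \<in> {- real n - 1..- real n} \<and> \<bar>F x\<bar> \<le> (LINT s:{- real n - 1..- real n}|lborel. \<bar>F s\<bar>)" for n
    using exists_below_mean[OF li, of "- real n - 1"] by (simp add: Bex_def)
  then obtain Y where Y: "\<And>n. Y n \<in> {- real n - 1..- real n}" "\<And>n. \<bar>F (Y n)\<bar> \<le> (LINT s:{- real n - 1..- real n}|lborel. \<bar>F s\<bar>)" by metis
  have FX: "(\<lambda>n. F (X n)) \<longlonglongrightarrow> 0"
    by (rule Lim_null_comparison[OF _ integrable_imp_unit_interval_small(1)[OF Fi]]) (use X(2) in auto)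
  have FY: "(\<lambda>n. F (Y n)) \<longlonglongrightarrow> 0"
    by (rule Lim_null_comparison[OF _ integrable_imp_unit_interval_small(2)[OF Fi]]) (use Y(2) in auto)
  have "(\<lambda>n. LINT s|lborel. indicator {Y n..X n} s *\<^sub>R f s) \<longlonglongrightarrow> (LINT s|lborel. f s)"
  proof (rule integral_dominated_convergence[where w="\<lambda>s. \<bar>f s\<bar>"])
    show "AE x in lborel. (\<lambda>n. indicator {Y n..X n} x *\<^sub>R f x) \<longlonglongrightarrow> f x"
    proof (intro AE_I2 tendsto_eventually)
      fix x
      obtain N where N: "\<bar>x\<bar> + 1 < real N" using reals_Archimedean2 by blast
      have "indicator {Y n..X n} x *\<^sub>R f x = f x" if "n \<ge> N" for n
      proof -
        have "real N \<le> real n" using that by simp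
        then have "x \<in> {Y n..X n}" using X(1)[of n] Y(1)[of n] N by auto
        then show ?thesis by simp
      qed
      then show "\<forall>\<^sub>F n in sequentially. indicator {Y n..X n} x *\<^sub>R f x = f x" by (rule eventually_sequentiallyI)
    qed
  qed (use fi borel_measurable_integrable[OF fi] in \<open>auto simp: indicator_def\<close>)
  moreover have "(LINT s|lborel. indicator {Y n..X n} s *\<^sub>R f s) = F (X n) - F (Y n)" for n
    using primitiveD(2)[OF F, of "Y n" "X n"] X(1)[of n] Y(1)[of n] by (simp add: set_lebesgue_integral_def)
  moreover have "(\<lambda>n. F (X n) - F (Y n)) \<longlonglongrightarrow> 0 - 0" by (intro tendsto_diff FX FY)
  ultimately show ?thesis using LIMSEQ_unique by fastforce
qed

section \<open>Test functions and weak derivatives\<close>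

text \<open>Smoothness of the test functions without their compact support.\<close>

definition smooth :: "(real \<Rightarrow> real) \<Rightarrow> bool" where
  "smooth f \<longleftrightarrow> (\<forall>n x. (deriv ^^ n) f differentiable (at x))"

lemma smooth_step:
  assumes "\<And>x. f differentiable (at x)" "smooth (deriv f)" shows "smooth f"
  unfolding smooth_def
proof (intro allI)
  fix n x show "(deriv ^^ n) f differentiable (at x)"
  proof (cases n)
    case (Suc m)
    then show ?thesis using assms(2)[unfolded smooth_def, rule_format, of m x] by (simp add: funpow_swap1)
  qed (use assms(1) in simp)
qed

lemma smooth_deriv: "smooth f \<Longrightarrow> smooth (deriv f)"
  unfolding smooth_def by (metis funpow_swap1 funpow.simps(2) comp_apply)

lemma smooth_differentiable: "smooth f \<Longrightarrow> f differentiable (at x)"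
  unfolding smooth_def by (metis funpow_0)

lemma smooth_DERIV: "smooth f \<Longrightarrow> (f has_real_derivative deriv f x) (at x)"
  using smooth_differentiable DERIV_deriv_iff_real_differentiable by blast

lemma smooth_coinduct:
  assumes "f \<in> S" "\<And>g x. g \<in> S \<Longrightarrow> g differentiable (at x)" "\<And>g. g \<in> S \<Longrightarrow> deriv g \<in> S"
  shows "smooth f"
proof -
  have "(deriv ^^ n) f \<in> S" for n by (induction n) (auto intro: assms)
  then show ?thesis using assms(2) by (simp add: smooth_def)
qed

lemma smooth_diff_cmult:
  assumes "smooth f" "smooth g" shows "smooth (\<lambda>x. f x - c * g x)"
proof (rule smooth_coinduct[where S="{\<lambda>x. f x - c * g x |f g c. smooth f \<and> smooth g}"])
  show "(\<lambda>x. f x - c * g x) \<in> {\<lambda>x. f x - c * g x |f g c. smooth f \<and> smooth g}" using assms by blast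
  fix h assume "h \<in> {\<lambda>x. f x - c * g x |f g c. smooth f \<and> smooth g}"
  then obtain f g c where h: "h = (\<lambda>x. f x - c * g x)" "smooth f" "smooth g" by blast
  have D: "(h has_real_derivative deriv f x - c * deriv g x) (at x)" for x
    unfolding h by (auto intro!: derivative_eq_intros smooth_DERIV h)
  show "h differentiable (at x)" for x using D real_differentiable_def by blast
  have "deriv h = (\<lambda>x. deriv f x - c * deriv g x)" using D DERIV_imp_deriv by blast
  then show "deriv h \<in> {\<lambda>x. f x - c * g x |f g c. smooth f \<and> smooth g}"
    using smooth_deriv[OF h(2)] smooth_deriv[OF h(3)] by blast
qed

text \<open>The flat function \<open>exp (-1/x)\<close> with polynomial factors in \<open>1/x\<close>. This family is closed under
differentiation, so that smoothness follows by coinduction.\<close>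

definition expinv :: "real poly \<Rightarrow> real \<Rightarrow> real" where
  "expinv p x = (if x > 0 then poly p (1 / x) * exp (- (1 / x)) else 0)"

lemma poly_exp_tendsto_0: "((\<lambda>u. poly p u * exp (- u)) \<longlongrightarrow> (0::real)) at_top"
proof -
  have "((\<lambda>u. \<Sum>i\<le>degree p. coeff p i * (u ^ i / exp u)) \<longlongrightarrow> (\<Sum>i\<le>degree p. coeff p i * 0)) at_top"
    by (intro tendsto_intros tendsto_power_div_exp_0)
  then show ?thesis
    by (simp add: poly_altdef sum_distrib_right exp_minus divide_inverse mult.assoc)
qed

lemma expinv_DERIV:
  "(expinv p has_real_derivative expinv (monom 1 2 * (p - pderiv p)) x) (at x)"
proof -
  consider "x > 0" | "x < 0" | "x = 0" by linarith
  then show ?thesis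
  proof cases
    case 1
    have "((\<lambda>x. poly p (1 / x) * exp (- (1 / x))) has_real_derivative expinv (monom 1 2 * (p - pderiv p)) x) (at x)"
      using 1 by (auto intro!: derivative_eq_intros poly_DERIV[THEN DERIV_chain2] simp: expinv_def poly_monom field_simps power2_eq_square)
    then show ?thesis
    proof (rule has_field_derivative_transform_within_open[where S="{0<..}"])
    qed (use 1 in \<open>auto simp: expinv_def\<close>)
  next
    case 2
    have "((\<lambda>x. 0) has_real_derivative expinv (monom 1 2 * (p - pderiv p)) x) (at x)"
      using 2 by (simp add: expinv_def)
    then show ?thesis
    proof (rule has_field_derivative_transform_within_open[where S="{..<0}"])
    qed (use 2 in \<open>auto simp: expinv_def\<close>)
  next
    case 3
    have "((\<lambda>h. expinv p h / h) \<longlongrightarrow> 0) (at 0)"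
    proof (intro filterlim_split_at)
      have "((\<lambda>u. poly (monom 1 1 * p) u * exp (- u)) \<longlongrightarrow> 0) at_top" by (rule poly_exp_tendsto_0)
      then have "((\<lambda>h. poly (monom 1 1 * p) (inverse h) * exp (- inverse h)) \<longlongrightarrow> 0) (at_right 0)"
        by (rule filterlim_compose[OF _ filterlim_inverse_at_top_right])
      then show "((\<lambda>h. expinv p h / h) \<longlongrightarrow> 0) (at_right 0)"
        by (rule filterlim_cong[THEN iffD1, rotated -1])
           (auto simp: eventually_at_right_less expinv_def poly_monom field_simps intro!: eventually_mono[OF eventually_at_right_less])
      show "((\<lambda>h. expinv p h / h) \<longlongrightarrow> 0) (at_left 0)"
        by (rule tendsto_eventually) (auto simp: expinv_def eventually_at_filter)
    qed
    then show ?thesis using 3 by (simp add: has_field_derivative_iff expinv_def)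
  qed
qed

text \<open>The functions reached from a bump by differentiating.\<close>

inductive_set bump_span :: "real \<Rightarrow> real \<Rightarrow> real \<Rightarrow> (real \<Rightarrow> real) set" for a b n where
  base: "(\<lambda>x. expinv p (n * (x - a)) * expinv q (n * (b - x))) \<in> bump_span a b n"
| add: "f \<in> bump_span a b n \<Longrightarrow> g \<in> bump_span a b n \<Longrightarrow> (\<lambda>x. f x + g x) \<in> bump_span a b n"

lemma expinv_cmult: "c * expinv p x = expinv (smult c p) x"
  by (simp add: expinv_def)

lemma bump_span_DERIV:
  "f \<in> bump_span a b n \<Longrightarrow> \<exists>g\<in>bump_span a b n. \<forall>x. (f has_real_derivative g x) (at x)"
proof (induction rule: bump_span.induct)
  case (base p q)
  define p' where "p' = smult n (monom 1 2 * (p - pderiv p))"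
  define q' where "q' = smult (- n) (monom 1 2 * (q - pderiv q))"
  have p: "((\<lambda>x. expinv p (n * (x - a))) has_real_derivative expinv p' (n * (x - a))) (at x)" for x
    unfolding p'_def expinv_cmult[symmetric] by (rule DERIV_chain2[OF expinv_DERIV, THEN DERIV_cong]) (auto intro!: derivative_eq_intros)
  have q: "((\<lambda>x. expinv q (n * (b - x))) has_real_derivative expinv q' (n * (b - x))) (at x)" for x
    unfolding q'_def expinv_cmult[symmetric] by (rule DERIV_chain2[OF expinv_DERIV, THEN DERIV_cong]) (auto intro!: derivative_eq_intros)
  show ?case
  proof (intro bexI allI)
    show "((\<lambda>x. expinv p (n * (x - a)) * expinv q (n * (b - x))) has_real_derivative
       (expinv p' (n * (x - a)) * expinv q (n * (b - x)) + expinv p (n * (x - a)) * expinv q' (n * (b - x)))) (at x)" for x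
      by (auto intro!: derivative_eq_intros p q)
    show "(\<lambda>x. expinv p' (n * (x - a)) * expinv q (n * (b - x)) + expinv p (n * (x - a)) * expinv q' (n * (b - x))) \<in> bump_span a b n"
      by (intro bump_span.intros)
  qed
next
  case (add f g)
  then obtain f' g' where "f' \<in> bump_span a b n" "\<forall>x. (f has_real_derivative f' x) (at x)"
     "g' \<in> bump_span a b n" "\<forall>x. (g has_real_derivative g' x) (at x)" by blast
  then show ?case by (intro bexI[of _ "\<lambda>x. f' x + g' x"]) (auto intro!: derivative_intros bump_span.add)
qed

lemma bump_span_smooth: "f \<in> bump_span a b n \<Longrightarrow> smooth f"
proof (rule smooth_coinduct[where S="bump_span a b n"])
  fix g assume g: "g \<in> bump_span a b n"
  then obtain h where h: "h \<in> bump_span a b n" "\<And>x. (g has_real_derivative h x) (at x)" using bump_span_DERIV by blast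
  show "g differentiable (at x)" for x using h(2) real_differentiable_def by blast
  show "deriv g \<in> bump_span a b n" using h DERIV_imp_deriv by (metis ext)
qed auto

definition bump :: "real \<Rightarrow> real \<Rightarrow> real \<Rightarrow> real \<Rightarrow> real" where
  "bump a b n x = expinv 1 (n * (x - a)) * expinv 1 (n * (b - x))"

lemma test_functions_iff: "\<phi> \<in> test_functions \<longleftrightarrow> smooth \<phi> \<and> (\<exists>R. \<forall>x. \<phi> x \<noteq> 0 \<longrightarrow> \<bar>x\<bar> \<le> R)"
proof -
  have "compact (closure {x. \<phi> x \<noteq> 0}) \<longleftrightarrow> bounded {x. \<phi> x \<noteq> 0}"
    using bounded_subset closure_subset compact_closure by (metis compact_imp_bounded)
  then show ?thesis by (auto simp: test_functions_def smooth_def bounded_iff)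
qed

lemma bump_test: 
  assumes "n > 0" shows "bump a b n \<in> test_functions"
  unfolding test_functions_iff
proof
  have "(\<lambda>x. expinv 1 (n * (x - a)) * expinv 1 (n * (b - x))) \<in> bump_span a b n" by (rule bump_span.base)
  then show "smooth (bump a b n)" using bump_span_smooth unfolding bump_def by blast
  show "\<exists>R. \<forall>x. bump a b n x \<noteq> 0 \<longrightarrow> \<bar>x\<bar> \<le> R"
    using assms by (intro exI[of _ "\<bar>a\<bar> + \<bar>b\<bar>"]) (auto simp: bump_def expinv_def zero_less_mult_iff split: if_splits)
qed

lemma bump_bounds: "0 \<le> bump a b n x" "bump a b n x \<le> 1"
proof -
  have "expinv 1 y \<le> 1" "0 \<le> expinv 1 y" for y by (auto simp: expinv_def)
  then show "0 \<le> bump a b n x" "bump a b n x \<le> 1" unfolding bump_def by (auto intro: mult_le_one)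
qed

lemma bump_zero: "n > 0 \<Longrightarrow> x \<notin> {a<..<b} \<Longrightarrow> bump a b n x = 0"
  by (auto simp: bump_def expinv_def zero_less_mult_iff)

text \<open>Steep bumps increase to indicators of intervals, which is how integrals against test functions
determine integrals over intervals.\<close>

lemma bump_tendsto: "(\<lambda>n. bump a b (real (Suc n)) x) \<longlonglongrightarrow> indicator {a<..<b} x"
proof (cases "x \<in> {a<..<b}")
  case True
  have l: "(\<lambda>n. exp (- ((1 / real (Suc n)) * (1 / c)))) \<longlonglongrightarrow> exp (- (0 * (1 / c)))" for c :: real
    by (intro tendsto_intros LIMSEQ_Suc lim_1_over_n)
  have "(\<lambda>n. exp (- ((1 / real (Suc n)) * (1 / (x - a)))) * exp (- ((1 / real (Suc n)) * (1 / (b - x))))) \<longlonglongrightarrow> exp (- (0 * (1 / (x - a)))) * exp (- (0 * (1 / (b - x))))"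
    by (intro tendsto_mult l)
  moreover have "bump a b (real (Suc n)) x = exp (- ((1 / real (Suc n)) * (1 / (x - a)))) * exp (- ((1 / real (Suc n)) * (1 / (b - x))))" for n
    using True by (simp add: bump_def expinv_def)
  ultimately show ?thesis using True by simp
next
  case False
  then show ?thesis using bump_zero[of _ x a b] by simp
qed

lemma test_bounded: 
  assumes "\<phi> \<in> test_functions"
  shows "loc_bounded \<phi>" "continuous_on UNIV \<phi>" "loc_bounded (deriv \<phi>)" "continuous_on UNIV (deriv \<phi>)"
    "(\<phi> has_real_derivative deriv \<phi> x) (at x)" "deriv \<phi> \<in> test_functions"
proof -
  have s: "smooth \<phi>" using assms by (simp add: test_functions_iff)
  show "(\<phi> has_real_derivative deriv \<phi> x) (at x)" by (rule smooth_DERIV[OF s])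
  show c: "continuous_on UNIV \<phi>" using smooth_differentiable[OF s] 
    by (meson continuous_at_imp_continuous_on differentiable_imp_continuous_within)
  show c2: "continuous_on UNIV (deriv \<phi>)" using smooth_differentiable[OF smooth_deriv[OF s]] 
    by (meson continuous_at_imp_continuous_on differentiable_imp_continuous_within)
  show "loc_bounded \<phi>" "loc_bounded (deriv \<phi>)" using c c2 loc_bounded_continuous by auto
  obtain R where R: "\<And>x. \<phi> x \<noteq> 0 \<Longrightarrow> \<bar>x\<bar> \<le> R" using assms by (auto simp: test_functions_iff)
  have "\<bar>x\<bar> \<le> R" if "deriv \<phi> x \<noteq> 0" for x
  proof (rule ccontr)
    assume x: "\<not> \<bar>x\<bar> \<le> R"
    have "(\<phi> has_real_derivative 0) (at x)"
    proof (rule has_field_derivative_transform_within_open[where f="\<lambda>_. 0" and S="{y. \<bar>y\<bar> > R}"])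
      show "open {y::real. \<bar>y\<bar> > R}" by (intro open_Collect_less continuous_intros)
    qed (use x R in \<open>force+\<close>)
    then show False using that DERIV_imp_deriv by blast
  qed
  then show "deriv \<phi> \<in> test_functions" using smooth_deriv[OF s] by (auto simp: test_functions_iff)
qed

lemma test_mult_integrable:
  assumes "\<phi> \<in> test_functions" "locally_integrable f"
  shows "integrable lborel (\<lambda>x. \<phi> x * f x)"
    "\<exists>R. \<forall>r\<ge>R. (LINT x|lborel. \<phi> x * f x) = (LINT x:{-r..r}|lborel. \<phi> x * f x)"
proof -
  obtain R where R: "\<And>x. \<phi> x \<noteq> 0 \<Longrightarrow> \<bar>x\<bar> \<le> R" using assms by (auto simp: test_functions_iff)
  have *: "indicator {-r..r} x * (\<phi> x * f x) = \<phi> x * f x" if "r \<ge> R" for r x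
    using R[of x] that by (auto simp: indicator_def abs_le_iff)
  have "set_integrable lborel {-R..R} (\<lambda>x. \<phi> x * f x)"
    using locally_integrable_mult_bounded[OF test_bounded(1)[OF assms(1)] assms(2)] by (simp add: locally_integrable_def)
  then show "integrable lborel (\<lambda>x. \<phi> x * f x)" unfolding set_integrable_def using *[of R] by simp
  show "\<exists>R. \<forall>r\<ge>R. (LINT x|lborel. \<phi> x * f x) = (LINT x:{-r..r}|lborel. \<phi> x * f x)"
    unfolding set_lebesgue_integral_def by (intro exI[of _ R] allI impI) (simp add: *)
qed

lemma locally_integrable_zero_intervals:
  fixes u :: "real \<Rightarrow> real"
  assumes u: "locally_integrable u" and z: "\<And>a b. a \<le> b \<Longrightarrow> (LINT x:{a..b}|lborel. u x) = 0"
  shows "AE x in lborel. u x = 0"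
proof -
  have "AE x in lborel. \<forall>N::nat. indicator {- real N..real N} x * u x = 0"
  proof (subst AE_all_countable, intro allI)
    fix N :: nat
    define v where "v = (\<lambda>x. indicator {- real N..real N} x * u x)"
    have vi: "integrable lborel v" using u unfolding v_def locally_integrable_def set_integrable_def by simp
    have int: "(LINT x:A|lborel. v x) = 0" if "A \<in> sets borel" for A
    proof -
      have A: "A \<in> sigma_sets UNIV (range (\<lambda>(a, b). {a..b::real}))"
        using that by (subst (asm) borel_eq_atLeastAtMost) simp
      \<comment> \<open>Closed intervals form a generator of the Borel sets that is stable under intersection.\<close>
      have "Int_stable (range (\<lambda>(a, b). {a..b::real}))" by (auto simp: Int_stable_def)
      moreover have "range (\<lambda>(a, b). {a..b::real}) \<subseteq> Pow UNIV" by simp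
      ultimately show ?thesis using A
      proof (induct A rule: sigma_sets_induct_disjoint)
        case (basic A)
        then obtain a b where A: "A = {a..b}" by auto
        have "(LINT x:A|lborel. v x) = (LINT x:{max a (-real N)..min b (real N)}|lborel. u x)"
          unfolding set_lebesgue_integral_def v_def A by (rule Bochner_Integration.integral_cong) (auto simp: indicator_def)
        also have "\<dots> = 0"
        proof (cases "max a (-real N) \<le> min b (real N)")
          case False
          then have "{max a (-real N)..min b (real N)} = {}" by auto
          then show ?thesis by (simp add: set_lebesgue_integral_def)
        qed (use z in blast)
        finally show ?case .
      next
        case (compl A)
        then have A: "A \<in> sets borel" by (subst borel_eq_atLeastAtMost) simp
        have "(LINT x:UNIV - A|lborel. v x) = (LINT x|lborel. v x) - (LINT x:A|lborel. v x)"
        proof -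
          have "integrable lborel (\<lambda>x. indicator A x *\<^sub>R v x)" using vi A by (intro integrable_mult_indicator) auto
          then have "(LINT x|lborel. v x) - (LINT x:A|lborel. v x) = (LINT x|lborel. v x - indicator A x *\<^sub>R v x)"
            unfolding set_lebesgue_integral_def by (intro Bochner_Integration.integral_diff[symmetric] vi)
          also have "\<dots> = (LINT x:UNIV - A|lborel. v x)"
            unfolding set_lebesgue_integral_def by (rule Bochner_Integration.integral_cong) (auto simp: indicator_def)
          finally show ?thesis by simp
        qed
        moreover have "(LINT x|lborel. v x) = 0"
          using z[of "- real N" "real N"] unfolding v_def set_lebesgue_integral_def by simp
        ultimately show ?case using compl by simp
      next
        case (union A)
        have A: "A i \<in> sets lborel" for i using union(2) by (subst sets_lborel, subst borel_eq_atLeastAtMost) auto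
        have "(LINT x:(\<Union>i. A i)|lborel. v x) = (\<Sum>i. (LINT x:A i|lborel. v x))"
        proof (rule lebesgue_integral_countable_add[OF A])
          show "\<And>i j. i \<noteq> j \<Longrightarrow> A i \<inter> A j = {}" using union(1) by (auto simp: disjoint_family_on_def)
          have "(\<Union>i. A i) \<in> sets lborel" using A by blast
          then show "set_integrable lborel (\<Union>i. A i) v" unfolding set_integrable_def using vi by (rule integrable_mult_indicator)
        qed
        then show ?case using union(3) by simp
      qed (auto simp: set_lebesgue_integral_def)
    qed
    have "AE x in lborel. v x = 0" using density_unique_real[OF vi, of "\<lambda>_. 0"] int by (simp add: set_lebesgue_integral_def)
    then show "AE x in lborel. indicator {- real N..real N} x * u x = 0" by (simp add: v_def)
  qed
  then show ?thesis
  proof eventually_elim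
    case (elim x)
    obtain N where "\<bar>x\<bar> \<le> real N" using real_arch_simple by blast
    then show ?case using elim[rule_format, of N] by (auto simp: indicator_def abs_le_iff)
  qed
qed

text \<open>The fundamental lemma of the calculus of variations.\<close>

lemma weakly_zero_imp_AE_zero:
  fixes u :: "real \<Rightarrow> real"
  assumes u: "locally_integrable u" and z: "\<And>\<phi>. \<phi> \<in> test_functions \<Longrightarrow> (LINT x|lborel. \<phi> x * u x) = 0"
  shows "AE x in lborel. u x = 0"
proof (rule locally_integrable_zero_intervals[OF u])
  fix a b :: real assume "a \<le> b"
  have m[measurable]: "u \<in> borel_measurable borel" by (rule locally_integrable_measurable[OF u])
  have bm[measurable]: "bump a b n \<in> borel_measurable borel" if "n > 0" for n
    using test_bounded(1)[OF bump_test[OF that]] loc_boundedD(1) by blast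
  have "(\<lambda>n. LINT x|lborel. bump a b (real (Suc n)) x * u x) \<longlonglongrightarrow> (LINT x|lborel. indicator {a<..<b} x * u x)"
  proof (rule integral_dominated_convergence[where w="\<lambda>x. indicator {a..b} x * \<bar>u x\<bar>"])
    show "integrable lborel (\<lambda>x. indicator {a..b} x * \<bar>u x\<bar>)"
      using locally_integrable_abs[OF u] by (simp add: locally_integrable_def set_integrable_def)
    show "AE x in lborel. (\<lambda>n. bump a b (real (Suc n)) x * u x) \<longlonglongrightarrow> indicator {a<..<b} x * u x"
      by (intro AE_I2 tendsto_intros bump_tendsto)
    show "AE x in lborel. norm (bump a b (real (Suc n)) x * u x) \<le> indicator {a..b} x * \<bar>u x\<bar>" for n
    proof (intro AE_I2)
      fix x
      show "norm (bump a b (real (Suc n)) x * u x) \<le> indicator {a..b} x * \<bar>u x\<bar>"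
      proof (cases "x \<in> {a<..<b}")
        case True
        then show ?thesis using bump_bounds[of a b "real (Suc n)" x] by (auto simp: abs_mult mult_left_le_one_le)
      next
        case False
        then show ?thesis using bump_zero[of "real (Suc n)" x a b] by simp
      qed
    qed
  qed (use bm in auto)
  moreover have "(LINT x|lborel. bump a b (real (Suc n)) x * u x) = 0" for n by (rule z[OF bump_test]) simp
  ultimately have "(LINT x|lborel. indicator {a<..<b} x * u x) = 0" using LIMSEQ_unique[of "\<lambda>_. 0 :: real"] by auto
  moreover have "(LINT x|lborel. indicator {a<..<b} x * u x) = (LINT x|lborel. indicator {a..b} x * u x)"
  proof (rule integral_cong_AE)
    have "AE x in lborel. x \<noteq> a" "AE x in lborel. x \<noteq> b" by (rule AE_lborel_singleton)+
    then show "AE x in lborel. indicator {a<..<b} x * u x = indicator {a..b} x * u x"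
      by eventually_elim (auto simp: indicator_def)
  qed auto
  ultimately show "(LINT x:{a..b}|lborel. u x) = 0" by (simp add: set_lebesgue_integral_def)
qed

lemma primitive_weak_deriv:
  assumes F: "primitive F f" and \<phi>: "\<phi> \<in> test_functions"
  shows "(LINT x|lborel. deriv \<phi> x * F x) = - (LINT x|lborel. \<phi> x * f x)"
proof -
  note t = test_bounded[OF \<phi>]
  have p: "primitive \<phi> (deriv \<phi>)" by (rule primitive_continuous_deriv[OF t(4) t(5)])
  have pm: "primitive (\<lambda>x. \<phi> x * F x) (\<lambda>x. deriv \<phi> x * F x + \<phi> x * f x)"
    by (rule primitive_mult[OF p t(3) F])
  have Fl: "locally_integrable F" by (intro locally_integrable_bounded primitive_loc_bounded[OF F])
  obtain R1 where R1: "\<And>r. r \<ge> R1 \<Longrightarrow> (LINT x|lborel. deriv \<phi> x * F x) = (LINT x:{-r..r}|lborel. deriv \<phi> x * F x)"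
    using test_mult_integrable(2)[OF t(6) Fl] by blast
  obtain R2 where R2: "\<And>r. r \<ge> R2 \<Longrightarrow> (LINT x|lborel. \<phi> x * f x) = (LINT x:{-r..r}|lborel. \<phi> x * f x)"
    using test_mult_integrable(2)[OF \<phi> primitiveD(1)[OF F]] by blast
  obtain R where R: "\<And>x. \<phi> x \<noteq> 0 \<Longrightarrow> \<bar>x\<bar> \<le> R" using \<phi> by (auto simp: test_functions_iff)
  define r where "r = \<bar>R1\<bar> + \<bar>R2\<bar> + \<bar>R\<bar> + 1"
  have "\<phi> r = 0" "\<phi> (-r) = 0" using R[of r] R[of "-r"] unfolding r_def by linarith+
  then have "(LINT x:{-r..r}|lborel. deriv \<phi> x * F x + \<phi> x * f x) = 0"
    using primitiveD(2)[OF pm, of "-r" r] by (simp add: r_def)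
  moreover have "(LINT x:{-r..r}|lborel. deriv \<phi> x * F x + \<phi> x * f x) = (LINT x:{-r..r}|lborel. deriv \<phi> x * F x) + (LINT x:{-r..r}|lborel. \<phi> x * f x)"
    using locally_integrable_mult_bounded[OF t(3) Fl] locally_integrable_mult_bounded[OF t(1) primitiveD(1)[OF F]]
    by (intro set_integral_add) (auto simp: locally_integrable_def)
  moreover have "r \<ge> R1" "r \<ge> R2" by (auto simp: r_def)
  ultimately show ?thesis using R1[of r] R2[of r] by linarith
qed

lemma has_weak_deriv_1_iff:
  fixes f g :: "real \<Rightarrow> real"
  shows "has_weak_deriv 1 f g \<longleftrightarrow> locally_integrable f \<and> locally_integrable g \<and>
    (\<forall>\<phi>\<in>test_functions. (LINT x|lborel. deriv \<phi> x * f x) = - (LINT x|lborel. \<phi> x * g x))"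
  by (simp add: has_weak_deriv_def)

lemma primitive_has_weak_deriv_1:
  assumes F: "primitive F f" shows "has_weak_deriv 1 F f"
  unfolding has_weak_deriv_1_iff
  using primitive_weak_deriv[OF F] primitiveD(1)[OF F] locally_integrable_bounded[OF primitive_loc_bounded[OF F]] by blast

lemma primitive_has_weak_deriv_2:
  assumes F: "primitive F f" and f: "primitive f g" shows "has_weak_deriv 2 F g"
  unfolding has_weak_deriv_def
proof (intro conjI ballI)
  show "locally_integrable F" using locally_integrable_bounded[OF primitive_loc_bounded[OF F]] .
  show "locally_integrable g" using primitiveD(1)[OF f] .
  fix \<phi> assume \<phi>: "\<phi> \<in> test_functions"
  have "(LINT x|lborel. deriv (deriv \<phi>) x * F x) = - (LINT x|lborel. deriv \<phi> x * f x)"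
    by (rule primitive_weak_deriv[OF F test_bounded(6)[OF \<phi>]])
  also have "\<dots> = (LINT x|lborel. \<phi> x * g x)" using primitive_weak_deriv[OF f \<phi>] by simp
  finally show "(LINT x|lborel. (deriv ^^ 2) \<phi> x *\<^sub>R F x) = (- 1)\<^sup>2 *\<^sub>R (LINT x|lborel. \<phi> x *\<^sub>R g x)"
    by (simp add: numeral_2_eq_2)
qed

lemma test_antiderivative:
  assumes \<eta>: "\<eta> \<in> test_functions" and I\<eta>: "(LINT x|lborel. \<eta> x) = 0"
  shows "\<exists>X\<in>test_functions. deriv X = \<eta>"
proof -
  obtain R0 where R0: "\<And>x. \<eta> x \<noteq> 0 \<Longrightarrow> \<bar>x\<bar> \<le> R0" using \<eta> by (auto simp: test_functions_iff)
  define R where "R = \<bar>R0\<bar>"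
  have \<eta>R: "\<bar>x\<bar> \<le> R" if "\<eta> x \<noteq> 0" for x using R0[OF that] by (simp add: R_def)
  have c\<eta>: "continuous_on UNIV \<eta>" by (rule test_bounded(2)[OF \<eta>])
  define X where "X x = integral {-R-1..x} \<eta>" for x
  have zero_left: "X x = 0" if "x \<le> -R" for x
  proof -
    have "X x = integral {-R-1..x} (\<lambda>_. 0)"
      unfolding X_def
    proof (rule integral_spike[of "{-R}"])
      show "negligible {-R}" by simp
      fix y assume "y \<in> {- R - 1..x} - {- R}" then show "0 = \<eta> y" using \<eta>R[of y] that by fastforce
    qed
    then show ?thesis by simp
  qed
  have zero_right: "X x = 0" if "x \<ge> R + 1" for x
  proof -
    have "(LINT y|lborel. \<eta> y) = (LINT y:{-R-1..x}|lborel. \<eta> y)"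
      unfolding set_lebesgue_integral_def
      by (rule Bochner_Integration.integral_cong) (use \<eta>R that in \<open>force simp: indicator_def\<close>)+
    also have "\<dots> = X x" unfolding X_def
      using locally_integrable_bounded[OF test_bounded(1)[OF \<eta>]] by (intro set_integral_eq_henstock(2)) (simp add: locally_integrable_def)
    finally show ?thesis using I\<eta> by simp
  qed
  have d: "(X has_real_derivative \<eta> x) (at x)" for x
  proof (cases "x > -R-1")
    case True
    have "((\<lambda>u. integral {-R-1..u} \<eta>) has_real_derivative \<eta> x) (at x within {-R-1..x+1})"
      by (rule integral_has_real_derivative) (use True continuous_on_subset[OF c\<eta>] in auto)
    then show ?thesis unfolding X_def using True at_within_Icc_at[of "-R-1" x "x+1"] by simp
  next
    case False
    have "\<eta> x = 0" using False \<eta>R[of x] by (auto simp: R_def)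
    moreover have "(X has_real_derivative 0) (at x)"
    proof (rule has_field_derivative_transform_within_open[where f="\<lambda>_. 0" and S="{..<-R}"])
    qed (use False zero_left in auto)
    ultimately show ?thesis by simp
  qed
  have dX: "deriv X = \<eta>" using d DERIV_imp_deriv by blast
  have "X \<in> test_functions"
    unfolding test_functions_iff
  proof
    show "smooth X" by (rule smooth_step) (use d real_differentiable_def dX \<eta> test_functions_iff in auto)
    show "\<exists>R. \<forall>x. X x \<noteq> 0 \<longrightarrow> \<bar>x\<bar> \<le> R"
      using zero_left zero_right by (intro exI[of _ "R + 1"]) (meson abs_le_iff linorder_le_cases minus_le_iff order_trans le_add_same_cancel1 zero_le_one)
  qed
  then show ?thesis using dX by blast
qed

lemma test_integrable: "\<phi> \<in> test_functions \<Longrightarrow> integrable lborel \<phi>"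
  using test_mult_integrable(1)[OF _ locally_integrable_const[of 1], of \<phi>] by simp

lemma bump_integral_pos: "(LINT x|lborel. bump 0 1 1 x) > 0"
proof -
  have \<rho>: "bump 0 1 1 \<in> test_functions" by (rule bump_test) simp
  have "(LINT x|lborel. bump 0 1 1 x) \<noteq> 0"
  proof
    assume "(LINT x|lborel. bump 0 1 1 x) = 0"
    then have "AE x in lborel. bump 0 1 1 x = 0"
      by (subst (asm) integral_nonneg_eq_0_iff_AE) (use test_integrable[OF \<rho>] bump_bounds in auto)
    then have "AE x in lborel. x \<notin> {0<..<1::real}"
      by eventually_elim (auto simp: bump_def expinv_def)
    then have "emeasure lborel {0<..<1::real} = 0" by (subst (asm) AE_iff_measurable[of "{0<..<1}"]) auto
    then show False by simp
  qed
  moreover have "(LINT x|lborel. bump 0 1 1 x) \<ge> 0" by (rule Bochner_Integration.integral_nonneg) (simp add: bump_bounds)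
  ultimately show ?thesis by simp
qed

text \<open>A test function is a derivative of a test function up to a multiple of one fixed bump. This reduces
statements about \<open>\<phi>\<close> to statements about \<open>\<phi>'\<close>.\<close>

lemma test_decomposition:
  assumes \<phi>: "\<phi> \<in> test_functions"
  shows "\<exists>X\<in>test_functions. deriv X = (\<lambda>x. \<phi> x - ((LINT x|lborel. \<phi> x) / (LINT x|lborel. bump 0 1 1 x)) * bump 0 1 1 x)"
proof -
  let ?\<rho> = "bump 0 1 1" and ?I = "\<lambda>\<phi>. LINT x|lborel. \<phi> x :: real"
  have \<rho>: "?\<rho> \<in> test_functions" by (rule bump_test) simp
  define \<eta> where "\<eta> = (\<lambda>x. \<phi> x - (?I \<phi> / ?I ?\<rho>) * ?\<rho> x)"
  obtain R1 where R1: "\<And>x. \<phi> x \<noteq> 0 \<Longrightarrow> \<bar>x\<bar> \<le> R1" using \<phi> by (auto simp: test_functions_iff)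
  obtain R2 where R2: "\<And>x. ?\<rho> x \<noteq> 0 \<Longrightarrow> \<bar>x\<bar> \<le> R2" using \<rho> by (auto simp: test_functions_iff)
  have s: "smooth \<eta>" unfolding \<eta>_def by (rule smooth_diff_cmult) (use \<phi> \<rho> in \<open>auto simp: test_functions_iff\<close>)
  have "\<bar>x\<bar> \<le> max R1 R2" if "\<eta> x \<noteq> 0" for x
    using that R1[of x] R2[of x] unfolding \<eta>_def by (cases "\<phi> x = 0"; cases "?\<rho> x = 0") auto
  then have \<eta>: "\<eta> \<in> test_functions" using s by (auto simp: test_functions_iff)
  have "?I \<eta> = 0"
  proof -
    have ne: "?I ?\<rho> \<noteq> 0" using bump_integral_pos by (rule less_imp_neq[symmetric])
    have "?I \<eta> = ?I \<phi> - (?I \<phi> / ?I ?\<rho>) * ?I ?\<rho>"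
      unfolding \<eta>_def using test_integrable[OF \<phi>] test_integrable[OF \<rho>] by simp
    also have "\<dots> = 0"
    proof -
      have "x - (x / y) * y = 0" if "y \<noteq> 0" for x y :: real using that by simp
      from this[OF ne] show ?thesis .
    qed
    finally show ?thesis .
  qed
  from test_antiderivative[OF \<eta> this] show ?thesis unfolding \<eta>_def .
qed

lemma weak_deriv_zero_imp_const:
  fixes f :: "real \<Rightarrow> real"
  assumes f: "locally_integrable f" and z: "\<And>\<phi>. \<phi> \<in> test_functions \<Longrightarrow> (LINT x|lborel. deriv \<phi> x * f x) = 0"
  shows "\<exists>c. AE x in lborel. f x = c"
proof -
  let ?\<rho> = "bump 0 1 1" and ?I = "\<lambda>\<phi>. LINT x|lborel. \<phi> x :: real"
  have \<rho>: "?\<rho> \<in> test_functions" by (rule bump_test) simp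
  define c where "c = (LINT x|lborel. ?\<rho> x * f x) / ?I ?\<rho>"
  have "AE x in lborel. f x - c = 0"
  proof (rule weakly_zero_imp_AE_zero)
    show "locally_integrable (\<lambda>x. f x - c)"
      using locally_integrable_add[OF f locally_integrable_const[of "-c"]] by simp
    fix \<phi> assume \<phi>: "\<phi> \<in> test_functions"
    obtain X where X: "X \<in> test_functions" "deriv X = (\<lambda>x. \<phi> x - (?I \<phi> / ?I ?\<rho>) * ?\<rho> x)" using test_decomposition[OF \<phi>] by blast
    have "0 = (LINT x|lborel. (\<phi> x - (?I \<phi> / ?I ?\<rho>) * ?\<rho> x) * f x)" using z[OF X(1)] by (simp add: X(2))
    also have "\<dots> = (LINT x|lborel. \<phi> x * f x) - (?I \<phi> / ?I ?\<rho>) * (LINT x|lborel. ?\<rho> x * f x)"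
      using test_mult_integrable(1)[OF \<phi> f] test_mult_integrable(1)[OF \<rho> f] by (simp add: left_diff_distrib mult.assoc)
    finally have "(LINT x|lborel. \<phi> x * f x) = c * ?I \<phi>" unfolding c_def by simp
    then show "(LINT x|lborel. \<phi> x * (f x - c)) = 0"
      using test_mult_integrable(1)[OF \<phi> f] test_integrable[OF \<phi>] by (simp add: right_diff_distrib mult.commute)
  qed
  then show ?thesis by auto
qed

text \<open>Uniqueness for the cell problem: the difference of two solutions is affine, and periodicity and the
mean condition leave only zero.\<close>

lemma weak_second_deriv_zero_imp_affine:
  fixes f :: "real \<Rightarrow> real"
  assumes c: "continuous_on UNIV f" and z: "\<And>\<phi>. \<phi> \<in> test_functions \<Longrightarrow> (LINT x|lborel. deriv (deriv \<phi>) x * f x) = 0"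
  shows "\<exists>p r. \<forall>x. f x = p + r * x"
proof -
  let ?\<rho> = "bump 0 1 1" and ?I = "\<lambda>\<phi>. LINT x|lborel. \<phi> x :: real"
  have \<rho>: "?\<rho> \<in> test_functions" by (rule bump_test) simp
  have f: "locally_integrable f" by (intro locally_integrable_bounded loc_bounded_continuous c)
  define r where "r = - (LINT x|lborel. deriv ?\<rho> x * f x) / ?I ?\<rho>"
  have id: "primitive (\<lambda>x. r * x) (\<lambda>x. r)"
    by (rule primitive_continuous_deriv) (auto intro!: derivative_eq_intros)
  have "\<exists>p. AE x in lborel. f x - r * x = p"
  proof (rule weak_deriv_zero_imp_const)
    have rl: "locally_integrable (\<lambda>x. r * x)" by (intro locally_integrable_bounded primitive_loc_bounded[OF id])
    show "locally_integrable (\<lambda>x. f x - r * x)" using f rl by (auto simp: locally_integrable_def)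
    fix \<phi> assume \<phi>: "\<phi> \<in> test_functions"
    obtain X where X: "X \<in> test_functions" "deriv X = (\<lambda>x. \<phi> x - (?I \<phi> / ?I ?\<rho>) * ?\<rho> x)" using test_decomposition[OF \<phi>] by blast
    have "((\<lambda>x. \<phi> x - (?I \<phi> / ?I ?\<rho>) * ?\<rho> x) has_real_derivative deriv \<phi> x - (?I \<phi> / ?I ?\<rho>) * deriv ?\<rho> x) (at x)" for x
      by (intro DERIV_diff DERIV_cmult test_bounded(5)[OF \<phi>] test_bounded(5)[OF \<rho>])
    then have "deriv (deriv X) x = deriv \<phi> x - (?I \<phi> / ?I ?\<rho>) * deriv ?\<rho> x" for x unfolding X(2) by (rule DERIV_imp_deriv)
    then have "0 = (LINT x|lborel. (deriv \<phi> x - (?I \<phi> / ?I ?\<rho>) * deriv ?\<rho> x) * f x)" using z[OF X(1)] by simp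
    also have "\<dots> = (LINT x|lborel. deriv \<phi> x * f x) - (?I \<phi> / ?I ?\<rho>) * (LINT x|lborel. deriv ?\<rho> x * f x)"
      using test_mult_integrable(1)[OF test_bounded(6)[OF \<phi>] f] test_mult_integrable(1)[OF test_bounded(6)[OF \<rho>] f] by (simp add: left_diff_distrib mult.assoc)
    finally have 1: "(LINT x|lborel. deriv \<phi> x * f x) = - r * ?I \<phi>" unfolding r_def by simp
    have 2: "(LINT x|lborel. deriv \<phi> x * (r * x)) = - r * ?I \<phi>" using primitive_weak_deriv[OF id \<phi>] by simp
    show "(LINT x|lborel. deriv \<phi> x * (f x - r * x)) = 0"
      using test_mult_integrable(1)[OF test_bounded(6)[OF \<phi>] f] test_mult_integrable(1)[OF test_bounded(6)[OF \<phi>] rl] 1 2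
      unfolding right_diff_distrib by (subst Bochner_Integration.integral_diff) auto
  qed
  then obtain p where "AE x in lborel. f x - r * x = p" by blast
  then have "AE x in lebesgue. x \<in> {x. f x = p + r * x}" by (subst AE_completion) (auto simp: algebra_simps elim!: eventually_mono)
  moreover have "closed {x. f x = p + r * x}" by (intro closed_Collect_eq c continuous_intros)
  ultimately show ?thesis using mem_closed_if_AE_lebesgue by blast
qed

text \<open>\<open>f\<close> minus a primitive of \<open>g\<close> has weak derivative zero and is therefore constant almost everywhere.\<close>

lemma weak_deriv_imp_primitive:
  fixes f g :: "real \<Rightarrow> real"
  assumes "has_weak_deriv 1 f g"
  shows "\<exists>F. primitive F g \<and> (AE x in lborel. f x = F x)"
proof -
  have f: "locally_integrable f" and g: "locally_integrable g"
    and w: "\<And>\<phi>. \<phi>\<in>test_functions \<Longrightarrow> (LINT x|lborel. deriv \<phi> x * f x) = - (LINT x|lborel. \<phi> x * g x)"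
    using assms unfolding has_weak_deriv_1_iff by auto
  note A = primitive_antideriv[OF g]
  have Al: "locally_integrable (antideriv g)" by (intro locally_integrable_bounded primitive_loc_bounded[OF A])
  have "\<exists>c. AE x in lborel. f x - antideriv g x = c"
  proof (rule weak_deriv_zero_imp_const)
    show "locally_integrable (\<lambda>x. f x - antideriv g x)"
      using f Al by (auto simp: locally_integrable_def)
    fix \<phi> assume \<phi>: "\<phi> \<in> test_functions"
    show "(LINT x|lborel. deriv \<phi> x * (f x - antideriv g x)) = 0"
      using w[OF \<phi>] primitive_weak_deriv[OF A \<phi>] test_mult_integrable(1)[OF test_bounded(6)[OF \<phi>] f]
        test_mult_integrable(1)[OF test_bounded(6)[OF \<phi>] Al] by (simp add: right_diff_distrib)
  qed
  then obtain c where c: "AE x in lborel. f x - antideriv g x = c" by blast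
  have "primitive (\<lambda>x. c + antideriv g x) (\<lambda>x. 0 + g x)" by (rule primitive_add[OF primitive_const A])
  moreover have "AE x in lborel. f x = c + antideriv g x" using c by eventually_elim auto
  ultimately show ?thesis by auto
qed

lemma has_weak_deriv_step:
  fixes f :: "real \<Rightarrow> real"
  assumes "has_weak_deriv n f g" "has_weak_deriv (Suc n) f h"
  shows "has_weak_deriv 1 g h"
  unfolding has_weak_deriv_1_iff
proof (intro conjI ballI)
  show "locally_integrable g" "locally_integrable h" using assms by (auto simp: has_weak_deriv_def)
  fix \<phi> assume \<phi>: "\<phi> \<in> test_functions"
  have "(LINT x|lborel. (deriv ^^ n) (deriv \<phi>) x *\<^sub>R f x) = (- 1) ^ n *\<^sub>R (LINT x|lborel. deriv \<phi> x *\<^sub>R g x)"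
    using assms(1) test_bounded(6)[OF \<phi>] unfolding has_weak_deriv_def by blast
  moreover have "(LINT x|lborel. (deriv ^^ Suc n) \<phi> x *\<^sub>R f x) = (- 1) ^ Suc n *\<^sub>R (LINT x|lborel. \<phi> x *\<^sub>R h x)"
    using assms(2) \<phi> unfolding has_weak_deriv_def by blast
  moreover have "(deriv ^^ Suc n) \<phi> = (deriv ^^ n) (deriv \<phi>)" by (simp add: funpow_swap1)
  ultimately have "(- 1) ^ n * (LINT x|lborel. deriv \<phi> x * g x) = (- 1) ^ n * - (LINT x|lborel. \<phi> x * h x)" by simp
  then show "(LINT x|lborel. deriv \<phi> x * g x) = - (LINT x|lborel. \<phi> x * h x)"
    by (subst (asm) mult_left_cancel) auto
qed

lemma has_weak_deriv_cong_AE: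
  fixes f g f' g' :: "real \<Rightarrow> real"
  assumes "has_weak_deriv n f g" "AE x in lborel. f x = f' x" "AE x in lborel. g x = g' x"
    "f' \<in> borel_measurable borel" "g' \<in> borel_measurable borel"
  shows "has_weak_deriv n f' g'"
proof -
  have m: "f \<in> borel_measurable borel" "g \<in> borel_measurable borel"
    using assms(1) by (auto simp: has_weak_deriv_def intro: locally_integrable_measurable)
  have li: "locally_integrable h'" if "locally_integrable h" "AE x in lborel. h x = h' x" "h' \<in> borel_measurable borel" for h h' :: "real \<Rightarrow> real"
    unfolding locally_integrable_def
  proof safe
    fix a b
    show "set_integrable lborel {a..b} h'"
      using that locally_integrable_measurable[OF that(1)] unfolding locally_integrable_def
      by (subst set_integrable_cong_AE[where g=h and f=h']) auto
  qed
  have sm: "(deriv ^^ k) \<phi> \<in> borel_measurable borel" if "\<phi> \<in> test_functions" for k \<phi>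
  proof -
    have "(deriv ^^ k) \<phi> \<in> test_functions" using that by (induction k) (auto intro: test_bounded(6))
    then show ?thesis using test_bounded(1) loc_boundedD(1) by blast
  qed
  have eq: "(LINT x|lborel. (deriv ^^ k) \<phi> x *\<^sub>R h x) = (LINT x|lborel. (deriv ^^ k) \<phi> x *\<^sub>R h' x)"
    if "\<phi> \<in> test_functions" "AE x in lborel. h x = h' x" "h' \<in> borel_measurable borel" "h \<in> borel_measurable borel" for \<phi> h h' k
    by (rule integral_cong_AE) (use that sm[OF that(1), of k] in auto)
  show ?thesis
    using assms(1) li[OF _ assms(2,4)] li[OF _ assms(3,5)] eq[OF _ assms(2,4) m(1), of _ n] eq[OF _ assms(3,5) m(2), of _ 0]
    unfolding has_weak_deriv_def by simp
qed


lemma has_weak_deriv_of_real: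
  assumes "has_weak_deriv n f g"
  shows "has_weak_deriv n (\<lambda>x. complex_of_real (f x)) (\<lambda>x. complex_of_real (g x))"
proof -
  have i: "(LINT x|lborel. u x *\<^sub>R complex_of_real (h x)) = complex_of_real (LINT x|lborel. u x *\<^sub>R h x)" for u h :: "real \<Rightarrow> real"
    by (simp add: scaleR_conv_of_real flip: of_real_mult)
  have l: "locally_integrable (\<lambda>x. complex_of_real (h x))" if "locally_integrable h" for h
    using that unfolding locally_integrable_def set_integrable_def
    by (simp add: scaleR_conv_of_real complex_of_real_integrable_eq flip: of_real_mult)
  show ?thesis
    using assms unfolding has_weak_deriv_def i by (auto simp: l scaleR_conv_of_real)
qed

lemma has_weak_deriv_Re_Im:
  fixes f g :: "real \<Rightarrow> complex"
  assumes "has_weak_deriv n f g"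
  shows "has_weak_deriv n (\<lambda>x. Re (f x)) (\<lambda>x. Re (g x))" "has_weak_deriv n (\<lambda>x. Im (f x)) (\<lambda>x. Im (g x))"
proof -
  have fl: "locally_integrable f" and gl: "locally_integrable g" using assms by (auto simp: has_weak_deriv_def)
  have l: "locally_integrable (\<lambda>x. Re (h x))" "locally_integrable (\<lambda>x. Im (h x))" if "locally_integrable h" for h :: "real \<Rightarrow> complex"
  proof -
    have i: "integrable lborel (\<lambda>x. indicator {a..b} x *\<^sub>R h x)" for a b :: real
      using that unfolding locally_integrable_def set_integrable_def by blast
    show "locally_integrable (\<lambda>x. Re (h x))" "locally_integrable (\<lambda>x. Im (h x))"
      using integrable_Re[OF i] integrable_Im[OF i] unfolding locally_integrable_def set_integrable_def by simp_all
  qed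
  have sm: "(deriv ^^ k) \<phi> \<in> test_functions" if "\<phi> \<in> test_functions" for k \<phi>
    using that by (induction k) (auto intro: test_bounded(6))
  have int: "integrable lborel (\<lambda>x. \<phi> x *\<^sub>R h x)" if \<phi>: "\<phi> \<in> test_functions" and h: "locally_integrable h" for \<phi> and h :: "real \<Rightarrow> complex"
  proof -
    have "integrable lborel (\<lambda>x. complex_of_real (\<phi> x * Re (h x)) + \<i> * complex_of_real (\<phi> x * Im (h x)))"
      using test_mult_integrable(1)[OF \<phi> l(1)[OF h]] test_mult_integrable(1)[OF \<phi> l(2)[OF h]]
      by (intro Bochner_Integration.integrable_add integrable_mult_right) (simp_all only: complex_of_real_integrable_eq)
    also have "(\<lambda>x. complex_of_real (\<phi> x * Re (h x)) + \<i> * complex_of_real (\<phi> x * Im (h x))) = (\<lambda>x. \<phi> x *\<^sub>R h x)"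
      by (auto simp: complex_eq_iff fun_eq_iff)
    finally show ?thesis .
  qed
  have R: "(LINT x|lborel. \<phi> x *\<^sub>R Re (h x)) = Re (LINT x|lborel. \<phi> x *\<^sub>R h x)"
    "(LINT x|lborel. \<phi> x *\<^sub>R Im (h x)) = Im (LINT x|lborel. \<phi> x *\<^sub>R h x)"
    if "\<phi> \<in> test_functions" "locally_integrable h" for \<phi> and h :: "real \<Rightarrow> complex"
    using integral_Re[OF int[OF that]] integral_Im[OF int[OF that]] by simp_all
  have w: "(LINT x|lborel. (deriv ^^ n) \<phi> x *\<^sub>R f x) = (- 1) ^ n *\<^sub>R (LINT x|lborel. \<phi> x *\<^sub>R g x)" if "\<phi> \<in> test_functions" for \<phi>
    using assms that unfolding has_weak_deriv_def by blast
  show "has_weak_deriv n (\<lambda>x. Re (f x)) (\<lambda>x. Re (g x))"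
    unfolding has_weak_deriv_def
  proof (intro conjI ballI l fl gl)
    fix \<phi> assume p: "\<phi> \<in> test_functions"
    show "(LINT x|lborel. (deriv ^^ n) \<phi> x *\<^sub>R Re (f x)) = (- 1) ^ n *\<^sub>R (LINT x|lborel. \<phi> x *\<^sub>R Re (g x))"
      unfolding R(1)[OF sm[OF p] fl] R(1)[OF p gl] w[OF p] by (cases "even n") auto
  qed
  show "has_weak_deriv n (\<lambda>x. Im (f x)) (\<lambda>x. Im (g x))"
    unfolding has_weak_deriv_def
  proof (intro conjI ballI l fl gl)
    fix \<phi> assume p: "\<phi> \<in> test_functions"
    show "(LINT x|lborel. (deriv ^^ n) \<phi> x *\<^sub>R Im (f x)) = (- 1) ^ n *\<^sub>R (LINT x|lborel. \<phi> x *\<^sub>R Im (g x))"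
      unfolding R(2)[OF sm[OF p] fl] R(2)[OF p gl] w[OF p] by (cases "even n") auto
  qed
qed

lemma primitive_eq_if_AE_eq:
  assumes "primitive F f" "primitive G g" "AE x in lborel. F x = G x"
  shows "F = G"
proof
  fix x
  have "closed {x. F x = G x}"
    by (intro closed_Collect_eq primitive_continuous[OF assms(1)] primitive_continuous[OF assms(2)])
  moreover have "AE x in lebesgue. x \<in> {x. F x = G x}" using assms(3) by (simp add: AE_completion)
  ultimately show "F x = G x" using mem_closed_if_AE_lebesgue by blast
qed

section \<open>Eigenfunctions as bound states\<close>

definition sq_integrable :: "(real \<Rightarrow> real) \<Rightarrow> bool" where
  "sq_integrable f \<longleftrightarrow> f \<in> borel_measurable borel \<and> integrable lborel (\<lambda>x. (f x)\<^sup>2)"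

lemma sq_integrable_mult:
  assumes "sq_integrable f" "sq_integrable g" shows "integrable lborel (\<lambda>x. f x * g x)"
proof (rule Bochner_Integration.integrable_bound[of lborel "\<lambda>x. (f x)\<^sup>2 + (g x)\<^sup>2"])
  show "AE x in lborel. norm (f x * g x) \<le> norm ((f x)\<^sup>2 + (g x)\<^sup>2)"
  proof (intro AE_I2)
    fix x
    have "0 \<le> (\<bar>f x\<bar> - \<bar>g x\<bar>)\<^sup>2" by simp
    then have "2 * (\<bar>f x\<bar> * \<bar>g x\<bar>) \<le> (f x)\<^sup>2 + (g x)\<^sup>2" by (simp add: power2_diff)
    moreover have "0 \<le> \<bar>f x\<bar> * \<bar>g x\<bar>" by simp
    ultimately show "norm (f x * g x) \<le> norm ((f x)\<^sup>2 + (g x)\<^sup>2)" unfolding real_norm_def abs_mult by linarith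
  qed
qed (use assms in \<open>auto simp: sq_integrable_def\<close>)

lemma sq_integrable_bounded_mult:
  assumes "sq_integrable f" "b \<in> borel_measurable borel" "\<And>x. \<bar>b x\<bar> \<le> B"
  shows "sq_integrable (\<lambda>x. b x * f x)"
  unfolding sq_integrable_def
proof
  have "f \<in> borel_measurable borel" using assms(1) by (simp add: sq_integrable_def)
  then show m: "(\<lambda>x. b x * f x) \<in> borel_measurable borel" using assms(2) by simp
  show "integrable lborel (\<lambda>x. (b x * f x)\<^sup>2)"
  proof (rule Bochner_Integration.integrable_bound[of lborel "\<lambda>x. B\<^sup>2 * (f x)\<^sup>2"])
    show "AE x in lborel. norm ((b x * f x)\<^sup>2) \<le> norm (B\<^sup>2 * (f x)\<^sup>2)"
      using assms(3) power_mono[OF assms(3), of _ 2] by (auto simp: power_mult_distrib intro!: AE_I2 mult_right_mono)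
  qed (use m assms(1) in \<open>auto simp: sq_integrable_def\<close>)
qed

lemma sq_integrable_cmult:
  assumes "sq_integrable f" shows "sq_integrable (\<lambda>x. c * f x)"
  by (rule sq_integrable_bounded_mult[OF assms, of _ "\<bar>c\<bar>"]) auto

lemma sq_integrable_add:
  assumes "sq_integrable f" "sq_integrable g" shows "sq_integrable (\<lambda>x. f x + g x)"
proof -
  have "integrable lborel (\<lambda>x. (f x)\<^sup>2 + (g x)\<^sup>2 + 2 * (f x * g x))"
    using assms sq_integrable_mult[OF assms] by (auto simp: sq_integrable_def)
  then show ?thesis using assms by (auto simp: sq_integrable_def power2_sum mult.assoc)
qed

lemma sq_integrable_diff:
  assumes "sq_integrable f" "sq_integrable g" shows "sq_integrable (\<lambda>x. f x - g x)"
  using sq_integrable_add[OF assms(1) sq_integrable_cmult[OF assms(2), of "-1"]] by simp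

lemma sq_integrable_cong_AE:
  assumes "sq_integrable f" "AE x in lborel. f x = g x" "g \<in> borel_measurable borel"
  shows "sq_integrable g"
proof -
  have "integrable lborel (\<lambda>x. (g x)\<^sup>2) \<longleftrightarrow> integrable lborel (\<lambda>x. (f x)\<^sup>2)"
    using assms by (intro integrable_cong_AE) (auto simp: sq_integrable_def)
  then show ?thesis using assms by (simp add: sq_integrable_def)
qed

lemma L2_of_real_iff: "(\<lambda>x. complex_of_real (f x)) \<in> L2 \<longleftrightarrow> sq_integrable f"
proof -
  have "(\<lambda>x. complex_of_real (f x)) \<in> borel_measurable borel \<longleftrightarrow> f \<in> borel_measurable borel"
    by (simp add: borel_measurable_complex_iff)
  then show ?thesis by (simp add: L2_def sq_integrable_def)
qed

lemma L2_Re_Im: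
  assumes "f \<in> L2" shows "sq_integrable (\<lambda>x. Re (f x))" "sq_integrable (\<lambda>x. Im (f x))"
proof -
  have m: "f \<in> borel_measurable borel" and i: "integrable lborel (\<lambda>x. (norm (f x))\<^sup>2)" using assms by (auto simp: L2_def)
  show "sq_integrable (\<lambda>x. Re (f x))" unfolding sq_integrable_def
    using m by (auto intro!: Bochner_Integration.integrable_bound[OF i] simp: cmod_power2)
  show "sq_integrable (\<lambda>x. Im (f x))" unfolding sq_integrable_def
    using m by (auto intro!: Bochner_Integration.integrable_bound[OF i] simp: cmod_power2)
qed

text \<open>A real solution of the eigenvalue equation with its derivative as a separate argument, everywhere
defined and not only up to null sets: evaluation at the origin must make sense.\<close>

definition bound_state :: "(real \<Rightarrow> real) \<Rightarrow> real \<Rightarrow> (real \<Rightarrow> real) \<Rightarrow> (real \<Rightarrow> real) \<Rightarrow> bool" where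
  "bound_state V \<nu> u u1 \<longleftrightarrow> primitive u u1 \<and> primitive u1 (\<lambda>x. (V x - \<nu>) * u x) \<and> sq_integrable u \<and> sq_integrable u1"

text \<open>The potential need only agree almost everywhere with a bounded measurable one, since the oscillating
potential is controlled only off a null set.\<close>

lemma bound_state_eigenfunction:
  assumes bs: "bound_state V \<nu> u u1" and ne: "\<exists>x. u x \<noteq> 0"
    and V: "V \<in> borel_measurable borel" "\<And>x. \<bar>V x\<bar> \<le> B"
    and W: "AE x in lborel. W x = V x"
  shows "eigenfunction W \<nu> (\<lambda>x. complex_of_real (u x))"
proof -
  have p: "primitive u u1" "primitive u1 (\<lambda>x. (V x - \<nu>) * u x)" and s: "sq_integrable u" "sq_integrable u1"
    using bs by (auto simp: bound_state_def)
  define u2 where "u2 = (\<lambda>x. (V x - \<nu>) * u x)"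
  have s2: "sq_integrable u2" unfolding u2_def
  proof (rule sq_integrable_bounded_mult[OF s(1)])
    show "\<bar>V x - \<nu>\<bar> \<le> B + \<bar>\<nu>\<bar>" for x using V(2)[of x] by linarith
  qed (use V(1) in simp)
  have sn: "sq_integrable (\<lambda>x. \<nu> * u x)" by (rule sq_integrable_cmult[OF s(1)])
  have w: "has_weak_deriv 1 u u1" "has_weak_deriv 2 u u2"
    using primitive_has_weak_deriv_1[OF p(1)] primitive_has_weak_deriv_2[OF p] by (auto simp: u2_def)
  have H2: "(\<lambda>x. complex_of_real (u x)) \<in> H2"
    unfolding H2_def using s s2 has_weak_deriv_of_real[OF w(1)] has_weak_deriv_of_real[OF w(2)]
    by (auto simp flip: L2_of_real_iff)
  have "schroedinger_op W (\<lambda>x. complex_of_real (u x)) (\<lambda>x. complex_of_real \<nu> * complex_of_real (u x))"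
    unfolding schroedinger_op_def
  proof (intro conjI H2 exI)
    show "(\<lambda>x. complex_of_real \<nu> * complex_of_real (u x)) \<in> L2" using sn by (simp flip: L2_of_real_iff)
    show "has_weak_deriv 2 (\<lambda>x. complex_of_real (u x)) (\<lambda>x. complex_of_real (u2 x))" by (rule has_weak_deriv_of_real[OF w(2)])
    show "AE x in lborel. complex_of_real \<nu> * complex_of_real (u x) = - complex_of_real (u2 x) + complex_of_real (W x) * complex_of_real (u x)"
      using W by eventually_elim (simp add: u2_def algebra_simps flip: of_real_mult of_real_add)
  qed
  moreover have "\<not> (AE x in lborel. complex_of_real (u x) = 0)"
  proof
    assume "AE x in lborel. complex_of_real (u x) = 0"
    then have "AE x in lborel. u x = 0" by simp
    then have "u = (\<lambda>_. 0)" by (rule primitive_eq_if_AE_eq[OF p(1) primitive_const[of 0]])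
    then show False using ne by simp
  qed
  ultimately show ?thesis by (simp add: eigenfunction_def)
qed

lemma weak_solution_imp_bound_state:
  assumes w: "has_weak_deriv 1 u f1" "has_weak_deriv 2 u f2" "sq_integrable u" "sq_integrable f1"
    and V: "V \<in> borel_measurable borel" "\<And>x. \<bar>V x\<bar> \<le> B"
    and eq: "AE x in lborel. f2 x = (V x - \<nu>) * u x"
  shows "\<exists>v v1. bound_state V \<nu> v v1 \<and> (AE x in lborel. u x = v x)"
proof -
  obtain v where v: "primitive v f1" "AE x in lborel. u x = v x" using weak_deriv_imp_primitive[OF w(1)] by blast
  have "has_weak_deriv 1 f1 f2" using has_weak_deriv_step[of 1 u f1 f2] w by (simp add: numeral_2_eq_2)
  then obtain v1 where v1: "primitive v1 f2" "AE x in lborel. f1 x = v1 x" using weak_deriv_imp_primitive by blast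
  have vm: "v \<in> borel_measurable borel" "v1 \<in> borel_measurable borel" by (rule primitive_measurable[OF v(1)], rule primitive_measurable[OF v1(1)])
  have "primitive v v1" by (rule primitive_cong_AE[OF v(1) v1(2) vm(2)])
  moreover have "primitive v1 (\<lambda>x. (V x - \<nu>) * v x)"
  proof (rule primitive_cong_AE[OF v1(1)])
    show "AE x in lborel. f2 x = (V x - \<nu>) * v x" using eq v(2) by eventually_elim simp
  qed (use V(1) vm in simp)
  moreover have "sq_integrable v" by (rule sq_integrable_cong_AE[OF w(3) v(2) vm(1)])
  moreover have "sq_integrable v1" by (rule sq_integrable_cong_AE[OF w(4) v1(2) vm(2)])
  ultimately show ?thesis using v(2) by (auto simp: bound_state_def)
qed

lemma has_weak_deriv_unique_AE:
  fixes f g h :: "real \<Rightarrow> real"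
  assumes "has_weak_deriv n f g" "has_weak_deriv n f h" shows "AE x in lborel. g x = h x"
proof -
  have l: "locally_integrable g" "locally_integrable h" using assms by (auto simp: has_weak_deriv_def)
  have "AE x in lborel. g x - h x = 0"
  proof (rule weakly_zero_imp_AE_zero)
    show "locally_integrable (\<lambda>x. g x - h x)" using l by (auto simp: locally_integrable_def)
    fix \<phi> assume p: "\<phi> \<in> test_functions"
    have "(- 1) ^ n * (LINT x|lborel. \<phi> x * g x) = (- 1) ^ n * (LINT x|lborel. \<phi> x * h x)"
      using assms p unfolding has_weak_deriv_def by auto
    then have "(LINT x|lborel. \<phi> x * g x) = (LINT x|lborel. \<phi> x * h x)"
      by (subst (asm) mult_left_cancel) auto
    then show "(LINT x|lborel. \<phi> x * (g x - h x)) = 0"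
      using test_mult_integrable(1)[OF p l(1)] test_mult_integrable(1)[OF p l(2)] by (simp add: right_diff_distrib)
  qed
  then show ?thesis by auto
qed

text \<open>The potential is real, so the real and the imaginary part solve the equation separately.\<close>

lemma eigenfunction_imp_bound_states:
  assumes ef: "eigenfunction W \<nu> f"
    and V: "V \<in> borel_measurable borel" "\<And>x. \<bar>V x\<bar> \<le> B"
    and W: "AE x in lborel. W x = V x"
  shows "\<exists>u u1 v v1. bound_state V \<nu> u u1 \<and> bound_state V \<nu> v v1 \<and> (AE x in lborel. f x = Complex (u x) (v x))"
proof -
  from ef obtain f2' where f: "f \<in> H2" "has_weak_deriv 2 f f2'"
    and eq: "AE x in lborel. complex_of_real \<nu> * f x = - f2' x + complex_of_real (W x) * f x"
    by (auto simp: eigenfunction_def schroedinger_op_def)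
  obtain f1 where f1: "f1 \<in> L2" "has_weak_deriv 1 f f1" using f(1) by (auto simp: H2_def)
  have fL: "f \<in> L2" using f(1) by (simp add: H2_def)
  have eq': "AE x in lborel. f2' x = complex_of_real (V x - \<nu>) * f x"
    using eq W by eventually_elim (simp add: algebra_simps)
  note w1 = has_weak_deriv_Re_Im[OF f1(2)] and w2 = has_weak_deriv_Re_Im[OF f(2)]
  have "\<exists>v v1. bound_state V \<nu> v v1 \<and> (AE x in lborel. Re (f x) = v x)"
  proof (rule weak_solution_imp_bound_state[OF w1(1) w2(1) L2_Re_Im(1)[OF fL] L2_Re_Im(1)[OF f1(1)] V])
    show "AE x in lborel. Re (f2' x) = (V x - \<nu>) * Re (f x)" using eq' by eventually_elim simp
  qed
  moreover have "\<exists>v v1. bound_state V \<nu> v v1 \<and> (AE x in lborel. Im (f x) = v x)"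
  proof (rule weak_solution_imp_bound_state[OF w1(2) w2(2) L2_Re_Im(2)[OF fL] L2_Re_Im(2)[OF f1(1)] V])
    show "AE x in lborel. Im (f2' x) = (V x - \<nu>) * Im (f x)" using eq' by eventually_elim simp
  qed
  ultimately obtain u u1 v v1 where "bound_state V \<nu> u u1" "AE x in lborel. Re (f x) = u x"
     "bound_state V \<nu> v v1" "AE x in lborel. Im (f x) = v x" by blast
  moreover from this have "AE x in lborel. f x = Complex (u x) (v x)" by (auto simp: complex_eq_iff)
  ultimately show ?thesis by blast
qed

section \<open>Slowly varying periodic functions and weighted period averages\<close>

lemma set_integral_Fubini_bounded:
  fixes f :: "real \<Rightarrow> real \<Rightarrow> real"
  assumes m: "(\<lambda>(x, y). f x y) \<in> borel_measurable borel" and B: "\<And>x y. x \<in> {a..b} \<Longrightarrow> y \<in> {c..d} \<Longrightarrow> \<bar>f x y\<bar> \<le> B"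
  shows "(LINT x:{a..b}|lborel. LINT y:{c..d}|lborel. f x y) = (LINT y:{c..d}|lborel. LINT x:{a..b}|lborel. f x y)"
proof -
  let ?F = "\<lambda>(x, y). indicator {a..b} x * (indicator {c..d} y * f x y)"
  have mm[measurable]: "(\<lambda>(x, y). f x y) \<in> borel_measurable (borel \<Otimes>\<^sub>M borel)" using m by (simp add: borel_prod)
  have i: "integrable (lborel \<Otimes>\<^sub>M lborel) ?F"
  proof (rule Bochner_Integration.integrable_bound)
    show "integrable (lborel \<Otimes>\<^sub>M lborel) (\<lambda>x. B * indicator ({a..b} \<times> {c..d}) x :: real)"
    proof (intro integrable_mult_right integrable_real_indicator)
      have "emeasure (lborel \<Otimes>\<^sub>M lborel) ({a..b} \<times> {c..d}) = emeasure lborel {a..b} * emeasure lborel {c..d}"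
        by (rule lborel.emeasure_pair_measure_Times) auto
      also have "\<dots> < \<infinity>" by (simp add: ennreal_mult_less_top emeasure_lborel_Icc_eq)
      finally show "emeasure (lborel \<Otimes>\<^sub>M lborel) ({a..b} \<times> {c..d}) < \<infinity>" .
    qed simp
    show "?F \<in> borel_measurable (lborel \<Otimes>\<^sub>M lborel)" by measurable
    show "AE x in lborel \<Otimes>\<^sub>M lborel. norm (?F x) \<le> norm (B * indicator ({a..b} \<times> {c..d}) x :: real)"
      using B by (intro AE_I2) (fastforce simp: indicator_def split: if_splits)
  qed
  have "(\<integral>y. (\<integral>x. indicator {a..b} x * (indicator {c..d} y * f x y) \<partial>lborel) \<partial>lborel) = (\<integral>x. (\<integral>y. indicator {a..b} x * (indicator {c..d} y * f x y) \<partial>lborel) \<partial>lborel)"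
    by (rule lborel_pair.Fubini_integral[OF i])
  moreover have "(\<integral>x. indicator {a..b} x * (indicator {c..d} y * f x y) \<partial>lborel) = indicator {c..d} y * (\<integral>x. indicator {a..b} x * f x y \<partial>lborel)" for y
    by (subst mult.left_commute) simp
  ultimately show ?thesis by (simp add: set_lebesgue_integral_def)
qed

text \<open>A weighted mean over the period that starts at the point itself. With a Bernoulli polynomial as
weight it is, up to sign, a periodic (iterated) antiderivative in \<open>y\<close> of a function of mean zero.\<close>

definition conv :: "(real \<Rightarrow> real) \<Rightarrow> (real \<Rightarrow> real \<Rightarrow> real) \<Rightarrow> real \<Rightarrow> real \<Rightarrow> real" where
  "conv k F X y = (LINT s:{0..1}|lborel. k s * F X (y + s))"

lemma set_integrable_kernel:
  fixes k f :: "real \<Rightarrow> real"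
  assumes k: "continuous_on UNIV k" and f: "f \<in> borel_measurable borel" "\<And>s. \<bar>f s\<bar> \<le> B"
  shows "set_integrable lborel {a..b} (\<lambda>s. k s * f s)"
  by (intro locally_integrable_bounded[unfolded locally_integrable_def, rule_format] loc_bounded_mult loc_bounded_continuous[OF k] loc_bounded_bounded[OF f])

lemma kernel_bound:
  fixes k :: "real \<Rightarrow> real"
  assumes k: "continuous_on UNIV k" shows "\<exists>K\<ge>0. \<forall>s\<in>{0..1}. \<bar>k s\<bar> \<le> K"
  using loc_boundedD(2)[OF loc_bounded_continuous[OF k], of 1] by fastforce

text \<open>Integration by parts over a period. By periodicity the boundary terms combine into
\<open>(k 1 - k 0) f v\<close>.\<close>

lemma periodic_integral_shift:
  assumes f: "f \<in> borel_measurable borel" "\<And>s. \<bar>f s\<bar> \<le> B" and per: "\<And>y. f (y + 1) = f y"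
    and k: "\<And>s. (k has_real_derivative k' s) (at s)" and k': "continuous_on UNIV k'"
  shows "primitive (\<lambda>v. LINT s:{0..1}|lborel. k s * f (v + s)) (\<lambda>v. (k 1 - k 0) * f v - (LINT s:{0..1}|lborel. k' s * f (v + s)))"
proof -
  have lf: "locally_integrable f" by (intro locally_integrable_bounded loc_bounded_bounded[OF f])
  define \<Phi> where "\<Phi> = antideriv f"
  have p\<Phi>: "primitive \<Phi> f" unfolding \<Phi>_def by (rule primitive_antideriv[OF lf])
  have pk: "primitive k k'" by (rule primitive_continuous_deriv[OF k' k])
  have ck: "continuous_on UNIV k" by (rule primitive_continuous[OF pk])
  have sh: "primitive (\<lambda>s. \<Phi> (v + s)) (\<lambda>s. f (v + s))" for v using primitive_affine[OF p\<Phi>, of 1 v] by simp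
  have fm: "(\<lambda>s. f (v + s)) \<in> borel_measurable borel" for v using f(1) by measurable
  have H: "(LINT s:{0..1}|lborel. k s * f (v + s)) = k 1 * \<Phi> (v + 1) - k 0 * \<Phi> v - (LINT s:{0..1}|lborel. k' s * \<Phi> (v + s))" for v
  proof -
    have pr: "primitive (\<lambda>s. k s * \<Phi> (v + s)) (\<lambda>s. k' s * \<Phi> (v + s) + k s * f (v + s))"
      by (rule primitive_mult[OF pk loc_bounded_continuous[OF k'] sh])
    have i1: "set_integrable lborel {0..1} (\<lambda>s. k' s * \<Phi> (v + s))"
      by (intro locally_integrable_bounded[unfolded locally_integrable_def, rule_format] loc_bounded_mult loc_bounded_continuous[OF k'] primitive_loc_bounded[OF sh])
    have i2: "set_integrable lborel {0..1} (\<lambda>s. k s * f (v + s))" by (rule set_integrable_kernel[OF ck fm f(2)])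
    show ?thesis using primitiveD(2)[OF pr, of 0 1] i1 i2 by simp
  qed
  have J: "primitive (\<lambda>v. LINT s:{0..1}|lborel. k' s * \<Phi> (v + s)) (\<lambda>v. LINT s:{0..1}|lborel. k' s * f (v + s))"
    unfolding primitive_def
  proof (intro conjI allI impI)
    obtain K where K: "K \<ge> 0" "\<And>s. s \<in> {0..1} \<Longrightarrow> \<bar>k' s\<bar> \<le> K" using kernel_bound[OF k'] by blast
    have km: "k' \<in> borel_measurable borel" by (rule borel_measurable_continuous_onI[OF k'])
    have meas: "(\<lambda>(s, u). k' s * f (u + s)) \<in> borel_measurable borel"
      using f(1) km unfolding borel_prod[symmetric] by measurable
    have meas2: "(\<lambda>(u, s). k' s * f (u + s)) \<in> borel_measurable (borel \<Otimes>\<^sub>M lborel)"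
      using f(1) km by measurable
    have B: "\<bar>LINT s:{0..1}|lborel. k' s * f (v + s)\<bar> \<le> K * B * (1 - 0)" for v
    proof (rule set_integral_abs_le[OF set_integrable_kernel[OF k' fm f(2)]])
      show "\<bar>k' s * f (v + s)\<bar> \<le> K * B" if "s \<in> {0..1}" for s unfolding abs_mult using K f(2)[of "v+s"] that by (intro mult_mono) auto
    qed simp
    have "(\<lambda>v. LINT s|lborel. indicator {0..1} s *\<^sub>R (k' s * f (v + s))) \<in> borel_measurable borel"
      using meas2 by measurable
    then show "locally_integrable (\<lambda>v. LINT s:{0..1}|lborel. k' s * f (v + s))"
      using B by (intro locally_integrable_bounded loc_bounded_bounded) (auto simp: set_lebesgue_integral_def)
    fix a b :: real assume ab: "a \<le> b"
    have i1: "set_integrable lborel {0..1} (\<lambda>s. k' s * \<Phi> (v + s))" for v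
      by (intro locally_integrable_bounded[unfolded locally_integrable_def, rule_format] loc_bounded_mult loc_bounded_continuous[OF k'] primitive_loc_bounded[OF sh])
    have "(LINT s:{0..1}|lborel. k' s * \<Phi> (b + s)) - (LINT s:{0..1}|lborel. k' s * \<Phi> (a + s)) = (LINT s:{0..1}|lborel. k' s * \<Phi> (b + s) - k' s * \<Phi> (a + s))"
      using i1 by simp
    also have "\<dots> = (LINT s:{0..1}|lborel. LINT u:{a..b}|lborel. k' s * f (u + s))"
    proof (rule set_lebesgue_integral_cong)
      show "\<forall>s. s \<in> {0..1} \<longrightarrow> k' s * \<Phi> (b + s) - k' s * \<Phi> (a + s) = (LINT u:{a..b}|lborel. k' s * f (u + s))"
      proof (intro allI impI)
        fix s
        have "primitive (\<lambda>u. \<Phi> (s + u)) (\<lambda>u. f (s + u))" by (rule sh)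
        from primitiveD(2)[OF this ab] show "k' s * \<Phi> (b + s) - k' s * \<Phi> (a + s) = (LINT u:{a..b}|lborel. k' s * f (u + s))"
          by (simp add: right_diff_distrib[symmetric] add.commute)
      qed
    qed simp
    also have "\<dots> = (LINT u:{a..b}|lborel. LINT s:{0..1}|lborel. k' s * f (u + s))"
    proof (rule set_integral_Fubini_bounded[OF meas])
      show "\<bar>k' s * f (u + s)\<bar> \<le> K * B" if "s \<in> {0..1}" for s u unfolding abs_mult using K f(2)[of "u+s"] that by (intro mult_mono) auto
    qed
    finally show "(LINT s:{0..1}|lborel. k' s * \<Phi> (b + s)) - (LINT s:{0..1}|lborel. k' s * \<Phi> (a + s)) = (LINT u:{a..b}|lborel. LINT s:{0..1}|lborel. k' s * f (u + s))" .
  qed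
  have "primitive (\<lambda>v. \<Phi> (v + 1)) (\<lambda>v. f v)" using sh[of 1] per by (simp add: add.commute)
  then have "primitive (\<lambda>v. k 1 * \<Phi> (v + 1) - k 0 * \<Phi> v - (LINT s:{0..1}|lborel. k' s * \<Phi> (v + s)))
     (\<lambda>v. k 1 * f v - k 0 * f v - (LINT s:{0..1}|lborel. k' s * f (v + s)))"
    by (intro primitive_diff primitive_cmult p\<Phi> J)
  then show ?thesis unfolding H by (simp add: left_diff_distrib)
qed

text \<open>\<open>F'\<close> is the derivative of \<open>F\<close> in the first variable, with bounds that are uniform in the second one. In
the second variable \<open>F\<close> is only periodic, bounded and measurable.\<close>

definition slow :: "(real \<Rightarrow> real \<Rightarrow> real) \<Rightarrow> (real \<Rightarrow> real \<Rightarrow> real) \<Rightarrow> bool" where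
  "slow F F' \<longleftrightarrow> (\<lambda>(X, y). F X y) \<in> borel_measurable borel \<and> (\<lambda>(X, y). F' X y) \<in> borel_measurable borel \<and>
     (\<forall>X y. F X (y + 1) = F X y) \<and> (\<forall>X y. F' X (y + 1) = F' X y) \<and>
     (\<exists>B\<ge>0. \<forall>X y. \<bar>F X y\<bar> \<le> B \<and> \<bar>F' X y\<bar> \<le> B \<and> (\<forall>h. \<bar>F (X + h) y - F X y - h * F' X y\<bar> \<le> B * h\<^sup>2))"

lemma slowI:
  assumes "(\<lambda>(X, y). F X y) \<in> borel_measurable borel" "(\<lambda>(X, y). F' X y) \<in> borel_measurable borel"
    "\<And>X y. F X (y + 1) = F X y" "\<And>X y. F' X (y + 1) = F' X y"
    "\<And>X y. \<bar>F X y\<bar> \<le> B1" "\<And>X y. \<bar>F' X y\<bar> \<le> B2" "\<And>X y h. \<bar>F (X + h) y - F X y - h * F' X y\<bar> \<le> B3 * h\<^sup>2"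
  shows "slow F F'"
proof -
  let ?B = "\<bar>B1\<bar> + \<bar>B2\<bar> + \<bar>B3\<bar>"
  have "\<bar>F X y\<bar> \<le> ?B" "\<bar>F' X y\<bar> \<le> ?B" for X y using assms(5)[of X y] assms(6)[of X y] by linarith+
  moreover have "\<bar>F (X + h) y - F X y - h * F' X y\<bar> \<le> ?B * h\<^sup>2" for X y h
  proof -
    have "B3 * h\<^sup>2 \<le> ?B * h\<^sup>2" by (intro mult_right_mono) auto
    then show ?thesis using assms(7)[where X=X and y=y and h=h] by linarith
  qed
  ultimately show ?thesis unfolding slow_def using assms(1-4) by (intro conjI exI[of _ ?B]) auto
qed

lemma slowE:
  assumes "slow F F'"
  obtains B where "B \<ge> 0" "\<And>X y. \<bar>F X y\<bar> \<le> B" "\<And>X y. \<bar>F' X y\<bar> \<le> B" "\<And>X y h. \<bar>F (X + h) y - F X y - h * F' X y\<bar> \<le> B * h\<^sup>2"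
    "\<And>X Y y. \<bar>F X y - F Y y\<bar> \<le> B * \<bar>X - Y\<bar>" "\<And>X Y y. \<bar>F' X y - F' Y y\<bar> \<le> B * \<bar>X - Y\<bar>"
proof -
  obtain B where B: "B \<ge> 0" "\<And>X y. \<bar>F X y\<bar> \<le> B" "\<And>X y. \<bar>F' X y\<bar> \<le> B" "\<And>X y h. \<bar>F (X + h) y - F X y - h * F' X y\<bar> \<le> B * h\<^sup>2"
    using assms unfolding slow_def by blast
  have L1: "\<bar>F X y - F Y y\<bar> \<le> 2 * B * \<bar>X - Y\<bar>" for X Y y
  proof (cases "\<bar>X - Y\<bar> \<le> 1")
    case True
    have "\<bar>F X y - F Y y - (X - Y) * F' Y y\<bar> \<le> B * (X - Y)\<^sup>2" using B(4)[where X=Y and h="X - Y" and y=y] by simp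
    also have "\<dots> \<le> B * \<bar>X - Y\<bar>" using True B(1) power_le_one_iff[of "\<bar>X-Y\<bar>" 2] mult_left_le[of "\<bar>X-Y\<bar>" "\<bar>X-Y\<bar>"]
      by (intro mult_left_mono) (auto simp: power2_eq_square abs_mult[symmetric])
    finally have 1: "\<bar>F X y - F Y y - (X - Y) * F' Y y\<bar> \<le> B * \<bar>X - Y\<bar>" .
    have 2: "\<bar>(X - Y) * F' Y y\<bar> \<le> \<bar>X - Y\<bar> * B" unfolding abs_mult using B(3)[of Y y] by (intro mult_left_mono) auto
    have "\<bar>F X y - F Y y\<bar> \<le> \<bar>F X y - F Y y - (X - Y) * F' Y y\<bar> + \<bar>(X - Y) * F' Y y\<bar>" by linarith
    also have "\<dots> \<le> B * \<bar>X - Y\<bar> + \<bar>X - Y\<bar> * B" by (intro add_mono 1 2)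
    finally show ?thesis by (simp add: algebra_simps)
  next
    case False
    have "\<bar>F X y - F Y y\<bar> \<le> 2 * B" using B(2)[of X y] B(2)[of Y y] by linarith
    also have "\<dots> \<le> 2 * B * \<bar>X - Y\<bar>" using False B(1) mult_left_mono[of 1 "\<bar>X - Y\<bar>" "2 * B"] by simp
    finally show ?thesis .
  qed
  have L2: "\<bar>F' X y - F' Y y\<bar> \<le> 2 * B * \<bar>X - Y\<bar>" for X Y y
  proof (cases "X = Y")
    case False
    let ?h = "X - Y"
    have 1: "\<bar>F X y - F Y y - ?h * F' Y y\<bar> \<le> B * ?h\<^sup>2" using B(4)[where X=Y and h="?h" and y=y] by simp
    have 2: "\<bar>F Y y - F X y + ?h * F' X y\<bar> \<le> B * ?h\<^sup>2" using B(4)[where X=X and h="- ?h" and y=y] by (simp add: algebra_simps power2_commute[of X Y])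
    have "?h * (F' X y - F' Y y) = (F X y - F Y y - ?h * F' Y y) + (F Y y - F X y + ?h * F' X y)" by (simp add: algebra_simps)
    then have "\<bar>?h * (F' X y - F' Y y)\<bar> \<le> \<bar>F X y - F Y y - ?h * F' Y y\<bar> + \<bar>F Y y - F X y + ?h * F' X y\<bar>" by (simp only: abs_triangle_ineq)
    also have "\<dots> \<le> B * ?h\<^sup>2 + B * ?h\<^sup>2" by (intro add_mono 1 2)
    also have "\<dots> = \<bar>?h\<bar> * (2 * B * \<bar>?h\<bar>)" by (simp add: power2_eq_square algebra_simps)
    finally have "\<bar>?h\<bar> * \<bar>F' X y - F' Y y\<bar> \<le> \<bar>?h\<bar> * (2 * B * \<bar>?h\<bar>)" by (simp add: abs_mult)
    then show ?thesis using False by (simp add: mult_le_cancel_left)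
  qed simp
  have B2: "B \<le> 2 * B" using B(1) by simp
  have T: "\<bar>F (X + h) y - F X y - h * F' X y\<bar> \<le> 2 * B * h\<^sup>2" for X h y
    using B(4)[where X=X and h=h and y=y] mult_right_mono[OF B2, of "h\<^sup>2"] by simp
  show ?thesis
    by (rule that[of "2 * B"]) (use B(1) order_trans[OF B(2) B2] order_trans[OF B(3) B2] L1 L2 T in auto)
qed

lemma slowD:
  assumes "slow F F'"
  shows "(\<lambda>(X, y). F X y) \<in> borel_measurable borel" "(\<lambda>(X, y). F' X y) \<in> borel_measurable borel"
    "F X (y + 1) = F X y" "F' X (y + 1) = F' X y"
  using assms by (auto simp: slow_def)

lemma measurable_compose2:
  assumes F: "(\<lambda>(X, y). F X y) \<in> borel_measurable borel" and f: "f \<in> borel_measurable M" and g: "g \<in> borel_measurable M"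
  shows "(\<lambda>x. F (f x :: real) (g x :: real) :: real) \<in> borel_measurable M"
proof -
  have "(\<lambda>x. (f x, g x)) \<in> measurable M (borel \<Otimes>\<^sub>M borel)" using f g by measurable
  from measurable_comp[OF this F[folded borel_prod]] show ?thesis by (simp add: o_def)
qed

lemma slow_measurable_slice: "slow F F' \<Longrightarrow> (\<lambda>y. F X y) \<in> borel_measurable borel"
  by (rule measurable_compose2[OF slowD(1)]) auto

lemma slow_cmult: assumes "slow F F'" shows "slow (\<lambda>X y. c * F X y) (\<lambda>X y. c * F' X y)"
proof -
  obtain B where B: "B \<ge> 0" "\<And>X y. \<bar>F X y\<bar> \<le> B" "\<And>X y. \<bar>F' X y\<bar> \<le> B" "\<And>X y h. \<bar>F (X + h) y - F X y - h * F' X y\<bar> \<le> B * h\<^sup>2"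
    using slowE[OF assms] by metis
  show ?thesis
  proof (rule slowI[where ?B1.0="\<bar>c\<bar> * B" and ?B2.0="\<bar>c\<bar> * B" and ?B3.0="\<bar>c\<bar> * B"])
    show "(\<lambda>(X, y). c * F X y) \<in> borel_measurable borel" "(\<lambda>(X, y). c * F' X y) \<in> borel_measurable borel"
      using slowD(1,2)[OF assms] by (simp_all add: split_beta')
    show "\<bar>c * F (X + h) y - c * F X y - h * (c * F' X y)\<bar> \<le> \<bar>c\<bar> * B * h\<^sup>2" for X y h
    proof -
      have "c * F (X + h) y - c * F X y - h * (c * F' X y) = c * (F (X + h) y - F X y - h * F' X y)" by (simp add: algebra_simps)
      then show ?thesis using mult_left_mono[OF B(4)[where X=X and y=y and h=h], of "\<bar>c\<bar>"] by (simp add: abs_mult mult.assoc)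
    qed
  qed (use B slowD(3,4)[OF assms] in \<open>auto simp: abs_mult mult_left_mono\<close>)
qed

lemma slow_add: assumes "slow F F'" "slow G G'" shows "slow (\<lambda>X y. F X y + G X y) (\<lambda>X y. F' X y + G' X y)"
proof -
  obtain B where B: "B \<ge> 0" "\<And>X y. \<bar>F X y\<bar> \<le> B" "\<And>X y. \<bar>F' X y\<bar> \<le> B" "\<And>X y h. \<bar>F (X + h) y - F X y - h * F' X y\<bar> \<le> B * h\<^sup>2"
    using slowE[OF assms(1)] by metis
  obtain C where C: "C \<ge> 0" "\<And>X y. \<bar>G X y\<bar> \<le> C" "\<And>X y. \<bar>G' X y\<bar> \<le> C" "\<And>X y h. \<bar>G (X + h) y - G X y - h * G' X y\<bar> \<le> C * h\<^sup>2"
    using slowE[OF assms(2)] by metis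
  show ?thesis
  proof (rule slowI[where ?B1.0="B + C" and ?B2.0="B + C" and ?B3.0="B + C"])
    show "(\<lambda>(X, y). F X y + G X y) \<in> borel_measurable borel" "(\<lambda>(X, y). F' X y + G' X y) \<in> borel_measurable borel"
      using slowD(1,2)[OF assms(1)] slowD(1,2)[OF assms(2)] by (simp_all add: split_beta')
    show "\<bar>F X y + G X y\<bar> \<le> B + C" for X y using B(2)[of X y] C(2)[of X y] by linarith
    show "\<bar>F' X y + G' X y\<bar> \<le> B + C" for X y using B(3)[of X y] C(3)[of X y] by linarith
    show "\<bar>F (X + h) y + G (X + h) y - (F X y + G X y) - h * (F' X y + G' X y)\<bar> \<le> (B + C) * h\<^sup>2" for X y h
    proof -
      have "F (X + h) y + G (X + h) y - (F X y + G X y) - h * (F' X y + G' X y) = (F (X + h) y - F X y - h * F' X y) + (G (X + h) y - G X y - h * G' X y)"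
        by (simp add: algebra_simps)
      then show ?thesis using add_mono[OF B(4)[where X=X and y=y and h=h] C(4)[where X=X and y=y and h=h]]
          abs_triangle_ineq[of "F (X + h) y - F X y - h * F' X y" "G (X + h) y - G X y - h * G' X y"] by (simp add: distrib_right)
    qed
  qed (use slowD(3,4)[OF assms(1)] slowD(3,4)[OF assms(2)] in auto)
qed

lemma slow_diff: assumes "slow F F'" "slow G G'" shows "slow (\<lambda>X y. F X y - G X y) (\<lambda>X y. F' X y - G' X y)"
  using slow_add[OF assms(1) slow_cmult[OF assms(2), of "-1"]] by simp

lemma slow_mult: assumes "slow F F'" "slow G G'" shows "slow (\<lambda>X y. F X y * G X y) (\<lambda>X y. F' X y * G X y + F X y * G' X y)"
proof -
  obtain B where B: "B \<ge> 0" "\<And>X y. \<bar>F X y\<bar> \<le> B" "\<And>X y. \<bar>F' X y\<bar> \<le> B" "\<And>X y h. \<bar>F (X + h) y - F X y - h * F' X y\<bar> \<le> B * h\<^sup>2"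
    "\<And>X Y y. \<bar>F X y - F Y y\<bar> \<le> B * \<bar>X - Y\<bar>" using slowE[OF assms(1)] by metis
  obtain C where C: "C \<ge> 0" "\<And>X y. \<bar>G X y\<bar> \<le> C" "\<And>X y. \<bar>G' X y\<bar> \<le> C" "\<And>X y h. \<bar>G (X + h) y - G X y - h * G' X y\<bar> \<le> C * h\<^sup>2"
    "\<And>X Y y. \<bar>G X y - G Y y\<bar> \<le> C * \<bar>X - Y\<bar>" using slowE[OF assms(2)] by metis
  show ?thesis
  proof (rule slowI[where ?B1.0="B * C" and ?B2.0="2 * (B * C)" and ?B3.0="3 * (B * C)"])
    show "(\<lambda>(X, y). F X y * G X y) \<in> borel_measurable borel" "(\<lambda>(X, y). F' X y * G X y + F X y * G' X y) \<in> borel_measurable borel"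
      using slowD(1,2)[OF assms(1)] slowD(1,2)[OF assms(2)] by (simp_all add: split_beta')
    show "\<bar>F X y * G X y\<bar> \<le> B * C" for X y unfolding abs_mult using B C by (intro mult_mono) auto
    show "\<bar>F' X y * G X y + F X y * G' X y\<bar> \<le> 2 * (B * C)" for X y
    proof -
      have "\<bar>F' X y * G X y\<bar> \<le> B * C" "\<bar>F X y * G' X y\<bar> \<le> B * C" unfolding abs_mult using B C by (auto intro!: mult_mono)
      then show ?thesis by linarith
    qed
    show "\<bar>F (X + h) y * G (X + h) y - F X y * G X y - h * (F' X y * G X y + F X y * G' X y)\<bar> \<le> 3 * (B * C) * h\<^sup>2" for X y h
    proof -
      have e: "F (X + h) y * G (X + h) y - F X y * G X y - h * (F' X y * G X y + F X y * G' X y) =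
         (F (X + h) y - F X y - h * F' X y) * G X y + F X y * (G (X + h) y - G X y - h * G' X y) + (F (X + h) y - F X y) * (G (X + h) y - G X y)"
        by (simp add: algebra_simps)
      have 1: "\<bar>(F (X + h) y - F X y - h * F' X y) * G X y\<bar> \<le> (B * h\<^sup>2) * C"
        unfolding abs_mult using B(1) by (intro mult_mono B C) auto
      have 2: "\<bar>F X y * (G (X + h) y - G X y - h * G' X y)\<bar> \<le> B * (C * h\<^sup>2)"
        unfolding abs_mult using B(1) by (intro mult_mono B C) auto
      have "\<bar>F (X + h) y - F X y\<bar> \<le> B * \<bar>h\<bar>" "\<bar>G (X + h) y - G X y\<bar> \<le> C * \<bar>h\<bar>" using B(5)[of "X + h" y X] C(5)[of "X + h" y X] by auto
      then have 3: "\<bar>(F (X + h) y - F X y) * (G (X + h) y - G X y)\<bar> \<le> (B * \<bar>h\<bar>) * (C * \<bar>h\<bar>)"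
        unfolding abs_mult using B(1) by (intro mult_mono) auto
      have "\<bar>a + b + c\<bar> \<le> \<bar>a\<bar> + \<bar>b\<bar> + \<bar>c\<bar>" for a b c :: real by linarith
      from order_trans[OF this add_mono[OF add_mono[OF 1 2] 3]] show ?thesis
        unfolding e by (simp add: power2_eq_square algebra_simps)
    qed
  qed (use slowD(3,4)[OF assms(1)] slowD(3,4)[OF assms(2)] in auto)
qed

lemma conv_measurable:
  assumes k: "continuous_on UNIV k" and F: "(\<lambda>(X, y). F X y) \<in> borel_measurable borel"
  shows "(\<lambda>(X, y). conv k F X y) \<in> borel_measurable borel"
proof -
  have km[measurable]: "k \<in> borel_measurable borel" by (rule borel_measurable_continuous_onI[OF k])
  have "(\<lambda>(p, s). indicator {0..1} s *\<^sub>R (k s * F (fst p) (snd p + s))) \<in> borel_measurable ((borel \<Otimes>\<^sub>M borel) \<Otimes>\<^sub>M lborel)"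
    unfolding split_beta'
    by (intro borel_measurable_scaleR borel_measurable_times measurable_compose2[OF F]) measurable
  then have "(\<lambda>p. LINT s|lborel. indicator {0..1} s *\<^sub>R (k s * F (fst p) (snd p + s))) \<in> borel_measurable (borel \<Otimes>\<^sub>M borel)"
    by (rule lborel.borel_measurable_lebesgue_integral)
  then show ?thesis by (simp add: conv_def set_lebesgue_integral_def split_beta' borel_prod)
qed

lemma conv_bound:
  assumes k: "continuous_on UNIV k" "\<And>s. s \<in> {0..1} \<Longrightarrow> \<bar>k s\<bar> \<le> K" and f: "(\<lambda>y. F X y) \<in> borel_measurable borel" "\<And>y. \<bar>F X y\<bar> \<le> B"
  shows "\<bar>conv k F X y\<bar> \<le> K * B"
proof -
  have "(\<lambda>s. F X (y + s)) \<in> borel_measurable borel" using f(1) by measurable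
  note i = set_integrable_kernel[OF k(1) this f(2)]
  have "0 \<le> B" "0 \<le> K" using f(2)[of 0] k(2)[of 0] by auto
  then have "\<bar>conv k F X y\<bar> \<le> K * B * (1 - 0)" unfolding conv_def
    by (intro set_integral_abs_le[OF i]) (auto simp: abs_mult intro!: mult_mono k f)
  then show ?thesis by simp
qed

lemma slow_conv: assumes k: "continuous_on UNIV k" and F: "slow F F'" shows "slow (conv k F) (conv k F')"
proof -
  obtain B where B: "B \<ge> 0" "\<And>X y. \<bar>F X y\<bar> \<le> B" "\<And>X y. \<bar>F' X y\<bar> \<le> B" "\<And>X y h. \<bar>F (X + h) y - F X y - h * F' X y\<bar> \<le> B * h\<^sup>2"
    using slowE[OF F] by metis
  obtain K where K: "K \<ge> 0" "\<And>s. s \<in> {0..1} \<Longrightarrow> \<bar>k s\<bar> \<le> K" using kernel_bound[OF k] by blast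
  have m: "(\<lambda>y. F X y) \<in> borel_measurable borel" "(\<lambda>y. F' X y) \<in> borel_measurable borel" for X
    by (rule measurable_compose2[OF slowD(1)[OF F]], auto, rule measurable_compose2[OF slowD(2)[OF F]], auto)
  have ms: "(\<lambda>s. F X (y + s)) \<in> borel_measurable borel" "(\<lambda>s. F' X (y + s)) \<in> borel_measurable borel" for X y
    using measurable_compose[OF _ m(1), of "\<lambda>s. y + s"] measurable_compose[OF _ m(2), of "\<lambda>s. y + s"] by auto
  show ?thesis
  proof (rule slowI[where ?B1.0="K * B" and ?B2.0="K * B" and ?B3.0="K * B"])
    show "(\<lambda>(X, y). conv k F X y) \<in> borel_measurable borel" "(\<lambda>(X, y). conv k F' X y) \<in> borel_measurable borel"
      by (rule conv_measurable[OF k slowD(1)[OF F]], rule conv_measurable[OF k slowD(2)[OF F]])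
    have "F X (y + 1 + s) = F X (y + s)" "F' X (y + 1 + s) = F' X (y + s)" for X y s
      using slowD(3)[OF F, of X "y + s"] slowD(4)[OF F, of X "y + s"] by (simp_all add: add_ac)
    then show "conv k F X (y + 1) = conv k F X y" "conv k F' X (y + 1) = conv k F' X y" for X y
      unfolding conv_def by (simp_all only:)
    show "\<bar>conv k F X y\<bar> \<le> K * B" "\<bar>conv k F' X y\<bar> \<le> K * B" for X y
      by (rule conv_bound[OF k K(2) m(1) B(2)], assumption, rule conv_bound[OF k K(2) m(2) B(3)], assumption)
    show "\<bar>conv k F (X + h) y - conv k F X y - h * conv k F' X y\<bar> \<le> K * B * h\<^sup>2" for X y h
    proof -
      have i: "set_integrable lborel {0..1} (\<lambda>s. k s * F Y (y + s))" "set_integrable lborel {0..1} (\<lambda>s. h * (k s * F' Y (y + s)))" for Y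
        using set_integrable_kernel[OF k ms(1) B(2)] set_integrable_kernel[OF k ms(2) B(3)] by simp_all
      have i2: "set_integrable lborel {0..1} (\<lambda>s. k s * F (X + h) (y + s) - k s * F X (y + s) - h * (k s * F' X (y + s)))"
        by (intro set_integral_diff i)
      have "conv k F (X + h) y - conv k F X y - h * conv k F' X y = (LINT s:{0..1}|lborel. k s * F (X + h) (y + s) - k s * F X (y + s) - h * (k s * F' X (y + s)))"
        unfolding conv_def using i by simp
      also have "\<bar>\<dots>\<bar> \<le> K * (B * h\<^sup>2) * (1 - 0)"
      proof (rule set_integral_abs_le[OF i2])
        fix s :: real assume s: "s \<in> {0..1}"
        have "k s * F (X + h) (y + s) - k s * F X (y + s) - h * (k s * F' X (y + s)) = k s * (F (X + h) (y + s) - F X (y + s) - h * F' X (y + s))"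
          by (simp add: algebra_simps)
        then show "\<bar>k s * F (X + h) (y + s) - k s * F X (y + s) - h * (k s * F' X (y + s))\<bar> \<le> K * (B * h\<^sup>2)"
          unfolding abs_mult using K B(1) s by (simp add: abs_mult) (intro mult_mono K B, auto)
      qed simp
      finally show ?thesis by simp
    qed
  qed
qed

lemma conv_primitive_fixed:
  assumes F: "slow F F'" and k: "\<And>s. (k has_real_derivative k' s) (at s)" and k': "continuous_on UNIV k'"
  shows "primitive (\<lambda>v. conv k F X v) (\<lambda>v. (k 1 - k 0) * F X v - conv k' F X v)"
proof -
  obtain B where B: "B \<ge> 0" "\<And>X y. \<bar>F X y\<bar> \<le> B" using slowE[OF F] by metis
  have m: "(\<lambda>y. F X y) \<in> borel_measurable borel" by (rule measurable_compose2[OF slowD(1)[OF F]]) auto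
  show ?thesis unfolding conv_def
    by (rule periodic_integral_shift[OF m B(2) slowD(3)[OF F] k k'])
qed

lemma conv_mean_const:
  assumes F: "slow F F'" shows "conv (\<lambda>_. 1) F X y = conv (\<lambda>_. 1) F X 0"
proof -
  have "primitive (\<lambda>v. conv (\<lambda>_. 1) F X v) (\<lambda>v. (1 - 1) * F X v - conv (\<lambda>_. 0) F X v)"
    by (rule conv_primitive_fixed[OF F]) (auto intro!: derivative_eq_intros)
  then have "primitive (\<lambda>v. conv (\<lambda>_. 1) F X v) (\<lambda>v. 0)" by (simp add: conv_def)
  from primitive_lipschitz_global[OF this, of 0 y 0] show ?thesis by simp
qed

text \<open>The chain rule along the curve \<open>v \<mapsto> (\<tau> v, v)\<close>: the fast derivative acts on the kernel, the slow one
on \<open>F\<close> and costs a factor \<open>\<tau>\<close>.\<close>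

lemma conv_chain:
  assumes F: "slow F F'" and k: "\<And>s. (k has_real_derivative k' s) (at s)" and k': "continuous_on UNIV k'" and \<tau>: "0 \<le> \<tau>"
  shows "primitive (\<lambda>v. conv k F (\<tau> * v) v)
    (\<lambda>v. (k 1 - k 0) * F (\<tau> * v) v - conv k' F (\<tau> * v) v + \<tau> * conv k F' (\<tau> * v) v)"
proof (rule primitiveI_small_increments)
  show "continuous_on UNIV (\<lambda>x::real. x)" by simp
  have ck: "continuous_on UNIV k" using k by (meson DERIV_isCont continuous_at_imp_continuous_on)
  have sH: "slow (conv k F) (conv k F')" by (rule slow_conv[OF ck F])
  have sH': "slow (conv k' F) (conv k' F')" by (rule slow_conv[OF k' F])
  define h where "h X v = (k 1 - k 0) * F X v - conv k' F X v" for X v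
  define H where "H = conv k F"
  define H' where "H' = conv k F'"
  obtain B where B: "B \<ge> 0" "\<And>X y. \<bar>F X y\<bar> \<le> B" "\<And>X y. \<bar>F' X y\<bar> \<le> B" "\<And>X Y y. \<bar>F X y - F Y y\<bar> \<le> B * \<bar>X - Y\<bar>"
    using slowE[OF F] by metis
  obtain C where C: "C \<ge> 0" "\<And>X y h. \<bar>H (X + h) y - H X y - h * H' X y\<bar> \<le> C * h\<^sup>2" "\<And>X Y y. \<bar>H' X y - H' Y y\<bar> \<le> C * \<bar>X - Y\<bar>" "\<And>X y. \<bar>H' X y\<bar> \<le> C"
    using slowE[OF sH] unfolding H_def H'_def by metis
  obtain D where D: "D \<ge> 0" "\<And>X y. \<bar>conv k' F X y\<bar> \<le> D" "\<And>X Y y. \<bar>conv k' F X y - conv k' F Y y\<bar> \<le> D * \<bar>X - Y\<bar>" "\<And>X y. \<bar>conv k' F' X y\<bar> \<le> D"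
    using slowE[OF sH'] by metis
  let ?K = "\<bar>k 1 - k 0\<bar>"
  have hb: "\<bar>h X v\<bar> \<le> ?K * B + D" for X v
    unfolding h_def using mult_left_mono[OF B(2)[of X v], of ?K] D(2)[of X v] by (simp add: abs_mult[symmetric])
  have hL: "\<bar>h X v - h Y v\<bar> \<le> (?K * B + D) * \<bar>X - Y\<bar>" for X Y v
  proof -
    have "h X v - h Y v = (k 1 - k 0) * (F X v - F Y v) - (conv k' F X v - conv k' F Y v)" by (simp add: h_def algebra_simps)
    moreover have "\<bar>(k 1 - k 0) * (F X v - F Y v)\<bar> \<le> ?K * (B * \<bar>X - Y\<bar>)" unfolding abs_mult by (intro mult_left_mono B) auto
    ultimately show ?thesis using D(3)[of X v Y] abs_triangle_ineq4[of "(k 1 - k 0) * (F X v - F Y v)" "conv k' F X v - conv k' F Y v"]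
      by (simp add: distrib_right mult.assoc)
  qed
  have HL: "\<bar>H' X u - H' X v\<bar> \<le> (?K * B + D) * \<bar>u - v\<bar>" for X u v
  proof -
    have m: "(\<lambda>y. F' X y) \<in> borel_measurable borel" by (rule measurable_compose2[OF slowD(2)[OF F]]) auto
    have "primitive (\<lambda>v. H' X v) (\<lambda>v. (k 1 - k 0) * F' X v - conv k' F' X v)"
      unfolding H'_def conv_def by (rule periodic_integral_shift[OF m B(3) slowD(4)[OF F] k k'])
    then show ?thesis
    proof (rule primitive_lipschitz_global)
      fix v
      show "\<bar>(k 1 - k 0) * F' X v - conv k' F' X v\<bar> \<le> ?K * B + D"
        using mult_left_mono[OF B(3)[of X v], of ?K] D(4)[of X v] by (simp add: abs_mult[symmetric])
    qed
  qed
  have comp: "(\<lambda>v. G (\<tau> * v) v) \<in> borel_measurable borel" if "(\<lambda>(X, y). G X y) \<in> borel_measurable borel" for G :: "real \<Rightarrow> real \<Rightarrow> real"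
    by (rule measurable_compose2[OF that]) auto
  define f where "f v = h (\<tau> * v) v + \<tau> * H' (\<tau> * v) v" for v
  have fm: "f \<in> borel_measurable borel" unfolding f_def h_def H'_def
    using comp[OF slowD(1)[OF F]] comp[OF slowD(1)[OF sH']] comp[OF slowD(2)[OF sH]] by simp
  have fb: "\<bar>f v\<bar> \<le> (?K * B + D) + \<tau> * C" for v
    unfolding f_def using hb[of "\<tau> * v" v] mult_left_mono[OF C(4)[of "\<tau> * v" v] \<tau>] \<tau>
      abs_triangle_ineq[of "h (\<tau> * v) v" "\<tau> * H' (\<tau> * v) v"] by (simp add: abs_mult)
  have lf: "locally_integrable f" by (intro locally_integrable_bounded loc_bounded_bounded[OF fm fb])
  have feq: "f = (\<lambda>v. (k 1 - k 0) * F (\<tau> * v) v - conv k' F (\<tau> * v) v + \<tau> * conv k F' (\<tau> * v) v)"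
    by (rule ext) (simp add: f_def h_def H'_def)
  show "locally_integrable (\<lambda>v. (k 1 - k 0) * F (\<tau> * v) v - conv k' F (\<tau> * v) v + \<tau> * conv k F' (\<tau> * v) v)"
    using lf unfolding feq .
  \<comment> \<open>The error is quadratic in the length of the interval: Taylor expansion in the slow variable, and Lipschitz bounds for the terms evaluated at its frozen value.\<close>
  define M where "M = C * \<tau>\<^sup>2 + ((?K * B + D) * \<tau> + \<tau> * (C * \<tau> + (?K * B + D)))"
  fix R :: real
  show "\<exists>M. \<forall>x y. - R \<le> x \<and> x \<le> y \<and> y \<le> R \<longrightarrow>
       \<bar>conv k F (\<tau> * y) y - conv k F (\<tau> * x) x -
        (LINT s:{x..y}|lborel. (k 1 - k 0) * F (\<tau> * s) s - conv k' F (\<tau> * s) s + \<tau> * conv k F' (\<tau> * s) s)\<bar> \<le> M * (y - x) * \<bar>y - x\<bar>"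
  proof (intro exI[of _ M] allI impI)
    fix x y :: real assume xy: "- R \<le> x \<and> x \<le> y \<and> y \<le> R"
    have ph: "primitive (\<lambda>v. H (\<tau> * x) v) (\<lambda>v. h (\<tau> * x) v)" unfolding H_def h_def by (rule conv_primitive_fixed[OF F k k'])
    have 1: "\<bar>H (\<tau> * y) y - H (\<tau> * x) y - \<tau> * (y - x) * H' (\<tau> * x) y\<bar> \<le> C * \<tau>\<^sup>2 * (y - x)\<^sup>2"
    proof -
      have "\<tau> * x + \<tau> * (y - x) = \<tau> * y" by (simp add: algebra_simps)
      then show ?thesis using C(2)[where X="\<tau> * x" and h="\<tau> * (y - x)" and y=y] by (simp add: power_mult_distrib mult.assoc)
    qed
    have c: "set_integrable lborel {x..y} (\<lambda>s. c :: real)" for c by (intro borel_integrable_atLeastAtMost') auto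
    have i1: "set_integrable lborel {x..y} f" using lf by (simp add: locally_integrable_def)
    have i2: "set_integrable lborel {x..y} (\<lambda>s. h (\<tau> * x) s + \<tau> * H' (\<tau> * x) y)" by (intro set_integral_add primitiveD(3)[OF ph] c)
    have e: "(LINT s:{x..y}|lborel. h (\<tau> * x) s + \<tau> * H' (\<tau> * x) y) = H (\<tau> * x) y - H (\<tau> * x) x + \<tau> * (y - x) * H' (\<tau> * x) y"
      using primitiveD(2)[OF ph, of x y] primitiveD(3)[OF ph, of x y] c xy by (simp add: set_integral_const)
    have "(LINT s:{x..y}|lborel. h (\<tau> * x) s + \<tau> * H' (\<tau> * x) y) - (LINT s:{x..y}|lborel. f s) = (LINT s:{x..y}|lborel. (h (\<tau> * x) s + \<tau> * H' (\<tau> * x) y) - f s)"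
      using i1 i2 by simp
    also have "\<bar>\<dots>\<bar> \<le> ((?K * B + D) * \<tau> + \<tau> * (C * \<tau> + (?K * B + D))) * (y - x) * (y - x)"
    proof (rule set_integral_abs_le)
      show "set_integrable lborel {x..y} (\<lambda>s. (h (\<tau> * x) s + \<tau> * H' (\<tau> * x) y) - f s)" using i1 i2 by (intro set_integral_diff)
      fix s assume s: "s \<in> {x..y}"
      have tx: "\<bar>\<tau> * x - \<tau> * s\<bar> \<le> \<tau> * (y - x)"
        using s \<tau> mult_left_mono[of "s - x" "y - x" \<tau>] by (simp add: right_diff_distrib[symmetric] abs_mult)
      have K0: "0 \<le> ?K * B + D" using B(1) D(1) by simp
      have "\<bar>h (\<tau> * x) s - h (\<tau> * s) s\<bar> \<le> (?K * B + D) * (\<tau> * (y - x))"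
        using hL[of "\<tau> * x" s "\<tau> * s"] mult_left_mono[OF tx K0] by linarith
      moreover have "\<bar>\<tau> * (H' (\<tau> * x) y - H' (\<tau> * s) s)\<bar> \<le> \<tau> * (C * (\<tau> * (y - x)) + (?K * B + D) * (y - x))"
      proof -
        have a: "\<bar>H' (\<tau> * x) y - H' (\<tau> * s) y\<bar> \<le> C * (\<tau> * (y - x))"
          using C(3)[of "\<tau> * x" y "\<tau> * s"] mult_left_mono[OF tx C(1)] by linarith
        have b: "\<bar>H' (\<tau> * s) y - H' (\<tau> * s) s\<bar> \<le> (?K * B + D) * (y - x)"
          using HL[of "\<tau> * s" y s] mult_left_mono[of "\<bar>y - s\<bar>" "y - x", OF _ K0] s by auto
        have "\<bar>H' (\<tau> * x) y - H' (\<tau> * s) s\<bar> \<le> C * (\<tau> * (y - x)) + (?K * B + D) * (y - x)"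
          using a b abs_triangle_ineq[of "H' (\<tau> * x) y - H' (\<tau> * s) y" "H' (\<tau> * s) y - H' (\<tau> * s) s"] by simp
        then show ?thesis using \<tau> by (simp add: abs_mult mult_left_mono)
      qed
      moreover have "(h (\<tau> * x) s + \<tau> * H' (\<tau> * x) y) - f s = (h (\<tau> * x) s - h (\<tau> * s) s) + \<tau> * (H' (\<tau> * x) y - H' (\<tau> * s) s)"
        by (simp add: f_def algebra_simps)
      ultimately show "\<bar>(h (\<tau> * x) s + \<tau> * H' (\<tau> * x) y) - f s\<bar> \<le> ((?K * B + D) * \<tau> + \<tau> * (C * \<tau> + (?K * B + D))) * (y - x)"
        using abs_triangle_ineq[of "h (\<tau> * x) s - h (\<tau> * s) s" "\<tau> * (H' (\<tau> * x) y - H' (\<tau> * s) s)"] by (simp add: algebra_simps)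
    qed (use xy in auto)
    finally have 2: "\<bar>H (\<tau> * x) y - H (\<tau> * x) x + \<tau> * (y - x) * H' (\<tau> * x) y - (LINT s:{x..y}|lborel. f s)\<bar> \<le> ((?K * B + D) * \<tau> + \<tau> * (C * \<tau> + (?K * B + D))) * (y - x) * (y - x)"
      unfolding e .
    have "H (\<tau> * y) y - H (\<tau> * x) x - (LINT s:{x..y}|lborel. f s) =
      (H (\<tau> * y) y - H (\<tau> * x) y - \<tau> * (y - x) * H' (\<tau> * x) y) + (H (\<tau> * x) y - H (\<tau> * x) x + \<tau> * (y - x) * H' (\<tau> * x) y - (LINT s:{x..y}|lborel. f s))"
      by simp
    then have "\<bar>H (\<tau> * y) y - H (\<tau> * x) x - (LINT s:{x..y}|lborel. f s)\<bar> \<le> C * \<tau>\<^sup>2 * (y - x)\<^sup>2 + ((?K * B + D) * \<tau> + \<tau> * (C * \<tau> + (?K * B + D))) * (y - x) * (y - x)"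
      using order_trans[OF abs_triangle_ineq add_mono[OF 1 2]] by simp
    also have "\<dots> = M * (y - x) * \<bar>y - x\<bar>" using xy by (simp add: M_def power2_eq_square algebra_simps)
    finally show "\<bar>conv k F (\<tau> * y) y - conv k F (\<tau> * x) x -
        (LINT s:{x..y}|lborel. (k 1 - k 0) * F (\<tau> * s) s - conv k' F (\<tau> * s) s + \<tau> * conv k F' (\<tau> * s) s)\<bar> \<le> M * (y - x) * \<bar>y - x\<bar>"
      unfolding feq H_def .
  qed
qed

section \<open>A regular representative of the potential\<close>

lemma continuous_AE_imp_eq:
  fixes f g :: "real \<Rightarrow> real"
  assumes "continuous_on UNIV f" "continuous_on UNIV g" "AE x in lborel. f x = g x"
  shows "f x = g x"
proof -
  have "closed {x. f x = g x}" by (intro closed_Collect_eq assms)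
  moreover have "AE x in lebesgue. x \<in> {x. f x = g x}" using assms(3) by (simp add: AE_completion)
  ultimately show ?thesis using mem_closed_if_AE_lebesgue by blast
qed

lemma continuous_AE_imp_le:
  fixes f :: "real \<Rightarrow> real"
  assumes "continuous_on UNIV f" "AE x in lborel. \<bar>f x\<bar> \<le> C"
  shows "\<bar>f x\<bar> \<le> C"
proof -
  have "closed {x. \<bar>f x\<bar> \<le> C}" by (intro closed_Collect_le continuous_on_rabs assms continuous_on_const)
  moreover have "AE x in lebesgue. x \<in> {x. \<bar>f x\<bar> \<le> C}" using assms(2) by (simp add: AE_completion)
  ultimately show ?thesis using mem_closed_if_AE_lebesgue by blast
qed

lemma primitive_DERIV:
  assumes p: "primitive F f" and c: "continuous_on UNIV f" shows "(F has_real_derivative f x) (at x)"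
proof -
  have "((\<lambda>u. integral {x-1..u} f) has_real_derivative f x) (at x within {x-1..x+1})"
    by (rule integral_has_real_derivative) (use continuous_on_subset[OF c] in auto)
  then have "((\<lambda>u. F (x - 1) + integral {x-1..u} f) has_real_derivative 0 + f x) (at x within {x-1..x+1})"
    by (intro DERIV_add DERIV_const)
  then have "(F has_real_derivative f x) (at x within {x-1..x+1})"
  proof (rule has_field_derivative_transform_within[where d=1, THEN DERIV_cong])
    fix y assume "y \<in> {x-1..x+1}"
    then show "F (x - 1) + integral {x-1..y} f = F y"
      using primitiveD(2)[OF p, of "x-1" y] set_integral_eq_henstock(2)[OF primitiveD(3)[OF p], of "x-1" y] by simp
  qed auto
  then show ?thesis using at_within_Icc_at[of "x-1" x "x+1"] by simp
qed

text \<open>Each weak derivative is almost everywhere a primitive of the next one, and continuity turns these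
equalities into equalities everywhere, by induction on the order.\<close>

lemma regular_slice:
  fixes f :: "real \<Rightarrow> real"
  assumes c: "continuous_on UNIV f" and w: "\<And>j. j \<le> Suc n \<Longrightarrow> has_weak_deriv j f (g j)" and b: "\<And>j. j \<le> Suc n \<Longrightarrow> AE x in lborel. \<bar>g j x\<bar> \<le> C"
  shows "\<And>j x. j < n \<Longrightarrow> ((deriv ^^ j) f has_real_derivative (deriv ^^ Suc j) f x) (at x)"
    "\<And>j x. j \<le> n \<Longrightarrow> \<bar>(deriv ^^ j) f x\<bar> \<le> C" "\<And>x y. \<bar>(deriv ^^ n) f x - (deriv ^^ n) f y\<bar> \<le> C * \<bar>x - y\<bar>"
proof -
  have "\<exists>F. primitive F (g (Suc j)) \<and> (AE x in lborel. g j x = F x)" if "j \<le> n" for j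
  proof (rule weak_deriv_imp_primitive, rule has_weak_deriv_step)
    show "has_weak_deriv j f (g j)" "has_weak_deriv (Suc j) f (g (Suc j))" by (rule w, use that in simp)+
  qed
  then have "\<forall>j\<in>{..n}. \<exists>F. primitive F (g (Suc j)) \<and> (AE x in lborel. g j x = F x)" by simp
  from bchoice[OF this] obtain F where F': "\<forall>j\<in>{..n}. primitive (F j) (g (Suc j)) \<and> (AE x in lborel. g j x = F j x)" by blast
  have F: "primitive (F j) (g (Suc j))" "AE x in lborel. g j x = F j x" if "j \<le> n" for j using F' that by auto
  have cF: "continuous_on UNIV (F j)" if "j \<le> n" for j by (rule primitive_continuous[OF F(1)[OF that]])
  have "has_weak_deriv 0 f f"
    unfolding has_weak_deriv_def using locally_integrable_bounded[OF loc_bounded_continuous[OF c]] by simp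
  then have "AE x in lborel. f x = g 0 x" by (rule has_weak_deriv_unique_AE) (simp add: w)
  moreover have "AE x in lborel. g 0 x = F 0 x" by (rule F(2)) simp
  ultimately have "AE x in lborel. f x = F 0 x" by eventually_elim simp
  then have f0: "f = F 0" by (intro ext continuous_AE_imp_eq[OF c cF]) simp_all
  have pF: "primitive (F j) (F (Suc j))" if "j < n" for j
  proof (rule primitive_cong_AE)
    show "primitive (F j) (g (Suc j))" "AE x in lborel. g (Suc j) x = F (Suc j) x" by (rule F, use that in simp)+
    show "F (Suc j) \<in> borel_measurable borel" by (rule borel_measurable_continuous_onI, rule cF) (use that in simp)
  qed
  have D: "(F j has_real_derivative F (Suc j) x) (at x)" if "j < n" for j x
    by (rule primitive_DERIV[OF pF[OF that] cF[OF Suc_leI[OF that]]])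
  have eq: "(deriv ^^ j) f = F j" if "j \<le> n" for j
    using that
  proof (induction j)
    case (Suc j)
    then have "j < n" by simp
    have "deriv (F j) = F (Suc j)" by (rule ext, rule DERIV_imp_deriv, rule D) fact
    then show ?case using Suc by simp
  qed (simp add: f0)
  show "((deriv ^^ j) f has_real_derivative (deriv ^^ Suc j) f x) (at x)" if "j < n" for j x
    unfolding eq[OF less_imp_le[OF that]] eq[OF Suc_leI[OF that]] by (rule D[OF that])
  show b2: "\<bar>(deriv ^^ j) f x\<bar> \<le> C" if "j \<le> n" for j x
  proof -
    have "AE x in lborel. \<bar>g j x\<bar> \<le> C" by (rule b) (use that in simp)
    with F(2)[OF that] have "AE x in lborel. \<bar>F j x\<bar> \<le> C" by eventually_elim simp
    then show ?thesis unfolding eq[OF that] by (rule continuous_AE_imp_le[OF cF[OF that]])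
  qed
  have C0: "0 \<le> C" using order_trans[OF abs_ge_zero b2[of 0 0]] by simp
  have gm: "g (Suc n) \<in> borel_measurable borel" by (rule locally_integrable_measurable[OF primitiveD(1)[OF F(1)[OF order_refl]]])
  have "primitive (F n) (\<lambda>x. max (- C) (min C (g (Suc n) x)))"
  proof (rule primitive_cong_AE[OF F(1)])
    show "AE x in lborel. g (Suc n) x = max (- C) (min C (g (Suc n) x))"
    proof -
      have "AE x in lborel. \<bar>g (Suc n) x\<bar> \<le> C" by (rule b) simp
      then show ?thesis by eventually_elim (auto simp: abs_le_iff)
    qed
  qed (use gm in auto)
  then have "\<bar>F n x - F n y\<bar> \<le> C * \<bar>x - y\<bar>" for x y
    by (rule primitive_lipschitz_global) (use C0 in \<open>simp add: abs_le_iff\<close>)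
  then show "\<bar>(deriv ^^ n) f x - (deriv ^^ n) f y\<bar> \<le> C * \<bar>x - y\<bar>" for x y
    unfolding eq[OF order_refl] .
qed

lemma taylor_from_lipschitz:
  fixes F F' :: "real \<Rightarrow> real"
  assumes D: "\<And>x. (F has_real_derivative F' x) (at x)" and L: "\<And>x y. \<bar>F' x - F' y\<bar> \<le> C * \<bar>x - y\<bar>"
  shows "\<bar>F (x + h) - F x - h * F' x\<bar> \<le> C * h\<^sup>2"
proof (cases "h = 0")
  case False
  have C: "C \<ge> 0" using L[of 1 0] by simp
  have "\<exists>z. \<bar>z - x\<bar> \<le> \<bar>h\<bar> \<and> F (x + h) - F x = h * F' z"
  proof (cases "h > 0")
    case True
    then obtain z where "x < z" "z < x + h" "F (x + h) - F x = (x + h - x) * F' z" using MVT2[of x "x + h" F F'] D by auto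
    then show ?thesis by (intro exI[of _ z]) auto
  next
    case nf: False
    then obtain z where "x + h < z" "z < x" "F x - F (x + h) = (x - (x + h)) * F' z" using MVT2[of "x + h" x F F'] D False by auto
    then show ?thesis by (intro exI[of _ z]) (auto simp: algebra_simps)
  qed
  then obtain z where z: "\<bar>z - x\<bar> \<le> \<bar>h\<bar>" "F (x + h) - F x = h * F' z" by blast
  have "\<bar>F' z - F' x\<bar> \<le> C * \<bar>h\<bar>" using L[of z x] mult_left_mono[OF z(1) C] by linarith
  then have "\<bar>h * (F' z - F' x)\<bar> \<le> \<bar>h\<bar> * (C * \<bar>h\<bar>)" unfolding abs_mult by (intro mult_left_mono) auto
  then show ?thesis unfolding z(2) by (simp add: right_diff_distrib power2_eq_square mult.left_commute)
qed simp

lemma AE_swap_bound: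
  fixes g :: "real \<Rightarrow> real \<Rightarrow> real"
  assumes m: "(\<lambda>(X, y). g X y) \<in> borel_measurable borel" and b: "AE p in lborel. \<bar>(\<lambda>(X, y). g X y) p\<bar> \<le> C"
  shows "AE y in lborel. AE X in lborel. \<bar>g X y\<bar> \<le> C"
proof -
  have mm[measurable]: "(\<lambda>(X, y). g X y) \<in> borel_measurable (borel \<Otimes>\<^sub>M borel)" using m by (simp add: borel_prod)
  have "AE p in lborel \<Otimes>\<^sub>M lborel. \<bar>g (fst p) (snd p)\<bar> \<le> C" unfolding lborel_prod using b by (simp add: split_beta)
  from lborel_pair.AE_pair[OF this] have 1: "AE X in lborel. AE y in lborel. \<bar>g X y\<bar> \<le> C" by simp
  have gm[measurable]: "(\<lambda>p. g (fst p) (snd p)) \<in> borel_measurable (lborel \<Otimes>\<^sub>M lborel)"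
    using mm by (simp add: split_beta' cong: measurable_cong_sets)
  have "{p \<in> space (lborel \<Otimes>\<^sub>M lborel). \<bar>g (fst p) (snd p)\<bar> \<le> C} \<in> sets (lborel \<Otimes>\<^sub>M lborel)" by measurable
  from lborel_pair.AE_commute[OF this] 1 show ?thesis by simp
qed

text \<open>The exceptional set is enlarged to be invariant under integer translations, so that modifying a
periodic function on it preserves periodicity.\<close>

lemma periodic_null_set:
  assumes "AE y in (lborel :: real measure). P y"
  shows "\<exists>N\<in>null_sets lborel. (\<forall>y. y + 1 \<in> N \<longleftrightarrow> y \<in> N) \<and> (\<forall>y. y \<notin> N \<longrightarrow> P y)"
proof -
  obtain M where M: "{y. \<not> P y} \<subseteq> M" "M \<in> null_sets lborel"
    using assms by (auto simp: eventually_ae_filter)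
  define N where "N = (\<Union>n::int. {y. y - of_int n \<in> M})"
  have "N \<in> null_sets lborel" unfolding N_def by (intro null_sets_UN null_sets_translation M(2))
  moreover have "y + 1 \<in> N \<longleftrightarrow> y \<in> N" for y
  proof
    assume "y + 1 \<in> N"
    then obtain n :: int where "y + 1 - of_int n \<in> M" by (auto simp: N_def)
    then have "y - of_int (n - 1) \<in> M" by (simp add: algebra_simps)
    then show "y \<in> N" unfolding N_def by blast
  next
    assume "y \<in> N"
    then obtain n :: int where "y - of_int n \<in> M" by (auto simp: N_def)
    then have "y + 1 - of_int (n + 1) \<in> M" by (simp add: algebra_simps)
    then show "y + 1 \<in> N" unfolding N_def by blast
  qed
  moreover have "P y" if "y \<notin> N" for y
  proof -
    have "y \<notin> M" using that unfolding N_def by (auto dest: spec[of _ 0])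
    then show ?thesis using M(1) by blast
  qed
  ultimately show ?thesis by blast
qed

text \<open>Off a null set of \<open>y\<close> the slices in \<open>X\<close> are classically differentiable; on it \<open>q\<close> is replaced by zero.
One loses one derivative: \<open>D n\<close> is Lipschitz rather than differentiable.\<close>

lemma W_inf_regular_representative:
  assumes q: "q \<in> W_inf (Suc n)"
  shows "\<exists>D N. N \<in> null_sets lborel \<and> (\<forall>y. y + 1 \<in> N \<longleftrightarrow> y \<in> N) \<and> (\<forall>X y. y \<notin> N \<longrightarrow> q X y = D 0 X y) \<and> (\<forall>j<n. slow (D j) (D (Suc j)))"
proof -
  have qm: "(\<lambda>(X, y). q X y) \<in> borel_measurable borel" and qp: "\<And>X y. q X (y + 1) = q X y"
    and qc: "AE y in lborel. continuous_on UNIV (\<lambda>X. q X y)"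
    using q by (auto simp: W_inf_def)
  have "\<forall>j\<in>{..Suc n}. \<exists>g. (\<lambda>(X, y). g X y) \<in> Linf \<and> (AE y in lborel. has_weak_deriv j (\<lambda>X. q X y) (\<lambda>X. g X y))"
    using q by (auto simp: W_inf_def)
  from bchoice[OF this] obtain g where g': "\<forall>j\<in>{..Suc n}. (\<lambda>(X, y). g j X y) \<in> Linf \<and> (AE y in lborel. has_weak_deriv j (\<lambda>X. q X y) (\<lambda>X. g j X y))"
    by blast
  have g: "(\<lambda>(X, y). g j X y) \<in> Linf" "AE y in lborel. has_weak_deriv j (\<lambda>X. q X y) (\<lambda>X. g j X y)" if "j \<le> Suc n" for j
    using g' that by auto
  have "\<exists>C. AE y in lborel. AE X in lborel. \<bar>g j X y\<bar> \<le> C" if j: "j \<le> Suc n" for j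
  proof -
    obtain C where "AE p in lborel. \<bar>(\<lambda>(X, y). g j X y) p\<bar> \<le> C" using g(1)[OF j] by (auto simp: Linf_def)
    moreover have "(\<lambda>(X, y). g j X y) \<in> borel_measurable borel" using g(1)[OF j] by (auto simp: Linf_def)
    ultimately show ?thesis using AE_swap_bound by blast
  qed
  then have "\<forall>j\<in>{..Suc n}. \<exists>C. AE y in lborel. AE X in lborel. \<bar>g j X y\<bar> \<le> C" by simp
  from bchoice[OF this] obtain C0 where C0': "\<forall>j\<in>{..Suc n}. AE y in lborel. AE X in lborel. \<bar>g j X y\<bar> \<le> C0 j" by blast
  have C0: "AE y in lborel. AE X in lborel. \<bar>g j X y\<bar> \<le> C0 j" if "j \<le> Suc n" for j using C0' that by simp
  define C where "C = (\<Sum>j\<le>Suc n. \<bar>C0 j\<bar>)"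
  have CC: "C0 j \<le> C" if "j \<le> Suc n" for j
    using member_le_sum[of j "{..Suc n}" "\<lambda>j. \<bar>C0 j\<bar>"] that by (simp add: C_def)
  have gC: "AE y in lborel. AE X in lborel. \<bar>g j X y\<bar> \<le> C" if "j \<le> Suc n" for j
    using C0[OF that]
  proof eventually_elim
    case (elim y)
    then show ?case by eventually_elim (use CC[OF that] in simp)
  qed
  \<comment> \<open>\<open>P y\<close> collects what holds on the slice at \<open>y\<close>, for almost every \<open>y\<close>.\<close>
  define P where "P y \<longleftrightarrow> continuous_on UNIV (\<lambda>X. q X y) \<and> (\<forall>j\<in>{..Suc n}. has_weak_deriv j (\<lambda>X. q X y) (\<lambda>X. g j X y) \<and> (AE X in lborel. \<bar>g j X y\<bar> \<le> C))" for y
  have "AE y in lborel. P y"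
  proof -
    have "AE y in lborel. \<forall>j\<in>{..Suc n}. has_weak_deriv j (\<lambda>X. q X y) (\<lambda>X. g j X y) \<and> (AE X in lborel. \<bar>g j X y\<bar> \<le> C)"
    proof (rule AE_finite_allI)
      fix j assume "j \<in> {..Suc n}"
      then show "AE y in lborel. has_weak_deriv j (\<lambda>X. q X y) (\<lambda>X. g j X y) \<and> (AE X in lborel. \<bar>g j X y\<bar> \<le> C)"
        using eventually_conj[OF g(2) gC, of j j] by simp
    qed simp
    from eventually_conj[OF qc this] show ?thesis unfolding P_def .
  qed
  from periodic_null_set[OF this] obtain N where N: "N \<in> null_sets lborel" "\<And>y. y + 1 \<in> N \<longleftrightarrow> y \<in> N" "\<And>y. y \<notin> N \<Longrightarrow> P y" by blast
  define r where "r X y = (if y \<in> N then 0 else q X y)" for X y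
  define D where "D j X y = (deriv ^^ j) (\<lambda>X. r X y) X" for j X y
  have C_nonneg: "0 \<le> C" unfolding C_def by (intro sum_nonneg) simp
  have zd: "(deriv ^^ j) (\<lambda>_::real. 0::real) = (\<lambda>_. 0)" for j by (induction j) auto
  have reg: "(j < n \<longrightarrow> ((\<lambda>X. D j X y) has_real_derivative D (Suc j) X y) (at X)) \<and> (j \<le> n \<longrightarrow> \<bar>D j X y\<bar> \<le> C) \<and> \<bar>D n X y - D n Y y\<bar> \<le> C * \<bar>X - Y\<bar>" for j X Y y
  proof (cases "y \<in> N")
    case True
    then have "(\<lambda>X. r X y) = (\<lambda>_. 0)" by (simp add: r_def)
    then have "D j X y = 0" for j X unfolding D_def by (simp only: zd)
    then show ?thesis using C_nonneg by (simp add: has_field_derivative_iff)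
  next
    case False
    then have ry: "(\<lambda>X. r X y) = (\<lambda>X. q X y)" by (simp add: r_def)
    have Py: "continuous_on UNIV (\<lambda>X. q X y)" "\<And>j. j \<le> Suc n \<Longrightarrow> has_weak_deriv j (\<lambda>X. q X y) (\<lambda>X. g j X y)" "\<And>j. j \<le> Suc n \<Longrightarrow> AE X in lborel. \<bar>g j X y\<bar> \<le> C"
      using N(3)[OF False] by (auto simp: P_def)
    note R = regular_slice[OF Py]
    have Dq: "(\<lambda>X. D j X y) = (deriv ^^ j) (\<lambda>X. q X y)" for j by (rule ext) (simp only: D_def ry)
    have Dq': "D j X y = (deriv ^^ j) (\<lambda>X. q X y) X" for j X by (simp only: D_def ry)
    show ?thesis unfolding Dq Dq' by (intro conjI impI R)
  qed
  have Dm: "(\<lambda>(X, y). D j X y) \<in> borel_measurable borel" if "j \<le> n" for j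
    using that
  proof (induction j)
    case 0
    have [measurable]: "N \<in> sets borel" using N(1) by auto
    have qm'[measurable]: "(\<lambda>p. q (fst p) (snd p)) \<in> borel_measurable (borel \<Otimes>\<^sub>M borel)" using qm by (simp add: borel_prod split_beta')
    have "(\<lambda>p. if snd p \<in> N then 0 else q (fst p) (snd p)) \<in> borel_measurable (borel \<Otimes>\<^sub>M borel)" by measurable
    then show ?case by (simp add: D_def r_def split_beta' borel_prod)
  next
    case (Suc j)
    have IH: "(\<lambda>(X, y). D j X y) \<in> borel_measurable borel" using Suc by simp
    have m1: "(\<lambda>p. D j (fst p + c) (snd p)) \<in> borel_measurable borel" for c
      by (rule measurable_compose2[OF IH]) (auto simp flip: borel_prod)
    show ?case unfolding split_beta'
    proof (rule borel_measurable_LIMSEQ_real)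
      fix p :: "real \<times> real"
      have "((\<lambda>X. D j X (snd p)) has_real_derivative D (Suc j) (fst p) (snd p)) (at (fst p))" using reg[of j "snd p" "fst p"] Suc by simp
      then have l: "(\<lambda>h. (D j (fst p + h) (snd p) - D j (fst p) (snd p)) / h) \<midarrow>0\<rightarrow> D (Suc j) (fst p) (snd p)" by (simp add: DERIV_def)
      show "(\<lambda>i. (D j (fst p + 1 / real (Suc i)) (snd p) - D j (fst p + 0) (snd p)) / (1 / real (Suc i))) \<longlonglongrightarrow> D (Suc j) (fst p) (snd p)"
      proof -
        have "(\<lambda>i. 1 / real (Suc i)) \<longlonglongrightarrow> 0" by (intro LIMSEQ_Suc lim_1_over_n)
        then have "filterlim (\<lambda>i. 1 / real (Suc i)) (at 0) sequentially" by (auto simp: filterlim_at)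
        from filterlim_compose[OF l this] show ?thesis by simp
      qed
    qed (use m1 in measurable)
  qed
  have per: "D j X (y + 1) = D j X y" for j X y
    unfolding D_def r_def qp N(2) ..
  have "slow (D j) (D (Suc j))" if j: "j < n" for j
  proof (rule slowI[where ?B1.0=C and ?B2.0=C and ?B3.0=C])
    show "(\<lambda>(X, y). D j X y) \<in> borel_measurable borel" "(\<lambda>(X, y). D (Suc j) X y) \<in> borel_measurable borel" using Dm j by auto
    show "\<bar>D j X y\<bar> \<le> C" for X y using reg[of j y X X] j by simp
    show "\<bar>D (Suc j) X y\<bar> \<le> C" for X y using reg[of "Suc j" y X X] j by simp
    have L: "\<bar>D (Suc j) X y - D (Suc j) Y y\<bar> \<le> C * \<bar>X - Y\<bar>" for X Y y
    proof (cases "Suc j = n")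
      case True then show ?thesis using reg[of 0 y X Y] by simp
    next
      case False
      then have "Suc j < n" using j by simp
      have *: "\<bar>D (Suc j) b y - D (Suc j) a y\<bar> \<le> C * (b - a)" if ab: "a < b" for a b
      proof -
        have "((\<lambda>X. D (Suc j) X y) has_real_derivative D (Suc (Suc j)) X y) (at X)" for X
          using reg[of "Suc j" y X] \<open>Suc j < n\<close> by blast
        then obtain z where z: "D (Suc j) b y - D (Suc j) a y = (b - a) * D (Suc (Suc j)) z y"
          using MVT2[OF ab, of "\<lambda>X. D (Suc j) X y" "\<lambda>X. D (Suc (Suc j)) X y"] by blast
        have "\<bar>D (Suc (Suc j)) z y\<bar> \<le> C" using reg[of "Suc (Suc j)" y z] \<open>Suc j < n\<close> by simp
        then have "\<bar>(b - a) * D (Suc (Suc j)) z y\<bar> \<le> (b - a) * C" unfolding abs_mult using ab by (intro mult_mono) auto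
        then show ?thesis unfolding z by (simp add: mult.commute)
      qed
      show ?thesis using *[of X Y] *[of Y X] by (cases X Y rule: linorder_cases) (auto simp: abs_minus_commute)
    qed
    show "\<bar>D j (X + h) y - D j X y - h * D (Suc j) X y\<bar> \<le> C * h\<^sup>2" for X y h
    proof (rule taylor_from_lipschitz[where F="\<lambda>X. D j X y" and F'="\<lambda>X. D (Suc j) X y"])
      show "((\<lambda>X. D j X y) has_real_derivative D (Suc j) X y) (at X)" for X using reg[of j y X X] j by blast
    qed (rule L)
  qed (rule per)+
  moreover have "q X y = D 0 X y" if "y \<notin> N" for X y using that by (simp add: D_def r_def)
  ultimately show ?thesis using N(1,2) by (intro exI[of _ D] exI[of _ N] conjI allI impI) simp_all
qed

section \<open>An approximate solution of the Riccati equation\<close>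

lemma abs_add_le: "\<bar>a\<bar> \<le> A \<Longrightarrow> \<bar>b\<bar> \<le> B \<Longrightarrow> \<bar>a + b\<bar> \<le> A + B" for a b A B :: real
  by linarith

lemma abs_diff_le: "\<bar>a\<bar> \<le> A \<Longrightarrow> \<bar>b\<bar> \<le> B \<Longrightarrow> \<bar>a - b\<bar> \<le> A + B" for a b A B :: real
  by linarith

lemma abs_mult_le: "\<bar>a\<bar> \<le> A \<Longrightarrow> \<bar>b\<bar> \<le> B \<Longrightarrow> \<bar>a * b\<bar> \<le> A * B" for a b A B :: real
  unfolding abs_mult by (intro mult_mono) auto

text \<open>Bernoulli polynomials up to sign, factorials and an additive constant in \<open>ker4\<close>: each is minus an
antiderivative of the previous one, and the last three take equal values at \<open>0\<close> and \<open>1\<close>, while \<open>ker1\<close>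
jumps by one.\<close>

definition ker1 :: "real \<Rightarrow> real" where "ker1 s = s - 1/2"
definition ker2 :: "real \<Rightarrow> real" where "ker2 s = s / 2 - s\<^sup>2 / 2 - 1/12"
definition ker3 :: "real \<Rightarrow> real" where "ker3 s = s ^ 3 / 6 - s\<^sup>2 / 4 + s / 12"
definition ker4 :: "real \<Rightarrow> real" where "ker4 s = s ^ 3 / 12 - s ^ 4 / 24 - s\<^sup>2 / 24"

lemma ker_DERIV:
  "(ker1 has_real_derivative 1) (at s)" "(ker2 has_real_derivative - ker1 s) (at s)"
  "(ker3 has_real_derivative - ker2 s) (at s)" "(ker4 has_real_derivative - ker3 s) (at s)"
  unfolding ker1_def ker2_def ker3_def ker4_def
  by (auto intro!: derivative_eq_intros simp: field_simps)

lemma ker_continuous: "continuous_on UNIV ker1" "continuous_on UNIV ker2" "continuous_on UNIV ker3" "continuous_on UNIV ker4"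
  using ker_DERIV by (meson DERIV_isCont continuous_at_imp_continuous_on)+

lemma conv_minus_kernel: "conv (\<lambda>s. - k s) F X y = - conv k F X y"
  by (simp add: conv_def set_lebesgue_integral_def)

lemma conv_ker1_chain:
  assumes F: "slow F F'" and \<tau>: "0 \<le> \<tau>"
  shows "primitive (\<lambda>v. conv ker1 F (\<tau> * v) v) (\<lambda>v. F (\<tau> * v) v - conv (\<lambda>_. 1) F (\<tau> * v) v + \<tau> * conv ker1 F' (\<tau> * v) v)"
  using conv_chain[OF F ker_DERIV(1) _ \<tau>] by (simp add: ker1_def)

text \<open>Up to terms of order \<open>\<tau>\<close>, integrating once along the curve replaces a kernel by the next one.\<close>

lemma conv_ker_chain:
  assumes F: "slow F F'" and \<tau>: "0 \<le> \<tau>"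
  shows "primitive (\<lambda>v. conv ker2 F (\<tau> * v) v) (\<lambda>v. conv ker1 F (\<tau> * v) v + \<tau> * conv ker2 F' (\<tau> * v) v)"
    "primitive (\<lambda>v. conv ker3 F (\<tau> * v) v) (\<lambda>v. conv ker2 F (\<tau> * v) v + \<tau> * conv ker3 F' (\<tau> * v) v)"
    "primitive (\<lambda>v. conv ker4 F (\<tau> * v) v) (\<lambda>v. conv ker3 F (\<tau> * v) v + \<tau> * conv ker4 F' (\<tau> * v) v)"
proof -
  have v: "ker2 1 - ker2 0 = 0" "ker3 1 - ker3 0 = 0" "ker4 1 - ker4 0 = 0" by (simp_all add: ker2_def ker3_def ker4_def)
  show "primitive (\<lambda>v. conv ker2 F (\<tau> * v) v) (\<lambda>v. conv ker1 F (\<tau> * v) v + \<tau> * conv ker2 F' (\<tau> * v) v)"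
    using conv_chain[OF F ker_DERIV(2) continuous_on_minus[OF ker_continuous(1)] \<tau>] unfolding v conv_minus_kernel by simp
  show "primitive (\<lambda>v. conv ker3 F (\<tau> * v) v) (\<lambda>v. conv ker2 F (\<tau> * v) v + \<tau> * conv ker3 F' (\<tau> * v) v)"
    using conv_chain[OF F ker_DERIV(3) continuous_on_minus[OF ker_continuous(2)] \<tau>] unfolding v conv_minus_kernel by simp
  show "primitive (\<lambda>v. conv ker4 F (\<tau> * v) v) (\<lambda>v. conv ker3 F (\<tau> * v) v + \<tau> * conv ker4 F' (\<tau> * v) v)"
    using conv_chain[OF F ker_DERIV(4) continuous_on_minus[OF ker_continuous(3)] \<tau>] unfolding v conv_minus_kernel by simp
qed

lemma conv_mean_idem:
  assumes F: "slow F F'"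
  shows "conv (\<lambda>_. 1) (\<lambda>X y. F X y - conv (\<lambda>_. 1) F X y) X y = 0"
proof -
  obtain B where B: "\<And>X y. \<bar>F X y\<bar> \<le> B" using slowE[OF F] by metis
  have m: "(\<lambda>s. F X (y + s)) \<in> borel_measurable borel" using slow_measurable_slice[OF F, of X] by measurable
  have i: "set_integrable lborel {0..1} (\<lambda>s. 1 * F X (y + s))"
    by (rule set_integrable_kernel[OF _ m B]) simp
  have c: "set_integrable lborel {0..1::real} (\<lambda>s. conv (\<lambda>_. 1) F X 0)" by (intro borel_integrable_atLeastAtMost') auto
  have "conv (\<lambda>_. 1) (\<lambda>X y. F X y - conv (\<lambda>_. 1) F X y) X y = (LINT s:{0..1}|lborel. 1 * F X (y + s) - conv (\<lambda>_. 1) F X 0)"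
    unfolding conv_def[of _ "\<lambda>X y. F X y - conv (\<lambda>_. 1) F X y"] by (subst conv_mean_const[OF F]) simp
  also have "\<dots> = conv (\<lambda>_. 1) F X y - (LINT s:{0..1::real}|lborel. conv (\<lambda>_. 1) F X 0)"
    unfolding conv_def[of _ F X y] by (rule set_integral_diff(2)[OF i c])
  also have "\<dots> = 0" using conv_mean_const[OF F, of X y] by (simp add: set_integral_const)
  finally show ?thesis .
qed

lemma slow_DERIV:
  assumes "slow F F'" shows "((\<lambda>X. F X y) has_real_derivative F' X y) (at X)"
proof -
  obtain B where B: "B \<ge> 0" "\<And>X y h. \<bar>F (X + h) y - F X y - h * F' X y\<bar> \<le> B * h\<^sup>2" using slowE[OF assms] by metis
  have "(\<lambda>h. (F (X + h) y - F X y) / h - F' X y) \<midarrow>0\<rightarrow> 0"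
  proof (rule Lim_null_comparison)
    show "\<forall>\<^sub>F h in at 0. norm ((F (X + h) y - F X y) / h - F' X y) \<le> B * \<bar>h\<bar>"
    proof (rule eventually_at_ball'[of 1 0, THEN eventually_mono])
      fix h :: real assume h: "h \<in> ball 0 1 \<and> h \<noteq> 0 \<and> h \<in> UNIV"
      then have "(F (X + h) y - F X y) / h - F' X y = (F (X + h) y - F X y - h * F' X y) / h" by (simp add: field_simps)
      also have "norm \<dots> \<le> B * h\<^sup>2 / \<bar>h\<bar>" using B(2)[where X=X and h=h and y=y] by (simp add: divide_right_mono)
      also have "\<dots> = B * \<bar>h\<bar>" using h by (simp add: power2_eq_square abs_if)
      finally show "norm ((F (X + h) y - F X y) / h - F' X y) \<le> B * \<bar>h\<bar>" .
    qed simp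
    show "(\<lambda>h. B * \<bar>h\<bar>) \<midarrow>0\<rightarrow> 0" by (auto intro!: tendsto_eq_intros)
  qed
  then show ?thesis unfolding DERIV_def by (rule Lim_transform2[OF tendsto_const, THEN tendsto_eq_rhs, OF _ refl, THEN iffD1[OF LIM_zero_iff, rotated]] | (subst LIM_zero_iff[symmetric], simp))+
qed

text \<open>The estimates of the corrector, separated from its construction: \<open>A\<close> and \<open>g\<close> are the terms of order
\<open>\<epsilon>\<^sup>2\<close> and \<open>\<epsilon>\<^sup>4\<close>, and every power of \<open>\<tau>\<close> is bounded by the same power of \<open>\<epsilon>\<close>.\<close>

lemma corrector_bounds:
  fixes K \<epsilon> \<tau> :: real
  assumes e: "0 < \<epsilon>" "\<epsilon> \<le> 1" "0 < \<tau>" "\<tau> \<le> \<epsilon>" and K: "1 \<le> K"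
    and b: "\<bar>p\<bar> \<le> K" "\<bar>x\<bar> \<le> K" "\<bar>y\<bar> \<le> K" "\<bar>z\<bar> \<le> K" "\<bar>r\<bar> \<le> K" "\<bar>e1\<bar> \<le> K" "\<bar>e2\<bar> \<le> K" "\<bar>e3\<bar> \<le> K" "\<bar>f1\<bar> \<le> K" "\<bar>f2\<bar> \<le> K"
  defines "A \<equiv> p - \<tau> * x + \<tau>\<^sup>2 * y - \<tau> ^ 3 * z" and "g \<equiv> e1 - \<tau> * e2 - \<tau> * e3"
    and "H \<equiv> x\<^sup>2 + 2 * ((p - \<tau> * x) * (y - \<tau> * z)) + \<tau>\<^sup>2 * (y - \<tau> * z)\<^sup>2 + f1 + f2"
  shows "\<bar>\<epsilon>\<^sup>2 * A - \<epsilon> ^ 4 * g\<bar> \<le> 50 * K\<^sup>2"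
    "\<bar>\<epsilon>\<^sup>2 * (\<tau>\<^sup>2 * y - \<tau> ^ 3 * z - 2 * \<tau> * x) - \<epsilon> ^ 4 * g\<bar> \<le> 50 * K\<^sup>2 * (\<epsilon>\<^sup>2 * \<tau> + \<epsilon> ^ 4)"
    "\<bar>\<epsilon>\<^sup>2 * \<tau> ^ 4 * r - \<epsilon> ^ 4 * \<tau>\<^sup>2 * H + 2 * \<epsilon> ^ 6 * (A * g) - \<epsilon> ^ 8 * g\<^sup>2\<bar> \<le> 50 * K\<^sup>2 * \<epsilon> ^ 6"
proof -
  have t1: "\<tau> \<le> 1" using e by simp
  have K2: "K \<le> K\<^sup>2" using K by (simp add: power2_eq_square)
  have tb: "\<bar>\<tau> * w\<bar> \<le> K" if "\<bar>w\<bar> \<le> K" for w using abs_mult_le[of \<tau> 1 w K] that t1 e by simp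
  have tb2: "\<bar>\<tau>\<^sup>2 * w\<bar> \<le> K" if "\<bar>w\<bar> \<le> K" for w using tb[OF tb[OF that]] by (simp add: power2_eq_square mult.assoc)
  have tb3: "\<bar>\<tau> ^ 3 * w\<bar> \<le> K" if "\<bar>w\<bar> \<le> K" for w using tb[OF tb2[OF that]] by (simp add: power3_eq_cube power2_eq_square mult.assoc)
  have Ab: "\<bar>A\<bar> \<le> 4 * K" unfolding A_def using abs_diff_le[OF abs_add_le[OF abs_diff_le[OF b(1) tb[OF b(2)]] tb2[OF b(3)]] tb3[OF b(4)]] by simp
  have gb: "\<bar>g\<bar> \<le> 3 * K" unfolding g_def using abs_diff_le[OF abs_diff_le[OF b(6) tb[OF b(7)]] tb[OF b(8)]] by simp
  have px: "\<bar>p - \<tau> * x\<bar> \<le> 2 * K" using abs_diff_le[OF b(1) tb[OF b(2)]] by simp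
  have yz: "\<bar>y - \<tau> * z\<bar> \<le> 2 * K" using abs_diff_le[OF b(3) tb[OF b(4)]] by simp
  have Hb: "\<bar>H\<bar> \<le> 15 * K\<^sup>2"
  proof -
    have 1: "\<bar>x\<^sup>2\<bar> \<le> K\<^sup>2" using abs_mult_le[OF b(2) b(2)] by (simp add: power2_eq_square)
    have 2: "\<bar>2 * ((p - \<tau> * x) * (y - \<tau> * z))\<bar> \<le> 8 * K\<^sup>2" using abs_mult_le[OF px yz] by (simp add: abs_mult power2_eq_square)
    have "\<bar>(y - \<tau> * z)\<^sup>2\<bar> \<le> 4 * K\<^sup>2" using abs_mult_le[OF yz yz] by (simp add: power2_eq_square)
    moreover have "\<bar>\<tau>\<^sup>2\<bar> \<le> 1" using t1 e by (simp add: power_le_one)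
    ultimately have 3: "\<bar>\<tau>\<^sup>2 * (y - \<tau> * z)\<^sup>2\<bar> \<le> 4 * K\<^sup>2" using abs_mult_le[of "\<tau>\<^sup>2" 1] by fastforce
    show ?thesis unfolding H_def
      using abs_add_le[OF abs_add_le[OF abs_add_le[OF abs_add_le[OF 1 2] 3] b(9)] b(10)] K2 by linarith
  qed
  have e0: "0 \<le> \<epsilon>" "0 \<le> \<tau>" using e by auto
  have e24: "\<epsilon> ^ n \<le> 1" for n using e by (simp add: power_le_one)
  show "\<bar>\<epsilon>\<^sup>2 * A - \<epsilon> ^ 4 * g\<bar> \<le> 50 * K\<^sup>2"
  proof -
    have "\<bar>\<epsilon>\<^sup>2 * A\<bar> \<le> 1 * (4 * K)" by (rule abs_mult_le[OF _ Ab]) (use e24[of 2] in simp)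
    moreover have "\<bar>\<epsilon> ^ 4 * g\<bar> \<le> 1 * (3 * K)" by (rule abs_mult_le[OF _ gb]) (use e24[of 4] in simp)
    ultimately show ?thesis using abs_diff_le[of "\<epsilon>\<^sup>2 * A" "1 * (4 * K)" "\<epsilon> ^ 4 * g" "1 * (3 * K)"] K K2 by linarith
  qed
  show "\<bar>\<epsilon>\<^sup>2 * (\<tau>\<^sup>2 * y - \<tau> ^ 3 * z - 2 * \<tau> * x) - \<epsilon> ^ 4 * g\<bar> \<le> 50 * K\<^sup>2 * (\<epsilon>\<^sup>2 * \<tau> + \<epsilon> ^ 4)"
  proof -
    have "\<bar>2 * x\<bar> \<le> 2 * K" using b(2) by simp
    from abs_diff_le[OF abs_diff_le[OF tb[OF b(3)] tb2[OF b(4)]] this]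
    have 1: "\<bar>\<tau> * y - \<tau>\<^sup>2 * z - 2 * x\<bar> \<le> 4 * K" by simp
    have 2: "\<bar>(\<epsilon>\<^sup>2 * \<tau>) * (\<tau> * y - \<tau>\<^sup>2 * z - 2 * x)\<bar> \<le> (\<epsilon>\<^sup>2 * \<tau>) * (4 * K)" by (rule abs_mult_le[OF _ 1]) (use e0 in simp)
    have 3: "\<bar>\<epsilon> ^ 4 * g\<bar> \<le> \<epsilon> ^ 4 * (3 * K)" by (rule abs_mult_le[OF _ gb]) (use e0 in simp)
    have eq: "\<epsilon>\<^sup>2 * (\<tau>\<^sup>2 * y - \<tau> ^ 3 * z - 2 * \<tau> * x) = (\<epsilon>\<^sup>2 * \<tau>) * (\<tau> * y - \<tau>\<^sup>2 * z - 2 * x)"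
      by (simp add: power2_eq_square power3_eq_cube algebra_simps)
    have l1: "(\<epsilon>\<^sup>2 * \<tau>) * (4 * K) \<le> (\<epsilon>\<^sup>2 * \<tau>) * (50 * K\<^sup>2)"
      using K K2 e0 by (intro mult_left_mono) auto
    have l2: "\<epsilon> ^ 4 * (3 * K) \<le> \<epsilon> ^ 4 * (50 * K\<^sup>2)"
      using K K2 e0 by (intro mult_left_mono) auto
    have c: "50 * K\<^sup>2 * (\<epsilon>\<^sup>2 * \<tau> + \<epsilon> ^ 4) = (\<epsilon>\<^sup>2 * \<tau>) * (50 * K\<^sup>2) + \<epsilon> ^ 4 * (50 * K\<^sup>2)" by (simp add: algebra_simps)
    show ?thesis unfolding eq c by (rule order_trans[OF abs_diff_le[OF 2 3] add_mono[OF l1 l2]])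
  qed
  show "\<bar>\<epsilon>\<^sup>2 * \<tau> ^ 4 * r - \<epsilon> ^ 4 * \<tau>\<^sup>2 * H + 2 * \<epsilon> ^ 6 * (A * g) - \<epsilon> ^ 8 * g\<^sup>2\<bar> \<le> 50 * K\<^sup>2 * \<epsilon> ^ 6"
  proof -
    have p1: "\<epsilon>\<^sup>2 * \<tau> ^ 4 \<le> \<epsilon> ^ 6"
      using mult_left_mono[OF power_mono[OF e(4) e0(2), of 4], of "\<epsilon>\<^sup>2"] by (simp flip: power_add)
    have p2: "\<epsilon> ^ 4 * \<tau>\<^sup>2 \<le> \<epsilon> ^ 6"
      using mult_left_mono[OF power_mono[OF e(4) e0(2), of 2], of "\<epsilon> ^ 4"] e0 by (simp flip: power_add)
    have p3: "\<epsilon> ^ 8 \<le> \<epsilon> ^ 6" using e by (intro power_decreasing) auto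
    have 1: "\<bar>\<epsilon>\<^sup>2 * \<tau> ^ 4 * r\<bar> \<le> \<epsilon> ^ 6 * K" by (rule abs_mult_le[OF _ b(5)]) (use p1 e0 in simp)
    have 2: "\<bar>\<epsilon> ^ 4 * \<tau>\<^sup>2 * H\<bar> \<le> \<epsilon> ^ 6 * (15 * K\<^sup>2)" by (rule abs_mult_le[OF _ Hb]) (use p2 e0 in simp)
    have 3: "\<bar>2 * \<epsilon> ^ 6 * (A * g)\<bar> \<le> 2 * \<epsilon> ^ 6 * (4 * K * (3 * K))" by (rule abs_mult_le[OF _ abs_mult_le[OF Ab gb]]) (use e0 in simp)
    have g2: "\<bar>g\<^sup>2\<bar> \<le> 3 * K * (3 * K)" using abs_mult_le[OF gb gb] by (simp add: power2_eq_square)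
    have 4: "\<bar>\<epsilon> ^ 8 * g\<^sup>2\<bar> \<le> \<epsilon> ^ 6 * (3 * K * (3 * K))" by (rule abs_mult_le[OF _ g2]) (use p3 e0 in simp)
    have "\<epsilon> ^ 6 * K \<le> \<epsilon> ^ 6 * K\<^sup>2" using K2 e0 by (intro mult_left_mono) auto
    moreover have "\<epsilon> ^ 6 * K\<^sup>2 + \<epsilon> ^ 6 * (15 * K\<^sup>2) + 2 * \<epsilon> ^ 6 * (4 * K * (3 * K)) + \<epsilon> ^ 6 * (3 * K * (3 * K)) = 49 * (\<epsilon> ^ 6 * K\<^sup>2)"
      by (simp add: power2_eq_square algebra_simps)
    moreover have "0 \<le> \<epsilon> ^ 6 * K\<^sup>2" using e0 by simp
    moreover have "50 * K\<^sup>2 * \<epsilon> ^ 6 = 50 * (\<epsilon> ^ 6 * K\<^sup>2)" by simp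
    ultimately show ?thesis using abs_diff_le[OF abs_add_le[OF abs_diff_le[OF 1 2] 3] 4] by linarith
  qed
qed

text \<open>\<open>D j\<close> is the derivative of order \<open>j\<close> of the potential in \<open>X\<close>.\<close>

locale regular_potential =
  fixes D :: "nat \<Rightarrow> real \<Rightarrow> real \<Rightarrow> real"
  assumes slow_D: "\<And>j. j < 4 \<Longrightarrow> slow (D j) (D (Suc j))" and mean_zero: "\<And>X. conv (\<lambda>_. 1) (D 0) X 0 = 0"
begin

text \<open>\<open>P\<close> and \<open>QX\<close> are the derivatives of the cell solution \<open>Q\<close> in \<open>y\<close> and in \<open>X\<close>; \<open>U0\<close> and \<open>U1\<close> are the
effective potentials.\<close>

definition "P = conv ker1 (D 0)"
definition "Q = conv ker2 (D 0)"
definition "QX = conv ker2 (D 1)"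
definition "U0 X = - conv (\<lambda>_. 1) (\<lambda>X y. P X y * P X y) X 0"
definition "U1 X = conv (\<lambda>_. 1) (\<lambda>X y. 2 * (P X y * QX X y)) X 0"

lemma slow_D': "slow (D 0) (D 1)" "slow (D 1) (D 2)" "slow (D 2) (D 3)" "slow (D 3) (D 4)"
  using slow_D[of 0] slow_D[of 1] slow_D[of 2] slow_D[of 3] by (simp_all add: numeral_2_eq_2 numeral_3_eq_3 eval_nat_numeral)

lemma mean_zero': "conv (\<lambda>_. 1) (D 0) X y = 0"
  using conv_mean_const[OF slow_D'(1), of X y] mean_zero by simp

text \<open>The squares that occur in the expansion of \<open>b\<^sup>2\<close>, with their derivatives in \<open>X\<close>; below, \<open>E0\<close> and \<open>R0\<close> are
their parts of mean zero in \<open>y\<close>.\<close>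

definition "PP = (\<lambda>X y. P X y * P X y)"
definition "PP1 = (\<lambda>X y. conv ker1 (D 1) X y * P X y + P X y * conv ker1 (D 1) X y)"
definition "PP2 = (\<lambda>X y. (conv ker1 (D 2) X y * P X y + conv ker1 (D 1) X y * conv ker1 (D 1) X y)
   + (conv ker1 (D 1) X y * conv ker1 (D 1) X y + P X y * conv ker1 (D 2) X y))"
definition "PQ = (\<lambda>X y. 2 * (P X y * QX X y))"
definition "PQ1 = (\<lambda>X y. 2 * (conv ker1 (D 1) X y * QX X y + P X y * conv ker2 (D 2) X y))"

lemma slow_PP: "slow PP PP1" and slow_PP1: "slow PP1 PP2" and slow_PQ: "slow PQ PQ1"
proof -
  have a: "slow P (conv ker1 (D 1))" "slow (conv ker1 (D 1)) (conv ker1 (D 2))" "slow QX (conv ker2 (D 2))"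
    unfolding P_def QX_def by (intro slow_conv ker_continuous slow_D')+
  show "slow PP PP1" unfolding PP_def PP1_def by (rule slow_mult[OF a(1,1)])
  show "slow PP1 PP2" unfolding PP1_def PP2_def by (rule slow_add[OF slow_mult[OF a(2,1)] slow_mult[OF a(1,2)]])
  show "slow PQ PQ1" unfolding PQ_def PQ1_def by (rule slow_cmult[OF slow_mult[OF a(1,3)]])
qed

definition "E0 = (\<lambda>X y. PP X y - conv (\<lambda>_. 1) PP X y)"
definition "E1 = (\<lambda>X y. PP1 X y - conv (\<lambda>_. 1) PP1 X y)"
definition "E2 = (\<lambda>X y. PP2 X y - conv (\<lambda>_. 1) PP2 X y)"
definition "R0 = (\<lambda>X y. PQ X y - conv (\<lambda>_. 1) PQ X y)"
definition "R1 = (\<lambda>X y. PQ1 X y - conv (\<lambda>_. 1) PQ1 X y)"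

lemma slow_E0: "slow E0 E1" and slow_E1: "slow E1 E2" and slow_R0: "slow R0 R1"
  unfolding E0_def E1_def E2_def R0_def R1_def
  by (intro slow_diff slow_PP slow_PP1 slow_PQ slow_conv continuous_on_const)+

lemma E0_eq: "E0 X y = (P X y)\<^sup>2 + U0 X"
  using conv_mean_const[OF slow_PP, of X y] by (simp add: E0_def U0_def PP_def power2_eq_square)

lemma R0_eq: "R0 X y = 2 * (P X y * QX X y) - U1 X"
  using conv_mean_const[OF slow_PQ, of X y] by (simp add: R0_def U1_def PQ_def)

lemma means_zero: "conv (\<lambda>_. 1) E0 X y = 0" "conv (\<lambda>_. 1) R0 X y = 0"
  unfolding E0_def R0_def by (rule conv_mean_idem[OF slow_PP], rule conv_mean_idem[OF slow_PQ])

text \<open>\<open>b\<close> solves the Riccati equation along the curve up to the effective potential and \<open>d\<close>, and \<open>\<beta>\<close> is an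
antiderivative of \<open>b\<close> up to \<open>a\<close>.\<close>

definition has_corrector :: "real \<Rightarrow> real \<Rightarrow> real \<Rightarrow> bool" where
  "has_corrector C \<epsilon> \<tau> \<longleftrightarrow> (\<exists>\<beta> a b d.
     primitive \<beta> (\<lambda>v. b v - a v) \<and>
     primitive b (\<lambda>v. \<epsilon>\<^sup>2 * D 0 (\<tau> * v) v - (b v)\<^sup>2 - \<epsilon> ^ 4 * (U0 (\<tau> * v) + \<tau> * U1 (\<tau> * v)) - d v) \<and>
     a \<in> borel_measurable borel \<and> d \<in> borel_measurable borel \<and>
     (\<forall>v. \<bar>\<beta> v\<bar> \<le> C * \<epsilon>\<^sup>2 \<and> \<bar>a v\<bar> \<le> C * (\<epsilon>\<^sup>2 * \<tau> + \<epsilon> ^ 4) \<and> \<bar>d v\<bar> \<le> C * \<epsilon> ^ 6 \<and> \<bar>b v\<bar> \<le> C))"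

text \<open>A formal two-scale expansion of the Riccati equation, cut off where the remainder has order \<open>\<epsilon>\<^sup>6\<close>. Four
derivatives in \<open>X\<close> are used because the terms of order \<open>\<epsilon>\<^sup>2\<close> have to be integrated up to order \<open>\<tau>\<^sup>4\<close>.\<close>

lemma corrector: "\<exists>C>0. \<forall>\<epsilon> \<tau>. 0 < \<epsilon> \<and> \<epsilon> \<le> 1 \<and> 0 < \<tau> \<and> \<tau> \<le> \<epsilon> \<longrightarrow> has_corrector C \<epsilon> \<tau>"
proof -
  have bnd: "\<exists>B. \<forall>X y. \<bar>F X y\<bar> \<le> B \<and> \<bar>F' X y\<bar> \<le> B" if "slow F F'" for F F' using slowE[OF that] by metis
  note kc = ker_continuous
  obtain B1 where B1: "\<bar>P X y\<bar> \<le> B1" for X y using bnd[OF slow_conv[OF kc(1) slow_D'(1)]] unfolding P_def by metis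
  obtain B2 where B2: "\<bar>QX X y\<bar> \<le> B2" for X y using bnd[OF slow_conv[OF kc(2) slow_D'(2)]] unfolding QX_def by metis
  obtain B3 where B3: "\<bar>conv ker3 (D 2) X y\<bar> \<le> B3" for X y using bnd[OF slow_conv[OF kc(3) slow_D'(3)]] by metis
  obtain B4 where B4: "\<bar>conv ker4 (D 3) X y\<bar> \<le> B4" "\<bar>conv ker4 (D 4) X y\<bar> \<le> B4" for X y using bnd[OF slow_conv[OF kc(4) slow_D'(4)]] by metis
  obtain B5 where B5: "\<bar>conv ker1 E0 X y\<bar> \<le> B5" for X y using bnd[OF slow_conv[OF kc(1) slow_E0]] by metis
  obtain B6 where B6: "\<bar>conv ker2 E1 X y\<bar> \<le> B6" "\<bar>conv ker2 E2 X y\<bar> \<le> B6" for X y using bnd[OF slow_conv[OF kc(2) slow_E1]] by metis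
  obtain B7 where B7: "\<bar>conv ker1 R0 X y\<bar> \<le> B7" "\<bar>conv ker1 R1 X y\<bar> \<le> B7" for X y using bnd[OF slow_conv[OF kc(1) slow_R0]] by metis
  obtain B8 where B8: "\<bar>Q X y\<bar> \<le> B8" for X y using bnd[OF slow_conv[OF kc(2) slow_D'(1)]] unfolding Q_def by metis
  define K where "K = 1 + \<bar>B1\<bar> + \<bar>B2\<bar> + \<bar>B3\<bar> + \<bar>B4\<bar> + \<bar>B5\<bar> + \<bar>B6\<bar> + \<bar>B7\<bar> + \<bar>B8\<bar>"
  have K: "1 \<le> K" "B1 \<le> K" "B2 \<le> K" "B3 \<le> K" "B4 \<le> K" "B5 \<le> K" "B6 \<le> K" "B7 \<le> K" "B8 \<le> K" unfolding K_def by simp_all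
  note bounds = order_trans[OF B1 K(2)] order_trans[OF B2 K(3)] order_trans[OF B3 K(4)] order_trans[OF B4(1) K(5)] order_trans[OF B4(2) K(5)]
    order_trans[OF B5 K(6)] order_trans[OF B6(1) K(7)] order_trans[OF B7(1) K(8)] order_trans[OF B7(2) K(8)] order_trans[OF B6(2) K(7)]
  show ?thesis
  proof (intro exI[of _ "50 * K\<^sup>2"] conjI allI impI)
    show "0 < 50 * K\<^sup>2" using K(1) by simp
    fix \<epsilon> \<tau> :: real assume "0 < \<epsilon> \<and> \<epsilon> \<le> 1 \<and> 0 < \<tau> \<and> \<tau> \<le> \<epsilon>"
    then have e: "0 < \<epsilon>" "\<epsilon> \<le> 1" "0 < \<tau>" "\<tau> \<le> \<epsilon>" and t: "0 \<le> \<tau>" by auto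
    let ?at = "\<lambda>F v. F (\<tau> * v) v :: real"
    \<comment> \<open>The functions of the two-scale expansion, evaluated along the curve \<open>(\<tau> v, v)\<close>.\<close>
    define p x y z r e1 e2 e3 f1 f2 where "p = ?at P" and "x = ?at QX" and "y = ?at (conv ker3 (D 2))" and "z = ?at (conv ker4 (D 3))"
      and "r = ?at (conv ker4 (D 4))" and "e1 = ?at (conv ker1 E0)" and "e2 = ?at (conv ker2 E1)" and "e3 = ?at (conv ker1 R0)"
      and "f1 = ?at (conv ker1 R1)" and "f2 = ?at (conv ker2 E2)"
    note defs = p_def x_def y_def z_def r_def e1_def e2_def e3_def f1_def f2_def
    \<comment> \<open>\<open>A\<close> is an antiderivative of \<open>q\<close> along the curve up to \<open>\<tau>\<^sup>4\<close>: each term cancels the slow derivative of the previous one. In the same way \<open>g\<close> is one of \<open>A\<^sup>2 + U0 + \<tau> U1\<close> up to \<open>\<tau>\<^sup>2\<close>.\<close>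
    define A where "A v = p v - \<tau> * x v + \<tau>\<^sup>2 * y v - \<tau> ^ 3 * z v" for v
    define g where "g v = e1 v - \<tau> * e2 v - \<tau> * e3 v" for v
    define H where "H v = (x v)\<^sup>2 + 2 * ((p v - \<tau> * x v) * (y v - \<tau> * z v)) + \<tau>\<^sup>2 * (y v - \<tau> * z v)\<^sup>2 + f1 v + f2 v" for v
    define b where "b v = \<epsilon>\<^sup>2 * A v - \<epsilon> ^ 4 * g v" for v
    define a where "a v = \<epsilon>\<^sup>2 * (\<tau>\<^sup>2 * y v - \<tau> ^ 3 * z v - 2 * \<tau> * x v) - \<epsilon> ^ 4 * g v" for v
    define d where "d v = \<epsilon>\<^sup>2 * \<tau> ^ 4 * r v - \<epsilon> ^ 4 * \<tau>\<^sup>2 * H v + 2 * \<epsilon> ^ 6 * (A v * g v) - \<epsilon> ^ 8 * (g v)\<^sup>2" for v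
    define \<beta> where "\<beta> v = \<epsilon>\<^sup>2 * Q (\<tau> * v) v" for v
    have pb: "\<bar>p v\<bar> \<le> K" "\<bar>x v\<bar> \<le> K" "\<bar>y v\<bar> \<le> K" "\<bar>z v\<bar> \<le> K" "\<bar>r v\<bar> \<le> K" "\<bar>e1 v\<bar> \<le> K" "\<bar>e2 v\<bar> \<le> K" "\<bar>e3 v\<bar> \<le> K" "\<bar>f1 v\<bar> \<le> K" "\<bar>f2 v\<bar> \<le> K" for v
      unfolding defs by (rule bounds)+
    note CB = corrector_bounds[OF e K(1) pb]
    have cm: "(\<lambda>v. F (\<tau> * v) v) \<in> borel_measurable borel" if "(\<lambda>(X, y). F X y) \<in> borel_measurable borel" for F :: "real \<Rightarrow> real \<Rightarrow> real"
      by (rule measurable_compose2[OF that]) auto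
    have meas: "p \<in> borel_measurable borel" "x \<in> borel_measurable borel" "y \<in> borel_measurable borel" "z \<in> borel_measurable borel" "r \<in> borel_measurable borel"
      "e1 \<in> borel_measurable borel" "e2 \<in> borel_measurable borel" "e3 \<in> borel_measurable borel" "f1 \<in> borel_measurable borel" "f2 \<in> borel_measurable borel"
      unfolding defs P_def QX_def
      by (rule cm[OF conv_measurable[OF kc(1) slowD(1)[OF slow_D'(1)]]] cm[OF conv_measurable[OF kc(2) slowD(1)[OF slow_D'(2)]]]
        cm[OF conv_measurable[OF kc(3) slowD(1)[OF slow_D'(3)]]] cm[OF conv_measurable[OF kc(4) slowD(1)[OF slow_D'(4)]]]
        cm[OF conv_measurable[OF kc(4) slowD(2)[OF slow_D'(4)]]] cm[OF conv_measurable[OF kc(1) slowD(1)[OF slow_E0]]]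
        cm[OF conv_measurable[OF kc(2) slowD(1)[OF slow_E1]]] cm[OF conv_measurable[OF kc(1) slowD(1)[OF slow_R0]]]
        cm[OF conv_measurable[OF kc(1) slowD(2)[OF slow_R0]]] cm[OF conv_measurable[OF kc(2) slowD(2)[OF slow_E1]]])+
    note [measurable] = meas
    have prP: "primitive p (\<lambda>v. D 0 (\<tau> * v) v + \<tau> * conv ker1 (D 1) (\<tau> * v) v)"
      using conv_ker1_chain[OF slow_D'(1) t] unfolding mean_zero' p_def P_def by simp
    have prx: "primitive x (\<lambda>v. conv ker1 (D 1) (\<tau> * v) v + \<tau> * conv ker2 (D 2) (\<tau> * v) v)"
      unfolding x_def QX_def by (rule conv_ker_chain(1)[OF slow_D'(2) t])
    have pry: "primitive y (\<lambda>v. conv ker2 (D 2) (\<tau> * v) v + \<tau> * conv ker3 (D 3) (\<tau> * v) v)"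
      unfolding y_def by (rule conv_ker_chain(2)[OF slow_D'(3) t])
    have prz: "primitive z (\<lambda>v. conv ker3 (D 3) (\<tau> * v) v + \<tau> * r v)"
      unfolding z_def r_def by (rule conv_ker_chain(3)[OF slow_D'(4) t])
    have "primitive A (\<lambda>v. (D 0 (\<tau> * v) v + \<tau> * conv ker1 (D 1) (\<tau> * v) v) - \<tau> * (conv ker1 (D 1) (\<tau> * v) v + \<tau> * conv ker2 (D 2) (\<tau> * v) v)
        + \<tau>\<^sup>2 * (conv ker2 (D 2) (\<tau> * v) v + \<tau> * conv ker3 (D 3) (\<tau> * v) v) - \<tau> ^ 3 * (conv ker3 (D 3) (\<tau> * v) v + \<tau> * r v))"
      unfolding A_def by (intro primitive_add primitive_diff primitive_cmult prP prx pry prz)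
    moreover have "(D 0 (\<tau> * v) v + \<tau> * conv ker1 (D 1) (\<tau> * v) v) - \<tau> * (conv ker1 (D 1) (\<tau> * v) v + \<tau> * conv ker2 (D 2) (\<tau> * v) v)
        + \<tau>\<^sup>2 * (conv ker2 (D 2) (\<tau> * v) v + \<tau> * conv ker3 (D 3) (\<tau> * v) v) - \<tau> ^ 3 * (conv ker3 (D 3) (\<tau> * v) v + \<tau> * r v) = D 0 (\<tau> * v) v - \<tau> ^ 4 * r v" for v
      by algebra
    ultimately have prA: "primitive A (\<lambda>v. D 0 (\<tau> * v) v - \<tau> ^ 4 * r v)" by (simp only:)
    have pre1: "primitive e1 (\<lambda>v. E0 (\<tau> * v) v + \<tau> * conv ker1 E1 (\<tau> * v) v)"
      using conv_ker1_chain[OF slow_E0 t] unfolding means_zero e1_def by simp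
    have pre2: "primitive e2 (\<lambda>v. conv ker1 E1 (\<tau> * v) v + \<tau> * f2 v)"
      unfolding e2_def f2_def by (rule conv_ker_chain(1)[OF slow_E1 t])
    have pre3: "primitive e3 (\<lambda>v. R0 (\<tau> * v) v + \<tau> * f1 v)"
      using conv_ker1_chain[OF slow_R0 t] unfolding means_zero e3_def f1_def by simp
    have "primitive g (\<lambda>v. (E0 (\<tau> * v) v + \<tau> * conv ker1 E1 (\<tau> * v) v) - \<tau> * (conv ker1 E1 (\<tau> * v) v + \<tau> * f2 v) - \<tau> * (R0 (\<tau> * v) v + \<tau> * f1 v))"
      unfolding g_def by (intro primitive_diff primitive_cmult pre1 pre2 pre3)
    moreover have "(E0 (\<tau> * v) v + \<tau> * conv ker1 E1 (\<tau> * v) v) - \<tau> * (conv ker1 E1 (\<tau> * v) v + \<tau> * f2 v) - \<tau> * (R0 (\<tau> * v) v + \<tau> * f1 v)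
       = (A v)\<^sup>2 + U0 (\<tau> * v) + \<tau> * U1 (\<tau> * v) - \<tau>\<^sup>2 * H v" for v
    proof -
      have "E0 (\<tau> * v) v = (p v)\<^sup>2 + U0 (\<tau> * v)" "R0 (\<tau> * v) v = 2 * (p v * x v) - U1 (\<tau> * v)" by (simp_all add: E0_eq R0_eq p_def x_def)
      then show ?thesis unfolding A_def H_def by algebra
    qed
    ultimately have prg: "primitive g (\<lambda>v. (A v)\<^sup>2 + U0 (\<tau> * v) + \<tau> * U1 (\<tau> * v) - \<tau>\<^sup>2 * H v)" by (simp only:)
    have "primitive b (\<lambda>v. \<epsilon>\<^sup>2 * (D 0 (\<tau> * v) v - \<tau> ^ 4 * r v) - \<epsilon> ^ 4 * ((A v)\<^sup>2 + U0 (\<tau> * v) + \<tau> * U1 (\<tau> * v) - \<tau>\<^sup>2 * H v))"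
      unfolding b_def by (intro primitive_diff primitive_cmult prA prg)
    moreover have "\<epsilon>\<^sup>2 * (D 0 (\<tau> * v) v - \<tau> ^ 4 * r v) - \<epsilon> ^ 4 * ((A v)\<^sup>2 + U0 (\<tau> * v) + \<tau> * U1 (\<tau> * v) - \<tau>\<^sup>2 * H v)
       = \<epsilon>\<^sup>2 * D 0 (\<tau> * v) v - (b v)\<^sup>2 - \<epsilon> ^ 4 * (U0 (\<tau> * v) + \<tau> * U1 (\<tau> * v)) - d v" for v
      unfolding b_def d_def by algebra
    ultimately have prb: "primitive b (\<lambda>v. \<epsilon>\<^sup>2 * D 0 (\<tau> * v) v - (b v)\<^sup>2 - \<epsilon> ^ 4 * (U0 (\<tau> * v) + \<tau> * U1 (\<tau> * v)) - d v)" by (simp only:)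
    have "primitive \<beta> (\<lambda>v. \<epsilon>\<^sup>2 * (p v + \<tau> * x v))"
      unfolding \<beta>_def p_def x_def Q_def P_def QX_def by (intro primitive_cmult conv_ker_chain(1)[OF slow_D'(1) t])
    moreover have "\<epsilon>\<^sup>2 * (p v + \<tau> * x v) = b v - a v" for v unfolding b_def a_def A_def by algebra
    ultimately have pr\<beta>: "primitive \<beta> (\<lambda>v. b v - a v)" by (simp only:)
    have K2: "K \<le> 50 * K\<^sup>2" using K(1) by (simp add: power2_eq_square)
    show "has_corrector (50 * K\<^sup>2) \<epsilon> \<tau>" unfolding has_corrector_def
    proof (rule exI[of _ \<beta>], rule exI[of _ a], rule exI[of _ b], rule exI[of _ d], intro conjI allI pr\<beta> prb)
      show "a \<in> borel_measurable borel" unfolding a_def g_def by measurable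
      show "d \<in> borel_measurable borel" unfolding d_def A_def g_def H_def by measurable
      fix v
      have "\<bar>\<epsilon>\<^sup>2 * Q (\<tau> * v) v\<bar> \<le> \<epsilon>\<^sup>2 * (50 * K\<^sup>2)" by (rule abs_mult_le) (use order_trans[OF order_trans[OF B8 K(9)] K2] in auto)
      then show "\<bar>\<beta> v\<bar> \<le> 50 * K\<^sup>2 * \<epsilon>\<^sup>2" by (simp add: \<beta>_def mult.commute)
      show "\<bar>a v\<bar> \<le> 50 * K\<^sup>2 * (\<epsilon>\<^sup>2 * \<tau> + \<epsilon> ^ 4)" unfolding a_def g_def by (rule CB(2))
      show "\<bar>d v\<bar> \<le> 50 * K\<^sup>2 * \<epsilon> ^ 6" unfolding d_def A_def g_def H_def by (rule CB(3))
      show "\<bar>b v\<bar> \<le> 50 * K\<^sup>2" unfolding b_def A_def g_def by (rule CB(1))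
    qed
  qed
qed

subsection \<open>The cell problem and the effective potentials\<close>

lemma Q_primitive: "primitive (Q X) (P X)" "primitive (P X) (D 0 X)"
proof -
  have "primitive (\<lambda>v. conv ker2 (D 0) X v) (\<lambda>v. (ker2 1 - ker2 0) * D 0 X v - conv (\<lambda>s. - ker1 s) (D 0) X v)"
    by (rule conv_primitive_fixed[OF slow_D'(1) ker_DERIV(2)]) (intro continuous_on_minus ker_continuous)
  then show "primitive (Q X) (P X)" by (simp add: conv_minus_kernel ker2_def Q_def P_def)
  have "primitive (\<lambda>v. conv ker1 (D 0) X v) (\<lambda>v. (ker1 1 - ker1 0) * D 0 X v - conv (\<lambda>_. 1) (D 0) X v)"
    by (rule conv_primitive_fixed[OF slow_D'(1) ker_DERIV(1)]) simp
  then show "primitive (P X) (D 0 X)" by (simp add: mean_zero' ker1_def P_def)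
qed

lemma Q_mean: "(LINT y:{0..1}|lborel. Q X y) = 0"
proof -
  obtain B where B: "\<And>X y. \<bar>D 0 X y\<bar> \<le> B" using slowE[OF slow_D'(1)] by metis
  obtain K where K: "K \<ge> 0" "\<And>s. s \<in> {0..1} \<Longrightarrow> \<bar>ker2 s\<bar> \<le> K" using kernel_bound[OF ker_continuous(2)] by blast
  have Dm: "(\<lambda>y. D 0 X y) \<in> borel_measurable borel" by (rule slow_measurable_slice[OF slow_D'(1)])
  have km: "ker2 \<in> borel_measurable borel" by (rule borel_measurable_continuous_onI[OF ker_continuous(2)])
  have m: "(\<lambda>(y, s). ker2 s * D 0 X (y + s)) \<in> borel_measurable borel"
    using Dm km unfolding borel_prod[symmetric] by measurable
  have "(LINT y:{0..1}|lborel. Q X y) = (LINT y:{0..1}|lborel. LINT s:{0..1}|lborel. ker2 s * D 0 X (y + s))"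
    by (simp add: Q_def conv_def)
  also have "\<dots> = (LINT s:{0..1}|lborel. LINT y:{0..1}|lborel. ker2 s * D 0 X (y + s))"
    by (rule set_integral_Fubini_bounded[OF m]) (rule abs_mult_le[OF K(2) B])
  also have "\<dots> = (LINT s:{0..1}|lborel. ker2 s * conv (\<lambda>_. 1) (D 0) X s)"
    unfolding conv_def by (simp add: add.commute)
  also have "\<dots> = 0" by (simp add: mean_zero')
  finally show ?thesis .
qed

context
  fixes q :: "real \<Rightarrow> real \<Rightarrow> real" and N :: "real set"
  assumes N: "N \<in> null_sets lborel" and q_eq: "\<And>X y. y \<notin> N \<Longrightarrow> q X y = D 0 X y"
    and q_meas: "\<And>X. (\<lambda>y. q X y) \<in> borel_measurable borel"
begin

lemma Q_weak_solution: "has_weak_deriv 2 (Q X) (q X)"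
proof (rule has_weak_deriv_cong_AE[OF primitive_has_weak_deriv_2[OF Q_primitive]])
  show "AE x in lborel. D 0 X x = q X x" using AE_not_in[OF N] by eventually_elim (simp add: q_eq)
qed (use q_meas primitive_measurable[OF Q_primitive(1)] in auto)

text \<open>\<open>Q\<close> has the defining properties, and the difference to any other solution is affine, periodic and of
mean zero.\<close>

lemma cell_solution_eq: "cell_solution q X = Q X"
  unfolding cell_solution_def
proof (rule the_equality)
  show "continuous_on UNIV (Q X) \<and> (\<forall>y. Q X (y + 1) = Q X y) \<and> has_weak_deriv 2 (Q X) (q X) \<and> (LINT y:{0..1}|lborel. Q X y) = 0"
    using primitive_continuous[OF Q_primitive(1)] slowD(3)[OF slow_conv[OF ker_continuous(2) slow_D'(1)]] Q_weak_solution Q_mean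
    by (simp add: Q_def)
  fix u assume u: "continuous_on UNIV u \<and> (\<forall>y. u (y + 1) = u y) \<and> has_weak_deriv 2 u (q X) \<and> (LINT y:{0..1}|lborel. u y) = 0"
  define w where "w = (\<lambda>y. u y - Q X y)"
  have cQ: "continuous_on UNIV (Q X)" by (rule primitive_continuous[OF Q_primitive(1)])
  have cw: "continuous_on UNIV w" unfolding w_def using u cQ by (intro continuous_intros) auto
  have li: "locally_integrable u" "locally_integrable (Q X)" using u cQ by (auto intro: locally_integrable_bounded loc_bounded_continuous)
  have "\<exists>p r. \<forall>x. w x = p + r * x"
  proof (rule weak_second_deriv_zero_imp_affine[OF cw])
    fix \<phi> assume \<phi>: "\<phi> \<in> test_functions"
    have d2: "(deriv ^^ 2) \<phi> = deriv (deriv \<phi>)" by (simp add: numeral_2_eq_2)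
    have t2: "deriv (deriv \<phi>) \<in> test_functions" by (intro test_bounded(6) \<phi>)
    have "(LINT x|lborel. deriv (deriv \<phi>) x * u x) = (LINT x|lborel. deriv (deriv \<phi>) x * Q X x)"
    proof -
      have "(LINT x|lborel. (deriv ^^ 2) \<phi> x *\<^sub>R u x) = (- 1) ^ 2 *\<^sub>R (LINT x|lborel. \<phi> x *\<^sub>R q X x)"
        using u \<phi> unfolding has_weak_deriv_def by blast
      moreover have "(LINT x|lborel. (deriv ^^ 2) \<phi> x *\<^sub>R Q X x) = (- 1) ^ 2 *\<^sub>R (LINT x|lborel. \<phi> x *\<^sub>R q X x)"
        using Q_weak_solution[of X] \<phi> unfolding has_weak_deriv_def by blast
      ultimately show ?thesis unfolding d2 by simp
    qed
    then show "(LINT x|lborel. deriv (deriv \<phi>) x * w x) = 0"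
      using test_mult_integrable(1)[OF t2 li(1)] test_mult_integrable(1)[OF t2 li(2)] by (simp add: w_def right_diff_distrib)
  qed
  then obtain p r where w: "\<And>x. w x = p + r * x" by blast
  have "w 1 = w 0" using u slowD(3)[OF slow_conv[OF ker_continuous(2) slow_D'(1)], of X 0] by (simp add: w_def Q_def) (metis add_0)
  then have "w x = p" for x using w[of 1] w[of 0] w[of x] by simp
  moreover have "(LINT y:{0..1}|lborel. w y) = 0"
    using u Q_mean[of X] li unfolding w_def by (subst set_integral_diff(2)) (auto simp: locally_integrable_def)
  ultimately have "p = 0" by (simp add: set_integral_const)
  then show "u = Q X" using \<open>\<And>x. w x = p\<close> by (auto simp: w_def fun_eq_iff)
qed

lemma V0_eq: "V0 q X = U0 X"
proof -
  have "deriv (Q X) y = P X y" for y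
    by (rule DERIV_imp_deriv, rule primitive_DERIV[OF Q_primitive(1) primitive_continuous[OF Q_primitive(2)]])
  then show ?thesis unfolding V0_def cell_solution_eq U0_def conv_def by (simp add: power2_eq_square)
qed

lemma V1_eq: "V1 q X = U1 X"
proof -
  have 1: "deriv (Q X) y = P X y" for y
    by (rule DERIV_imp_deriv, rule primitive_DERIV[OF Q_primitive(1) primitive_continuous[OF Q_primitive(2)]])
  have 2: "deriv (\<lambda>X'. Q X' y) X = QX X y" for y
    unfolding Q_def QX_def by (rule DERIV_imp_deriv, rule slow_DERIV, rule slow_conv[OF ker_continuous(2) slow_D'(1)])
  have "V1 q X = 2 * (LINT y:{0..1}|lborel. QX X y * P X y)" unfolding V1_def cell_solution_eq 1 2 ..
  also have "\<dots> = (LINT y:{0..1}|lborel. 2 * (QX X y * P X y))" by simp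
  also have "\<dots> = U1 X" unfolding U1_def conv_def by (simp add: mult.commute)
  finally show ?thesis .
qed

end

lemma U_bounded: "\<exists>B. \<forall>X. \<bar>U0 X\<bar> \<le> B \<and> \<bar>U1 X\<bar> \<le> B"
proof -
  obtain B where B: "\<And>X y. \<bar>conv (\<lambda>_. 1) PP X y\<bar> \<le> B" using slowE[OF slow_conv[OF continuous_on_const slow_PP]] by metis
  obtain C where C: "\<And>X y. \<bar>conv (\<lambda>_. 1) PQ X y\<bar> \<le> C" using slowE[OF slow_conv[OF continuous_on_const slow_PQ]] by metis
  have "\<bar>U0 X\<bar> \<le> max B C" "\<bar>U1 X\<bar> \<le> max B C" for X
    using B[of X 0] C[of X 0] by (simp_all add: U0_def U1_def PP_def PQ_def le_max_iff_disj)
  then show ?thesis by blast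
qed

lemma U0_nonpos: "U0 X \<le> 0"
  unfolding U0_def conv_def by (simp add: set_integral_nonneg)

end

section \<open>The weighted Green kernel\<close>

lemma has_bochner_integral_exp_abs:
  fixes c :: real assumes "c > 0"
  shows "has_bochner_integral lborel (\<lambda>s::real. exp (- (c * \<bar>s\<bar>))) (2 / c)"
proof -
  have "has_bochner_integral lborel (\<lambda>s::real. indicator {0..} s *\<^sub>R exp (- (c * \<bar>s\<bar>))) (1 / c)"
  proof (rule has_bochner_integral_nn_integral)
    have l: "((\<lambda>x. - exp (- (c * x)) / c) \<longlongrightarrow> - 0 / c) at_top"
      using assms by (intro tendsto_intros filterlim_compose[OF exp_at_bot] filterlim_compose[OF filterlim_uminus_at_bot_at_top] filterlim_tendsto_pos_mult_at_top[OF tendsto_const _ filterlim_ident]) auto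
    have "(\<integral>\<^sup>+x. ennreal (exp (- (c * x))) * indicator {0 ..} x \<partial>lborel) = ennreal (0 - (- exp (- (c * 0)) / c))"
    proof (rule nn_integral_FTC_atLeast)
      show "((\<lambda>x. - exp (- (c * x)) / c) \<longlongrightarrow> 0) at_top" using l by simp
    qed (use assms in \<open>auto intro!: derivative_eq_intros\<close>)
    moreover have "(\<integral>\<^sup>+ x. ennreal (indicator {0..} x *\<^sub>R exp (- (c * \<bar>x\<bar>))) \<partial>lborel) = (\<integral>\<^sup>+x. ennreal (exp (- (c * x))) * indicator {0 ..} x \<partial>lborel)"
      by (rule nn_integral_cong) (auto simp: indicator_def)
    ultimately show "(\<integral>\<^sup>+ x. ennreal (indicator {0..} x *\<^sub>R exp (- (c * \<bar>x\<bar>))) \<partial>lborel) = ennreal (1 / c)" by simp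
  qed (use assms in auto)
  from has_bochner_integral_even_function[OF this] show ?thesis by simp
qed

lemma integral_exp_abs:
  fixes c :: real assumes "c > 0"
  shows "integrable lborel (\<lambda>s::real. exp (- (c * \<bar>s - z\<bar>)))" "(LINT s|lborel. exp (- (c * \<bar>s - z\<bar>))) = 2 / c"
proof -
  note h = has_bochner_integral_exp_abs[OF assms]
  have i: "integrable lborel (\<lambda>s::real. exp (- (c * \<bar>s\<bar>)))" using h by (simp add: has_bochner_integral_iff)
  show "integrable lborel (\<lambda>s::real. exp (- (c * \<bar>s - z\<bar>)))"
    using lborel_integrable_real_affine[OF i, of 1 "-z"] by simp
  show "(LINT s|lborel. exp (- (c * \<bar>s - z\<bar>))) = 2 / c"
    using lborel_integral_real_affine[of 1 "\<lambda>s. exp (- (c * \<bar>s\<bar>))" "-z"] h by (simp add: has_bochner_integral_iff)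
qed

text \<open>The Green function \<open>exp (- \<bar>z - s\<bar>)\<close> conjugated with the weight \<open>exp (\<bar>z\<bar>/2)\<close>. Since the weight grows
at half the rate of decay, the kernel remains integrable in \<open>s\<close>, uniformly in \<open>z\<close>.\<close>

definition kern :: "real \<Rightarrow> real \<Rightarrow> real" where
  "kern z s = exp (\<bar>z\<bar> / 2 - \<bar>s\<bar> / 2 - \<bar>z - s\<bar>)"

lemma kern_bounds: "0 < kern z s" "kern z s \<le> exp (- (1/2 * \<bar>s - z\<bar>))" "kern z s \<le> 1"
proof -
  show "0 < kern z s" by (simp add: kern_def)
  have "\<bar>z\<bar> / 2 - \<bar>s\<bar> / 2 - \<bar>z - s\<bar> \<le> - (1/2 * \<bar>s - z\<bar>)"
    using abs_triangle_ineq2[of z s] by (simp add: abs_minus_commute[of s z])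
  then show 1: "kern z s \<le> exp (- (1/2 * \<bar>s - z\<bar>))" by (simp only: kern_def exp_le_cancel_iff)
  also have "\<dots> \<le> 1" by simp
  finally show "kern z s \<le> 1" .
qed

lemma kern_measurable[measurable]: "(\<lambda>s. kern z s) \<in> borel_measurable borel"
  by (simp add: kern_def)

text \<open>The sources consist of a small bounded part, estimated by \<open>c\<close>, and a part dominated by an integrable
function of mass at most \<open>\<mu>\<close>; the second comes from the well and is not bounded uniformly.\<close>

definition src :: "real \<Rightarrow> real \<Rightarrow> (real \<Rightarrow> real) \<Rightarrow> (real \<Rightarrow> real) \<Rightarrow> bool" where
  "src c \<mu> g f \<longleftrightarrow> g \<in> borel_measurable borel \<and> f \<in> borel_measurable borel \<and>
     (\<exists>m. integrable lborel m \<and> (\<forall>s. 0 \<le> m s) \<and> (LINT s|lborel. m s) \<le> \<mu> \<and> (\<forall>s. \<bar>g s\<bar> + \<bar>f s\<bar> \<le> c + m s))"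

text \<open>The decaying solution, in weighted form, of \<open>\<phi>' = p + f\<close>, \<open>p' = \<phi> + g\<close>; \<open>kint1\<close> is \<open>\<phi>\<close> and \<open>kint2\<close>
is \<open>p\<close>.\<close>

definition kint1 :: "(real \<Rightarrow> real) \<Rightarrow> (real \<Rightarrow> real) \<Rightarrow> real \<Rightarrow> real" where
  "kint1 g f z = - (1/2) * (LINT s|lborel. kern z s * (g s + sgn (s - z) * f s))"

definition kint2 :: "(real \<Rightarrow> real) \<Rightarrow> (real \<Rightarrow> real) \<Rightarrow> real \<Rightarrow> real" where
  "kint2 g f z = - (1/2) * (LINT s|lborel. kern z s * (sgn (s - z) * g s + f s))"

lemma kern_integral_bound:
  assumes h: "h \<in> borel_measurable borel" and m: "integrable lborel m" "\<And>s. 0 \<le> m s" "(LINT s|lborel. m s) \<le> \<mu>"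
    and c: "0 \<le> c" and le: "\<And>s. \<bar>h s\<bar> \<le> c + m s"
  shows "integrable lborel (\<lambda>s. kern z s * h s)" "\<bar>LINT s|lborel. kern z s * h s\<bar> \<le> 4 * c + \<mu>"
proof -
  let ?w = "\<lambda>s. c * exp (- (1/2 * \<bar>s - z\<bar>)) + m s"
  have wi: "integrable lborel ?w" using integral_exp_abs(1)[of "1/2" z] m(1) by simp
  have b: "\<bar>kern z s * h s\<bar> \<le> ?w s" for s
  proof -
    have "\<bar>kern z s * h s\<bar> \<le> kern z s * (c + m s)"
      using kern_bounds(1)[of z s] le[of s] by (simp add: abs_mult mult_left_mono)
    also have "\<dots> \<le> c * exp (- (1/2 * \<bar>s - z\<bar>)) + 1 * m s"
      using mult_left_mono[OF kern_bounds(2)[of z s] c] mult_right_mono[OF kern_bounds(3)[of z s] m(2)[of s]]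
      by (simp add: algebra_simps)
    finally show ?thesis by simp
  qed
  show i: "integrable lborel (\<lambda>s. kern z s * h s)"
    by (rule Bochner_Integration.integrable_bound[OF wi]) (use h b in \<open>auto intro!: AE_I2 order_trans[OF b]\<close>)
  have "\<bar>LINT s|lborel. kern z s * h s\<bar> \<le> (LINT s|lborel. \<bar>kern z s * h s\<bar>)" by (rule integral_abs_bound)
  also have "\<dots> \<le> (LINT s|lborel. ?w s)" by (intro integral_mono wi integrable_abs i b)
  also have "\<dots> = c * 4 + (LINT s|lborel. m s)" using integral_exp_abs[of "1/2" z] m(1) by simp
  finally show "\<bar>LINT s|lborel. kern z s * h s\<bar> \<le> 4 * c + \<mu>" using m(3) by simp
qed

lemma src_kern:
  assumes s: "src c \<mu> g f" and c: "0 \<le> c"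
  shows "integrable lborel (\<lambda>s. kern z s * (g s + sgn (s - x) * f s))"
    "integrable lborel (\<lambda>s. kern z s * (sgn (s - x) * g s + f s))"
    "\<bar>LINT s|lborel. kern z s * (g s + sgn (s - x) * f s)\<bar> \<le> 4 * c + \<mu>"
    "\<bar>LINT s|lborel. kern z s * (sgn (s - x) * g s + f s)\<bar> \<le> 4 * c + \<mu>"
proof -
  obtain m where gf[measurable]: "g \<in> borel_measurable borel" "f \<in> borel_measurable borel"
    and m: "integrable lborel m" "\<And>s. 0 \<le> m s" "(LINT s|lborel. m s) \<le> \<mu>" "\<And>s. \<bar>g s\<bar> + \<bar>f s\<bar> \<le> c + m s"
    using s by (auto simp: src_def)
  have sg: "\<bar>sgn (s - x) * u\<bar> \<le> \<bar>u\<bar>" for s u by (simp add: abs_mult sgn_if)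
  have b1: "\<bar>g s + sgn (s - x) * f s\<bar> \<le> c + m s" for s using m(4)[of s] sg[of s "f s"] by linarith
  have b2: "\<bar>sgn (s - x) * g s + f s\<bar> \<le> c + m s" for s using m(4)[of s] sg[of s "g s"] by linarith
  have m1: "(\<lambda>s. g s + sgn (s - x) * f s) \<in> borel_measurable borel" by measurable
  have m2: "(\<lambda>s. sgn (s - x) * g s + f s) \<in> borel_measurable borel" by measurable
  show "integrable lborel (\<lambda>s. kern z s * (g s + sgn (s - x) * f s))" by (rule kern_integral_bound(1)[OF m1 m(1,2,3) c b1])
  show "integrable lborel (\<lambda>s. kern z s * (sgn (s - x) * g s + f s))" by (rule kern_integral_bound(1)[OF m2 m(1,2,3) c b2])
  show "\<bar>LINT s|lborel. kern z s * (g s + sgn (s - x) * f s)\<bar> \<le> 4 * c + \<mu>" by (rule kern_integral_bound(2)[OF m1 m(1,2,3) c b1])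
  show "\<bar>LINT s|lborel. kern z s * (sgn (s - x) * g s + f s)\<bar> \<le> 4 * c + \<mu>" by (rule kern_integral_bound(2)[OF m2 m(1,2,3) c b2])
qed

lemma kint_bound:
  assumes "src c \<mu> g f" "0 \<le> c"
  shows "\<bar>kint1 g f z\<bar> \<le> 1/2 * (4 * c + \<mu>)" "\<bar>kint2 g f z\<bar> \<le> 1/2 * (4 * c + \<mu>)"
  using src_kern(3,4)[OF assms, of z z] by (auto simp: kint1_def kint2_def abs_mult)

lemma kint_add:
  assumes "src c \<mu> g f" "src c' \<mu>' g' f'" "0 \<le> c" "0 \<le> c'"
  shows "kint1 (\<lambda>s. g s + g' s) (\<lambda>s. f s + f' s) z = kint1 g f z + kint1 g' f' z"
    "kint2 (\<lambda>s. g s + g' s) (\<lambda>s. f s + f' s) z = kint2 g f z + kint2 g' f' z"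
proof -
  have "(LINT s|lborel. kern z s * (g s + g' s + sgn (s - z) * (f s + f' s))) =
      (LINT s|lborel. kern z s * (g s + sgn (s - z) * f s) + kern z s * (g' s + sgn (s - z) * f' s))"
    by (rule Bochner_Integration.integral_cong) (simp_all add: algebra_simps)
  also have "\<dots> = (LINT s|lborel. kern z s * (g s + sgn (s - z) * f s)) + (LINT s|lborel. kern z s * (g' s + sgn (s - z) * f' s))"
    by (rule Bochner_Integration.integral_add[OF src_kern(1)[OF assms(1,3)] src_kern(1)[OF assms(2,4)]])
  finally show "kint1 (\<lambda>s. g s + g' s) (\<lambda>s. f s + f' s) z = kint1 g f z + kint1 g' f' z"
    unfolding kint1_def by (simp only: ring_distribs)
  have "(LINT s|lborel. kern z s * (sgn (s - z) * (g s + g' s) + (f s + f' s))) =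
      (LINT s|lborel. kern z s * (sgn (s - z) * g s + f s) + kern z s * (sgn (s - z) * g' s + f' s))"
    by (rule Bochner_Integration.integral_cong) (simp_all add: algebra_simps)
  also have "\<dots> = (LINT s|lborel. kern z s * (sgn (s - z) * g s + f s)) + (LINT s|lborel. kern z s * (sgn (s - z) * g' s + f' s))"
    by (rule Bochner_Integration.integral_add[OF src_kern(2)[OF assms(1,3)] src_kern(2)[OF assms(2,4)]])
  finally show "kint2 (\<lambda>s. g s + g' s) (\<lambda>s. f s + f' s) z = kint2 g f z + kint2 g' f' z"
    unfolding kint2_def by (simp only: ring_distribs)
qed

lemma kern_continuous: "isCont (\<lambda>z. kern z s) z"
  unfolding kern_def by (intro continuous_intros) auto

lemma kern_sgn_integral_continuous:
  assumes h: "h \<in> borel_measurable borel" "k \<in> borel_measurable borel" and m: "integrable lborel m" "\<And>s. 0 \<le> m s"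
    and c: "0 \<le> c" and le: "\<And>s. \<bar>h s\<bar> + \<bar>k s\<bar> \<le> c + m s"
  shows "continuous_on UNIV (\<lambda>z. LINT s|lborel. kern z s * (h s + sgn (s - z) * k s))"
proof -
  have "isCont (\<lambda>z. LINT s|lborel. kern z s * (h s + sgn (s - z) * k s)) z" for z
    unfolding continuous_at_sequentially o_def
  proof (intro allI impI)
    fix x :: "nat \<Rightarrow> real" assume x: "x \<longlonglongrightarrow> z"
    then obtain N where N: "\<And>n. n \<ge> N \<Longrightarrow> \<bar>x n - z\<bar> < 1"
      unfolding LIMSEQ_def dist_real_def by (meson zero_less_one)
    let ?w = "\<lambda>s. exp (1/2) * (c * exp (- (1/2 * \<bar>s - z\<bar>))) + m s"
    have wi: "integrable lborel ?w" using integral_exp_abs(1)[of "1/2" z] m(1) by simp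
    have "(\<lambda>n. LINT s|lborel. kern (x (n + N)) s * (h s + sgn (s - x (n + N)) * k s)) \<longlonglongrightarrow> (LINT s|lborel. kern z s * (h s + sgn (s - z) * k s))"
    proof (rule integral_dominated_convergence[where w="?w"])
      have "AE s in lborel. s \<noteq> z" by (rule AE_lborel_singleton)
      then show "AE s in lborel. (\<lambda>n. kern (x (n + N)) s * (h s + sgn (s - x (n + N)) * k s)) \<longlonglongrightarrow> kern z s * (h s + sgn (s - z) * k s)"
      proof eventually_elim
        case (elim s)
        have x': "(\<lambda>n. x (n + N)) \<longlonglongrightarrow> z" using x by (rule LIMSEQ_ignore_initial_segment)
        have "(\<lambda>n. kern (x (n + N)) s) \<longlonglongrightarrow> kern z s" by (rule isCont_tendsto_compose[OF kern_continuous x'])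
        moreover have "(\<lambda>n. sgn (s - x (n + N))) \<longlonglongrightarrow> sgn (s - z)" by (rule tendsto_sgn[OF tendsto_diff[OF tendsto_const x']]) (use elim in simp)
        ultimately show ?case by (intro tendsto_mult tendsto_add tendsto_const)
      qed
      show "AE s in lborel. norm (kern (x (n + N)) s * (h s + sgn (s - x (n + N)) * k s)) \<le> ?w s" for n
      proof (intro AE_I2)
        fix s
        let ?z = "x (n + N)"
        have k1: "kern ?z s \<le> exp (1/2) * exp (- (1/2 * \<bar>s - z\<bar>))"
        proof -
          have "- (1/2 * \<bar>s - ?z\<bar>) \<le> 1/2 + - (1/2 * \<bar>s - z\<bar>)" using N[of "n + N"] abs_triangle_ineq2[of "s - z" "s - ?z"] by simp
          then have "exp (- (1/2 * \<bar>s - ?z\<bar>)) \<le> exp (1/2) * exp (- (1/2 * \<bar>s - z\<bar>))" by (simp only: exp_add[symmetric] exp_le_cancel_iff)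
          then show ?thesis using kern_bounds(2)[of ?z s] by linarith
        qed
        have "\<bar>h s + sgn (s - ?z) * k s\<bar> \<le> c + m s"
        proof -
          have "\<bar>sgn (s - ?z) * k s\<bar> \<le> \<bar>k s\<bar>" by (simp add: abs_mult sgn_if)
          then show ?thesis using le[of s] by linarith
        qed
        then have "\<bar>kern ?z s * (h s + sgn (s - ?z) * k s)\<bar> \<le> kern ?z s * (c + m s)"
          using kern_bounds(1)[of ?z s] by (simp add: abs_mult mult_left_mono)
        also have "\<dots> \<le> ?w s"
          using mult_left_mono[OF k1 c] mult_right_mono[OF kern_bounds(3)[of ?z s] m(2)[of s]] by (simp add: algebra_simps)
        finally show "norm (kern ?z s * (h s + sgn (s - ?z) * k s)) \<le> ?w s" by simp
      qed
    qed (use wi h in auto)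
    then show "(\<lambda>n. LINT s|lborel. kern (x n) s * (h s + sgn (s - x n) * k s)) \<longlonglongrightarrow> (LINT s|lborel. kern z s * (h s + sgn (s - z) * k s))"
      by (rule LIMSEQ_offset)
  qed
  then show ?thesis by (simp add: continuous_at_imp_continuous_on)
qed

lemma kint_continuous:
  assumes s: "src c \<mu> g f" and c: "0 \<le> c"
  shows "continuous_on UNIV (kint1 g f)" "continuous_on UNIV (kint2 g f)"
proof -
  obtain m where gf: "g \<in> borel_measurable borel" "f \<in> borel_measurable borel"
    and m: "integrable lborel m" "\<And>s. 0 \<le> m s" "(LINT s|lborel. m s) \<le> \<mu>" "\<And>s. \<bar>g s\<bar> + \<bar>f s\<bar> \<le> c + m s"
    using s by (auto simp: src_def)
  show "continuous_on UNIV (kint1 g f)" unfolding kint1_def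
    by (intro continuous_intros kern_sgn_integral_continuous[OF gf m(1,2) c m(4)])
  have m': "\<And>s. \<bar>f s\<bar> + \<bar>g s\<bar> \<le> c + m s" using m(4) by (simp add: add.commute)
  have "continuous_on UNIV (\<lambda>z. - (1/2) * (LINT s|lborel. kern z s * (f s + sgn (s - z) * g s)))"
    by (intro continuous_intros kern_sgn_integral_continuous[OF gf(2,1) m(1,2) c m'])
  then show "continuous_on UNIV (kint2 g f)" unfolding kint2_def by (simp add: add.commute)
qed

definition kbc1 :: "(real \<Rightarrow> real) \<Rightarrow> (real \<Rightarrow> real) \<Rightarrow> real \<Rightarrow>\<^sub>C real" where "kbc1 g f = Bcontfun (kint1 g f)"
definition kbc2 :: "(real \<Rightarrow> real) \<Rightarrow> (real \<Rightarrow> real) \<Rightarrow> real \<Rightarrow>\<^sub>C real" where "kbc2 g f = Bcontfun (kint2 g f)"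

lemma kbc_apply:
  assumes "src c \<mu> g f" "0 \<le> c"
  shows "apply_bcontfun (kbc1 g f) = kint1 g f" "apply_bcontfun (kbc2 g f) = kint2 g f"
proof -
  have "kint1 g f \<in> bcontfun" "kint2 g f \<in> bcontfun"
    unfolding bcontfun_def bounded_iff using kint_continuous[OF assms] kint_bound[OF assms] unfolding real_norm_def by blast+
  then show "apply_bcontfun (kbc1 g f) = kint1 g f" "apply_bcontfun (kbc2 g f) = kint2 g f"
    by (auto simp: kbc1_def kbc2_def Bcontfun_inverse)
qed

lemma bcontfun_dist_abs: "\<bar>apply_bcontfun f z - apply_bcontfun g z\<bar> \<le> dist f g" for f g :: "real \<Rightarrow>\<^sub>C real"
  using dist_bounded[of f z g] by (simp add: dist_real_def)

lemma bcontfun_loc_bounded: "loc_bounded (apply_bcontfun (f :: real \<Rightarrow>\<^sub>C real))"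
  by (rule loc_bounded_continuous) simp

text \<open>Variation of constants for \<open>u' = u - h\<close>, with integration from \<open>+\<infinity>\<close>.\<close>

lemma exp_moment_primitive:
  assumes h: "integrable lborel (\<lambda>s. exp (- \<bar>s\<bar>) * h s)" and hb: "loc_bounded h"
  shows "primitive (\<lambda>z. exp z * (LINT s|lborel. indicator {z<..} s * (exp (- s) * h s)))
     (\<lambda>z. exp z * (LINT s|lborel. indicator {z<..} s * (exp (- s) * h s)) - h z)"
proof -
  have hm[measurable]: "h \<in> borel_measurable borel" using hb loc_boundedD by blast
  have i: "integrable lborel (\<lambda>s. indicator {z<..} s * (exp (- s) * h s))" for z
  proof (rule Bochner_Integration.integrable_bound)
    show "integrable lborel (\<lambda>s. exp (2 * \<bar>z\<bar>) * (exp (- \<bar>s\<bar>) * h s))" using h by simp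
    show "AE s in lborel. norm (indicator {z<..} s * (exp (- s) * h s)) \<le> norm (exp (2 * \<bar>z\<bar>) * (exp (- \<bar>s\<bar>) * h s))"
    proof (intro AE_I2)
      fix s
      have "exp (- s) \<le> exp (2 * \<bar>z\<bar>) * exp (- \<bar>s\<bar>)" if "s > z"
        unfolding exp_add[symmetric] exp_le_cancel_iff using that by linarith
      then show "norm (indicator {z<..} s * (exp (- s) * h s)) \<le> norm (exp (2 * \<bar>z\<bar>) * (exp (- \<bar>s\<bar>) * h s))"
        by (cases "s > z") (auto simp: abs_mult mult_right_mono simp flip: mult.assoc)
    qed
  qed simp
  let ?E = "\<lambda>z. LINT s|lborel. indicator {z<..} s * (exp (- s) * h s)"
  have eb: "loc_bounded (\<lambda>s. exp (- s) * h s)"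
    by (intro loc_bounded_mult hb loc_bounded_continuous continuous_intros)
  have "primitive ?E (\<lambda>z. - (exp (- z) * h z))"
    unfolding primitive_def
  proof (intro conjI allI impI)
    show "locally_integrable (\<lambda>z. - (exp (- z) * h z))"
      by (intro locally_integrable_bounded loc_bounded_minus eb)
    fix a b :: real assume ab: "a \<le> b"
    have "?E b - ?E a = (LINT s|lborel. indicator {b<..} s * (exp (- s) * h s) - indicator {a<..} s * (exp (- s) * h s))"
      by (intro Bochner_Integration.integral_diff[symmetric] i)
    also have "\<dots> = (LINT s|lborel. indicator {a..b} s *\<^sub>R - (exp (- s) * h s))"
    proof (rule integral_cong_AE)
      have "AE s in lborel. s \<noteq> a" by (rule AE_lborel_singleton)
      then show "AE s in lborel. indicator {b<..} s * (exp (- s) * h s) - indicator {a<..} s * (exp (- s) * h s) = indicator {a..b} s *\<^sub>R - (exp (- s) * h s)"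
        by eventually_elim (use ab in \<open>auto simp: indicator_def\<close>)
    qed simp_all
    finally show "?E b - ?E a = (LINT s:{a..b}|lborel. - (exp (- s) * h s))" by (simp add: set_lebesgue_integral_def)
  qed
  moreover have "primitive exp exp" by (rule primitive_continuous_deriv) (auto intro: continuous_intros)
  moreover have "loc_bounded (exp :: real \<Rightarrow> real)" by (intro loc_bounded_continuous continuous_intros)
  ultimately have "primitive (\<lambda>z. exp z * ?E z) (\<lambda>z. exp z * ?E z + exp z * - (exp (- z) * h z))"
    by (intro primitive_mult)
  moreover have "exp z * ?E z + exp z * - (exp (- z) * h z) = exp z * ?E z - h z" for z
    by (simp add: exp_minus)
  ultimately show ?thesis by (simp only:)
qed

lemma exp_moment_primitive':
  assumes h: "integrable lborel (\<lambda>s. exp (- \<bar>s\<bar>) * h s)" and hb: "loc_bounded h"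
  shows "primitive (\<lambda>z. exp (- z) * (LINT s|lborel. indicator {..<z} s * (exp s * h s)))
     (\<lambda>z. - (exp (- z) * (LINT s|lborel. indicator {..<z} s * (exp s * h s))) + h z)"
proof -
  have hm[measurable]: "h \<in> borel_measurable borel" using hb loc_boundedD by blast
  have i: "integrable lborel (\<lambda>s. indicator {..<z} s * (exp s * h s))" for z
  proof (rule Bochner_Integration.integrable_bound)
    show "integrable lborel (\<lambda>s. exp (2 * \<bar>z\<bar>) * (exp (- \<bar>s\<bar>) * h s))" using h by simp
    show "AE s in lborel. norm (indicator {..<z} s * (exp s * h s)) \<le> norm (exp (2 * \<bar>z\<bar>) * (exp (- \<bar>s\<bar>) * h s))"
    proof (intro AE_I2)
      fix s
      have "exp s \<le> exp (2 * \<bar>z\<bar>) * exp (- \<bar>s\<bar>)" if "s < z"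
        unfolding exp_add[symmetric] exp_le_cancel_iff using that by linarith
      then show "norm (indicator {..<z} s * (exp s * h s)) \<le> norm (exp (2 * \<bar>z\<bar>) * (exp (- \<bar>s\<bar>) * h s))"
        by (cases "s < z") (auto simp: abs_mult mult_right_mono simp flip: mult.assoc)
    qed
  qed simp
  let ?E = "\<lambda>z. LINT s|lborel. indicator {..<z} s * (exp s * h s)"
  have eb: "loc_bounded (\<lambda>s. exp s * h s)"
    by (intro loc_bounded_mult hb loc_bounded_continuous continuous_intros)
  have "primitive ?E (\<lambda>z. exp z * h z)"
    unfolding primitive_def
  proof (intro conjI allI impI)
    show "locally_integrable (\<lambda>z. exp z * h z)"
      by (intro locally_integrable_bounded eb)
    fix a b :: real assume ab: "a \<le> b"
    have "?E b - ?E a = (LINT s|lborel. indicator {..<b} s * (exp s * h s) - indicator {..<a} s * (exp s * h s))"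
      by (intro Bochner_Integration.integral_diff[symmetric] i)
    also have "\<dots> = (LINT s|lborel. indicator {a..b} s *\<^sub>R (exp s * h s))"
    proof (rule integral_cong_AE)
      have "AE s in lborel. s \<noteq> b" by (rule AE_lborel_singleton)
      then show "AE s in lborel. indicator {..<b} s * (exp s * h s) - indicator {..<a} s * (exp s * h s) = indicator {a..b} s *\<^sub>R (exp s * h s)"
        by eventually_elim (use ab in \<open>auto simp: indicator_def\<close>)
    qed simp_all
    finally show "?E b - ?E a = (LINT s:{a..b}|lborel. exp s * h s)" by (simp add: set_lebesgue_integral_def)
  qed
  moreover have "primitive (\<lambda>z. exp (- z)) (\<lambda>z. - exp (- z))"
    by (rule primitive_continuous_deriv) (auto intro!: continuous_intros derivative_eq_intros)
  moreover have "loc_bounded (\<lambda>z. - exp (- z) :: real)" by (intro loc_bounded_continuous continuous_intros)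
  ultimately have "primitive (\<lambda>z. exp (- z) * ?E z) (\<lambda>z. - exp (- z) * ?E z + exp (- z) * (exp z * h z))"
    by (intro primitive_mult)
  moreover have "- exp (- z) * ?E z + exp (- z) * (exp z * h z) = - (exp (- z) * ?E z) + h z" for z
    by (simp add: exp_minus)
  ultimately show ?thesis by (simp only:)
qed

text \<open>The Green function is split into its left and right exponential halves, each of which solves a scalar
linear equation.\<close>

lemma kint_primitive:
  assumes s: "src c \<mu> g f" and c: "0 \<le> c" and lb: "loc_bounded g" "loc_bounded f"
  defines "\<phi> \<equiv> \<lambda>z. exp (- (\<bar>z\<bar> / 2)) * kint1 g f z" and "p \<equiv> \<lambda>z. exp (- (\<bar>z\<bar> / 2)) * kint2 g f z"
  shows "primitive \<phi> (\<lambda>z. p z + exp (- (\<bar>z\<bar> / 2)) * f z)" "primitive p (\<lambda>z. \<phi> z + exp (- (\<bar>z\<bar> / 2)) * g z)"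
proof -
  define G F where "G = (\<lambda>s. exp (- (\<bar>s\<bar> / 2)) * g s)" and "F = (\<lambda>s. exp (- (\<bar>s\<bar> / 2)) * f s)"
  have GF: "loc_bounded G" "loc_bounded F" unfolding G_def F_def
    by (intro loc_bounded_mult lb loc_bounded_continuous continuous_intros; simp)+
  have [measurable]: "g \<in> borel_measurable borel" "f \<in> borel_measurable borel" using s by (auto simp: src_def)
  have [measurable]: "G \<in> borel_measurable borel" "F \<in> borel_measurable borel" using GF loc_boundedD by auto
  have kF: "exp (- (\<bar>z\<bar> / 2)) * kern z s = exp (- \<bar>z - s\<bar>) * exp (- (\<bar>s\<bar> / 2))" for z s
    by (simp add: kern_def exp_add[symmetric])
  have i1: "integrable lborel (\<lambda>s. exp (- \<bar>z - s\<bar>) * (G s + sgn (s - x) * F s))" for z x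
  proof -
    have "integrable lborel (\<lambda>s. exp (- (\<bar>z\<bar> / 2)) * (kern z s * (g s + sgn (s - x) * f s)))"
      using src_kern(1)[OF s c] by simp
    then show ?thesis by (simp add: mult.assoc[symmetric] kF) (simp add: G_def F_def algebra_simps)
  qed
  have i2: "integrable lborel (\<lambda>s. exp (- \<bar>z - s\<bar>) * (sgn (s - x) * G s + F s))" for z x
  proof -
    have "integrable lborel (\<lambda>s. exp (- (\<bar>z\<bar> / 2)) * (kern z s * (sgn (s - x) * g s + f s)))"
      using src_kern(2)[OF s c] by simp
    then show ?thesis by (simp add: mult.assoc[symmetric] kF) (simp add: G_def F_def algebra_simps)
  qed
  have phi: "\<phi> z = - (1/2) * (LINT s|lborel. exp (- \<bar>z - s\<bar>) * (G s + sgn (s - z) * F s))" for z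
  proof -
    have "\<phi> z = - (1/2) * (LINT s|lborel. exp (- (\<bar>z\<bar> / 2)) * (kern z s * (g s + sgn (s - z) * f s)))"
      unfolding \<phi>_def kint1_def by simp
    also have "(\<lambda>s. exp (- (\<bar>z\<bar> / 2)) * (kern z s * (g s + sgn (s - z) * f s))) = (\<lambda>s. exp (- \<bar>z - s\<bar>) * (G s + sgn (s - z) * F s))"
      by (simp add: mult.assoc[symmetric] kF fun_eq_iff) (simp add: G_def F_def algebra_simps)
    finally show ?thesis .
  qed
  have pe: "p z = - (1/2) * (LINT s|lborel. exp (- \<bar>z - s\<bar>) * (sgn (s - z) * G s + F s))" for z
  proof -
    have "p z = - (1/2) * (LINT s|lborel. exp (- (\<bar>z\<bar> / 2)) * (kern z s * (sgn (s - z) * g s + f s)))"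
      unfolding p_def kint2_def by simp
    also have "(\<lambda>s. exp (- (\<bar>z\<bar> / 2)) * (kern z s * (sgn (s - z) * g s + f s))) = (\<lambda>s. exp (- \<bar>z - s\<bar>) * (sgn (s - z) * G s + F s))"
      by (simp add: mult.assoc[symmetric] kF fun_eq_iff) (simp add: G_def F_def algebra_simps)
    finally show ?thesis .
  qed
  have iG: "integrable lborel (\<lambda>s. exp (- \<bar>s\<bar>) * G s)" and iF: "integrable lborel (\<lambda>s. exp (- \<bar>s\<bar>) * F s)"
  proof -
    have "kern 0 s = exp (- \<bar>s\<bar>) * exp (- (\<bar>s\<bar> / 2))" for s by (simp add: kern_def exp_add[symmetric])
    note k0 = this
    obtain m where m: "integrable lborel m" "\<And>s. 0 \<le> m s" "(LINT s|lborel. m s) \<le> \<mu>" "\<And>s. \<bar>g s\<bar> + \<bar>f s\<bar> \<le> c + m s"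
      using s by (auto simp: src_def)
    have "integrable lborel (\<lambda>s. kern 0 s * g s)"
      by (rule kern_integral_bound(1)[OF _ m(1,2,3) c]) (use m(4) in \<open>auto intro: order_trans[OF _ m(4)]\<close>)
    then show "integrable lborel (\<lambda>s. exp (- \<bar>s\<bar>) * G s)" by (simp add: k0 G_def mult.assoc)
    have "integrable lborel (\<lambda>s. kern 0 s * f s)"
      by (rule kern_integral_bound(1)[OF _ m(1,2,3) c]) (use m(4) in \<open>auto intro: order_trans[OF _ m(4)]\<close>)
    then show "integrable lborel (\<lambda>s. exp (- \<bar>s\<bar>) * F s)" by (simp add: k0 F_def mult.assoc)
  qed
  define A where "A z = exp z * (LINT s|lborel. indicator {z<..} s * (exp (- s) * (G s + F s)))" for z
  define B where "B z = exp (- z) * (LINT s|lborel. indicator {..<z} s * (exp s * (G s - F s)))" for z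
  have "integrable lborel (\<lambda>s. exp (- \<bar>s\<bar>) * (G s + F s))" using Bochner_Integration.integrable_add[OF iG iF] by (simp add: algebra_simps)
  from exp_moment_primitive[OF this loc_bounded_add[OF GF]] have pA: "primitive A (\<lambda>z. A z - (G z + F z))" unfolding A_def .
  have "integrable lborel (\<lambda>s. exp (- \<bar>s\<bar>) * (G s - F s))" using Bochner_Integration.integrable_diff[OF iG iF] by (simp add: algebra_simps)
  from exp_moment_primitive'[OF this loc_bounded_diff[OF GF]] have pB: "primitive B (\<lambda>z. - B z + (G z - F z))" unfolding B_def .
  have sum: "p z + \<phi> z = - A z" for z
  proof -
    have "p z + \<phi> z = - (1/2) * (LINT s|lborel. exp (- \<bar>z - s\<bar>) * (G s + sgn (s - z) * F s) + exp (- \<bar>z - s\<bar>) * (sgn (s - z) * G s + F s))"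
      unfolding phi pe Bochner_Integration.integral_add[OF i1 i2] by (simp only: ring_distribs add.commute)
    also have "(LINT s|lborel. exp (- \<bar>z - s\<bar>) * (G s + sgn (s - z) * F s) + exp (- \<bar>z - s\<bar>) * (sgn (s - z) * G s + F s))
      = (LINT s|lborel. 2 * (exp z * (indicator {z<..} s * (exp (- s) * (G s + F s)))))"
    proof (rule integral_cong_AE)
      have "AE s in lborel. s \<noteq> z" by (rule AE_lborel_singleton)
      then show "AE s in lborel. exp (- \<bar>z - s\<bar>) * (G s + sgn (s - z) * F s) + exp (- \<bar>z - s\<bar>) * (sgn (s - z) * G s + F s) = 2 * (exp z * (indicator {z<..} s * (exp (- s) * (G s + F s))))"
      proof eventually_elim
        case (elim s)
        show ?case
        proof (cases "s < z")
          case False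
          then have "exp (- \<bar>z - s\<bar>) = exp z * exp (- s)" "sgn (s - z) = 1" "s \<in> {z<..}"
            using elim by (simp_all add: exp_add[symmetric])
          then show ?thesis by (simp add: algebra_simps)
        qed (simp add: algebra_simps)
      qed
    qed measurable
    finally show ?thesis unfolding A_def by simp
  qed
  have diff: "p z - \<phi> z = B z" for z
  proof -
    have "p z - \<phi> z = - (1/2) * (LINT s|lborel. exp (- \<bar>z - s\<bar>) * (sgn (s - z) * G s + F s) - exp (- \<bar>z - s\<bar>) * (G s + sgn (s - z) * F s))"
      unfolding phi pe Bochner_Integration.integral_diff[OF i2 i1] by (simp only: ring_distribs)
    also have "(LINT s|lborel. exp (- \<bar>z - s\<bar>) * (sgn (s - z) * G s + F s) - exp (- \<bar>z - s\<bar>) * (G s + sgn (s - z) * F s))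
      = (LINT s|lborel. - 2 * (exp (- z) * (indicator {..<z} s * (exp s * (G s - F s)))))"
    proof (rule integral_cong_AE)
      have "AE s in lborel. s \<noteq> z" by (rule AE_lborel_singleton)
      then show "AE s in lborel. exp (- \<bar>z - s\<bar>) * (sgn (s - z) * G s + F s) - exp (- \<bar>z - s\<bar>) * (G s + sgn (s - z) * F s) = - 2 * (exp (- z) * (indicator {..<z} s * (exp s * (G s - F s))))"
      proof eventually_elim
        case (elim s)
        show ?case
        proof (cases "s < z")
          case True
          then have "exp (- \<bar>z - s\<bar>) = exp (- z) * exp s" "sgn (s - z) = - 1" "s \<in> {..<z}"
            by (simp_all add: exp_add[symmetric])
          then show ?thesis by (simp add: algebra_simps)
        qed (use elim in \<open>simp add: algebra_simps\<close>)
      qed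
    qed measurable
    finally show ?thesis unfolding B_def by simp
  qed
  have p': "p z = 1/2 * (B z - A z)" for z using sum[of z] diff[of z] by simp
  have phi': "\<phi> z = 1/2 * (- A z - B z)" for z using sum[of z] diff[of z] by simp
  have pp: "p = (\<lambda>z. 1/2 * (B z - A z))" "\<phi> = (\<lambda>z. 1/2 * (- A z - B z))"
    by (rule ext, rule p', rule ext, rule phi')
  have "primitive (\<lambda>z. 1/2 * (B z - A z)) (\<lambda>z. 1/2 * ((- B z + (G z - F z)) - (A z - (G z + F z))))"
    by (intro primitive_cmult primitive_diff pA pB)
  then show "primitive p (\<lambda>z. \<phi> z + exp (- (\<bar>z\<bar> / 2)) * g z)" unfolding pp by (simp add: G_def field_simps)
  have "primitive (\<lambda>z. 1/2 * (- A z - B z)) (\<lambda>z. 1/2 * (- (A z - (G z + F z)) - (- B z + (G z - F z))))"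
    by (intro primitive_cmult primitive_diff primitive_minus pA pB)
  then show "primitive \<phi> (\<lambda>z. p z + exp (- (\<bar>z\<bar> / 2)) * f z)" unfolding pp by (simp add: F_def field_simps)
qed

section \<open>The ground state profile as a fixed point\<close>

text \<open>The delta well ground state \<open>exp (- \<bar>s\<bar>)\<close> after multiplication by the weight \<open>exp (\<bar>s\<bar>/2)\<close>.\<close>

definition Phi0 :: "real \<Rightarrow> real" where "Phi0 s = exp (- (\<bar>s\<bar> / 2))"

lemma Phi0_bounds: "0 < Phi0 s" "Phi0 s \<le> 1" by (auto simp: Phi0_def)

lemma Phi0_cont: "continuous_on UNIV Phi0" unfolding Phi0_def by (intro continuous_intros) auto

lemma Phi0_measurable[measurable]: "Phi0 \<in> borel_measurable borel"
  by (rule borel_measurable_continuous_onI[OF Phi0_cont])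

lemma antideriv_0: "antideriv f 0 = 0" by (simp only: antideriv_def set_integral_singleton order_refl if_True)

lemma antideriv_diff_bound:
  assumes f: "locally_integrable f" and g: "locally_integrable g" and le: "\<And>s. \<bar>f s - g s\<bar> \<le> B"
  shows "\<bar>antideriv f s - antideriv g s\<bar> \<le> B * \<bar>s\<bar>"
  using primitive_lipschitz_global[OF primitive_diff[OF primitive_antideriv[OF f] primitive_antideriv[OF g]] le, of s 0]
  by (simp add: antideriv_0)

lemma antideriv_bound:
  assumes f: "locally_integrable f" and le: "\<And>s. \<bar>f s\<bar> \<le> B"
  shows "\<bar>antideriv f s\<bar> \<le> B * \<bar>s\<bar>"
  using primitive_lipschitz_global[OF primitive_antideriv[OF f] le, of s 0] by (simp add: antideriv_0)

lemma exp_minus_one_bound: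
  fixes x :: real assumes "\<bar>x\<bar> \<le> 1/2" shows "\<bar>exp x - 1\<bar> \<le> 3/2 * \<bar>x\<bar>"
proof (cases "x \<ge> 0")
  case True
  have "exp x \<le> 1 + x + x\<^sup>2" using exp_bound[of x] True assms by auto
  moreover have "x\<^sup>2 \<le> 1/2 * x" using True assms mult_left_mono[of x "1/2" x] by (simp add: power2_eq_square)
  moreover have "exp x \<ge> 1" using True by simp
  ultimately show ?thesis using True by auto
next
  case False
  have "1 + x \<le> exp x" by (rule exp_ge_add_one_self)
  moreover have "exp x \<le> 1" "\<bar>x\<bar> = - x" using False by simp_all
  ultimately show ?thesis using False by linarith
qed

text \<open>The data by which the factorized oscillating problem differs from the effective one. The threshold
\<open>10\<^sup>-\<^sup>6\<close> here and in \<open>delta_well\<close> is a crude choice for which the fixed point map is a contraction.\<close>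

definition small_corrector :: "real \<Rightarrow> (real \<Rightarrow> real) \<Rightarrow> (real \<Rightarrow> real) \<Rightarrow> (real \<Rightarrow> real) \<Rightarrow> bool" where
  "small_corrector t \<beta> a d \<longleftrightarrow> 0 \<le> t \<and> t \<le> 1 / 10^6 \<and> continuous_on UNIV \<beta> \<and> a \<in> borel_measurable borel \<and> d \<in> borel_measurable borel \<and>
     (\<forall>s. \<bar>\<beta> s\<bar> \<le> t \<and> \<bar>a s\<bar> \<le> t \<and> \<bar>d s\<bar> \<le> t)"

lemma small_correctorD:
  assumes "small_corrector t \<beta> a d"
  shows "0 \<le> t" "t \<le> 1 / 10^6" "continuous_on UNIV \<beta>" "\<bar>\<beta> s\<bar> \<le> t" "\<bar>a s\<bar> \<le> t" "\<bar>d s\<bar> \<le> t"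
    "loc_bounded \<beta>" "loc_bounded a" "loc_bounded d" "loc_bounded (\<lambda>s. exp (2 * \<beta> s))" "loc_bounded (\<lambda>s. exp (- (2 * \<beta> s)))"
    "\<bar>exp (2 * \<beta> s) - 1\<bar> \<le> 3 * t" "\<bar>exp (- (2 * \<beta> s)) - 1\<bar> \<le> 3 * t" "exp (2 * \<beta> s) \<le> 2" "exp (- (2 * \<beta> s)) \<le> 2"
    "\<bar>exp (2 * \<beta> s) * (1 + d s) - 1\<bar> \<le> 5 * t"
proof -
  show 1: "0 \<le> t" "t \<le> 1 / 10^6" "continuous_on UNIV \<beta>" "\<bar>\<beta> s\<bar> \<le> t" "\<bar>a s\<bar> \<le> t" "\<bar>d s\<bar> \<le> t"
    using assms by (auto simp: small_corrector_def)
  show "loc_bounded \<beta>" "loc_bounded (\<lambda>s. exp (2 * \<beta> s))" "loc_bounded (\<lambda>s. exp (- (2 * \<beta> s)))"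
    by (intro loc_bounded_continuous continuous_intros 1)+
  show "loc_bounded a" "loc_bounded d"
    using assms by (auto simp: small_corrector_def intro: loc_bounded_bounded[where B=t])
  have "\<bar>exp (2 * \<beta> s) - 1\<bar> \<le> 3/2 * \<bar>2 * \<beta> s\<bar>" using 1 by (intro exp_minus_one_bound) (simp add: abs_mult)
  then show 2: "\<bar>exp (2 * \<beta> s) - 1\<bar> \<le> 3 * t" using 1(4) by (simp add: abs_mult)
  have "\<bar>exp (- (2 * \<beta> s)) - 1\<bar> \<le> 3/2 * \<bar>- (2 * \<beta> s)\<bar>" using 1 by (intro exp_minus_one_bound) (simp add: abs_mult)
  then show 3: "\<bar>exp (- (2 * \<beta> s)) - 1\<bar> \<le> 3 * t" using 1(4) by (simp add: abs_mult)
  show 4: "exp (2 * \<beta> s) \<le> 2" "exp (- (2 * \<beta> s)) \<le> 2" using 2 3 1(2) by auto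
  have "\<bar>exp (2 * \<beta> s) * d s\<bar> \<le> 2 * t" unfolding abs_mult using 4(1) 1(6) by (intro mult_mono) auto
  moreover have "exp (2 * \<beta> s) * (1 + d s) - 1 = (exp (2 * \<beta> s) - 1) + exp (2 * \<beta> s) * d s" by (simp add: algebra_simps)
  ultimately show "\<bar>exp (2 * \<beta> s) * (1 + d s) - 1\<bar> \<le> 5 * t" using 2 by linarith
qed

lemma small_corrector_0: "small_corrector 0 (\<lambda>_. 0) (\<lambda>_. 0) (\<lambda>_. 0)" by (simp add: small_corrector_def)

text \<open>The derivative of \<open>\<Phi> = exp (\<bar>s\<bar>/2) \<phi>\<close> when \<open>\<phi>' = a \<phi> + e\<^sup>-\<^sup>2\<^sup>\<beta> \<pi>\<close>.\<close>

definition slope :: "(real \<Rightarrow> real) \<Rightarrow> (real \<Rightarrow> real) \<Rightarrow> (real \<Rightarrow> real) \<Rightarrow> (real \<Rightarrow> real) \<Rightarrow> real \<Rightarrow> real" where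
  "slope \<beta> a \<Phi> \<Psi> s = a s * \<Phi> s + exp (- (2 * \<beta> s)) * \<Psi> s + sgn s / 2 * \<Phi> s"

text \<open>The deviation of the equation for \<open>\<phi>\<close> from \<open>\<phi>' = \<pi>\<close>.\<close>

definition srcf :: "(real \<Rightarrow> real) \<Rightarrow> (real \<Rightarrow> real) \<Rightarrow> (real \<Rightarrow> real) \<Rightarrow> (real \<Rightarrow> real) \<Rightarrow> real \<Rightarrow> real" where
  "srcf \<beta> a \<Phi> \<Psi> s = a s * \<Phi> s + (exp (- (2 * \<beta> s)) - 1) * \<Psi> s"

text \<open>The deviation of the equation for \<open>\<pi>\<close> from \<open>\<pi>' = \<phi> + v + \<omega> \<Phi>\<^sub>0\<close> (in weighted form). In the well term
\<open>v \<Phi>\<close> the value \<open>\<Phi> s\<close> is written as one plus the integral of its slope: the first moment of \<open>v\<close> is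
small, so this isolates \<open>v\<close> itself as the main part, although \<open>v\<close> is not small.\<close>

definition srcg :: "(real \<Rightarrow> real) \<Rightarrow> (real \<Rightarrow> real) \<Rightarrow> (real \<Rightarrow> real) \<Rightarrow> (real \<Rightarrow> real) \<Rightarrow> (real \<Rightarrow> real) \<Rightarrow> (real \<Rightarrow> real) \<Rightarrow> real \<Rightarrow> real \<Rightarrow> real" where
  "srcg v \<beta> a d \<Phi> \<Psi> \<omega> s = - (a s * \<Psi> s) + (exp (2 * \<beta> s) * (1 + d s) - 1) * \<Phi> s + \<omega> * (exp (2 * \<beta> s) * \<Phi> s - Phi0 s)
     + v s * (exp (2 * \<beta> s) * (1 + antideriv (slope \<beta> a \<Phi> \<Psi>) s) - 1)"

text \<open>The value of \<open>\<omega>\<close> for which the new \<open>\<phi>\<close> satisfies \<open>\<phi> 0 = 1\<close>.\<close>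

definition energy_shift :: "(real \<Rightarrow> real) \<Rightarrow> (real \<Rightarrow> real) \<Rightarrow> real" where
  "energy_shift h f = - 2 - (LINT s|lborel. kern 0 s * (h s + sgn (s - 0) * f s))"

text \<open>The unknowns \<open>(\<Phi>, \<Psi>, \<omega>)\<close>: weighted profile, weighted derivative and energy shift.\<close>

type_synonym state = "(real \<Rightarrow>\<^sub>C real) \<times> (real \<Rightarrow>\<^sub>C real) \<times> real"

abbreviation profile :: "state \<Rightarrow> real \<Rightarrow> real" where "profile x \<equiv> apply_bcontfun (fst x)"
abbreviation momentum :: "state \<Rightarrow> real \<Rightarrow> real" where "momentum x \<equiv> apply_bcontfun (fst (snd x))"
abbreviation shift :: "state \<Rightarrow> real" where "shift x \<equiv> snd (snd x)"

text \<open>The solution of the linear problem with given sources, with \<open>\<omega>\<close> adjusted to the normalization.\<close>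

definition response :: "(real \<Rightarrow> real) \<Rightarrow> (real \<Rightarrow> real) \<Rightarrow> state" where
  "response h f = (kbc1 (\<lambda>s. h s + energy_shift h f * Phi0 s) f, kbc2 (\<lambda>s. h s + energy_shift h f * Phi0 s) f, energy_shift h f)"

lemma loc_bounded_sgn: "loc_bounded (\<lambda>s. sgn s / 2)"
  by (rule loc_bounded_bounded[where B=1]) (auto simp: sgn_if)

lemma slope_loc_bounded:
  assumes "small_corrector t \<beta> a d" "loc_bounded \<Phi>" "loc_bounded \<Psi>"
  shows "loc_bounded (slope \<beta> a \<Phi> \<Psi>)"
  unfolding slope_def by (intro loc_bounded_add loc_bounded_mult small_correctorD[OF assms(1)] assms(2,3) loc_bounded_sgn)

lemma srcf_loc_bounded:
  assumes "small_corrector t \<beta> a d" "loc_bounded \<Phi>" "loc_bounded \<Psi>"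
  shows "loc_bounded (srcf \<beta> a \<Phi> \<Psi>)"
  unfolding srcf_def by (intro loc_bounded_add loc_bounded_mult loc_bounded_diff loc_bounded_const small_correctorD[OF assms(1)] assms(2,3))

lemma srcg_loc_bounded:
  assumes p: "small_corrector t \<beta> a d" and l: "loc_bounded \<Phi>" "loc_bounded \<Psi>" and v: "loc_bounded v"
  shows "loc_bounded (srcg v \<beta> a d \<Phi> \<Psi> \<omega>)"
  unfolding srcg_def
  by (intro loc_bounded_add loc_bounded_mult loc_bounded_minus loc_bounded_diff loc_bounded_const small_correctorD[OF p] l v
      loc_bounded_continuous[OF Phi0_cont] primitive_loc_bounded[OF primitive_antideriv] locally_integrable_bounded slope_loc_bounded[OF p l])

lemma abs_sgn_half: "\<bar>sgn s / 2 * (x::real)\<bar> \<le> \<bar>x\<bar> / 2" for s :: real by (simp add: abs_mult sgn_if)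

lemma slope_bound:
  assumes p: "small_corrector t \<beta> a d" and "\<bar>\<Phi> s\<bar> \<le> A" "\<bar>\<Psi> s\<bar> \<le> B"
  shows "\<bar>slope \<beta> a \<Phi> \<Psi> s\<bar> \<le> t * A + 2 * B + A / 2"
proof -
  have "\<bar>a s * \<Phi> s\<bar> \<le> t * A" unfolding abs_mult using small_correctorD(1,5)[OF p] assms(2) by (intro mult_mono) auto
  moreover have "\<bar>exp (- (2 * \<beta> s)) * \<Psi> s\<bar> \<le> 2 * B" unfolding abs_mult using small_correctorD(15)[OF p] assms(3) by (intro mult_mono) auto
  moreover have "\<bar>sgn s / 2 * \<Phi> s\<bar> \<le> A / 2" using abs_sgn_half[of s "\<Phi> s"] assms(2) by simp
  ultimately show ?thesis unfolding slope_def by (intro abs_add_le)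
qed

lemma srcf_bound:
  assumes p: "small_corrector t \<beta> a d" and "\<bar>\<Phi> s\<bar> \<le> A" "\<bar>\<Psi> s\<bar> \<le> B"
  shows "\<bar>srcf \<beta> a \<Phi> \<Psi> s\<bar> \<le> t * A + 3 * t * B"
proof -
  have "\<bar>a s * \<Phi> s\<bar> \<le> t * A" unfolding abs_mult using small_correctorD(1,5)[OF p] assms(2) by (intro mult_mono) auto
  moreover have "\<bar>(exp (- (2 * \<beta> s)) - 1) * \<Psi> s\<bar> \<le> 3 * t * B" unfolding abs_mult using small_correctorD(1,13)[OF p] assms(3) by (intro mult_mono) auto
  ultimately show ?thesis unfolding srcf_def by (intro abs_add_le)
qed

lemma srcg_bound:
  assumes p: "small_corrector t \<beta> a d" and l: "loc_bounded \<Phi>" "loc_bounded \<Psi>" and b: "\<And>s. \<bar>\<Phi> s\<bar> \<le> 2" "\<And>s. \<bar>\<Psi> s\<bar> \<le> 4"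
    and r: "\<And>s. \<bar>\<Phi> s - Phi0 s\<bar> \<le> r" and w: "\<bar>\<omega>\<bar> \<le> w"
  shows "\<bar>srcg v \<beta> a d \<Phi> \<Psi> \<omega> s\<bar> \<le> 14 * t + w * (6 * t + r) + \<bar>v s\<bar> * (3 * t + 20 * \<bar>s\<bar>)"
proof -
  note P = small_correctorD[OF p]
  have 1: "\<bar>a s * \<Psi> s\<bar> \<le> t * 4" unfolding abs_mult using P(1,5) b(2) by (intro mult_mono) auto
  have 2: "\<bar>(exp (2 * \<beta> s) * (1 + d s) - 1) * \<Phi> s\<bar> \<le> 5 * t * 2" unfolding abs_mult using P(1,16) b(1) by (intro mult_mono) auto
  have "\<bar>(exp (2 * \<beta> s) - 1) * \<Phi> s\<bar> \<le> 3 * t * 2" unfolding abs_mult using P(1,12) b(1) by (intro mult_mono) auto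
  moreover have "exp (2 * \<beta> s) * \<Phi> s - Phi0 s = (exp (2 * \<beta> s) - 1) * \<Phi> s + (\<Phi> s - Phi0 s)" by (simp add: algebra_simps)
  ultimately have "\<bar>exp (2 * \<beta> s) * \<Phi> s - Phi0 s\<bar> \<le> 6 * t + r" using r[of s] by linarith
  then have 3: "\<bar>\<omega> * (exp (2 * \<beta> s) * \<Phi> s - Phi0 s)\<bar> \<le> w * (6 * t + r)" unfolding abs_mult using w by (intro mult_mono) auto
  have "\<bar>slope \<beta> a \<Phi> \<Psi> x\<bar> \<le> 10" for x using slope_bound[where \<Phi>=\<Phi> and \<Psi>=\<Psi> and s=x and A=2 and B=4, OF p b] P(2) by auto
  then have L: "\<bar>antideriv (slope \<beta> a \<Phi> \<Psi>) s\<bar> \<le> 10 * \<bar>s\<bar>"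
    by (intro antideriv_bound locally_integrable_bounded slope_loc_bounded[OF p l])
  have "\<bar>exp (2 * \<beta> s) * antideriv (slope \<beta> a \<Phi> \<Psi>) s\<bar> \<le> 2 * (10 * \<bar>s\<bar>)" unfolding abs_mult using P(14) L by (intro mult_mono) auto
  moreover have "exp (2 * \<beta> s) * (1 + antideriv (slope \<beta> a \<Phi> \<Psi>) s) - 1 = (exp (2 * \<beta> s) - 1) + exp (2 * \<beta> s) * antideriv (slope \<beta> a \<Phi> \<Psi>) s" by (simp add: algebra_simps)
  ultimately have "\<bar>exp (2 * \<beta> s) * (1 + antideriv (slope \<beta> a \<Phi> \<Psi>) s) - 1\<bar> \<le> 3 * t + 20 * \<bar>s\<bar>" using P(12)[of s] by linarith
  then have 4: "\<bar>v s * (exp (2 * \<beta> s) * (1 + antideriv (slope \<beta> a \<Phi> \<Psi>) s) - 1)\<bar> \<le> \<bar>v s\<bar> * (3 * t + 20 * \<bar>s\<bar>)"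
    unfolding abs_mult by (intro mult_left_mono) auto
  have "\<bar>- (a s * \<Psi> s)\<bar> \<le> t * 4" using 1 by simp
  from abs_add_le[OF abs_add_le[OF abs_add_le[OF this 2] 3] 4] show ?thesis unfolding srcg_def by simp
qed

lemma srcf_diff:
  "srcf \<beta> a \<Phi> \<Psi> s - srcf \<beta> a \<Phi>' \<Psi>' s = srcf \<beta> a (\<lambda>s. \<Phi> s - \<Phi>' s) (\<lambda>s. \<Psi> s - \<Psi>' s) s"
  by (simp add: srcf_def algebra_simps)

lemma slope_diff:
  "slope \<beta> a \<Phi> \<Psi> s - slope \<beta> a \<Phi>' \<Psi>' s = slope \<beta> a (\<lambda>s. \<Phi> s - \<Phi>' s) (\<lambda>s. \<Psi> s - \<Psi>' s) s"
  by (simp add: slope_def algebra_simps add_divide_distrib diff_divide_distrib)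

lemma srcg_lipschitz:
  assumes p: "small_corrector t \<beta> a d" and l: "loc_bounded \<Phi>" "loc_bounded \<Psi>" "loc_bounded \<Phi>'" "loc_bounded \<Psi>'"
    and b: "\<And>s. \<bar>\<Phi> s\<bar> \<le> 2" and D: "\<And>s. \<bar>\<Phi> s - \<Phi>' s\<bar> \<le> D" "\<And>s. \<bar>\<Psi> s - \<Psi>' s\<bar> \<le> D" "\<bar>\<omega> - \<omega>'\<bar> \<le> D"
    and r: "\<And>s. \<bar>\<Phi> s - Phi0 s\<bar> \<le> r" and w: "\<bar>\<omega>'\<bar> \<le> r"
  shows "\<bar>srcg v \<beta> a d \<Phi> \<Psi> \<omega> s - srcg v \<beta> a d \<Phi>' \<Psi>' \<omega>' s\<bar> \<le> (12 * t + 3 * r) * D + \<bar>v s\<bar> * (0 + 6 * D * \<bar>s\<bar>)"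
proof -
  note P = small_correctorD[OF p]
  have D0: "D \<ge> 0" using D(3) by linarith
  have r0: "r \<ge> 0" using w by linarith
  have 1: "\<bar>a s * (\<Psi> s - \<Psi>' s)\<bar> \<le> t * D" unfolding abs_mult using P(1,5) D(2) by (intro mult_mono) auto
  have 2: "\<bar>(exp (2 * \<beta> s) * (1 + d s) - 1) * (\<Phi> s - \<Phi>' s)\<bar> \<le> 5 * t * D" unfolding abs_mult using P(1,16) D(1) by (intro mult_mono) auto
  have "\<bar>(exp (2 * \<beta> s) - 1) * \<Phi> s\<bar> \<le> 3 * t * 2" unfolding abs_mult using P(1,12) b(1) by (intro mult_mono) auto
  moreover have "exp (2 * \<beta> s) * \<Phi> s - Phi0 s = (exp (2 * \<beta> s) - 1) * \<Phi> s + (\<Phi> s - Phi0 s)" by (simp add: algebra_simps)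
  ultimately have "\<bar>exp (2 * \<beta> s) * \<Phi> s - Phi0 s\<bar> \<le> 6 * t + r" using r[of s] by linarith
  then have 3: "\<bar>(\<omega> - \<omega>') * (exp (2 * \<beta> s) * \<Phi> s - Phi0 s)\<bar> \<le> D * (6 * t + r)" unfolding abs_mult using D(3) by (intro mult_mono) auto
  have "\<bar>exp (2 * \<beta> s) * (\<Phi> s - \<Phi>' s)\<bar> \<le> 2 * D" unfolding abs_mult using P(14) D(1) by (intro mult_mono) auto
  then have h3: "\<bar>\<omega>' * (exp (2 * \<beta> s) * (\<Phi> s - \<Phi>' s))\<bar> \<le> r * (2 * D)" unfolding abs_mult[of "\<omega>'"] using w r0 by (intro mult_mono) auto
  let ?L = "antideriv (slope \<beta> a \<Phi> \<Psi>) s" and ?L' = "antideriv (slope \<beta> a \<Phi>' \<Psi>') s"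
  have "\<bar>slope \<beta> a \<Phi> \<Psi> x - slope \<beta> a \<Phi>' \<Psi>' x\<bar> \<le> 3 * D" for x
  proof -
    have "\<bar>slope \<beta> a \<Phi> \<Psi> x - slope \<beta> a \<Phi>' \<Psi>' x\<bar> \<le> t * D + 2 * D + D / 2"
      unfolding slope_diff by (rule slope_bound[OF p]) (use D in auto)
    moreover have "t * D \<le> 1 / 2 * D" using P(2) D0 by (intro mult_right_mono) auto
    ultimately show ?thesis by linarith
  qed
  then have L: "\<bar>?L - ?L'\<bar> \<le> 3 * D * \<bar>s\<bar>"
    by (intro antideriv_diff_bound locally_integrable_bounded slope_loc_bounded[OF p] l)
  have "\<bar>exp (2 * \<beta> s) * (?L - ?L')\<bar> \<le> 2 * (3 * D * \<bar>s\<bar>)" unfolding abs_mult using P(14) L by (intro mult_mono) auto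
  then have 4: "\<bar>v s * (exp (2 * \<beta> s) * (?L - ?L'))\<bar> \<le> \<bar>v s\<bar> * (0 + 6 * D * \<bar>s\<bar>)"
    unfolding abs_mult[of "v s"] by (intro mult_left_mono) auto
  have eq: "srcg v \<beta> a d \<Phi> \<Psi> \<omega> s - srcg v \<beta> a d \<Phi>' \<Psi>' \<omega>' s = - (a s * (\<Psi> s - \<Psi>' s)) + (exp (2 * \<beta> s) * (1 + d s) - 1) * (\<Phi> s - \<Phi>' s)
     + ((\<omega> - \<omega>') * (exp (2 * \<beta> s) * \<Phi> s - Phi0 s) + \<omega>' * (exp (2 * \<beta> s) * (\<Phi> s - \<Phi>' s))) + v s * (exp (2 * \<beta> s) * (?L - ?L'))"
    by (simp add: srcg_def algebra_simps)
  have c: "(12 * t + 3 * r) * D = t * D + 5 * t * D + (D * (6 * t + r) + r * (2 * D))" by (simp add: algebra_simps)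
  have "\<bar>- (a s * (\<Psi> s - \<Psi>' s))\<bar> \<le> t * D" using 1 by simp
  from abs_add_le[OF abs_add_le[OF abs_add_le[OF this 2] abs_add_le[OF 3 h3]] 4] show ?thesis unfolding eq c .
qed

lemma srcg_vs_unperturbed:
  assumes p: "small_corrector t \<beta> a d" and l: "loc_bounded \<Phi>" "loc_bounded \<Psi>" and b: "\<And>s. \<bar>\<Phi> s\<bar> \<le> 2" "\<And>s. \<bar>\<Psi> s\<bar> \<le> 4"
    and w: "\<bar>\<omega>\<bar> \<le> 1"
  shows "\<bar>srcg v \<beta> a d \<Phi> \<Psi> \<omega> s - srcg v (\<lambda>_. 0) (\<lambda>_. 0) (\<lambda>_. 0) \<Phi> \<Psi> \<omega> s\<bar> \<le> 20 * t + \<bar>v s\<bar> * (3 * t + 44 * t * \<bar>s\<bar>)"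
proof -
  note P = small_correctorD[OF p]
  have 1: "\<bar>a s * \<Psi> s\<bar> \<le> t * 4" unfolding abs_mult using P(1,5) b(2) by (intro mult_mono) auto
  have 2: "\<bar>(exp (2 * \<beta> s) * (1 + d s) - 1) * \<Phi> s\<bar> \<le> 5 * t * 2" unfolding abs_mult using P(1,16) b(1) by (intro mult_mono) auto
  have "\<bar>(exp (2 * \<beta> s) - 1) * \<Phi> s\<bar> \<le> 3 * t * 2" unfolding abs_mult using P(1,12) b(1) by (intro mult_mono) auto
  then have 3: "\<bar>\<omega> * ((exp (2 * \<beta> s) - 1) * \<Phi> s)\<bar> \<le> 1 * (3 * t * 2)" unfolding abs_mult[of "\<omega>"] using w by (intro mult_mono) auto
  let ?L = "antideriv (slope \<beta> a \<Phi> \<Psi>) s" and ?L' = "antideriv (slope (\<lambda>_. 0) (\<lambda>_. 0) \<Phi> \<Psi>) s"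
  have "\<bar>slope \<beta> a \<Phi> \<Psi> x\<bar> \<le> 10" for x using slope_bound[where \<Phi>=\<Phi> and \<Psi>=\<Psi> and s=x and A=2 and B=4, OF p b] P(2) by auto
  then have L: "\<bar>?L\<bar> \<le> 10 * \<bar>s\<bar>"
    by (intro antideriv_bound locally_integrable_bounded slope_loc_bounded[OF p l])
  have "\<bar>slope \<beta> a \<Phi> \<Psi> x - slope (\<lambda>_. 0) (\<lambda>_. 0) \<Phi> \<Psi> x\<bar> \<le> 14 * t" for x
  proof -
    have "slope \<beta> a \<Phi> \<Psi> x - slope (\<lambda>_. 0) (\<lambda>_. 0) \<Phi> \<Psi> x = srcf \<beta> a \<Phi> \<Psi> x" by (simp add: slope_def srcf_def algebra_simps)
    then show ?thesis using srcf_bound[where \<Phi>=\<Phi> and \<Psi>=\<Psi> and s=x and A=2 and B=4, OF p b] by simp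
  qed
  then have L2: "\<bar>?L - ?L'\<bar> \<le> 14 * t * \<bar>s\<bar>"
    by (intro antideriv_diff_bound locally_integrable_bounded slope_loc_bounded[OF p] slope_loc_bounded[OF small_corrector_0] l)
  have "\<bar>(exp (2 * \<beta> s) - 1) * (1 + ?L)\<bar> \<le> 3 * t * (1 + 10 * \<bar>s\<bar>)" unfolding abs_mult using P(1,12) L by (intro mult_mono) auto
  then have "\<bar>(exp (2 * \<beta> s) - 1) * (1 + ?L) + (?L - ?L')\<bar> \<le> 3 * t + 44 * t * \<bar>s\<bar>" using L2 by (simp add: algebra_simps)
  then have 4: "\<bar>v s * ((exp (2 * \<beta> s) - 1) * (1 + ?L) + (?L - ?L'))\<bar> \<le> \<bar>v s\<bar> * (3 * t + 44 * t * \<bar>s\<bar>)"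
    unfolding abs_mult[of "v s"] by (intro mult_left_mono) auto
  have eq: "srcg v \<beta> a d \<Phi> \<Psi> \<omega> s - srcg v (\<lambda>_. 0) (\<lambda>_. 0) (\<lambda>_. 0) \<Phi> \<Psi> \<omega> s = - (a s * \<Psi> s) + (exp (2 * \<beta> s) * (1 + d s) - 1) * \<Phi> s
     + \<omega> * ((exp (2 * \<beta> s) - 1) * \<Phi> s) + v s * ((exp (2 * \<beta> s) - 1) * (1 + ?L) + (?L - ?L'))"
    by (simp add: srcg_def algebra_simps)
  have c: "20 * t = t * 4 + 5 * t * 2 + 1 * (3 * t * 2)" by simp
  have "\<bar>- (a s * \<Psi> s)\<bar> \<le> t * 4" using 1 by simp
  from abs_add_le[OF abs_add_le[OF abs_add_le[OF this 2] 3] 4] show ?thesis unfolding eq c .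
qed

lemma src_diff_bounds:
  assumes D: "src c \<mu> (\<lambda>s. h s - h' s) (\<lambda>s. f s - f' s)" "0 \<le> c" and h': "src c' \<mu>' h' f'" "0 \<le> c'"
  shows "\<bar>kint1 h f z - kint1 h' f' z\<bar> \<le> 1/2 * (4 * c + \<mu>)" "\<bar>kint2 h f z - kint2 h' f' z\<bar> \<le> 1/2 * (4 * c + \<mu>)"
    "\<bar>energy_shift h f - energy_shift h' f'\<bar> \<le> 4 * c + \<mu>" "src (c + c') (\<mu> + \<mu>') h f"
proof -
  have "(\<lambda>s. (h s - h' s) + h' s) = h" "(\<lambda>s. (f s - f' s) + f' s) = f" by auto
  note eq = this
  have k: "kint1 h f z = kint1 (\<lambda>s. h s - h' s) (\<lambda>s. f s - f' s) z + kint1 h' f' z"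
    "kint2 h f z = kint2 (\<lambda>s. h s - h' s) (\<lambda>s. f s - f' s) z + kint2 h' f' z"
    using kint_add[OF D(1) h'(1) D(2) h'(2), of z] unfolding eq by auto
  show "\<bar>kint1 h f z - kint1 h' f' z\<bar> \<le> 1/2 * (4 * c + \<mu>)" "\<bar>kint2 h f z - kint2 h' f' z\<bar> \<le> 1/2 * (4 * c + \<mu>)"
    unfolding k using kint_bound[OF D, of z] by auto
  have "(LINT s|lborel. kern 0 s * (h s + sgn (s - 0) * f s)) = (LINT s|lborel. kern 0 s * ((h s - h' s) + sgn (s - 0) * (f s - f' s)) + kern 0 s * (h' s + sgn (s - 0) * f' s))"
    by (rule Bochner_Integration.integral_cong) (simp_all add: algebra_simps)
  also have "\<dots> = (LINT s|lborel. kern 0 s * ((h s - h' s) + sgn (s - 0) * (f s - f' s))) + (LINT s|lborel. kern 0 s * (h' s + sgn (s - 0) * f' s))"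
    by (rule Bochner_Integration.integral_add[OF src_kern(1)[OF D] src_kern(1)[OF h']])
  finally show "\<bar>energy_shift h f - energy_shift h' f'\<bar> \<le> 4 * c + \<mu>"
    unfolding energy_shift_def using src_kern(3)[OF D, of 0 0] by linarith
  show "src (c + c') (\<mu> + \<mu>') h f"
  proof -
    obtain m where m: "integrable lborel m" "\<And>s. 0 \<le> m s" "(LINT s|lborel. m s) \<le> \<mu>" "\<And>s. \<bar>h s - h' s\<bar> + \<bar>f s - f' s\<bar> \<le> c + m s"
      and M1: "(\<lambda>s. h s - h' s) \<in> borel_measurable borel" "(\<lambda>s. f s - f' s) \<in> borel_measurable borel" using D(1) by (auto simp: src_def)
    obtain m' where m': "integrable lborel m'" "\<And>s. 0 \<le> m' s" "(LINT s|lborel. m' s) \<le> \<mu>'" "\<And>s. \<bar>h' s\<bar> + \<bar>f' s\<bar> \<le> c' + m' s"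
      and M2: "h' \<in> borel_measurable borel" "f' \<in> borel_measurable borel" using h'(1) by (auto simp: src_def)
    show ?thesis unfolding src_def
    proof (intro conjI exI[of _ "\<lambda>s. m s + m' s"] allI)
      show "h \<in> borel_measurable borel" "f \<in> borel_measurable borel"
        using borel_measurable_add[OF M1(1) M2(1)] borel_measurable_add[OF M1(2) M2(2)] unfolding eq by auto
      show "(LINT s|lborel. m s + m' s) \<le> \<mu> + \<mu>'" using m m' by simp
      show "\<bar>h s\<bar> + \<bar>f s\<bar> \<le> c + c' + (m s + m' s)" for s using m(4)[of s] m'(4)[of s] by linarith
    qed (use m m' in auto)
  qed
qed

lemma src_add_Phi0:
  assumes "src c \<mu> h f" shows "src (c + \<bar>k\<bar>) \<mu> (\<lambda>s. h s + k * Phi0 s) f"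
proof -
  have "\<bar>h s + k * Phi0 s\<bar> \<le> \<bar>h s\<bar> + \<bar>k\<bar>" for s
  proof -
    have "\<bar>k * Phi0 s\<bar> \<le> \<bar>k\<bar> * 1" unfolding abs_mult using Phi0_bounds[of s] by (intro mult_left_mono) auto
    then show ?thesis by linarith
  qed
  note * = this
  obtain m where m: "integrable lborel m" "\<And>s. 0 \<le> m s" "(LINT s|lborel. m s) \<le> \<mu>" "\<And>s. \<bar>h s\<bar> + \<bar>f s\<bar> \<le> c + m s"
    and M: "h \<in> borel_measurable borel" "f \<in> borel_measurable borel" using assms by (auto simp: src_def)
  show ?thesis unfolding src_def
  proof (intro conjI exI[of _ m] allI)
    show "\<bar>h s + k * Phi0 s\<bar> + \<bar>f s\<bar> \<le> c + \<bar>k\<bar> + m s" for s using *[of s] m(4)[of s] by linarith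
  qed (use m M in auto)
qed

lemma dist_state_le:
  fixes x y :: state
  shows "dist x y \<le> dist (fst x) (fst y) + dist (fst (snd x)) (fst (snd y)) + \<bar>shift x - shift y\<bar>"
proof -
  obtain a b c where x: "x = (a, b, c)" by (cases x)
  obtain a' b' c' where y: "y = (a', b', c')" by (cases y)
  have "dist x y \<le> dist a a' + dist (b, c) (b', c')" unfolding x y dist_Pair_Pair by (rule sqrt_sum_squares_le_sum) auto
  also have "dist (b, c) (b', c') \<le> dist b b' + dist c c'" unfolding dist_Pair_Pair by (rule sqrt_sum_squares_le_sum) auto
  finally show ?thesis by (simp add: x y dist_real_def)
qed

lemma dist_state_ge:
  fixes x y :: state
  shows "\<bar>profile x z - profile y z\<bar> \<le> dist x y"
    "\<bar>momentum x z - momentum y z\<bar> \<le> dist x y"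
    "\<bar>shift x - shift y\<bar> \<le> dist x y"
proof -
  have 1: "dist (fst x) (fst y) \<le> dist x y" by (rule dist_fst_le)
  have 2: "dist (snd x) (snd y) \<le> dist x y" by (rule dist_snd_le)
  have 3: "dist (fst (snd x)) (fst (snd y)) \<le> dist (snd x) (snd y)" by (rule dist_fst_le)
  have 4: "dist (shift x) (shift y) \<le> dist (snd x) (snd y)" by (rule dist_snd_le)
  show "\<bar>profile x z - profile y z\<bar> \<le> dist x y" using bcontfun_dist_abs[of "fst x" z "fst y"] 1 by linarith
  show "\<bar>momentum x z - momentum y z\<bar> \<le> dist x y" using bcontfun_dist_abs[of "fst (snd x)" z "fst (snd y)"] 2 3 by linarith
  show "\<bar>shift x - shift y\<bar> \<le> dist x y" using 2 4 by (simp add: dist_real_def)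
qed

lemma response_lipschitz:
  assumes D: "src c \<mu> (\<lambda>s. h s - h' s) (\<lambda>s. f s - f' s)" "0 \<le> c" and h': "src c' \<mu>' h' f'" "0 \<le> c'"
  shows "dist (response h f) (response h' f') \<le> 6 * (4 * c + \<mu>)"
proof -
  let ?k = "energy_shift h f" and ?k' = "energy_shift h' f'"
  have dk: "\<bar>?k - ?k'\<bar> \<le> 4 * c + \<mu>" by (rule src_diff_bounds(3)[OF D h'])
  have h: "src (c + c') (\<mu> + \<mu>') h f" by (rule src_diff_bounds(4)[OF D h'])
  have "src (c + \<bar>?k - ?k'\<bar>) \<mu> (\<lambda>s. h s - h' s + (?k - ?k') * Phi0 s) (\<lambda>s. f s - f' s)" by (rule src_add_Phi0[OF D(1)])
  then have D2: "src (c + \<bar>?k - ?k'\<bar>) \<mu> (\<lambda>s. (h s + ?k * Phi0 s) - (h' s + ?k' * Phi0 s)) (\<lambda>s. f s - f' s)" by (simp add: algebra_simps)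
  have c2: "0 \<le> c + \<bar>?k - ?k'\<bar>" using D(2) by simp
  have h2: "src (c' + \<bar>?k'\<bar>) \<mu>' (\<lambda>s. h' s + ?k' * Phi0 s) f'" "0 \<le> c' + \<bar>?k'\<bar>" using src_add_Phi0[OF h'(1)] h'(2) by auto
  have h3: "src (c + c' + \<bar>?k\<bar>) (\<mu> + \<mu>') (\<lambda>s. h s + ?k * Phi0 s) f" "0 \<le> c + c' + \<bar>?k\<bar>" using src_add_Phi0[OF h] D(2) h'(2) by auto
  have b: "1/2 * (4 * (c + \<bar>?k - ?k'\<bar>) + \<mu>) \<le> 5/2 * (4 * c + \<mu>)" using dk by simp
  have 1: "dist (fst (response h f)) (fst (response h' f')) \<le> 5/2 * (4 * c + \<mu>)"
    proof (rule dist_bound)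
    fix z
    show "dist (apply_bcontfun (fst (response h f)) z) (apply_bcontfun (fst (response h' f')) z) \<le> 5/2 * (4 * c + \<mu>)"
      using order_trans[OF src_diff_bounds(1)[OF D2 c2 h2] b, of z] by (simp add: response_def kbc_apply[OF h2] kbc_apply[OF h3] dist_real_def)
  qed
  have 2: "dist (fst (snd (response h f))) (fst (snd (response h' f'))) \<le> 5/2 * (4 * c + \<mu>)"
    proof (rule dist_bound)
    fix z
    show "dist (apply_bcontfun (fst (snd (response h f))) z) (apply_bcontfun (fst (snd (response h' f'))) z) \<le> 5/2 * (4 * c + \<mu>)"
      using order_trans[OF src_diff_bounds(2)[OF D2 c2 h2] b, of z] by (simp add: response_def kbc_apply[OF h2] kbc_apply[OF h3] dist_real_def)
  qed
  show ?thesis using dist_state_le[of "response h f" "response h' f'"] 1 2 dk by (simp add: response_def)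
qed

text \<open>\<open>v\<close> is close to \<open>-2\<delta>\<close>: its mass is close to \<open>-2\<close>, and its first moment is small.\<close>

locale delta_well =
  fixes v :: "real \<Rightarrow> real" and \<eta> :: real
  assumes v_bounded: "loc_bounded v" and v_int: "integrable lborel v" and v_mom: "integrable lborel (\<lambda>s. \<bar>s\<bar> * \<bar>v s\<bar>)"
    and v_mass: "\<bar>(LINT s|lborel. v s) + 2\<bar> \<le> \<eta>" and v_mom_small: "(LINT s|lborel. \<bar>s\<bar> * \<bar>v s\<bar>) \<le> \<eta>"
    and v_abs: "(LINT s|lborel. \<bar>v s\<bar>) \<le> 3" and \<eta>_small: "\<eta> \<le> 1 / 10^6"
begin

lemma \<eta>_nonneg: "0 \<le> \<eta>" using v_mass by linarith

lemma v_measurable[measurable]: "v \<in> borel_measurable borel" using v_bounded loc_boundedD by blast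

lemma srcI:
  assumes "g \<in> borel_measurable borel" "f \<in> borel_measurable borel" "0 \<le> m0" "0 \<le> m1"
    "\<And>s. \<bar>g s\<bar> + \<bar>f s\<bar> \<le> c + \<bar>v s\<bar> * (m0 + m1 * \<bar>s\<bar>)"
  shows "src c (3 * m0 + m1 * \<eta>) g f"
  unfolding src_def
proof (intro conjI exI[of _ "\<lambda>s. m0 * \<bar>v s\<bar> + m1 * (\<bar>s\<bar> * \<bar>v s\<bar>)"] allI)
  show "integrable lborel (\<lambda>s. m0 * \<bar>v s\<bar> + m1 * (\<bar>s\<bar> * \<bar>v s\<bar>))" using v_int v_mom by simp
  have "(LINT s|lborel. m0 * \<bar>v s\<bar> + m1 * (\<bar>s\<bar> * \<bar>v s\<bar>)) = m0 * (LINT s|lborel. \<bar>v s\<bar>) + m1 * (LINT s|lborel. \<bar>s\<bar> * \<bar>v s\<bar>)"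
    using v_int v_mom by simp
  also have "\<dots> \<le> m0 * 3 + m1 * \<eta>" using v_abs v_mom_small assms by (intro add_mono mult_left_mono) auto
  finally show "(LINT s|lborel. m0 * \<bar>v s\<bar> + m1 * (\<bar>s\<bar> * \<bar>v s\<bar>)) \<le> 3 * m0 + m1 * \<eta>" by simp
qed (use assms in \<open>auto simp: algebra_simps\<close>)

lemma src_v: "src 0 3 v (\<lambda>_. 0)" using srcI[of v "\<lambda>_. 0" 1 0 0] by simp

text \<open>The right hand side of the fixed point equation: the linear response to sources computed from the
previous state.\<close>

definition profile_map :: "(real \<Rightarrow> real) \<Rightarrow> (real \<Rightarrow> real) \<Rightarrow> (real \<Rightarrow> real) \<Rightarrow> state \<Rightarrow> state" where
  "profile_map \<beta> a d x = response (\<lambda>s. v s + srcg v \<beta> a d (fst x) (fst (snd x)) (shift x) s) (srcf \<beta> a (fst x) (fst (snd x)))"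

text \<open>The state of the delta well with the derivative smeared out by \<open>v\<close>. The derivative jumps at the origin
in the limit, so it is close to the Green response of \<open>v\<close> but not to its pointwise limit.\<close>

definition x0 :: state where "x0 = (Bcontfun Phi0, kbc2 v (\<lambda>_. 0), 0)"

lemma Phi0_apply: "apply_bcontfun (Bcontfun Phi0) = Phi0"
  by (rule Bcontfun_inverse) (use Phi0_bounds Phi0_cont in \<open>auto simp: bcontfun_def bounded_iff intro!: exI[of _ 1] simp: less_imp_le\<close>)

definition state_ball :: "state set" where
  "state_ball = {x. (\<forall>z. \<bar>profile x z - Phi0 z\<bar> \<le> 1/400) \<and> (\<forall>z. \<bar>momentum x z\<bar> \<le> 4) \<and> \<bar>shift x\<bar> \<le> 1/400}"

lemma x0_Pi: "\<bar>momentum x0 z\<bar> \<le> 3/2"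
  unfolding x0_def using kint_bound(2)[OF src_v, of z] by (simp add: kbc_apply[OF src_v])

lemma near_x0_state_ball: assumes "dist x x0 \<le> 1/400" shows "x \<in> state_ball"
  unfolding state_ball_def
proof (intro CollectI conjI allI)
  note d = dist_state_ge(1)[of x _ x0] dist_state_ge(2)[of x _ x0] dist_state_ge(3)[of x x0]
  show "\<bar>profile x z - Phi0 z\<bar> \<le> 1/400" for z using d(1)[of z] assms by (simp add: x0_def Phi0_apply)
  show "\<bar>momentum x z\<bar> \<le> 4" for z using d(2)[of z] x0_Pi[of z] assms by linarith
  show "\<bar>shift x\<bar> \<le> 1/400" using d(3) assms by (simp add: x0_def)
qed

lemma state_ballD:
  assumes "x \<in> state_ball"
  shows "\<bar>profile x z - Phi0 z\<bar> \<le> 1/400" "\<bar>profile x z\<bar> \<le> 2" "\<bar>momentum x z\<bar> \<le> 4" "\<bar>shift x\<bar> \<le> 1/400"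
proof -
  show 1: "\<bar>profile x z - Phi0 z\<bar> \<le> 1/400" and "\<bar>momentum x z\<bar> \<le> 4" "\<bar>shift x\<bar> \<le> 1/400"
    using assms by (auto simp: state_ball_def)
  show "\<bar>profile x z\<bar> \<le> 2" using 1 Phi0_bounds[of z] by linarith
qed

text \<open>The kernel is Lipschitz in \<open>s\<close> at the origin, so integrating it against the well costs one first
moment.\<close>

lemma kern_v_approx: "\<bar>(LINT s|lborel. kern z s * v s) - Phi0 z * (LINT s|lborel. v s)\<bar> \<le> 3/2 * \<eta>"
proof -
  have ki: "integrable lborel (\<lambda>s. kern z s * v s)" using src_kern(1)[OF src_v, of z 0] by simp
  have el: "\<bar>exp x - exp y\<bar> \<le> \<bar>x - y\<bar>" if "x \<le> 0" "y \<le> 0" for x y :: real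
  proof -
    have *: "exp y - exp x \<le> y - x" if "x \<le> y" "y \<le> 0" for x y :: real
    proof -
      have "1 + (x - y) \<le> exp (x - y)" by (rule exp_ge_add_one_self)
      moreover have "exp y \<le> 1" "exp (x - y) \<le> 1" using that by simp_all
      ultimately have "exp y * (1 - exp (x - y)) \<le> 1 * (y - x)" by (intro mult_mono) linarith+
      then show ?thesis by (simp add: right_diff_distrib exp_add[symmetric])
    qed
    show ?thesis using *[of x y] *[of y x] that by (cases "x \<le> y") auto
  qed
  have kl: "\<bar>kern z s - Phi0 z\<bar> \<le> 3/2 * \<bar>s\<bar>" for s
  proof -
    have "\<bar>exp (\<bar>z\<bar> / 2 - \<bar>s\<bar> / 2 - \<bar>z - s\<bar>) - exp (- (\<bar>z\<bar> / 2))\<bar> \<le> \<bar>(\<bar>z\<bar> / 2 - \<bar>s\<bar> / 2 - \<bar>z - s\<bar>) - - (\<bar>z\<bar> / 2)\<bar>"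
      by (rule el) (use abs_triangle_ineq2[of z s] in simp_all)
    also have "(\<bar>z\<bar> / 2 - \<bar>s\<bar> / 2 - \<bar>z - s\<bar>) - - (\<bar>z\<bar> / 2) = (\<bar>z\<bar> - \<bar>z - s\<bar>) - \<bar>s\<bar> / 2" by simp
    also have "\<bar>\<dots>\<bar> \<le> \<bar>\<bar>z\<bar> - \<bar>z - s\<bar>\<bar> + \<bar>\<bar>s\<bar> / 2\<bar>" by (rule abs_triangle_ineq4)
    also have "\<dots> \<le> 3/2 * \<bar>s\<bar>" using abs_triangle_ineq3[of z "z - s"] by simp
    finally show ?thesis by (simp add: kern_def Phi0_def)
  qed
  have "(LINT s|lborel. kern z s * v s) - Phi0 z * (LINT s|lborel. v s) = (LINT s|lborel. kern z s * v s - Phi0 z * v s)"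
    using ki v_int by simp
  also have "\<bar>\<dots>\<bar> \<le> (LINT s|lborel. \<bar>kern z s * v s - Phi0 z * v s\<bar>)" by (rule integral_abs_bound)
  also have "\<dots> \<le> (LINT s|lborel. 3/2 * (\<bar>s\<bar> * \<bar>v s\<bar>))"
  proof (rule integral_mono)
    show "\<bar>kern z s * v s - Phi0 z * v s\<bar> \<le> 3/2 * (\<bar>s\<bar> * \<bar>v s\<bar>)" for s
      using mult_right_mono[OF kl[of s], of "\<bar>v s\<bar>"] by (simp add: abs_mult[symmetric] left_diff_distrib mult.assoc)
  qed (use ki v_int v_mom in auto)
  also have "\<dots> \<le> 3/2 * \<eta>" using v_mom_small by simp
  finally show ?thesis .
qed

lemma response_v_near: "dist (response v (\<lambda>_. 0)) x0 \<le> 14 * \<eta>"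
proof -
  have Pz: "Phi0 0 = 1" by (simp add: Phi0_def)
  have om: "\<bar>energy_shift v (\<lambda>_. 0)\<bar> \<le> 5/2 * \<eta>"
  proof -
    let ?A = "LINT s|lborel. kern 0 s * v s" and ?V = "LINT s|lborel. v s"
    have "\<bar>- 2 - ?A\<bar> \<le> \<bar>?A - ?V\<bar> + \<bar>?V + 2\<bar>" by linarith
    then show ?thesis unfolding energy_shift_def using kern_v_approx[of 0] v_mass Pz by simp
  qed
  let ?k = "energy_shift v (\<lambda>_. 0)"
  have s2: "src (0 + \<bar>?k\<bar>) 3 (\<lambda>s. v s + ?k * Phi0 s) (\<lambda>_. 0)" by (rule src_add_Phi0[OF src_v])
  have "src (0 + \<bar>?k\<bar>) 0 (\<lambda>s. 0 + ?k * Phi0 s) (\<lambda>_. 0)" by (rule src_add_Phi0) (auto simp: src_def intro!: exI[of _ "\<lambda>_. 0"])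
  then have s3: "src \<bar>?k\<bar> 0 (\<lambda>s. (v s + ?k * Phi0 s) - v s) (\<lambda>s. 0 - 0)" by simp
  have k1: "\<bar>kint1 v (\<lambda>_. 0) z - Phi0 z\<bar> \<le> 5/4 * \<eta>" for z
  proof -
    have "\<bar>Phi0 z * ((LINT s|lborel. v s) + 2)\<bar> \<le> 1 * \<eta>" unfolding abs_mult using Phi0_bounds[of z] v_mass by (intro mult_mono) auto
    moreover have "kint1 v (\<lambda>_. 0) z - Phi0 z = - (((LINT s|lborel. kern z s * v s) - Phi0 z * (LINT s|lborel. v s)) / 2) - Phi0 z * ((LINT s|lborel. v s) + 2) / 2"
      by (simp add: kint1_def algebra_simps add_divide_distrib diff_divide_distrib)
    moreover have "\<bar>- (a / 2) - b / 2\<bar> \<le> \<bar>a\<bar> / 2 + \<bar>b\<bar> / 2" for a b :: real by linarith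
    ultimately have "\<bar>kint1 v (\<lambda>_. 0) z - Phi0 z\<bar> \<le> \<bar>(LINT s|lborel. kern z s * v s) - Phi0 z * (LINT s|lborel. v s)\<bar> / 2 + \<bar>Phi0 z * ((LINT s|lborel. v s) + 2)\<bar> / 2"
      by metis
    moreover have "x \<le> a / 2 + b / 2 \<Longrightarrow> a \<le> 3/2 * \<eta> \<Longrightarrow> b \<le> 1 * \<eta> \<Longrightarrow> x \<le> 5/4 * \<eta>" for x a b :: real by simp
    ultimately show ?thesis using kern_v_approx[of z] \<open>\<bar>Phi0 z * ((LINT s|lborel. v s) + 2)\<bar> \<le> 1 * \<eta>\<close> by blast
  qed
  have 1: "dist (fst (response v (\<lambda>_. 0))) (fst x0) \<le> 5/4 * \<eta> + 2 * (5/2 * \<eta>)"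
  proof (rule dist_bound)
    fix z
    show "dist (apply_bcontfun (fst (response v (\<lambda>_. 0))) z) (profile x0 z) \<le> 5/4 * \<eta> + 2 * (5/2 * \<eta>)"
    proof -
      have "\<bar>kint1 (\<lambda>s. v s + ?k * Phi0 s) (\<lambda>_. 0) z - kint1 v (\<lambda>_. 0) z\<bar> \<le> 2 * (5/2 * \<eta>)"
        using src_diff_bounds(1)[OF s3 _ src_v, of z] om by simp
      then have "\<bar>kint1 (\<lambda>s. v s + ?k * Phi0 s) (\<lambda>_. 0) z - Phi0 z\<bar> \<le> 5/4 * \<eta> + 2 * (5/2 * \<eta>)"
        using k1[of z] by linarith
      then show ?thesis using s2 by (simp add: response_def x0_def Phi0_apply kbc_apply[OF s2] dist_real_def)
    qed
  qed
  have 2: "dist (fst (snd (response v (\<lambda>_. 0)))) (fst (snd x0)) \<le> 2 * (5/2 * \<eta>)"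
  proof (rule dist_bound)
    fix z
    show "dist (apply_bcontfun (fst (snd (response v (\<lambda>_. 0)))) z) (momentum x0 z) \<le> 2 * (5/2 * \<eta>)"
      using src_diff_bounds(2)[OF s3 _ src_v, of z] om s2
      by (simp add: response_def x0_def kbc_apply[OF s2] kbc_apply[OF src_v] dist_real_def)
  qed
  show ?thesis using dist_state_le[of "response v (\<lambda>_. 0)" x0] 1 2 om \<eta>_nonneg by (simp add: response_def x0_def)
qed

lemma profile_map_src:
  assumes p: "small_corrector t \<beta> a d" and r: "\<And>z. \<bar>profile x z - Phi0 z\<bar> \<le> r" and b: "x \<in> state_ball" and w: "\<bar>shift x\<bar> \<le> w"
  shows "src (28 * t + w * (6 * t + r)) (3 * (3 * t) + 20 * \<eta>)
     (\<lambda>s. (v s + srcg v \<beta> a d (fst x) (fst (snd x)) (shift x) s) - v s) (\<lambda>s. srcf \<beta> a (fst x) (fst (snd x)) s - 0)"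
proof (rule srcI)
  note l = bcontfun_loc_bounded[of "fst x"] bcontfun_loc_bounded[of "fst (snd x)"]
  show "(\<lambda>s. (v s + srcg v \<beta> a d (fst x) (fst (snd x)) (shift x) s) - v s) \<in> borel_measurable borel"
    using loc_boundedD(1)[OF srcg_loc_bounded[OF p l v_bounded]] by simp
  show "(\<lambda>s. srcf \<beta> a (fst x) (fst (snd x)) s - 0) \<in> borel_measurable borel"
    using loc_boundedD(1)[OF srcf_loc_bounded[OF p l]] by simp
  fix s
  have "\<bar>srcf \<beta> a (fst x) (fst (snd x)) s\<bar> \<le> t * 2 + 3 * t * 4" by (rule srcf_bound[OF p]) (rule state_ballD[OF b])+
  moreover have "\<bar>srcg v \<beta> a d (fst x) (fst (snd x)) (shift x) s\<bar> \<le> 14 * t + w * (6 * t + r) + \<bar>v s\<bar> * (3 * t + 20 * \<bar>s\<bar>)"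
    by (rule srcg_bound[OF p l state_ballD(2)[OF b] state_ballD(3)[OF b] r w])
  ultimately show "\<bar>(v s + srcg v \<beta> a d (fst x) (fst (snd x)) (shift x) s) - v s\<bar> + \<bar>srcf \<beta> a (fst x) (fst (snd x)) s - 0\<bar>
      \<le> 28 * t + w * (6 * t + r) + \<bar>v s\<bar> * (3 * t + 20 * \<bar>s\<bar>)" by simp
qed (use small_correctorD(1)[OF p] in auto)

lemma profile_map_near:
  assumes p: "small_corrector t \<beta> a d" and r: "\<And>z. \<bar>profile x z - Phi0 z\<bar> \<le> r" and b: "x \<in> state_ball" and w: "\<bar>shift x\<bar> \<le> w"
  shows "dist (profile_map \<beta> a d x) x0 \<le> 6 * (4 * (28 * t + w * (6 * t + r)) + (3 * (3 * t) + 20 * \<eta>)) + 14 * \<eta>"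
proof -
  have r0: "0 \<le> r" using r[of 0] by linarith
  have w0: "0 \<le> w" using w by linarith
  have "dist (profile_map \<beta> a d x) (response v (\<lambda>_. 0)) \<le> 6 * (4 * (28 * t + w * (6 * t + r)) + (3 * (3 * t) + 20 * \<eta>))"
    unfolding profile_map_def by (rule response_lipschitz[OF profile_map_src[OF p r b w] _ src_v]) (use r0 w0 small_correctorD(1)[OF p] in auto)
  then show ?thesis using response_v_near dist_triangle[of "profile_map \<beta> a d x" x0 "response v (\<lambda>_. 0)"] by linarith
qed

lemma profile_map_src_full:
  assumes p: "small_corrector t \<beta> a d" and b: "x \<in> state_ball"
  shows "\<exists>c \<mu>. 0 \<le> c \<and> src c \<mu> (\<lambda>s. v s + srcg v \<beta> a d (fst x) (fst (snd x)) (shift x) s) (srcf \<beta> a (fst x) (fst (snd x)))"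
proof -
  have nn: "0 \<le> 28 * t + (1/400) * (6 * t + 1/400)" using small_correctorD(1)[OF p] by simp
  from src_diff_bounds(4)[OF profile_map_src[OF p state_ballD(1)[OF b] b state_ballD(4)[OF b]] nn src_v] nn show ?thesis by fastforce
qed

text \<open>Every term of the source is small times the state, or carries the first moment of \<open>v\<close>.\<close>

lemma profile_map_contraction:
  assumes p: "small_corrector t \<beta> a d" and b: "x \<in> state_ball" "y \<in> state_ball"
  shows "dist (profile_map \<beta> a d x) (profile_map \<beta> a d y) \<le> 1/2 * dist x y"
proof -
  let ?D = "dist x y"
  note l = bcontfun_loc_bounded[of "fst x"] bcontfun_loc_bounded[of "fst (snd x)"] bcontfun_loc_bounded[of "fst y"] bcontfun_loc_bounded[of "fst (snd y)"]
  obtain c' \<mu>' where c': "0 \<le> c'" "src c' \<mu>' (\<lambda>s. v s + srcg v \<beta> a d (fst y) (fst (snd y)) (shift y) s) (srcf \<beta> a (fst y) (fst (snd y)))"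
    using profile_map_src_full[OF p b(2)] by blast
  have "dist (profile_map \<beta> a d x) (profile_map \<beta> a d y) \<le> 6 * (4 * ((16 * t + 3 * (1/400)) * ?D) + (3 * 0 + 6 * ?D * \<eta>))"
    unfolding profile_map_def
  proof (rule response_lipschitz[OF _ _ c'(2) c'(1)])
    show "src ((16 * t + 3 * (1/400)) * ?D) (3 * 0 + 6 * ?D * \<eta>)
       (\<lambda>s. (v s + srcg v \<beta> a d (fst x) (fst (snd x)) (shift x) s) - (v s + srcg v \<beta> a d (fst y) (fst (snd y)) (shift y) s))
       (\<lambda>s. srcf \<beta> a (fst x) (fst (snd x)) s - srcf \<beta> a (fst y) (fst (snd y)) s)"
    proof (rule srcI)
      show "(\<lambda>s. (v s + srcg v \<beta> a d (fst x) (fst (snd x)) (shift x) s) - (v s + srcg v \<beta> a d (fst y) (fst (snd y)) (shift y) s)) \<in> borel_measurable borel"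
        using loc_boundedD(1)[OF srcg_loc_bounded[OF p l(1,2) v_bounded]] loc_boundedD(1)[OF srcg_loc_bounded[OF p l(3,4) v_bounded]] by simp
      show "(\<lambda>s. srcf \<beta> a (fst x) (fst (snd x)) s - srcf \<beta> a (fst y) (fst (snd y)) s) \<in> borel_measurable borel"
        using loc_boundedD(1)[OF srcf_loc_bounded[OF p l(1,2)]] loc_boundedD(1)[OF srcf_loc_bounded[OF p l(3,4)]] by simp
      fix s
      have 1: "\<bar>srcf \<beta> a (fst x) (fst (snd x)) s - srcf \<beta> a (fst y) (fst (snd y)) s\<bar> \<le> t * ?D + 3 * t * ?D"
        by (subst srcf_diff)
          (rule srcf_bound[where \<Phi>="\<lambda>s. profile x s - profile y s" and \<Psi>="\<lambda>s. momentum x s - momentum y s",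
            OF p dist_state_ge(1)[of x s y] dist_state_ge(2)[of x s y]])
      have 2: "\<bar>srcg v \<beta> a d (fst x) (fst (snd x)) (shift x) s - srcg v \<beta> a d (fst y) (fst (snd y)) (shift y) s\<bar>
        \<le> (12 * t + 3 * (1/400)) * ?D + \<bar>v s\<bar> * (0 + 6 * ?D * \<bar>s\<bar>)"
        by (rule srcg_lipschitz[where r="1/400", OF p l]) (intro state_ballD[OF b(1)] state_ballD[OF b(2)] dist_state_ge)+
      have 3: "(16 * t + 3 * (1/400)) * ?D = t * ?D + 3 * t * ?D + (12 * t + 3 * (1/400)) * ?D" by (simp add: algebra_simps)
      show "\<bar>(v s + srcg v \<beta> a d (fst x) (fst (snd x)) (shift x) s) - (v s + srcg v \<beta> a d (fst y) (fst (snd y)) (shift y) s)\<bar>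
        + \<bar>srcf \<beta> a (fst x) (fst (snd x)) s - srcf \<beta> a (fst y) (fst (snd y)) s\<bar> \<le> (16 * t + 3 * (1/400)) * ?D + \<bar>v s\<bar> * (0 + 6 * ?D * \<bar>s\<bar>)"
      proof -
        have "\<bar>(v s + A) - (v s + B)\<bar> = \<bar>A - B\<bar>" for A B by simp
        then show ?thesis unfolding 3 using add_mono[OF 2 1] by (simp only: add_ac)
      qed
    qed auto
  qed (use small_correctorD(1)[OF p] in auto)
  also have "\<dots> = (384 * t + 9/50 + 36 * \<eta>) * ?D" by algebra
  also have "\<dots> \<le> 1/2 * ?D" using small_correctorD(2)[OF p] \<eta>_small by (intro mult_right_mono) auto
  finally show ?thesis .
qed

lemma state_ball_closed: "closed state_ball"
proof -
  have c: "continuous_on UNIV (\<lambda>x :: real \<Rightarrow>\<^sub>C real. apply_bcontfun x z)" for z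
  proof (rule continuous_onI)
    fix x :: "real \<Rightarrow>\<^sub>C real" and e :: real assume "e > 0"
    then show "\<exists>d>0. \<forall>x'\<in>UNIV. dist x' x < d \<longrightarrow> dist (apply_bcontfun x' z) (apply_bcontfun x z) \<le> e"
      by (intro exI[of _ e]) (auto intro: order_trans[OF dist_bounded])
  qed
  have c1: "continuous_on UNIV (\<lambda>x::state. profile x z)" for z
    by (rule continuous_on_compose2[OF c continuous_on_fst[OF continuous_on_id] subset_UNIV])
  have c2: "continuous_on UNIV (\<lambda>x::state. momentum x z)" for z
    by (rule continuous_on_compose2[OF c continuous_on_fst[OF continuous_on_snd[OF continuous_on_id]] subset_UNIV])
  show ?thesis unfolding state_ball_def
    by (intro closed_Collect_conj closed_Collect_all closed_Collect_le continuous_on_rabs continuous_on_diff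
        c1 c2 continuous_on_snd continuous_on_id continuous_on_const)
qed

lemma profile_map_fixed_point:
  assumes p: "small_corrector t \<beta> a d"
  shows "\<exists>x\<in>state_ball. profile_map \<beta> a d x = x \<and> dist x x0 \<le> 1500 * (t + \<eta>)"
proof -
  note P = small_correctorD[OF p]
  have "\<exists>!x\<in>state_ball. profile_map \<beta> a d x = x"
  proof (rule Banach_fix)
    show "complete state_ball" using state_ball_closed complete_eq_closed by blast
    show "state_ball \<noteq> {}" using near_x0_state_ball[of x0] by auto
    show "profile_map \<beta> a d ` state_ball \<subseteq> state_ball"
    proof (rule image_subsetI)
      fix x assume x: "x \<in> state_ball"
      have "dist (profile_map \<beta> a d x) x0 \<le> 6 * (4 * (28 * t + (1/400) * (6 * t + 1/400)) + (3 * (3 * t) + 20 * \<eta>)) + 14 * \<eta>"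
        by (rule profile_map_near[OF p state_ballD(1)[OF x] x state_ballD(4)[OF x]])
      also have "\<dots> \<le> 1/400" using P(1,2) \<eta>_small \<eta>_nonneg by (simp add: algebra_simps add_divide_distrib)
      finally show "profile_map \<beta> a d x \<in> state_ball" by (rule near_x0_state_ball)
    qed
    show "dist (profile_map \<beta> a d x) (profile_map \<beta> a d y) \<le> 1/2 * dist x y" if "x \<in> state_ball" "y \<in> state_ball" for x y
      by (rule profile_map_contraction[OF p that])
  qed auto
  then obtain x where x: "x \<in> state_ball" "profile_map \<beta> a d x = x" by blast
  have x0: "x0 \<in> state_ball" by (rule near_x0_state_ball) simp
  have "dist (profile_map \<beta> a d x0) x0 \<le> 6 * (4 * (28 * t + 0 * (6 * t + 0)) + (3 * (3 * t) + 20 * \<eta>)) + 14 * \<eta>"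
    by (rule profile_map_near[OF p _ x0]) (auto simp: x0_def Phi0_apply)
  then have 1: "dist (profile_map \<beta> a d x0) x0 \<le> 750 * (t + \<eta>)" using P(1) \<eta>_nonneg by simp
  have "dist x x0 \<le> dist (profile_map \<beta> a d x) (profile_map \<beta> a d x0) + dist (profile_map \<beta> a d x0) x0"
    using dist_triangle[of x x0 "profile_map \<beta> a d x0"] x(2) by simp
  also have "\<dots> \<le> 1/2 * dist x x0 + 750 * (t + \<eta>)" using profile_map_contraction[OF p x(1) x0] 1 by linarith
  finally show ?thesis using x by (intro bexI[of _ x]) auto
qed

text \<open>The unperturbed fixed point is almost fixed for the perturbed map, with an error proportional to \<open>t\<close>;
both problems share the same \<open>v\<close>, so \<open>\<eta>\<close> does not enter.\<close>

lemma fixed_points_close: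
  assumes p: "small_corrector t \<beta> a d" and x: "x \<in> state_ball" "profile_map \<beta> a d x = x" and y: "y \<in> state_ball" "profile_map (\<lambda>_. 0) (\<lambda>_. 0) (\<lambda>_. 0) y = y"
  shows "dist x y \<le> 2000 * t"
proof -
  note P = small_correctorD[OF p]
  note l = bcontfun_loc_bounded[of "fst y"] bcontfun_loc_bounded[of "fst (snd y)"]
  let ?o = "\<lambda>_::real. 0::real"
  obtain c' \<mu>' where c': "0 \<le> c'" "src c' \<mu>' (\<lambda>s. v s + srcg v ?o ?o ?o (fst y) (fst (snd y)) (shift y) s) (srcf ?o ?o (fst y) (fst (snd y)))"
    using profile_map_src_full[OF small_corrector_0 y(1)] by blast
  have "dist (profile_map \<beta> a d y) (profile_map ?o ?o ?o y) \<le> 6 * (4 * (34 * t) + (3 * (3 * t) + 44 * t * \<eta>))"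
    unfolding profile_map_def
  proof (rule response_lipschitz[OF _ _ c'(2) c'(1)])
    show "src (34 * t) (3 * (3 * t) + 44 * t * \<eta>)
       (\<lambda>s. (v s + srcg v \<beta> a d (fst y) (fst (snd y)) (shift y) s) - (v s + srcg v ?o ?o ?o (fst y) (fst (snd y)) (shift y) s))
       (\<lambda>s. srcf \<beta> a (fst y) (fst (snd y)) s - srcf ?o ?o (fst y) (fst (snd y)) s)"
    proof (rule srcI)
      show "(\<lambda>s. (v s + srcg v \<beta> a d (fst y) (fst (snd y)) (shift y) s) - (v s + srcg v ?o ?o ?o (fst y) (fst (snd y)) (shift y) s)) \<in> borel_measurable borel"
        using loc_boundedD(1)[OF srcg_loc_bounded[OF p l v_bounded]] loc_boundedD(1)[OF srcg_loc_bounded[OF small_corrector_0 l v_bounded]] by simp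
      show "(\<lambda>s. srcf \<beta> a (fst y) (fst (snd y)) s - srcf ?o ?o (fst y) (fst (snd y)) s) \<in> borel_measurable borel"
        using loc_boundedD(1)[OF srcf_loc_bounded[OF p l]] loc_boundedD(1)[OF srcf_loc_bounded[OF small_corrector_0 l]] by simp
      fix s
      have 1: "\<bar>srcf \<beta> a (fst y) (fst (snd y)) s\<bar> \<le> t * 2 + 3 * t * 4" by (rule srcf_bound[OF p]) (rule state_ballD[OF y(1)])+
      have 2: "srcf ?o ?o (fst y) (fst (snd y)) s = 0" by (simp add: srcf_def)
      have 3: "\<bar>srcg v \<beta> a d (fst y) (fst (snd y)) (shift y) s - srcg v ?o ?o ?o (fst y) (fst (snd y)) (shift y) s\<bar>
        \<le> 20 * t + \<bar>v s\<bar> * (3 * t + 44 * t * \<bar>s\<bar>)"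
        by (rule srcg_vs_unperturbed[OF p l state_ballD(2)[OF y(1)] state_ballD(3)[OF y(1)]]) (use state_ballD(4)[OF y(1)] in simp)
      show "\<bar>(v s + srcg v \<beta> a d (fst y) (fst (snd y)) (shift y) s) - (v s + srcg v ?o ?o ?o (fst y) (fst (snd y)) (shift y) s)\<bar>
        + \<bar>srcf \<beta> a (fst y) (fst (snd y)) s - srcf ?o ?o (fst y) (fst (snd y)) s\<bar> \<le> 34 * t + \<bar>v s\<bar> * (3 * t + 44 * t * \<bar>s\<bar>)"
        using 1 3 unfolding 2 by simp
    qed (use P(1) in auto)
  qed (use P(1) in auto)
  also have "\<dots> \<le> 1000 * t"
  proof -
    have "t * \<eta> \<le> t * 1" using P(1) \<eta>_small by (intro mult_left_mono) auto
    then have "t * \<eta> \<le> t * (1/10^6)" using P(1) \<eta>_small by (intro mult_left_mono) auto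
    then show ?thesis using P(1) by (simp add: mult.commute[of t])
  qed
  finally have "dist (profile_map \<beta> a d y) y \<le> 1000 * t" using y(2) by simp
  moreover have "dist x y \<le> dist (profile_map \<beta> a d x) (profile_map \<beta> a d y) + dist (profile_map \<beta> a d y) y"
    using dist_triangle[of x y "profile_map \<beta> a d y"] x(2) by simp
  ultimately show ?thesis using profile_map_contraction[OF p x(1) y(1)] by linarith
qed

lemma exp_half_abs_primitive: "primitive (\<lambda>z. exp (\<bar>z\<bar> / 2)) (\<lambda>z. sgn z / 2 * exp (\<bar>z\<bar> / 2))"
proof -
  have "primitive (\<lambda>z. antideriv (\<lambda>s. sgn s / 2) z) (\<lambda>s. sgn s / 2)"
    by (intro primitive_antideriv locally_integrable_bounded loc_bounded_sgn)
  moreover have "antideriv (\<lambda>s. sgn s / 2) z = \<bar>z\<bar> / 2" for z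
  proof (cases "0 \<le> z")
    case True
    have "(LINT s:{0..z}|lborel. sgn s / 2) = (LINT s:{0..z}|lborel. 1 / 2)"
      by (rule set_lebesgue_integral_cong_AE) (use AE_lborel_singleton[of "0::real"] in \<open>auto elim!: eventually_mono\<close>)
    then show ?thesis using True by (simp add: antideriv_def set_integral_const)
  next
    case False
    have "(LINT s:{z..0}|lborel. sgn s / 2) = (LINT s:{z..0}|lborel. - 1 / 2)"
      by (rule set_lebesgue_integral_cong_AE) (use AE_lborel_singleton[of "0::real"] in \<open>auto elim!: eventually_mono\<close>)
    then show ?thesis using False by (simp add: antideriv_def set_integral_const)
  qed
  ultimately have "primitive (\<lambda>z. \<bar>z\<bar> / 2) (\<lambda>s. sgn s / 2)" by simp
  from primitive_exp[OF this loc_bounded_sgn] show ?thesis .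
qed

text \<open>The map was derived from this system, with \<open>\<Phi>\<close> replaced by \<open>1\<close> plus its integrated slope; at a fixed
point with \<open>\<Phi> 0 = 1\<close> the two agree.\<close>

lemma fixed_point_solves:
  assumes p: "small_corrector t \<beta> a d" and x: "x \<in> state_ball" "profile_map \<beta> a d x = x"
  defines "\<phi> \<equiv> \<lambda>z. exp (- (\<bar>z\<bar> / 2)) * profile x z" and "\<pi> \<equiv> \<lambda>z. exp (- (\<bar>z\<bar> / 2)) * momentum x z"
  shows "primitive \<phi> (\<lambda>z. a z * \<phi> z + exp (- (2 * \<beta> z)) * \<pi> z)"
    "primitive \<pi> (\<lambda>z. - (a z * \<pi> z) + exp (2 * \<beta> z) * (v z + d z + (1 + shift x)) * \<phi> z)" "\<phi> 0 = 1"
proof -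
  let ?\<Phi> = "profile x" and ?\<Psi> = "momentum x" and ?\<omega> = "shift x"
  define f where "f = srcf \<beta> a ?\<Phi> ?\<Psi>"
  define h where "h = (\<lambda>s. v s + srcg v \<beta> a d ?\<Phi> ?\<Psi> ?\<omega> s)"
  note l = bcontfun_loc_bounded[of "fst x"] bcontfun_loc_bounded[of "fst (snd x)"]
  obtain c \<mu> where c: "0 \<le> c" "src c \<mu> h f" using profile_map_src_full[OF p x(1)] unfolding h_def f_def by blast
  have eq: "response h f = x" using x(2) unfolding profile_map_def h_def f_def .
  have "snd (snd (response h f)) = energy_shift h f" by (simp add: response_def)
  then have om: "energy_shift h f = ?\<omega>" unfolding eq by simp
  define g where "g = (\<lambda>s. h s + ?\<omega> * Phi0 s)"
  have s: "src (c + \<bar>?\<omega>\<bar>) \<mu> g f" "0 \<le> c + \<bar>?\<omega>\<bar>" unfolding g_def using src_add_Phi0[OF c(2)] c(1) by auto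
  have r: "fst (response h f) = kbc1 g f" "fst (snd (response h f)) = kbc2 g f" by (simp_all add: response_def om g_def)
  have e1: "fst x = kbc1 g f" "fst (snd x) = kbc2 g f" using r unfolding eq by auto
  have P1: "?\<Phi> = kint1 g f" "?\<Psi> = kint2 g f" unfolding e1 by (rule kbc_apply[OF s])+
  have lf: "loc_bounded f" unfolding f_def by (rule srcf_loc_bounded[OF p l])
  have lg: "loc_bounded g" unfolding g_def h_def
    by (intro loc_bounded_add loc_bounded_mult loc_bounded_const v_bounded srcg_loc_bounded[OF p l v_bounded] loc_bounded_continuous[OF Phi0_cont])
  have prim: "primitive \<phi> (\<lambda>z. \<pi> z + exp (- (\<bar>z\<bar> / 2)) * f z)" "primitive \<pi> (\<lambda>z. \<phi> z + exp (- (\<bar>z\<bar> / 2)) * g z)"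
    unfolding \<phi>_def \<pi>_def P1 by (rule kint_primitive[OF s lg lf])+
  have fe: "\<pi> z + exp (- (\<bar>z\<bar> / 2)) * f z = a z * \<phi> z + exp (- (2 * \<beta> z)) * \<pi> z" for z
    by (simp add: f_def srcf_def \<phi>_def \<pi>_def algebra_simps)
  show prim1: "primitive \<phi> (\<lambda>z. a z * \<phi> z + exp (- (2 * \<beta> z)) * \<pi> z)" using prim(1) unfolding fe .
  have k0: "kern 0 s * Phi0 s = exp (- (2 * \<bar>s - 0\<bar>))" for s by (simp add: kern_def Phi0_def exp_add[symmetric])
  have iP: "(LINT s|lborel. kern 0 s * Phi0 s) = 1" "integrable lborel (\<lambda>s. kern 0 s * Phi0 s)"
    unfolding k0 using integral_exp_abs[of 2 0] by auto
  \<comment> \<open>This is the choice of the energy shift.\<close>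
  have "?\<Phi> 0 = 1"
  proof -
    have "(LINT s|lborel. kern 0 s * (g s + sgn (s - 0) * f s)) = (LINT s|lborel. kern 0 s * (h s + sgn (s - 0) * f s) + ?\<omega> * (kern 0 s * Phi0 s))"
      by (rule Bochner_Integration.integral_cong) (simp_all add: g_def algebra_simps)
    also have "\<dots> = (LINT s|lborel. kern 0 s * (h s + sgn (s - 0) * f s)) + ?\<omega> * 1"
      using Bochner_Integration.integral_add[OF src_kern(1)[OF c(2,1), of 0 0] integrable_mult_right[OF iP(2), of ?\<omega>]] iP(1) by simp
    also have "\<dots> = -2" using om unfolding energy_shift_def by linarith
    finally show ?thesis unfolding P1 kint1_def by simp
  qed
  then show "\<phi> 0 = 1" by (simp add: \<phi>_def)
  \<comment> \<open>\<open>1 + ?L\<close> and the weighted profile have the same derivative and the same value at the origin.\<close>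
  let ?L = "antideriv (slope \<beta> a ?\<Phi> ?\<Psi>)"
  have "primitive (\<lambda>z. exp (\<bar>z\<bar> / 2) * \<phi> z) (\<lambda>z. sgn z / 2 * exp (\<bar>z\<bar> / 2) * \<phi> z + exp (\<bar>z\<bar> / 2) * (a z * \<phi> z + exp (- (2 * \<beta> z)) * \<pi> z))"
    by (intro primitive_mult exp_half_abs_primitive prim1 loc_bounded_mult loc_bounded_sgn loc_bounded_continuous) (auto intro!: continuous_intros)
  moreover have "exp (\<bar>z\<bar> / 2) * \<phi> z = ?\<Phi> z" for z by (simp add: \<phi>_def mult.assoc[symmetric] exp_add[symmetric])
  moreover have "exp (\<bar>z\<bar> / 2) * \<pi> z = ?\<Psi> z" for z by (simp add: \<pi>_def mult.assoc[symmetric] exp_add[symmetric])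
  moreover have "sgn z / 2 * exp (\<bar>z\<bar> / 2) * \<phi> z + exp (\<bar>z\<bar> / 2) * (a z * \<phi> z + exp (- (2 * \<beta> z)) * \<pi> z)
    = sgn z / 2 * (exp (\<bar>z\<bar> / 2) * \<phi> z) + (a z * (exp (\<bar>z\<bar> / 2) * \<phi> z) + exp (- (2 * \<beta> z)) * (exp (\<bar>z\<bar> / 2) * \<pi> z))" for z
    by (simp add: algebra_simps)
  ultimately have pPhi: "primitive ?\<Phi> (\<lambda>z. sgn z / 2 * ?\<Phi> z + (a z * ?\<Phi> z + exp (- (2 * \<beta> z)) * ?\<Psi> z))" by (simp only:)
  have pL: "primitive ?L (slope \<beta> a ?\<Phi> ?\<Psi>)"
    by (intro primitive_antideriv locally_integrable_bounded slope_loc_bounded[OF p l])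
  have "primitive (\<lambda>z. ?\<Phi> z - ?L z) (\<lambda>z. (sgn z / 2 * ?\<Phi> z + (a z * ?\<Phi> z + exp (- (2 * \<beta> z)) * ?\<Psi> z)) - slope \<beta> a ?\<Phi> ?\<Psi> z)"
    by (rule primitive_diff[OF pPhi pL])
  then have "primitive (\<lambda>z. ?\<Phi> z - ?L z) (\<lambda>z. 0)" by (simp add: slope_def)
  from primitive_lipschitz_global[OF this, of 0] have "?\<Phi> z - ?L z = ?\<Phi> 0 - ?L 0" for z by simp
  then have PL: "1 + ?L z = ?\<Phi> z" for z using \<open>?\<Phi> 0 = 1\<close> antideriv_0[of "slope \<beta> a ?\<Phi> ?\<Psi>"] by (metis diff_0_right add.commute diff_add_cancel)
  have "\<phi> z + exp (- (\<bar>z\<bar> / 2)) * g z = - (a z * \<pi> z) + exp (2 * \<beta> z) * (v z + d z + (1 + ?\<omega>)) * \<phi> z" for z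
    unfolding g_def h_def srcg_def PL by (simp add: \<phi>_def \<pi>_def algebra_simps)
  then show "primitive \<pi> (\<lambda>z. - (a z * \<pi> z) + exp (2 * \<beta> z) * (v z + d z + (1 + ?\<omega>)) * \<phi> z)" using prim(2) by (simp only:)
qed

end

section \<open>Uniqueness below the threshold\<close>

lemma set_integral_Cauchy_Schwarz:
  fixes f :: "real \<Rightarrow> real"
  assumes f: "set_integrable lborel {a..b} f" and f2: "set_integrable lborel {a..b} (\<lambda>s. (f s)\<^sup>2)" and "a \<le> b"
  shows "(LINT s:{a..b}|lborel. f s)\<^sup>2 \<le> (b - a) * (LINT s:{a..b}|lborel. (f s)\<^sup>2)"
proof (cases "a = b")
  case True
  then show ?thesis using set_integral_singleton[of b f] by simp
next
  case False
  then have ab: "b - a > 0" using assms(3) by simp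
  define I where "I = (LINT s:{a..b}|lborel. f s)"
  define m where "m = I / (b - a)"
  have c: "set_integrable lborel {a..b} (\<lambda>s. c :: real)" for c by (intro borel_integrable_atLeastAtMost') auto
  have i1: "set_integrable lborel {a..b} (\<lambda>s. (f s)\<^sup>2 - 2 * m * f s)" using f f2 by (intro set_integral_diff) auto
  have "0 \<le> (LINT s:{a..b}|lborel. (f s - m)\<^sup>2)" by (rule set_integral_nonneg) simp
  also have "\<dots> = (LINT s:{a..b}|lborel. ((f s)\<^sup>2 - 2 * m * f s) + m\<^sup>2)"
    by (rule set_lebesgue_integral_cong) (auto simp: power2_diff)
  also have "\<dots> = (LINT s:{a..b}|lborel. (f s)\<^sup>2 - 2 * m * f s) + (LINT s:{a..b}|lborel. m\<^sup>2)" by (rule set_integral_add(2)[OF i1 c])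
  also have "(LINT s:{a..b}|lborel. m\<^sup>2) = m\<^sup>2 * (b - a)" using assms(3) by (simp add: set_integral_const)
  also have "(LINT s:{a..b}|lborel. (f s)\<^sup>2 - 2 * m * f s) = (LINT s:{a..b}|lborel. (f s)\<^sup>2) - 2 * m * I"
    using f f2 by (subst set_integral_diff(2)) (auto simp: I_def)
  also have "(LINT s:{a..b}|lborel. (f s)\<^sup>2) - 2 * m * I + m\<^sup>2 * (b - a) = (LINT s:{a..b}|lborel. (f s)\<^sup>2) - I\<^sup>2 / (b - a)"
  proof -
    have "m * (b - a) = I" using ab by (simp add: m_def)
    then have "m\<^sup>2 * (b - a) = m * I" by (simp add: power2_eq_square mult.assoc)
    moreover have "I\<^sup>2 / (b - a) = m * I" by (simp add: m_def power2_eq_square)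
    ultimately show ?thesis by simp
  qed
  finally have "I\<^sup>2 / (b - a) \<le> (LINT s:{a..b}|lborel. (f s)\<^sup>2)" by simp
  then show ?thesis using ab by (simp add: I_def field_simps)
qed

text \<open>A one-dimensional Hardy bound, from the Cauchy--Schwarz inequality.\<close>

lemma primitive_sq_bound:
  assumes F: "primitive F f" and f: "sq_integrable f" and 0: "F 0 = 0"
  shows "(F z)\<^sup>2 \<le> \<bar>z\<bar> * (LINT s|lborel. (f s)\<^sup>2)"
proof -
  have i2: "set_integrable lborel A (\<lambda>s. (f s)\<^sup>2)" if "A \<in> sets borel" for A
    unfolding set_integrable_def using f that by (intro integrable_mult_indicator) (auto simp: sq_integrable_def)
  have le: "(LINT s:{a..b}|lborel. (f s)\<^sup>2) \<le> (LINT s|lborel. (f s)\<^sup>2)" for a b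
    unfolding set_lebesgue_integral_def using f i2[of "{a..b}"] 
    by (intro integral_mono) (auto simp: sq_integrable_def set_integrable_def indicator_def)
  have b: "(F y - F x)\<^sup>2 \<le> (y - x) * (LINT s|lborel. (f s)\<^sup>2)" if "x \<le> y" for x y
  proof -
    have "(F y - F x)\<^sup>2 \<le> (y - x) * (LINT s:{x..y}|lborel. (f s)\<^sup>2)"
      using set_integral_Cauchy_Schwarz[OF primitiveD(3)[OF F] i2 that] primitiveD(2)[OF F that] by simp
    also have "\<dots> \<le> (y - x) * (LINT s|lborel. (f s)\<^sup>2)" using le that by (intro mult_left_mono) auto
    finally show ?thesis .
  qed
  show ?thesis
  proof (cases "0 \<le> z")
    case True then show ?thesis using b[of 0 z] 0 by simp
  next
    case False then show ?thesis using b[of z 0] 0 by simp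
  qed
qed

lemma sq_integrable_zero_imp:
  assumes u: "sq_integrable u" and c: "continuous_on UNIV u" and z: "(LINT x|lborel. (u x)\<^sup>2) = 0"
  shows "u x = 0"
proof -
  have "AE x in lborel. (u x)\<^sup>2 = 0"
    using z u by (subst (asm) integral_nonneg_eq_0_iff_AE) (auto simp: sq_integrable_def)
  then have "AE x in lebesgue. x \<in> {x. u x = 0}" by (simp add: AE_completion)
  moreover have "closed {x. u x = 0}" by (intro closed_Collect_eq c continuous_on_const)
  ultimately show ?thesis using mem_closed_if_AE_lebesgue by blast
qed

lemma bound_stateD:
  assumes "bound_state V \<nu> u u1"
  shows "primitive u u1" "primitive u1 (\<lambda>x. (V x - \<nu>) * u x)" "sq_integrable u" "sq_integrable u1" "continuous_on UNIV u"
  using assms primitive_continuous by (auto simp: bound_state_def)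

lemma bound_state_lincomb:
  assumes "bound_state V \<nu> u u1" "bound_state V \<nu> v v1"
  shows "bound_state V \<nu> (\<lambda>x. p * u x + r * v x) (\<lambda>x. p * u1 x + r * v1 x)"
proof -
  note u = bound_stateD[OF assms(1)] and v = bound_stateD[OF assms(2)]
  have "primitive (\<lambda>x. p * u1 x + r * v1 x) (\<lambda>x. p * ((V x - \<nu>) * u x) + r * ((V x - \<nu>) * v x))"
    by (intro primitive_add primitive_cmult u v)
  then have "primitive (\<lambda>x. p * u1 x + r * v1 x) (\<lambda>x. (V x - \<nu>) * (p * u x + r * v x))" by (simp add: algebra_simps)
  then show ?thesis
    unfolding bound_state_def by (intro conjI primitive_add primitive_cmult sq_integrable_add sq_integrable_cmult u v)
qed

lemma sq_integrable_exp_decay: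
  assumes m: "f \<in> borel_measurable borel" and le: "\<And>z. \<bar>f z\<bar> \<le> C * exp (- (\<bar>z\<bar> / 2))"
  shows "sq_integrable f" "(LINT z|lborel. (f z)\<^sup>2) \<le> 2 * C\<^sup>2"
proof -
  have C: "C \<ge> 0" using le[of 0] by simp
  have i: "integrable lborel (\<lambda>z::real. C\<^sup>2 * exp (- (1 * \<bar>z - 0\<bar>)))" using integral_exp_abs(1)[of 1 0] by simp
  have b: "(f z)\<^sup>2 \<le> C\<^sup>2 * exp (- (1 * \<bar>z - 0\<bar>))" for z
  proof -
    have "\<bar>f z\<bar>\<^sup>2 \<le> (C * exp (- (\<bar>z\<bar> / 2)))\<^sup>2" using le by (intro power_mono) auto
    then show ?thesis by (simp add: power_mult_distrib power2_eq_square[of "exp _"] exp_add[symmetric])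
  qed
  show s: "sq_integrable f" unfolding sq_integrable_def
    using m b by (auto intro!: Bochner_Integration.integrable_bound[OF i] AE_I2)
  have "(LINT z|lborel. (f z)\<^sup>2) \<le> (LINT z|lborel. C\<^sup>2 * exp (- (1 * \<bar>z - 0\<bar>)))"
    using s b by (intro integral_mono i) (auto simp: sq_integrable_def)
  also have "\<dots> = C\<^sup>2 * 2" using integral_exp_abs[of 1 0] by simp
  finally show "(LINT z|lborel. (f z)\<^sup>2) \<le> 2 * C\<^sup>2" by simp
qed

text \<open>The scaled oscillating potential \<open>W\<close> with its corrector. All perturbation data zero and \<open>W = v\<close> gives
the effective problem.\<close>

locale factorized_well = delta_well +
  fixes W \<beta> b a d :: "real \<Rightarrow> real" and t B :: real
  assumes small_corrector: "small_corrector t \<beta> a d"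
    and prim_\<beta>: "primitive \<beta> (\<lambda>z. b z - a z)"
    and prim_b: "primitive b (\<lambda>z. W z - (b z)\<^sup>2 - v z - d z)"
    and W_measurable: "W \<in> borel_measurable borel"
    and bounds: "\<And>z. \<bar>W z\<bar> \<le> B" "\<And>z. \<bar>b z\<bar> \<le> B" "\<And>z. \<bar>v z\<bar> \<le> B"
begin

lemmas P = small_correctorD[OF small_corrector]

lemma b_loc_bounded: "loc_bounded b" by (rule primitive_loc_bounded[OF prim_b])

lemma W_loc_bounded: "loc_bounded W" by (rule loc_bounded_bounded[OF W_measurable bounds(1)])

text \<open>The substitution \<open>\<psi> = e\<^sup>\<beta> \<phi>\<close>, \<open>\<psi>' = b \<psi> + e\<^sup>-\<^sup>\<beta> \<pi>\<close> is undone; the Riccati equation for \<open>b\<close> cancels the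
oscillating part of the potential.\<close>

lemma bound_state_of_fixed_point:
  assumes x: "x \<in> state_ball" "profile_map \<beta> a d x = x"
  defines "\<psi> \<equiv> \<lambda>z. exp (\<beta> z) * (exp (- (\<bar>z\<bar> / 2)) * profile x z)"
  shows "\<exists>\<psi>1. bound_state W (- (1 + shift x)) \<psi> \<psi>1" "\<exists>z. \<psi> z \<noteq> 0"
proof -
  define \<phi> where "\<phi> = (\<lambda>z. exp (- (\<bar>z\<bar> / 2)) * profile x z)"
  define \<pi> where "\<pi> = (\<lambda>z. exp (- (\<bar>z\<bar> / 2)) * momentum x z)"
  define \<omega> where "\<omega> = shift x"
  have s: "primitive \<phi> (\<lambda>z. a z * \<phi> z + exp (- (2 * \<beta> z)) * \<pi> z)"
    "primitive \<pi> (\<lambda>z. - (a z * \<pi> z) + exp (2 * \<beta> z) * (v z + d z + (1 + \<omega>)) * \<phi> z)" "\<phi> 0 = 1"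
    unfolding \<phi>_def \<pi>_def \<omega>_def by (rule fixed_point_solves[OF small_corrector x])+
  have \<psi>: "\<psi> = (\<lambda>z. exp (\<beta> z) * \<phi> z)" by (simp add: \<psi>_def \<phi>_def)
  define \<psi>1 where "\<psi>1 = (\<lambda>z. b z * \<psi> z + exp (- \<beta> z) * \<pi> z)"
  have ba: "loc_bounded (\<lambda>z. b z - a z)" by (intro loc_bounded_diff b_loc_bounded P)
  have pe: "primitive (\<lambda>z. exp (\<beta> z)) (\<lambda>z. (b z - a z) * exp (\<beta> z))" by (rule primitive_exp[OF prim_\<beta> ba])
  have pm: "primitive (\<lambda>z. exp (- \<beta> z)) (\<lambda>z. - (b z - a z) * exp (- \<beta> z))"
    by (rule primitive_exp[OF primitive_minus[OF prim_\<beta>] loc_bounded_minus[OF ba]])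
  have ee: "exp (\<beta> z) * exp (- (2 * \<beta> z)) = exp (- \<beta> z)" "exp (- \<beta> z) * exp (2 * \<beta> z) = exp (\<beta> z)" for z
    by (simp_all add: exp_add[symmetric])
  have "primitive \<psi> (\<lambda>z. (b z - a z) * exp (\<beta> z) * \<phi> z + exp (\<beta> z) * (a z * \<phi> z + exp (- (2 * \<beta> z)) * \<pi> z))"
    unfolding \<psi> by (intro primitive_mult pe s loc_bounded_mult ba primitive_loc_bounded[OF pe])
  moreover have "(b z - a z) * exp (\<beta> z) * \<phi> z + exp (\<beta> z) * (a z * \<phi> z + exp (- (2 * \<beta> z)) * \<pi> z) = \<psi>1 z" for z
  proof -
    have "exp (\<beta> z) * (exp (- (2 * \<beta> z)) * \<pi> z) = exp (- \<beta> z) * \<pi> z" by (simp only: ee mult.assoc[symmetric])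
    then show ?thesis unfolding \<psi>1_def \<psi> by (simp add: algebra_simps)
  qed
  ultimately have p1: "primitive \<psi> \<psi>1" by simp
  have lb: "loc_bounded (\<lambda>z. W z - (b z)\<^sup>2 - v z - d z)"
    by (intro loc_bounded_diff loc_bounded_power W_loc_bounded b_loc_bounded v_bounded P)
  have "primitive \<psi>1 (\<lambda>z. ((W z - (b z)\<^sup>2 - v z - d z) * \<psi> z + b z * \<psi>1 z)
     + (- (b z - a z) * exp (- \<beta> z) * \<pi> z + exp (- \<beta> z) * (- (a z * \<pi> z) + exp (2 * \<beta> z) * (v z + d z + (1 + \<omega>)) * \<phi> z)))"
    unfolding \<psi>1_def[THEN fun_cong, THEN ext, symmetric]
    by (subst (1) \<psi>1_def, intro primitive_add primitive_mult prim_b lb p1 pm s loc_bounded_mult loc_bounded_minus ba primitive_loc_bounded[OF pm])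
  moreover have "((W z - (b z)\<^sup>2 - v z - d z) * \<psi> z + b z * \<psi>1 z)
     + (- (b z - a z) * exp (- \<beta> z) * \<pi> z + exp (- \<beta> z) * (- (a z * \<pi> z) + exp (2 * \<beta> z) * (v z + d z + (1 + \<omega>)) * \<phi> z)) = (W z - - (1 + \<omega>)) * \<psi> z" for z
  proof -
    have "exp (- \<beta> z) * (exp (2 * \<beta> z) * (v z + d z + (1 + \<omega>)) * \<phi> z) = (v z + d z + (1 + \<omega>)) * \<psi> z"
      unfolding \<psi> by (simp only: ee mult.assoc[symmetric]) (simp only: mult_ac)
    then show ?thesis unfolding \<psi>1_def by (simp add: algebra_simps power2_eq_square)
  qed
  ultimately have p2: "primitive \<psi>1 (\<lambda>z. (W z - - (1 + \<omega>)) * \<psi> z)" by (simp only:)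
  have eb: "exp (\<beta> z) \<le> 2" "exp (- \<beta> z) \<le> 2" for z
  proof -
    have "\<bar>\<beta> z\<bar> \<le> 1/2" using P(2) P(4)[of z] by simp
    then have "exp (\<beta> z) \<le> exp (1/2)" "exp (- \<beta> z) \<le> exp (1/2)" unfolding exp_le_cancel_iff by (simp_all only: abs_le_iff)
    moreover have "exp (1/2::real) \<le> 2" using exp_half_le2 .
    ultimately show "exp (\<beta> z) \<le> 2" "exp (- \<beta> z) \<le> 2" by linarith+
  qed
  have pb: "\<bar>\<psi> z\<bar> \<le> 4 * exp (- (\<bar>z\<bar> / 2))" for z
  proof -
    have "\<bar>exp (\<beta> z)\<bar> * \<bar>profile x z\<bar> \<le> 2 * 2" using eb(1)[of z] state_ballD(2)[OF x(1), of z] by (intro mult_mono) auto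
    then have "exp (\<beta> z) * \<bar>profile x z\<bar> * exp (- (\<bar>z\<bar> / 2)) \<le> 4 * exp (- (\<bar>z\<bar> / 2))" by (intro mult_right_mono) auto
    then show ?thesis unfolding \<psi> \<phi>_def abs_mult by (simp add: mult_ac)
  qed
  have p1b: "\<bar>\<psi>1 z\<bar> \<le> (B * 4 + 8) * exp (- (\<bar>z\<bar> / 2))" for z
  proof -
    have "\<bar>b z * \<psi> z\<bar> \<le> B * (4 * exp (- (\<bar>z\<bar> / 2)))" unfolding abs_mult using bounds(2)[of z] pb[of z] by (intro mult_mono) auto
    moreover have "\<bar>exp (- \<beta> z)\<bar> * \<bar>momentum x z\<bar> \<le> 2 * 4" using eb(2)[of z] state_ballD(3)[OF x(1), of z] by (intro mult_mono) auto
    then have "exp (- \<beta> z) * \<bar>momentum x z\<bar> * exp (- (\<bar>z\<bar> / 2)) \<le> 8 * exp (- (\<bar>z\<bar> / 2))" by (intro mult_right_mono) auto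
    then have "\<bar>exp (- \<beta> z) * \<pi> z\<bar> \<le> 8 * exp (- (\<bar>z\<bar> / 2))" unfolding \<pi>_def abs_mult by (simp add: mult_ac)
    ultimately show ?thesis unfolding \<psi>1_def using abs_add_le by (simp add: algebra_simps)
  qed
  have "sq_integrable \<psi>" by (rule sq_integrable_exp_decay(1)[OF primitive_measurable[OF p1] pb])
  moreover have "sq_integrable \<psi>1" by (rule sq_integrable_exp_decay(1)[OF primitive_measurable[OF p2] p1b])
  ultimately have "bound_state W (- (1 + \<omega>)) \<psi> \<psi>1" using p1 p2 by (simp add: bound_state_def)
  then show "\<exists>\<psi>1. bound_state W (- (1 + shift x)) \<psi> \<psi>1" unfolding \<omega>_def by blast
  show "\<exists>z. \<psi> z \<noteq> 0" using s(3) by (intro exI[of _ 0]) (simp add: \<psi>)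
qed

text \<open>Completing the square with \<open>b\<close> turns the energy into \<open>\<integral> (w' - b w)\<^sup>2 + v w\<^sup>2 + d w\<^sup>2\<close>. As \<open>w\<close>
vanishes at the origin, \<open>w\<^sup>2\<close> is bounded by \<open>\<bar>z\<bar>\<close> times the first term, up to small errors, and the first moment of \<open>v\<close>
is small.\<close>

lemma form_lower_bound:
  assumes w: "primitive w w1" "loc_bounded w1" "w 0 = 0" "sq_integrable w" "sq_integrable w1"
  shows "- (2 * t) * (LINT z|lborel. (w z)\<^sup>2) \<le> (LINT z|lborel. (w1 z)\<^sup>2 + W z * (w z)\<^sup>2)"
proof -
  have bm[measurable]: "b \<in> borel_measurable borel" and vm[measurable]: "v \<in> borel_measurable borel"
    and am[measurable]: "a \<in> borel_measurable borel" and dm[measurable]: "d \<in> borel_measurable borel"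
    and Wm[measurable]: "W \<in> borel_measurable borel" and bem[measurable]: "\<beta> \<in> borel_measurable borel"
    using loc_boundedD(1)[OF b_loc_bounded] v_measurable loc_boundedD(1)[OF P(7)] loc_boundedD(1)[OF P(8)] loc_boundedD(1)[OF P(9)] W_measurable by auto
  \<comment> \<open>\<open>w1\<close> is the derivative of \<open>w\<close>, and \<open>\<zeta>\<close> is what the factor \<open>d/dz - b\<close> makes of \<open>w\<close>.\<close>
  define \<zeta> where "\<zeta> z = w1 z - b z * w z" for z
  have bw: "sq_integrable (\<lambda>z. b z * w z)" by (rule sq_integrable_bounded_mult[OF w(4) bm bounds(2)])
  have s\<zeta>: "sq_integrable \<zeta>" unfolding \<zeta>_def by (rule sq_integrable_diff[OF w(5) bw])
  have m: "integrable lborel (\<lambda>z. f z * (w z)\<^sup>2)" if "f \<in> borel_measurable borel" "\<And>z. \<bar>f z\<bar> \<le> C" for f C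
    using sq_integrable_mult[OF sq_integrable_bounded_mult[OF w(4) that] w(4)] by (simp add: power2_eq_square mult.assoc)
  have iW: "integrable lborel (\<lambda>z. W z * (w z)\<^sup>2)" by (rule m[OF Wm bounds(1)])
  have iv: "integrable lborel (\<lambda>z. v z * (w z)\<^sup>2)" by (rule m[OF vm bounds(3)])
  have id: "integrable lborel (\<lambda>z. d z * (w z)\<^sup>2)" by (rule m[OF dm P(6)])
  have ib2: "integrable lborel (\<lambda>z. (b z)\<^sup>2 * (w z)\<^sup>2)" using bw by (simp add: sq_integrable_def power_mult_distrib)
  have ibw: "integrable lborel (\<lambda>z. b z * w z * w1 z)" using sq_integrable_mult[OF bw w(5)] .
  have ib: "integrable lborel (\<lambda>z. b z * (w z)\<^sup>2)" by (rule m[OF bm bounds(2)])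
  have iw1: "integrable lborel (\<lambda>z. (w1 z)\<^sup>2)" using w(5) by (simp add: sq_integrable_def)
  have iw: "integrable lborel (\<lambda>z. (w z)\<^sup>2)" using w(4) by (simp add: sq_integrable_def)
  have i\<zeta>: "integrable lborel (\<lambda>z. (\<zeta> z)\<^sup>2)" using s\<zeta> by (simp add: sq_integrable_def)
  have lb: "loc_bounded (\<lambda>z. W z - (b z)\<^sup>2 - v z - d z)"
    by (intro loc_bounded_diff loc_bounded_power W_loc_bounded b_loc_bounded v_bounded P)
  \<comment> \<open>The integral of \<open>(b w\<^sup>2)'\<close> vanishes; inserting the Riccati equation trades \<open>W\<close> for the square.\<close>
  have pw2: "primitive (\<lambda>z. w z * w z) (\<lambda>z. w1 z * w z + w z * w1 z)" by (rule primitive_mult[OF w(1,2,1)])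
  have "primitive (\<lambda>z. b z * (w z * w z)) (\<lambda>z. (W z - (b z)\<^sup>2 - v z - d z) * (w z * w z) + b z * (w1 z * w z + w z * w1 z))"
    by (rule primitive_mult[OF prim_b lb pw2])
  moreover have "(W z - (b z)\<^sup>2 - v z - d z) * (w z * w z) + b z * (w1 z * w z + w z * w1 z)
      = W z * (w z)\<^sup>2 - (b z)\<^sup>2 * (w z)\<^sup>2 - v z * (w z)\<^sup>2 - d z * (w z)\<^sup>2 + 2 * (b z * w z * w1 z)" for z
    by (simp add: algebra_simps power2_eq_square)
  moreover have "b z * (w z * w z) = b z * (w z)\<^sup>2" for z by (simp add: power2_eq_square)
  ultimately have pr: "primitive (\<lambda>z. b z * (w z)\<^sup>2) (\<lambda>z. W z * (w z)\<^sup>2 - (b z)\<^sup>2 * (w z)\<^sup>2 - v z * (w z)\<^sup>2 - d z * (w z)\<^sup>2 + 2 * (b z * w z * w1 z))"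
    by (simp only:)
  have ir: "integrable lborel (\<lambda>z. W z * (w z)\<^sup>2 - (b z)\<^sup>2 * (w z)\<^sup>2 - v z * (w z)\<^sup>2 - d z * (w z)\<^sup>2 + 2 * (b z * w z * w1 z))"
    using iW ib2 iv id ibw by simp
  have zero: "(LINT z|lborel. W z * (w z)\<^sup>2 - (b z)\<^sup>2 * (w z)\<^sup>2 - v z * (w z)\<^sup>2 - d z * (w z)\<^sup>2 + 2 * (b z * w z * w1 z)) = 0"
    by (rule primitive_integral_zero[OF pr ib ir])
  define Z where "Z = (LINT z|lborel. (\<zeta> z)\<^sup>2)"
  define N where "N = (LINT z|lborel. (w z)\<^sup>2)"
  have Z0: "0 \<le> Z" "0 \<le> N" by (simp_all add: Z_def N_def)
  have split: "(LINT z|lborel. (w1 z)\<^sup>2 + W z * (w z)\<^sup>2) = Z + (LINT z|lborel. v z * (w z)\<^sup>2) + (LINT z|lborel. d z * (w z)\<^sup>2)"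
  proof -
    have "(LINT z|lborel. (w1 z)\<^sup>2 + W z * (w z)\<^sup>2) = (LINT z|lborel. (((\<zeta> z)\<^sup>2 + v z * (w z)\<^sup>2) + d z * (w z)\<^sup>2)
       + (W z * (w z)\<^sup>2 - (b z)\<^sup>2 * (w z)\<^sup>2 - v z * (w z)\<^sup>2 - d z * (w z)\<^sup>2 + 2 * (b z * w z * w1 z)))"
      by (rule Bochner_Integration.integral_cong) (simp_all add: \<zeta>_def power2_eq_square algebra_simps)
    also have "\<dots> = (LINT z|lborel. ((\<zeta> z)\<^sup>2 + v z * (w z)\<^sup>2) + d z * (w z)\<^sup>2) + 0"
      using i\<zeta> iv id ir zero by (subst Bochner_Integration.integral_add) auto
    also have "\<dots> = Z + (LINT z|lborel. v z * (w z)\<^sup>2) + (LINT z|lborel. d z * (w z)\<^sup>2)"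
      using i\<zeta> iv id by (simp add: Z_def)
    finally show ?thesis .
  qed
  \<comment> \<open>\<open>e\<^sup>-\<^sup>\<beta> w\<close> has a derivative comparable to \<open>\<zeta>\<close>: the large function \<open>b\<close> drops out and only \<open>a\<close> remains.\<close>
  define \<phi> where "\<phi> = (\<lambda>z. exp (- \<beta> z) * w z)"
  define \<phi>1 where "\<phi>1 = (\<lambda>z. exp (- \<beta> z) * (\<zeta> z + a z * w z))"
  have ba: "loc_bounded (\<lambda>z. b z - a z)" by (intro loc_bounded_diff b_loc_bounded P)
  have pm: "primitive (\<lambda>z. exp (- \<beta> z)) (\<lambda>z. - (b z - a z) * exp (- \<beta> z))"
    by (rule primitive_exp[OF primitive_minus[OF prim_\<beta>] loc_bounded_minus[OF ba]])
  have "primitive \<phi> (\<lambda>z. - (b z - a z) * exp (- \<beta> z) * w z + exp (- \<beta> z) * w1 z)"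
    unfolding \<phi>_def by (intro primitive_mult pm w(1) loc_bounded_mult loc_bounded_minus ba primitive_loc_bounded[OF pm])
  moreover have "- (b z - a z) * exp (- \<beta> z) * w z + exp (- \<beta> z) * w1 z = \<phi>1 z" for z
    by (simp add: \<phi>1_def \<zeta>_def algebra_simps)
  ultimately have p\<phi>: "primitive \<phi> \<phi>1" by simp
  have \<phi>1b: "(\<phi>1 z)\<^sup>2 \<le> 4 * (\<zeta> z)\<^sup>2 + 4 * t\<^sup>2 * (w z)\<^sup>2" for z
  proof -
    have "(exp (- \<beta> z))\<^sup>2 = exp (- (2 * \<beta> z))" by (simp add: power2_eq_square exp_add[symmetric])
    then have "(\<phi>1 z)\<^sup>2 = exp (- (2 * \<beta> z)) * (\<zeta> z + a z * w z)\<^sup>2" by (simp add: \<phi>1_def power_mult_distrib)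
    also have "\<dots> \<le> 2 * (\<zeta> z + a z * w z)\<^sup>2" using P(15) by (intro mult_right_mono) auto
    also have "\<dots> \<le> 2 * (2 * (\<zeta> z)\<^sup>2 + 2 * (a z * w z)\<^sup>2)"
      using sum_squares_bound[of "\<zeta> z" "a z * w z"] by (simp add: power2_sum)
    also have "(a z * w z)\<^sup>2 \<le> t\<^sup>2 * (w z)\<^sup>2"
      unfolding power_mult_distrib using P(5)[of z] P(1) by (intro mult_right_mono) (auto simp: abs_le_square_iff[symmetric])
    finally show ?thesis by simp
  qed
  have s\<phi>1: "sq_integrable \<phi>1"
    unfolding \<phi>1_def
  proof (rule sq_integrable_bounded_mult[OF sq_integrable_add[OF s\<zeta> sq_integrable_bounded_mult[OF w(4) am P(5)]]])
    show "(\<lambda>z. exp (- \<beta> z)) \<in> borel_measurable borel" by measurable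
    show "\<bar>exp (- \<beta> z)\<bar> \<le> exp t" for z using P(4)[of z] by simp
  qed
  have \<phi>1I: "(LINT z|lborel. (\<phi>1 z)\<^sup>2) \<le> 4 * Z + 4 * t\<^sup>2 * N"
  proof -
    have "(LINT z|lborel. (\<phi>1 z)\<^sup>2) \<le> (LINT z|lborel. 4 * (\<zeta> z)\<^sup>2 + 4 * t\<^sup>2 * (w z)\<^sup>2)"
      using s\<phi>1 i\<zeta> iw \<phi>1b by (intro integral_mono) (auto simp: sq_integrable_def)
    also have "\<dots> = 4 * Z + 4 * t\<^sup>2 * N" using i\<zeta> iw by (simp add: Z_def N_def)
    finally show ?thesis .
  qed
  have wz: "(w z)\<^sup>2 \<le> 8 * (Z + t\<^sup>2 * N) * \<bar>z\<bar>" for z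
  proof -
    have "(w z)\<^sup>2 = exp (2 * \<beta> z) * (\<phi> z)\<^sup>2"
    proof -
      have "(exp (- \<beta> z))\<^sup>2 = exp (- (2 * \<beta> z))" by (simp add: power2_eq_square exp_add[symmetric])
      then show ?thesis by (simp add: \<phi>_def power_mult_distrib mult.assoc[symmetric] exp_add[symmetric])
    qed
    also have "\<dots> \<le> 2 * (\<bar>z\<bar> * (4 * Z + 4 * t\<^sup>2 * N))"
    proof (rule mult_mono)
      have "(\<phi> z)\<^sup>2 \<le> \<bar>z\<bar> * (LINT s|lborel. (\<phi>1 s)\<^sup>2)" by (rule primitive_sq_bound[OF p\<phi> s\<phi>1]) (simp add: \<phi>_def w(3))
      also have "\<dots> \<le> \<bar>z\<bar> * (4 * Z + 4 * t\<^sup>2 * N)" by (intro mult_left_mono \<phi>1I) auto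
      finally show "(\<phi> z)\<^sup>2 \<le> \<bar>z\<bar> * (4 * Z + 4 * t\<^sup>2 * N)" .
    qed (use P(14) in auto)
    finally show ?thesis by (simp add: algebra_simps)
  qed
  have vI: "- (8 * (Z + t\<^sup>2 * N) * \<eta>) \<le> (LINT z|lborel. v z * (w z)\<^sup>2)"
  proof -
    have "- (8 * (Z + t\<^sup>2 * N) * \<eta>) \<le> - (8 * (Z + t\<^sup>2 * N) * (LINT z|lborel. \<bar>z\<bar> * \<bar>v z\<bar>))"
      using v_mom_small Z0 by (auto intro!: mult_left_mono)
    also have "\<dots> = (LINT z|lborel. - (8 * (Z + t\<^sup>2 * N)) * (\<bar>z\<bar> * \<bar>v z\<bar>))" by (subst integral_mult_right_zero) (simp only: mult_minus_left)
    also have "\<dots> \<le> (LINT z|lborel. v z * (w z)\<^sup>2)"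
    proof (rule integral_mono)
      fix z
      have "\<bar>v z\<bar> * (w z)\<^sup>2 \<le> \<bar>v z\<bar> * (8 * (Z + t\<^sup>2 * N) * \<bar>z\<bar>)" by (intro mult_left_mono wz) auto
      moreover have "- (\<bar>v z\<bar> * (w z)\<^sup>2) \<le> v z * (w z)\<^sup>2" by (simp only: mult_minus_left[symmetric]) (intro mult_right_mono, auto)
      ultimately show "- (8 * (Z + t\<^sup>2 * N)) * (\<bar>z\<bar> * \<bar>v z\<bar>) \<le> v z * (w z)\<^sup>2" by (simp add: algebra_simps)
    qed (use v_mom iv in auto)
    finally show ?thesis .
  qed
  have dI: "- (t * N) \<le> (LINT z|lborel. d z * (w z)\<^sup>2)"
  proof -
    have "- (t * N) = (LINT z|lborel. - t * (w z)\<^sup>2)" using iw by (simp add: N_def)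
    also have "\<dots> \<le> (LINT z|lborel. d z * (w z)\<^sup>2)"
      using iw id P(6) by (intro integral_mono mult_right_mono) (auto simp: abs_le_iff minus_le_iff)
    finally show ?thesis .
  qed
  have "8 * \<eta> * Z \<le> 1 * Z" using \<eta>_small Z0 by (intro mult_right_mono) auto
  moreover have "8 * \<eta> * t * (t * N) \<le> 1 * (t * N)"
  proof (intro mult_right_mono)
    have "8 * \<eta> * t \<le> 1 * 1" using \<eta>_small \<eta>_nonneg P(1,2) by (intro mult_mono) auto
    then show "8 * \<eta> * t \<le> 1" by simp
  qed (use P(1) Z0 in auto)
  moreover have "8 * (Z + t\<^sup>2 * N) * \<eta> = 8 * \<eta> * Z + 8 * \<eta> * t * (t * N)" by (simp add: algebra_simps power2_eq_square)
  ultimately have "- (2 * t * N) \<le> Z + (LINT z|lborel. v z * (w z)\<^sup>2) + (LINT z|lborel. d z * (w z)\<^sup>2)"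
    using vI dI by linarith
  then show ?thesis unfolding split N_def by simp
qed

lemma bound_state_energy:
  assumes w: "primitive w w1" "primitive w1 w2" "sq_integrable w" "sq_integrable w1" "sq_integrable w2"
  shows "(LINT z|lborel. (w1 z)\<^sup>2 + w z * w2 z) = 0"
proof -
  have "primitive (\<lambda>z. w z * w1 z) (\<lambda>z. w1 z * w1 z + w z * w2 z)"
    by (rule primitive_mult[OF w(1) primitive_loc_bounded[OF w(2)] w(2)])
  from primitive_integral_zero[OF this sq_integrable_mult[OF w(3,4)]]
  show ?thesis using sq_integrable_mult[OF w(4,4)] sq_integrable_mult[OF w(3,5)] by (simp add: power2_eq_square)
qed

lemma W_mult_sq: "sq_integrable u \<Longrightarrow> sq_integrable (\<lambda>z. (W z - E) * u z)"
proof (rule sq_integrable_bounded_mult)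
  show "\<bar>W z - E\<bar> \<le> B + \<bar>E\<bar>" for z using bounds(1)[of z] by linarith
qed (use W_measurable in auto)

lemma W_sq_integrable: "sq_integrable u \<Longrightarrow> integrable lborel (\<lambda>z. W z * (u z)\<^sup>2)"
  using sq_integrable_mult[OF sq_integrable_bounded_mult[OF _ W_measurable bounds(1)], of u u] by (simp add: power2_eq_square mult.assoc)

text \<open>Green's formula: the Wronskian is a primitive of \<open>(E1 - E2) u y\<close>.\<close>

lemma bound_states_orthogonal:
  assumes u: "bound_state W E1 u u1" and y: "bound_state W E2 y y1" and ne: "E1 \<noteq> E2"
  shows "(LINT z|lborel. u z * y z) = 0"
proof -
  note U = bound_stateD[OF u] and V = bound_stateD[OF y]
  have "primitive (\<lambda>z. u z * y1 z - y z * u1 z) (\<lambda>z. (u1 z * y1 z + u z * ((W z - E2) * y z)) - (y1 z * u1 z + y z * ((W z - E1) * u z)))"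
    by (intro primitive_diff primitive_mult U V primitive_loc_bounded[OF U(2)] primitive_loc_bounded[OF V(2)])
  then have p: "primitive (\<lambda>z. u z * y1 z - y z * u1 z) (\<lambda>z. (E1 - E2) * (u z * y z))" by (simp add: algebra_simps)
  have "(LINT z|lborel. (E1 - E2) * (u z * y z)) = 0"
    by (rule primitive_integral_zero[OF p]) (use sq_integrable_mult[OF U(3) V(4)] sq_integrable_mult[OF V(3) U(4)] sq_integrable_mult[OF U(3) V(3)] in auto)
  then show ?thesis using ne by simp
qed

lemma bound_state_vanishing_at_0:
  assumes u: "bound_state W E u u1" and E: "E < - (2 * t)" and 0: "u 0 = 0"
  shows "u z = 0"
proof -
  note U = bound_stateD[OF u]
  have "(LINT z|lborel. (u1 z)\<^sup>2 + u z * ((W z - E) * u z)) = 0"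
    by (rule bound_state_energy[OF U(1,2,3,4) W_mult_sq[OF U(3)]])
  moreover have "(LINT z|lborel. (u1 z)\<^sup>2 + u z * ((W z - E) * u z)) = (LINT z|lborel. ((u1 z)\<^sup>2 + W z * (u z)\<^sup>2) - E * (u z)\<^sup>2)"
    by (rule Bochner_Integration.integral_cong) (simp_all add: algebra_simps power2_eq_square)
  moreover have "(LINT z|lborel. ((u1 z)\<^sup>2 + W z * (u z)\<^sup>2) - E * (u z)\<^sup>2) = (LINT z|lborel. ((u1 z)\<^sup>2 + W z * (u z)\<^sup>2)) - E * (LINT z|lborel. (u z)\<^sup>2)"
    using U(3,4) W_sq_integrable[OF U(3)] by (subst Bochner_Integration.integral_diff) (auto simp: sq_integrable_def)
  ultimately have "- (2 * t) * (LINT z|lborel. (u z)\<^sup>2) \<le> E * (LINT z|lborel. (u z)\<^sup>2)"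
    using form_lower_bound[OF U(1) primitive_loc_bounded[OF U(2)] 0 U(3,4)] by simp
  moreover have "0 \<le> (LINT z|lborel. (u z)\<^sup>2)" by simp
  ultimately have "(LINT z|lborel. (u z)\<^sup>2) = 0" using E by (metis antisym_conv2 mult_less_cancel_right not_le order_less_le)
  then show ?thesis by (rule sq_integrable_zero_imp[OF U(3,5)])
qed

text \<open>The combination \<open>y(0) u - u(0) y\<close> vanishes at the origin, and by orthogonality its energy is the weighted
sum of the two energies, both below the bound.\<close>

lemma bound_states_unique_energy:
  assumes u: "bound_state W E1 u u1" and y: "bound_state W E2 y y1" and E: "E1 < - (2 * t)" "E2 < - (2 * t)"
    and ne: "\<exists>z. u z \<noteq> 0" "\<exists>z. y z \<noteq> 0"
  shows "E1 = E2"
proof (rule ccontr)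
  assume d: "E1 \<noteq> E2"
  note U = bound_stateD[OF u] and V = bound_stateD[OF y]
  have u0: "u 0 \<noteq> 0" and v0: "y 0 \<noteq> 0" using bound_state_vanishing_at_0[OF u E(1)] bound_state_vanishing_at_0[OF y E(2)] ne by auto
  define p r where "p = y 0" and "r = - u 0"
  define w where "w = (\<lambda>z. p * u z + r * y z)"
  define w1 where "w1 = (\<lambda>z. p * u1 z + r * y1 z)"
  define w2 where "w2 = (\<lambda>z. p * ((W z - E1) * u z) + r * ((W z - E2) * y z))"
  have pw: "primitive w w1" "primitive w1 w2" unfolding w_def w1_def w2_def by (intro primitive_add primitive_cmult U V)+
  have sw: "sq_integrable w" "sq_integrable w1" "sq_integrable w2" unfolding w_def w1_def w2_def
    by (intro sq_integrable_add sq_integrable_cmult U V W_mult_sq)+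
  have w0: "w 0 = 0" by (simp add: w_def p_def r_def)
  define Nu Nv where "Nu = (LINT z|lborel. (u z)\<^sup>2)" and "Nv = (LINT z|lborel. (y z)\<^sup>2)"
  have iu: "integrable lborel (\<lambda>z. (u z)\<^sup>2)" and iv: "integrable lborel (\<lambda>z. (y z)\<^sup>2)" using U(3) V(3) by (auto simp: sq_integrable_def)
  have iuv: "integrable lborel (\<lambda>z. u z * y z)" by (rule sq_integrable_mult[OF U(3) V(3)])
  have ort: "(LINT z|lborel. u z * y z) = 0" by (rule bound_states_orthogonal[OF u y d])
  have lin: "(LINT z|lborel. A * (u z)\<^sup>2 + C * (y z)\<^sup>2 + D * (u z * y z)) = A * Nu + C * Nv" for A C D
    using iu iv iuv ort by (simp add: Nu_def Nv_def)
  have N: "(LINT z|lborel. (w z)\<^sup>2) = p\<^sup>2 * Nu + r\<^sup>2 * Nv"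
    unfolding lin[of "p\<^sup>2" "r\<^sup>2" "2 * p * r", symmetric]
    by (rule Bochner_Integration.integral_cong) (simp_all add: w_def algebra_simps power2_eq_square)
  have "(LINT z|lborel. (w1 z)\<^sup>2 + W z * (w z)\<^sup>2) = (LINT z|lborel. ((w1 z)\<^sup>2 + w z * w2 z) + ((p\<^sup>2 * E1) * (u z)\<^sup>2 + (r\<^sup>2 * E2) * (y z)\<^sup>2 + (p * r * (E1 + E2)) * (u z * y z)))"
    by (rule Bochner_Integration.integral_cong) (simp_all add: w_def w2_def algebra_simps power2_eq_square)
  also have "\<dots> = (LINT z|lborel. (w1 z)\<^sup>2 + w z * w2 z) + (LINT z|lborel. (p\<^sup>2 * E1) * (u z)\<^sup>2 + (r\<^sup>2 * E2) * (y z)\<^sup>2 + (p * r * (E1 + E2)) * (u z * y z))"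
    using sw iu iv iuv sq_integrable_mult[OF sw(1,3)] by (intro Bochner_Integration.integral_add) (auto simp: sq_integrable_def)
  also have "\<dots> = p\<^sup>2 * E1 * Nu + r\<^sup>2 * E2 * Nv" unfolding lin bound_state_energy[OF pw sw] by simp
  finally have "- (2 * t) * (p\<^sup>2 * Nu + r\<^sup>2 * Nv) \<le> p\<^sup>2 * E1 * Nu + r\<^sup>2 * E2 * Nv"
    using form_lower_bound[OF pw(1) primitive_loc_bounded[OF pw(2)] w0 sw(1,2)] unfolding N by simp
  then have le: "(- (2 * t) - E1) * (p\<^sup>2 * Nu) + (- (2 * t) - E2) * (r\<^sup>2 * Nv) \<le> 0" by (simp add: algebra_simps)
  have "Nu \<noteq> 0" using sq_integrable_zero_imp[OF U(3,5)] ne(1) unfolding Nu_def by blast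
  moreover have "Nu \<ge> 0" "Nv \<ge> 0" by (simp_all add: Nu_def Nv_def)
  ultimately have "0 < (- (2 * t) - E1) * (p\<^sup>2 * Nu)" "0 \<le> (- (2 * t) - E2) * (r\<^sup>2 * Nv)"
    using E v0 by (auto simp: p_def intro!: mult_pos_pos mult_nonneg_nonneg)
  then show False using le by linarith
qed

end

section \<open>Scaling and normalization\<close>

lemma sq_integrable_scale:
  assumes "sq_integrable f" "c > 0"
  shows "sq_integrable (\<lambda>x. f (c * x))"
  unfolding sq_integrable_def
proof
  have m: "f \<in> borel_measurable borel" and i: "integrable lborel (\<lambda>x. (f x)\<^sup>2)" using assms(1) by (auto simp: sq_integrable_def)
  show "(\<lambda>x. f (c * x)) \<in> borel_measurable borel" using m by measurable
  show "integrable lborel (\<lambda>x. (f (c * x))\<^sup>2)" using lborel_integrable_real_affine[OF i, of c 0] assms(2) by simp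
qed

lemma bound_state_scale:
  assumes bs: "bound_state W E u u1" and c: "c > 0"
  shows "bound_state (\<lambda>x. c\<^sup>2 * W (c * x)) (c\<^sup>2 * E) (\<lambda>x. u (c * x)) (\<lambda>x. c * u1 (c * x))"
proof -
  note b = bound_stateD[OF bs]
  have "primitive (\<lambda>x. c * u1 (c * x)) (\<lambda>x. c * (c * ((W (c * x) - E) * u (c * x))))"
    by (intro primitive_cmult primitive_scale b c)
  then have "primitive (\<lambda>x. c * u1 (c * x)) (\<lambda>x. (c\<^sup>2 * W (c * x) - c\<^sup>2 * E) * u (c * x))"
    by (simp add: power2_eq_square algebra_simps)
  then show ?thesis
    unfolding bound_state_def by (intro conjI primitive_scale b c sq_integrable_cmult sq_integrable_scale)
qed

lemma bound_state_unscale: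
  assumes bs: "bound_state (\<lambda>x. c\<^sup>2 * W (c * x)) \<nu> u u1" and c: "c > 0"
  shows "bound_state W (\<nu> / c\<^sup>2) (\<lambda>x. u (x / c)) (\<lambda>x. u1 (x / c) / c)"
  using bound_state_scale[OF bs, of "1 / c"] c by (simp add: power_divide)

lemma L2_norm_scale:
  fixes f :: "real \<Rightarrow> real"
  assumes "c > 0"
  shows "L2_norm (\<lambda>x. sqrt c * f (c * x)) = L2_norm f"
proof -
  have "(LINT x|lborel. (f x)\<^sup>2) = c * (LINT x|lborel. (f (c * x))\<^sup>2)"
    using lborel_integral_real_affine[of c "\<lambda>x. (f x)\<^sup>2" 0] assms by simp
  also have "\<dots> = (LINT x|lborel. (sqrt c * f (c * x))\<^sup>2)"
    using assms by (simp add: power_mult_distrib)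
  finally show ?thesis by (simp add: L2_norm_def)
qed

lemma L2_norm_decay:
  fixes f :: "real \<Rightarrow> real"
  assumes "f \<in> borel_measurable borel" "\<And>z. \<bar>f z\<bar> \<le> C * exp (- (\<bar>z\<bar> / 2))"
  shows "L2_norm f \<le> 2 * C"
proof -
  have C: "C \<ge> 0" using assms(2)[of 0] by simp
  have "(LINT z|lborel. (norm (f z))\<^sup>2) \<le> (2 * C)\<^sup>2"
  proof -
    have "(LINT z|lborel. (norm (f z))\<^sup>2) \<le> 2 * C\<^sup>2" using sq_integrable_exp_decay(2)[OF assms] by simp
    moreover have "0 \<le> C\<^sup>2" by simp
    moreover have "(2 * C)\<^sup>2 = 4 * C\<^sup>2" by (simp add: power_mult_distrib)
    ultimately show ?thesis by linarith
  qed
  then have "sqrt (LINT z|lborel. (norm (f z))\<^sup>2) \<le> sqrt ((2 * C)\<^sup>2)" by (rule real_sqrt_le_mono)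
  also have "\<dots> = 2 * C" using C by (intro real_sqrt_unique) auto
  finally show ?thesis unfolding L2_norm_def .
qed

lemma exp_abs_sq: "(exp (- \<bar>z\<bar>))\<^sup>2 = exp (- (2 * \<bar>z\<bar>))" for z :: real
  by (simp add: power2_eq_square exp_add[symmetric])

lemma L2_norm_exp_abs: "L2_norm (\<lambda>z::real. exp (- \<bar>z\<bar>)) = 1"
  using integral_exp_abs(2)[of 2 0] by (simp add: L2_norm_def exp_abs_sq)

lemma diff_sq_integral:
  fixes f g :: "real \<Rightarrow> real"
  assumes m: "f \<in> borel_measurable borel" "g \<in> borel_measurable borel"
    and b: "\<And>z. \<bar>f z\<bar> \<le> M * exp (- (\<bar>z\<bar> / 2))" "\<And>z. \<bar>g z\<bar> \<le> M * exp (- (\<bar>z\<bar> / 2))"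
      "\<And>z. \<bar>f z - g z\<bar> \<le> s * exp (- (\<bar>z\<bar> / 2))"
  shows "\<bar>(L2_norm f)\<^sup>2 - (L2_norm g)\<^sup>2\<bar> \<le> 4 * M * s"
proof -
  have i: "integrable lborel (\<lambda>z. (f z)\<^sup>2)" "integrable lborel (\<lambda>z. (g z)\<^sup>2)"
    using sq_integrable_exp_decay(1)[OF m(1) b(1)] sq_integrable_exp_decay(1)[OF m(2) b(2)] by (auto simp: sq_integrable_def)
  have ie: "integrable lborel (\<lambda>z::real. 2 * M * s * exp (- (1 * \<bar>z - 0\<bar>)))" by (intro integrable_mult_right integral_exp_abs(1)) simp
  have p: "\<bar>(f z)\<^sup>2 - (g z)\<^sup>2\<bar> \<le> 2 * M * s * exp (- (1 * \<bar>z - 0\<bar>))" for z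
  proof -
    have "\<bar>f z + g z\<bar> \<le> 2 * M * exp (- (\<bar>z\<bar> / 2))" using abs_add_le[OF b(1)[of z] b(2)[of z]] by simp
    from abs_mult_le[OF b(3)[of z] this] have "\<bar>(f z - g z) * (f z + g z)\<bar> \<le> 2 * M * s * (exp (- (\<bar>z\<bar> / 2)) * exp (- (\<bar>z\<bar> / 2)))"
      by (simp add: mult_ac)
    moreover have "(f z - g z) * (f z + g z) = (f z)\<^sup>2 - (g z)\<^sup>2" by (simp add: power2_eq_square algebra_simps)
    moreover have "exp (- (\<bar>z\<bar> / 2)) * exp (- (\<bar>z\<bar> / 2)) = exp (- (1 * \<bar>z - 0\<bar>))" by (simp flip: exp_add)
    ultimately show ?thesis by simp
  qed
  have "\<bar>(LINT z|lborel. (f z)\<^sup>2) - (LINT z|lborel. (g z)\<^sup>2)\<bar> = \<bar>LINT z|lborel. (f z)\<^sup>2 - (g z)\<^sup>2\<bar>" using i by simp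
  also have "\<dots> \<le> (LINT z|lborel. \<bar>(f z)\<^sup>2 - (g z)\<^sup>2\<bar>)" by (rule integral_abs_bound)
  also have "\<dots> \<le> (LINT z|lborel. 2 * M * s * exp (- (1 * \<bar>z - 0\<bar>)))"
    by (rule integral_mono) (use i ie p in auto)
  also have "\<dots> = 4 * M * s" using integral_exp_abs(2)[of 1 0] by simp
  finally show ?thesis by (simp add: L2_norm_def)
qed

lemma near_exp_abs:
  fixes f :: "real \<Rightarrow> real"
  assumes m: "f \<in> borel_measurable borel" and f: "\<And>z. \<bar>f z - exp (- \<bar>z\<bar>)\<bar> \<le> 1/100 * exp (- (\<bar>z\<bar> / 2))"
  shows "\<bar>f z\<bar> \<le> 2 * exp (- (\<bar>z\<bar> / 2))" "1/2 \<le> L2_norm f"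
proof -
  have e: "exp (- \<bar>z\<bar>) \<le> exp (- (\<bar>z\<bar> / 2))" for z :: real by simp
  have b: "\<bar>f z\<bar> \<le> 2 * exp (- (\<bar>z\<bar> / 2))" for z
  proof -
    have p: "0 < exp (- \<bar>z\<bar>)" by simp
    show ?thesis using f[of z] e[of z] p by linarith
  qed
  then show "\<bar>f z\<bar> \<le> 2 * exp (- (\<bar>z\<bar> / 2))" .
  have b2: "\<bar>exp (- \<bar>z\<bar>)\<bar> \<le> 2 * exp (- (\<bar>z\<bar> / 2))" for z :: real
    using e[of z] exp_gt_zero[of "- \<bar>z\<bar>"] by linarith
  have "\<bar>(L2_norm f)\<^sup>2 - (L2_norm (\<lambda>z::real. exp (- \<bar>z\<bar>)))\<^sup>2\<bar> \<le> 4 * 2 * (1/100)"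
    by (rule diff_sq_integral[OF m _ b b2 f]) measurable
  then have "\<bar>(L2_norm f)\<^sup>2 - 1\<bar> \<le> 8/100" unfolding L2_norm_exp_abs by simp
  then have "1/4 \<le> (L2_norm f)\<^sup>2" by linarith
  then have "(1/2)\<^sup>2 \<le> (L2_norm f)\<^sup>2" by (simp add: power2_eq_square)
  then show "1/2 \<le> L2_norm f" by (rule power2_le_imp_le) (simp add: L2_norm_def)
qed

text \<open>Pointwise bounds with the weight \<open>exp (- \<bar>z\<bar>/2)\<close> control the difference of the functions and that of
their norms alike.\<close>

lemma normalized_difference:
  fixes f g :: "real \<Rightarrow> real"
  assumes m: "f \<in> borel_measurable borel" "g \<in> borel_measurable borel"
    and f: "\<And>z. \<bar>f z - exp (- \<bar>z\<bar>)\<bar> \<le> 1/100 * exp (- (\<bar>z\<bar> / 2))"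
    and g: "\<And>z. \<bar>g z - exp (- \<bar>z\<bar>)\<bar> \<le> 1/100 * exp (- (\<bar>z\<bar> / 2))"
    and fg: "\<And>z. \<bar>f z - g z\<bar> \<le> s * exp (- (\<bar>z\<bar> / 2))"
  shows "L2_norm (\<lambda>z. f z / L2_norm f - g z / L2_norm g) \<le> 200 * s"
proof -
  define F G where "F = L2_norm f" and "G = L2_norm g"
  note nf = near_exp_abs[OF m(1) f] and ng = near_exp_abs[OF m(2) g]
  have s0: "s \<ge> 0" using fg[of 0] by simp
  have FG: "1/2 \<le> F" "1/2 \<le> G" using nf(2) ng(2) by (auto simp: F_def G_def)
  have "\<bar>F\<^sup>2 - G\<^sup>2\<bar> \<le> 4 * 2 * s" unfolding F_def G_def by (rule diff_sq_integral[OF m nf(1) ng(1) fg])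
  then have "\<bar>F - G\<bar> * (F + G) \<le> 8 * s" using FG by (simp add: power2_eq_square square_diff_square_factored abs_mult mult.commute)
  moreover have "\<bar>F - G\<bar> * 1 \<le> \<bar>F - G\<bar> * (F + G)" using FG by (intro mult_left_mono) auto
  ultimately have d: "\<bar>F - G\<bar> \<le> 8 * s" by simp
  have inv: "1 / F \<le> 2" "1 / G \<le> 2" using FG by (auto simp: field_simps)
  have "\<bar>1 / F - 1 / G\<bar> = \<bar>F - G\<bar> * (1 / F * (1 / G))"
  proof -
    have "1 / F - 1 / G = (G - F) * (1 / F * (1 / G))" using FG by (simp add: field_simps)
    then show ?thesis using FG by (simp add: abs_mult abs_minus_commute)
  qed
  also have "\<dots> \<le> 8 * s * (2 * 2)" using d inv FG by (intro mult_mono) auto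
  finally have i: "\<bar>1 / F - 1 / G\<bar> \<le> 32 * s" by simp
  have "L2_norm (\<lambda>z. f z / F - g z / G) \<le> 2 * (100 * s)"
  proof (rule L2_norm_decay)
    show "(\<lambda>z. f z / F - g z / G) \<in> borel_measurable borel" using m by measurable
    fix z :: real
    let ?e = "exp (- (\<bar>z\<bar> / 2))"
    have "\<bar>1 / F\<bar> \<le> 2" using inv FG by simp
    from abs_add_le[OF abs_mult_le[OF this fg] abs_mult_le[OF i ng(1)]]
    have A: "\<bar>1 / F * (f z - g z) + (1 / F - 1 / G) * g z\<bar> \<le> 2 * (s * ?e) + 32 * s * (2 * ?e)" .
    have eq: "1 / F * (f z - g z) + (1 / F - 1 / G) * g z = f z / F - g z / G"
      by (simp only: left_diff_distrib right_diff_distrib times_divide_eq_left mult_1_left)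
    have "2 * (s * ?e) + 32 * s * (2 * ?e) \<le> 100 * s * ?e"
    proof -
      have "0 \<le> s * ?e" using s0 by (rule mult_nonneg_nonneg) simp
      moreover have "32 * s * (2 * ?e) = 64 * (s * ?e)" "100 * s * ?e = 100 * (s * ?e)" by simp_all
      ultimately show ?thesis by linarith
    qed
    then show "\<bar>f z / F - g z / G\<bar> \<le> 100 * s * ?e" using A unfolding eq by (rule order_trans[rotated])
  qed
  then show ?thesis by (simp add: F_def G_def)
qed

context factorized_well
begin

context
  fixes \<kappa> :: real and V :: "real \<Rightarrow> real"
  assumes \<kappa>: "\<kappa> > 0" and V: "AE x in lborel. V x = \<kappa>\<^sup>2 * W (\<kappa> * x)"
begin

lemma scaled_measurable: "(\<lambda>x. \<kappa>\<^sup>2 * W (\<kappa> * x)) \<in> borel_measurable borel"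
  using W_measurable by measurable

lemma scaled_bounded: "\<bar>\<kappa>\<^sup>2 * W (\<kappa> * x)\<bar> \<le> \<kappa>\<^sup>2 * B"
  using bounds(1)[of "\<kappa> * x"] by (simp add: abs_mult mult_left_mono)

lemma scaled_vanishing_at_0:
  assumes u: "bound_state (\<lambda>x. \<kappa>\<^sup>2 * W (\<kappa> * x)) \<nu> u u1" and \<nu>: "\<nu> < - (2 * t) * \<kappa>\<^sup>2" and 0: "u 0 = 0"
  shows "u x = 0"
proof -
  have "\<nu> / \<kappa>\<^sup>2 < - (2 * t)" using \<nu> \<kappa> by (simp add: divide_less_eq)
  then have "u (\<kappa> * x / \<kappa>) = 0" by (rule bound_state_vanishing_at_0[OF bound_state_unscale[OF u \<kappa>]]) (simp add: 0)
  then show ?thesis using \<kappa> by simp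
qed

text \<open>The profile already provides one bound state below the threshold, and there is at most one energy.\<close>

lemma eigenvalue_unique_below:
  assumes x: "x \<in> state_ball" "profile_map \<beta> a d x = x" and ev: "eigenvalue V \<nu>" and \<nu>: "\<nu> < - (2 * t) * \<kappa>\<^sup>2"
  shows "\<nu> = - (\<kappa>\<^sup>2 * (1 + shift x))"
proof -
  obtain f where f: "eigenfunction V \<nu> f" using ev by (auto simp: eigenvalue_def)
  obtain u u1 w w1 where u: "bound_state (\<lambda>x. \<kappa>\<^sup>2 * W (\<kappa> * x)) \<nu> u u1" and w: "bound_state (\<lambda>x. \<kappa>\<^sup>2 * W (\<kappa> * x)) \<nu> w w1"
    and fuw: "AE x in lborel. f x = Complex (u x) (w x)"
    using eigenfunction_imp_bound_states[OF f scaled_measurable scaled_bounded V] by blast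
  have "(\<exists>x. u x \<noteq> 0) \<or> (\<exists>x. w x \<noteq> 0)"
  proof (rule ccontr)
    assume "\<not> ?thesis"
    then have z: "u x = 0" "w x = 0" for x by auto
    have "AE x in lborel. f x = 0" using fuw by eventually_elim (simp add: z complex_eq_iff)
    then show False using f by (simp add: eigenfunction_def)
  qed
  then obtain p p1 y where p: "bound_state (\<lambda>x. \<kappa>\<^sup>2 * W (\<kappa> * x)) \<nu> p p1" and y: "p y \<noteq> 0" using u w by blast
  have pz: "\<exists>z. p (z / \<kappa>) \<noteq> 0" using y \<kappa> by (intro exI[of _ "\<kappa> * y"]) simp
  obtain \<psi> \<psi>1 where b: "bound_state W (- (1 + shift x)) \<psi> \<psi>1" and ne: "\<exists>z. \<psi> z \<noteq> 0" using bound_state_of_fixed_point[OF x] by blast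
  have o: "- (1 + shift x) < - (2 * t)" using x(1) P(2) by (auto simp: state_ball_def)
  have "\<nu> / \<kappa>\<^sup>2 < - (2 * t)" using \<nu> \<kappa> by (simp add: divide_less_eq)
  from bound_states_unique_energy[OF bound_state_unscale[OF p \<kappa>] b this o pz ne] show ?thesis using \<kappa> by (simp add: field_simps)
qed

text \<open>The multiple is chosen to make the difference vanish at the origin.\<close>

lemma eigenfunctions_proportional:
  assumes f: "eigenfunction V \<nu> f" and g: "eigenfunction V \<nu> g" and \<nu>: "\<nu> < - (2 * t) * \<kappa>\<^sup>2"
  shows "\<exists>c. AE x in lborel. g x = c * f x"
proof -
  let ?W = "\<lambda>x. \<kappa>\<^sup>2 * W (\<kappa> * x)"
  obtain u u1 w w1 where u: "bound_state ?W \<nu> u u1" and w: "bound_state ?W \<nu> w w1"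
    and fuw: "AE x in lborel. f x = Complex (u x) (w x)"
    using eigenfunction_imp_bound_states[OF f scaled_measurable scaled_bounded V] by blast
  obtain p p1 r r1 where p: "bound_state ?W \<nu> p p1" and r: "bound_state ?W \<nu> r r1"
    and gpr: "AE x in lborel. g x = Complex (p x) (r x)"
    using eigenfunction_imp_bound_states[OF g scaled_measurable scaled_bounded V] by blast
  have "Complex (u 0) (w 0) \<noteq> 0"
  proof
    assume "Complex (u 0) (w 0) = 0"
    then have z: "u x = 0" "w x = 0" for x using scaled_vanishing_at_0[OF u \<nu>] scaled_vanishing_at_0[OF w \<nu>] by (auto simp: complex_eq_iff)
    have "AE x in lborel. f x = 0" using fuw by eventually_elim (simp add: z complex_eq_iff)
    then show False using f by (simp add: eigenfunction_def)
  qed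
  define c where "c = Complex (p 0) (r 0) / Complex (u 0) (w 0)"
  have c0: "Complex (p 0) (r 0) = c * Complex (u 0) (w 0)" using \<open>Complex (u 0) (w 0) \<noteq> 0\<close> by (simp add: c_def)
  have cR: "p 0 = Re c * u 0 - Im c * w 0" and cI: "r 0 = Re c * w 0 + Im c * u 0" using c0 by (auto simp: complex_eq_iff)
  have 1: "1 * p x + (- 1) * (Re c * u x + (- Im c) * w x) = 0" for x
    by (rule scaled_vanishing_at_0[OF bound_state_lincomb[OF p bound_state_lincomb[OF u w]] \<nu>]) (simp add: cR)
  have 2: "1 * r x + (- 1) * (Re c * w x + Im c * u x) = 0" for x
    by (rule scaled_vanishing_at_0[OF bound_state_lincomb[OF r bound_state_lincomb[OF w u]] \<nu>]) (simp add: cI)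
  have "AE x in lborel. g x = c * f x"
    using fuw gpr
  proof eventually_elim
    case (elim x)
    then show ?case using 1[of x] 2[of x] by (simp add: complex_eq_iff)
  qed
  then show ?thesis by blast
qed

lemma fixed_point_eigenfunction:
  assumes x: "x \<in> state_ball" "profile_map \<beta> a d x = x" and c: "c \<noteq> 0"
  shows "eigenfunction V (- (\<kappa>\<^sup>2 * (1 + shift x))) (\<lambda>y. complex_of_real (c * (exp (\<beta> (\<kappa> * y)) * (exp (- (\<bar>\<kappa> * y\<bar> / 2)) * profile x (\<kappa> * y)))))"
proof -
  define \<psi> where "\<psi> = (\<lambda>z. exp (\<beta> z) * (exp (- (\<bar>z\<bar> / 2)) * profile x z))"
  obtain \<psi>1 where b: "bound_state W (- (1 + shift x)) \<psi> \<psi>1" and ne: "\<exists>z. \<psi> z \<noteq> 0"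
    using bound_state_of_fixed_point[OF x] unfolding \<psi>_def by blast
  have s: "bound_state (\<lambda>x. \<kappa>\<^sup>2 * W (\<kappa> * x)) (\<kappa>\<^sup>2 * - (1 + shift x)) (\<lambda>y. \<psi> (\<kappa> * y)) (\<lambda>y. \<kappa> * \<psi>1 (\<kappa> * y))"
    by (rule bound_state_scale[OF b \<kappa>])
  from bound_state_lincomb[OF s s, of c 0]
  have s: "bound_state (\<lambda>x. \<kappa>\<^sup>2 * W (\<kappa> * x)) (\<kappa>\<^sup>2 * - (1 + shift x)) (\<lambda>y. c * \<psi> (\<kappa> * y)) (\<lambda>y. c * (\<kappa> * \<psi>1 (\<kappa> * y)))" by simp
  obtain z where z: "\<psi> z \<noteq> 0" using ne by blast
  have "\<exists>y. c * \<psi> (\<kappa> * y) \<noteq> 0" using z c \<kappa> by (intro exI[of _ "z / \<kappa>"]) simp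
  from bound_state_eigenfunction[OF s this scaled_measurable scaled_bounded V] 
  have "eigenfunction V (\<kappa>\<^sup>2 * - (1 + shift x)) (\<lambda>y. complex_of_real (c * \<psi> (\<kappa> * y)))" .
  moreover have "\<kappa>\<^sup>2 * - (1 + shift x) = - (\<kappa>\<^sup>2 * (1 + shift x))" by (rule mult_minus_right)
  ultimately show ?thesis by (simp only: \<psi>_def)
qed

end

lemma fixed_point_profile:
  assumes x: "x \<in> state_ball" "profile_map \<beta> a d x = x"
  defines "\<psi> \<equiv> \<lambda>z. exp (\<beta> z) * (exp (- (\<bar>z\<bar> / 2)) * profile x z)"
  shows "\<psi> \<in> borel_measurable borel" "\<bar>\<psi> z - exp (- (\<bar>z\<bar> / 2)) * profile x z\<bar> \<le> 4 * t * exp (- (\<bar>z\<bar> / 2))"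
    "\<bar>\<psi> z - exp (- \<bar>z\<bar>)\<bar> \<le> 1/100 * exp (- (\<bar>z\<bar> / 2))"
proof -
  have m: "profile x \<in> borel_measurable borel" using loc_boundedD(1)[OF bcontfun_loc_bounded] .
  have mb: "\<beta> \<in> borel_measurable borel" using loc_boundedD(1)[OF P(7)] .
  show "\<psi> \<in> borel_measurable borel" unfolding \<psi>_def using m mb by measurable
  have d: "\<bar>profile x z - Phi0 z\<bar> \<le> 1/400" using x(1) by (simp add: state_ball_def)
  have p2: "\<bar>profile x z\<bar> \<le> 2" using d Phi0_bounds[of z] by linarith
  have e: "\<bar>exp (\<beta> z) - 1\<bar> \<le> 2 * t"
  proof -
    have "t \<le> 1/2" using P(2) by simp
    then show ?thesis using exp_minus_one_bound[of "\<beta> z"] P(4)[of z] by linarith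
  qed
  let ?e = "exp (- (\<bar>z\<bar> / 2))"
  have 1: "\<bar>(exp (\<beta> z) - 1) * profile x z * ?e\<bar> \<le> 2 * t * 2 * ?e"
    by (rule abs_mult_le[OF abs_mult_le[OF e p2]]) simp
  have s1: "\<psi> z - ?e * profile x z = (exp (\<beta> z) - 1) * profile x z * ?e" by (simp add: \<psi>_def algebra_simps)
  show A: "\<bar>\<psi> z - ?e * profile x z\<bar> \<le> 4 * t * ?e" using 1 unfolding s1 by simp
  have 2: "\<bar>?e * (profile x z - Phi0 z)\<bar> \<le> ?e * (1/400)" by (rule abs_mult_le[OF _ d]) simp
  have s2: "\<psi> z - exp (- \<bar>z\<bar>) = (\<psi> z - ?e * profile x z) + ?e * (profile x z - Phi0 z)"
  proof -
    have "?e * Phi0 z = exp (- \<bar>z\<bar>)" by (simp add: Phi0_def flip: exp_add)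
    then show ?thesis by (simp add: algebra_simps)
  qed
  have "\<bar>\<psi> z - exp (- \<bar>z\<bar>)\<bar> \<le> 4 * t * ?e + ?e * (1/400)" unfolding s2 by (rule abs_add_le[OF A 2])
  also have "\<dots> \<le> 1/100 * ?e"
  proof -
    have "t \<le> 1 / 1000000" using P(2) by simp
    then have "4 * t + 1/400 \<le> 1/100" by linarith
    then have "(4 * t + 1/400) * ?e \<le> 1/100 * ?e" by (rule mult_right_mono) simp
    moreover have "(4 * t + 1/400) * ?e = 4 * t * ?e + ?e * (1/400)" by algebra
    ultimately show ?thesis by (simp only:)
  qed
  finally show "\<bar>\<psi> z - exp (- \<bar>z\<bar>)\<bar> \<le> 1/100 * ?e" .
qed

lemma normalized_scaled_eigenfunction:
  fixes \<kappa> :: real and V :: "real \<Rightarrow> real"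
  assumes \<kappa>: "\<kappa> > 0" and V: "AE x in lborel. V x = \<kappa>\<^sup>2 * W (\<kappa> * x)"
    and x: "x \<in> state_ball" "profile_map \<beta> a d x = x"
  defines "\<psi> \<equiv> \<lambda>z. exp (\<beta> z) * (exp (- (\<bar>z\<bar> / 2)) * profile x z)"
  shows "normalized_eigenfunction V (- (\<kappa>\<^sup>2 * (1 + shift x))) (\<lambda>y. sqrt \<kappa> * (\<psi> (\<kappa> * y) / L2_norm \<psi>))"
    "simple_eigenvalue V (- (\<kappa>\<^sup>2 * (1 + shift x)))"
proof -
  have N: "1/2 \<le> L2_norm \<psi>" unfolding \<psi>_def by (rule near_exp_abs(2)[OF fixed_point_profile(1,3)[OF x]])
  define c where "c = sqrt \<kappa> / L2_norm \<psi>"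
  have c: "c \<noteq> 0" using \<kappa> N by (auto simp: c_def)
  have ef: "eigenfunction V (- (\<kappa>\<^sup>2 * (1 + shift x))) (\<lambda>y. complex_of_real (c * \<psi> (\<kappa> * y)))"
    using fixed_point_eigenfunction[OF \<kappa> V x c] unfolding \<psi>_def .
  have "c * \<psi> (\<kappa> * y) = sqrt \<kappa> * (\<psi> (\<kappa> * y) / L2_norm \<psi>)" for y by (simp add: c_def)
  then have ef: "eigenfunction V (- (\<kappa>\<^sup>2 * (1 + shift x))) (\<lambda>y. complex_of_real (sqrt \<kappa> * (\<psi> (\<kappa> * y) / L2_norm \<psi>)))"
    using ef by (simp only:)
  have "L2_norm (\<lambda>y. sqrt \<kappa> * (\<psi> (\<kappa> * y) / L2_norm \<psi>)) = L2_norm (\<lambda>z. \<psi> z / L2_norm \<psi>)"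
    by (rule L2_norm_scale[OF \<kappa>, of "\<lambda>z. \<psi> z / L2_norm \<psi>"])
  also have "\<dots> = L2_norm \<psi> / L2_norm \<psi>" by (simp add: L2_norm_def power_divide real_sqrt_divide)
  also have "\<dots> = 1" using N by simp
  finally show "normalized_eigenfunction V (- (\<kappa>\<^sup>2 * (1 + shift x))) (\<lambda>y. sqrt \<kappa> * (\<psi> (\<kappa> * y) / L2_norm \<psi>))"
    using ef unfolding normalized_eigenfunction_def by (intro conjI)
  have "2 * t - 1 < shift x" using x(1) P(2) by (auto simp: state_ball_def)
  then have "(2 * t) * \<kappa>\<^sup>2 < (1 + shift x) * \<kappa>\<^sup>2" using \<kappa> by (intro mult_strict_right_mono) auto
  then have below: "- (\<kappa>\<^sup>2 * (1 + shift x)) < - (2 * t) * \<kappa>\<^sup>2" by (simp add: algebra_simps)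
  show "simple_eigenvalue V (- (\<kappa>\<^sup>2 * (1 + shift x)))"
    unfolding simple_eigenvalue_def eigenvalue_def using ef eigenfunctions_proportional[OF \<kappa> V _ _ below] by blast
qed

text \<open>All conclusions at one fixed scale: \<open>V\<close> is the oscillating operator in the original variable and \<open>V'\<close>
the effective one.\<close>

lemma comparison_with_reduced_well:
  fixes \<kappa> :: real and V V' :: "real \<Rightarrow> real"
  assumes \<kappa>: "\<kappa> > 0" and V: "AE x in lborel. V x = \<kappa>\<^sup>2 * W (\<kappa> * x)" and V': "\<And>x. V' x = \<kappa>\<^sup>2 * v (\<kappa> * x)"
  shows "\<exists>lam \<psi> \<mu> \<phi>. lam < 0 \<and> simple_eigenvalue V lam \<and> \<bar>lam + \<kappa>\<^sup>2\<bar> \<le> 1500 * (t + \<eta>) * \<kappa>\<^sup>2 \<and>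
    normalized_eigenfunction V lam \<psi> \<and> {\<nu>. \<nu> < 0 \<and> eigenvalue V' \<nu>} = {\<mu>} \<and> simple_eigenvalue V' \<mu> \<and>
    normalized_eigenfunction V' \<mu> \<phi> \<and> L2_norm (\<lambda>x. \<psi> x - \<phi> x) \<le> 500000 * t \<and>
    L2_norm (\<lambda>x. \<phi> x - sqrt \<kappa> * exp (- (\<kappa> * \<bar>x\<bar>))) \<le> 500000 * \<eta> \<and>
    (\<forall>\<nu>. \<nu> < 0 \<and> \<nu> \<noteq> lam \<and> eigenvalue V \<nu> \<longrightarrow> \<bar>\<nu>\<bar> \<le> 2 * t * \<kappa>\<^sup>2)"
proof -
  \<comment> \<open>The effective problem is the case of vanishing perturbation data.\<close>
  interpret reduced: factorized_well v \<eta> v "\<lambda>_. 0" "\<lambda>_. 0" "\<lambda>_. 0" "\<lambda>_. 0" 0 B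
    by unfold_locales (use small_corrector_0 primitive_const[of 0] bounds order_trans[OF abs_ge_zero bounds(1)[of 0]] in auto)
  obtain x where x: "x \<in> state_ball" "profile_map \<beta> a d x = x" "dist x x0 \<le> 1500 * (t + \<eta>)" using profile_map_fixed_point[OF small_corrector] by blast
  obtain y where y: "y \<in> state_ball" "profile_map (\<lambda>_. 0) (\<lambda>_. 0) (\<lambda>_. 0) y = y" "dist y x0 \<le> 1500 * (0 + \<eta>)" using profile_map_fixed_point[OF small_corrector_0] by blast
  have xy: "dist x y \<le> 2000 * t" by (rule fixed_points_close[OF small_corrector x(1,2) y(1,2)])
  define \<psi> where "\<psi> = (\<lambda>z. exp (\<beta> z) * (exp (- (\<bar>z\<bar> / 2)) * profile x z))"
  define \<phi> where "\<phi> = (\<lambda>z::real. exp 0 * (exp (- (\<bar>z\<bar> / 2)) * profile y z))"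
  define lam where "lam = - (\<kappa>\<^sup>2 * (1 + shift x))"
  define \<mu> where "\<mu> = - (\<kappa>\<^sup>2 * (1 + shift y))"
  have AV': "AE x in lborel. V' x = \<kappa>\<^sup>2 * v (\<kappa> * x)" by (simp add: V')
  have p\<psi>: "\<psi> \<in> borel_measurable borel" "\<bar>\<psi> z - exp (- (\<bar>z\<bar> / 2)) * profile x z\<bar> \<le> 4 * t * exp (- (\<bar>z\<bar> / 2))"
    "\<bar>\<psi> z - exp (- \<bar>z\<bar>)\<bar> \<le> 1/100 * exp (- (\<bar>z\<bar> / 2))" for z
    unfolding \<psi>_def by (rule fixed_point_profile[OF x(1,2)])+
  have p\<phi>: "\<phi> \<in> borel_measurable borel" "\<bar>\<phi> z - exp (- \<bar>z\<bar>)\<bar> \<le> 1/100 * exp (- (\<bar>z\<bar> / 2))" for z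
    unfolding \<phi>_def by (rule reduced.fixed_point_profile[OF y(1,2)])+
  have nx: "normalized_eigenfunction V lam (\<lambda>y. sqrt \<kappa> * (\<psi> (\<kappa> * y) / L2_norm \<psi>))" "simple_eigenvalue V lam"
    unfolding \<psi>_def lam_def by (rule normalized_scaled_eigenfunction[OF \<kappa> V x(1,2)])+
  have ny: "normalized_eigenfunction V' \<mu> (\<lambda>y. sqrt \<kappa> * (\<phi> (\<kappa> * y) / L2_norm \<phi>))" "simple_eigenvalue V' \<mu>"
    unfolding \<phi>_def \<mu>_def by (rule reduced.normalized_scaled_eigenfunction[OF \<kappa> AV' y(1,2)])+
  have neg: "- (\<kappa>\<^sup>2 * (1 + shift w)) < 0" if "w \<in> state_ball" for w
    using that \<kappa> by (auto simp: state_ball_def intro!: mult_pos_pos)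
  have "\<bar>shift x\<bar> \<le> 1500 * (t + \<eta>)" using dist_state_ge(3)[of x x0] x(3) by (simp add: x0_def)
  then have "\<bar>shift x\<bar> * \<kappa>\<^sup>2 \<le> 1500 * (t + \<eta>) * \<kappa>\<^sup>2" by (rule mult_right_mono) simp
  moreover have "lam + \<kappa>\<^sup>2 = - (shift x * \<kappa>\<^sup>2)" by (simp add: lam_def algebra_simps)
  ultimately have l: "\<bar>lam + \<kappa>\<^sup>2\<bar> \<le> 1500 * (t + \<eta>) * \<kappa>\<^sup>2" by (simp add: abs_mult)
  have set: "{\<nu>. \<nu> < 0 \<and> eigenvalue V' \<nu>} = {\<mu>}"
  proof (intro equalityI subsetI)
    fix \<nu> assume "\<nu> \<in> {\<nu>. \<nu> < 0 \<and> eigenvalue V' \<nu>}"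
    then show "\<nu> \<in> {\<mu>}" using reduced.eigenvalue_unique_below[OF \<kappa> AV' y(1,2), of \<nu>] by (simp add: \<mu>_def)
  next
    fix \<nu> assume "\<nu> \<in> {\<mu>}"
    then show "\<nu> \<in> {\<nu>. \<nu> < 0 \<and> eigenvalue V' \<nu>}" using neg[OF y(1)] ny(2) by (simp add: \<mu>_def simple_eigenvalue_def)
  qed
  have d1: "\<bar>\<psi> z - \<phi> z\<bar> \<le> (2004 * t) * exp (- (\<bar>z\<bar> / 2))" for z
  proof -
    let ?e = "exp (- (\<bar>z\<bar> / 2))"
    have "\<bar>profile x z - profile y z\<bar> \<le> 2000 * t" using dist_state_ge(1)[of x z y] xy by linarith
    then have "\<bar>?e * (profile x z - profile y z)\<bar> \<le> ?e * (2000 * t)" by (intro abs_mult_le) auto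
    from abs_add_le[OF p\<psi>(2)[of z] this]
    have "\<bar>(\<psi> z - ?e * profile x z) + ?e * (profile x z - profile y z)\<bar> \<le> 4 * t * ?e + ?e * (2000 * t)" .
    moreover have "(\<psi> z - ?e * profile x z) + ?e * (profile x z - profile y z) = \<psi> z - \<phi> z"
      unfolding \<phi>_def exp_zero by algebra
    moreover have "4 * t * ?e + ?e * (2000 * t) = (2004 * t) * ?e" by algebra
    ultimately show ?thesis by (simp only:)
  qed
  have d2: "\<bar>\<phi> z - exp (- \<bar>z\<bar>)\<bar> \<le> (1500 * \<eta>) * exp (- (\<bar>z\<bar> / 2))" for z
  proof -
    let ?e = "exp (- (\<bar>z\<bar> / 2))"
    have "\<bar>profile y z - Phi0 z\<bar> \<le> 1500 * \<eta>" using dist_state_ge(1)[of y z x0] y(3) by (simp add: x0_def Phi0_apply)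
    then have "\<bar>?e * (profile y z - Phi0 z)\<bar> \<le> ?e * (1500 * \<eta>)" by (intro abs_mult_le) auto
    moreover have "?e * Phi0 z = exp (- \<bar>z\<bar>)" by (simp add: Phi0_def flip: exp_add)
    then have "?e * (profile y z - Phi0 z) = \<phi> z - exp (- \<bar>z\<bar>)" unfolding \<phi>_def exp_zero by (simp only: right_diff_distrib mult_1_left)
    moreover have "?e * (1500 * \<eta>) = 1500 * \<eta> * ?e" by algebra
    ultimately show ?thesis by (simp only:)
  qed
  have e0: "(\<lambda>z::real. exp (- \<bar>z\<bar>)) \<in> borel_measurable borel" by measurable
  have n1: "L2_norm (\<lambda>z. \<psi> z / L2_norm \<psi> - \<phi> z / L2_norm \<phi>) \<le> 200 * (2004 * t)"
    by (rule normalized_difference[OF p\<psi>(1) p\<phi>(1) p\<psi>(3) p\<phi>(2) d1])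
  have n2: "L2_norm (\<lambda>z. \<phi> z / L2_norm \<phi> - exp (- \<bar>z\<bar>) / L2_norm (\<lambda>z::real. exp (- \<bar>z\<bar>))) \<le> 200 * (1500 * \<eta>)"
    by (rule normalized_difference[OF p\<phi>(1) e0 p\<phi>(2) _ d2]) simp
  have r1: "L2_norm (\<lambda>x. sqrt \<kappa> * (\<psi> (\<kappa> * x) / L2_norm \<psi>) - sqrt \<kappa> * (\<phi> (\<kappa> * x) / L2_norm \<phi>)) \<le> 500000 * t"
    using n1 P(1) L2_norm_scale[OF \<kappa>, of "\<lambda>z. \<psi> z / L2_norm \<psi> - \<phi> z / L2_norm \<phi>"] by (simp add: right_diff_distrib)
  have ek: "exp (- \<bar>\<kappa> * x\<bar>) = exp (- (\<kappa> * \<bar>x\<bar>))" for x using \<kappa> by (simp add: abs_mult)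
  have r2: "L2_norm (\<lambda>x. sqrt \<kappa> * (\<phi> (\<kappa> * x) / L2_norm \<phi>) - sqrt \<kappa> * exp (- (\<kappa> * \<bar>x\<bar>))) \<le> 500000 * \<eta>"
    using n2 \<eta>_nonneg L2_norm_scale[OF \<kappa>, of "\<lambda>z. \<phi> z / L2_norm \<phi> - exp (- \<bar>z\<bar>)"] unfolding L2_norm_exp_abs ek
    by (simp add: right_diff_distrib)
  have o: "\<bar>\<nu>\<bar> \<le> 2 * t * \<kappa>\<^sup>2" if "\<nu> < 0" "\<nu> \<noteq> lam" "eigenvalue V \<nu>" for \<nu>
  proof (rule ccontr)
    assume "\<not> \<bar>\<nu>\<bar> \<le> 2 * t * \<kappa>\<^sup>2"
    then have "\<nu> < - (2 * t) * \<kappa>\<^sup>2" using that(1) by simp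
    from eigenvalue_unique_below[OF \<kappa> V x(1,2) that(3) this] show False using that(2) by (simp add: lam_def)
  qed
  have o': "\<forall>\<nu>. \<nu> < 0 \<and> \<nu> \<noteq> lam \<and> eigenvalue V \<nu> \<longrightarrow> \<bar>\<nu>\<bar> \<le> 2 * t * \<kappa>\<^sup>2"
    by (intro allI impI, elim conjE, rule o)
  show ?thesis
    by (rule exI[of _ lam], rule exI[of _ "\<lambda>y. sqrt \<kappa> * (\<psi> (\<kappa> * y) / L2_norm \<psi>)"],
        rule exI[of _ \<mu>], rule exI[of _ "\<lambda>y. sqrt \<kappa> * (\<phi> (\<kappa> * y) / L2_norm \<phi>)"],
        intro conjI neg[OF x(1), folded lam_def] nx(2) l nx(1) set ny(2) ny(1) r1 r2 o')
qed

end

section \<open>The scales of the problem\<close>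

lemma weighted_integrableD:
  fixes f :: "real \<Rightarrow> real"
  assumes "integrable lborel (\<lambda>X. (1 + \<bar>X\<bar>) * f X)"
  shows "f \<in> borel_measurable borel" "integrable lborel f" "integrable lborel (\<lambda>X. \<bar>X\<bar> * \<bar>f X\<bar>)"
    "(LINT X|lborel. \<bar>f X\<bar>) \<le> (LINT X|lborel. \<bar>(1 + \<bar>X\<bar>) * f X\<bar>)"
    "(LINT X|lborel. \<bar>X\<bar> * \<bar>f X\<bar>) \<le> (LINT X|lborel. \<bar>(1 + \<bar>X\<bar>) * f X\<bar>)"
proof -
  have "(\<lambda>X. (1 + \<bar>X\<bar>) * f X / (1 + \<bar>X\<bar>)) \<in> borel_measurable borel"
    using borel_measurable_integrable[OF assms] by measurable
  moreover have "(1 + \<bar>X\<bar>) * f X / (1 + \<bar>X\<bar>) = f X" for X :: real by (simp add: add_nonneg_eq_0_iff)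
  ultimately show m: "f \<in> borel_measurable borel" by simp
  have le: "\<bar>f X\<bar> \<le> \<bar>(1 + \<bar>X\<bar>) * f X\<bar>" "\<bar>X\<bar> * \<bar>f X\<bar> \<le> \<bar>(1 + \<bar>X\<bar>) * f X\<bar>" for X
  proof -
    have "\<bar>(1 + \<bar>X\<bar>) * f X\<bar> = \<bar>1 + \<bar>X\<bar>\<bar> * \<bar>f X\<bar>" by (rule abs_mult)
    also have "\<dots> = \<bar>f X\<bar> + \<bar>X\<bar> * \<bar>f X\<bar>" by (simp add: distrib_right)
    finally have "\<bar>(1 + \<bar>X\<bar>) * f X\<bar> = \<bar>f X\<bar> + \<bar>X\<bar> * \<bar>f X\<bar>" .
    moreover have "0 \<le> \<bar>X\<bar> * \<bar>f X\<bar>" "0 \<le> \<bar>f X\<bar>" by simp_all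
    ultimately show "\<bar>f X\<bar> \<le> \<bar>(1 + \<bar>X\<bar>) * f X\<bar>" "\<bar>X\<bar> * \<bar>f X\<bar> \<le> \<bar>(1 + \<bar>X\<bar>) * f X\<bar>" by linarith+
  qed
  show i: "integrable lborel f"
    by (rule Bochner_Integration.integrable_bound[OF assms]) (use m le(1) in \<open>auto intro!: AE_I2\<close>)
  show i2: "integrable lborel (\<lambda>X. \<bar>X\<bar> * \<bar>f X\<bar>)"
    by (rule Bochner_Integration.integrable_bound[OF assms]) (use m le(2) in \<open>auto intro!: AE_I2\<close>)
  show "(LINT X|lborel. \<bar>f X\<bar>) \<le> (LINT X|lborel. \<bar>(1 + \<bar>X\<bar>) * f X\<bar>)"
    using i assms le(1) by (intro integral_mono integrable_abs) auto
  show "(LINT X|lborel. \<bar>X\<bar> * \<bar>f X\<bar>) \<le> (LINT X|lborel. \<bar>(1 + \<bar>X\<bar>) * f X\<bar>)"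
    using i2 assms le(2) by (intro integral_mono integrable_abs) auto
qed

lemma contracted_integral:
  fixes f :: "real \<Rightarrow> real"
  assumes f: "integrable lborel f" and c: "c > 0"
  shows "integrable lborel (\<lambda>z. c * f (c * z))" "(LINT z|lborel. c * f (c * z)) = (LINT X|lborel. f X)"
proof -
  show "integrable lborel (\<lambda>z. c * f (c * z))"
    using lborel_integrable_real_affine[OF f, of c 0] c by simp
  show "(LINT z|lborel. c * f (c * z)) = (LINT X|lborel. f X)"
    using lborel_integral_real_affine[of c f 0] c by simp
qed

text \<open>Concentration by the factor \<open>c\<close> keeps the mass and divides the first moment by \<open>c\<close>; the lower order term
\<open>\<tau> g\<close> changes the mass by \<open>O(\<tau>)\<close>.\<close>

lemma concentrated_delta_well:
  fixes f g :: "real \<Rightarrow> real" and k0 \<tau> c :: real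
  assumes fg: "integrable lborel (\<lambda>X. (1 + \<bar>X\<bar>) * f X)" "integrable lborel (\<lambda>X. (1 + \<bar>X\<bar>) * g X)"
    and bdd: "\<And>X. \<bar>f X\<bar> \<le> B" "\<And>X. \<bar>g X\<bar> \<le> B" and neg: "\<And>X. f X \<le> 0"
    and k0: "k0 > 0" "(LINT X|lborel. f X) = - (2 * k0)" and \<tau>: "0 < \<tau>" "\<tau> \<le> 1" and c: "c > 0"
  defines "M \<equiv> (LINT X|lborel. \<bar>(1 + \<bar>X\<bar>) * f X\<bar>) + (LINT X|lborel. \<bar>(1 + \<bar>X\<bar>) * g X\<bar>)"
  assumes small: "M / k0 * \<tau> + M / (k0 * c) \<le> \<eta>" "\<eta> \<le> 1 / 10 ^ 6"
  shows "delta_well (\<lambda>z. c / k0 * (f (c * z) + \<tau> * g (c * z))) \<eta>"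
proof -
  note F = weighted_integrableD[OF fg(1)] and G = weighted_integrableD[OF fg(2)]
  define h where "h X = f X + \<tau> * g X" for X
  define v where "v = (\<lambda>z. c / k0 * (f (c * z) + \<tau> * g (c * z)))"
  have v: "v = (\<lambda>z. 1 / k0 * (c * h (c * z)))" by (simp add: v_def h_def fun_eq_iff)
  have hi: "integrable lborel h" unfolding h_def using F(2) G(2) by simp
  have Mn: "0 \<le> M" by (simp add: M_def)
  have hb: "\<bar>h X\<bar> \<le> \<bar>f X\<bar> + \<bar>g X\<bar> \<and> \<bar>h X\<bar> \<le> \<bar>f X\<bar> + \<tau> * \<bar>g X\<bar>" for X
  proof -
    have "\<bar>h X\<bar> \<le> \<bar>f X\<bar> + \<bar>\<tau> * g X\<bar>" unfolding h_def by (rule abs_triangle_ineq)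
    moreover have "\<bar>\<tau> * g X\<bar> = \<tau> * \<bar>g X\<bar>" using \<tau> by (simp add: abs_mult)
    moreover have "\<tau> * \<bar>g X\<bar> \<le> 1 * \<bar>g X\<bar>" using \<tau> by (intro mult_right_mono) auto
    ultimately show ?thesis by simp
  qed
  have hm: "h \<in> borel_measurable borel" using borel_measurable_integrable[OF hi] by simp
  have hmom: "integrable lborel (\<lambda>X. \<bar>X\<bar> * \<bar>h X\<bar>)"
  proof (rule Bochner_Integration.integrable_bound[OF Bochner_Integration.integrable_add[OF F(3) G(3)]])
    show "(\<lambda>X. \<bar>X\<bar> * \<bar>h X\<bar>) \<in> borel_measurable lborel" using hm by simp
    have "\<bar>X\<bar> * \<bar>h X\<bar> \<le> \<bar>X\<bar> * \<bar>f X\<bar> + \<bar>X\<bar> * \<bar>g X\<bar>" for X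
      using mult_left_mono[OF conjunct1[OF hb[of X]], of "\<bar>X\<bar>"] by (simp add: distrib_left)
    then show "AE X in lborel. norm (\<bar>X\<bar> * \<bar>h X\<bar>) \<le> norm (\<bar>X\<bar> * \<bar>f X\<bar> + \<bar>X\<bar> * \<bar>g X\<bar>)" by (intro AE_I2) simp
  qed
  have hmomle: "(LINT X|lborel. \<bar>X\<bar> * \<bar>h X\<bar>) \<le> M"
  proof -
    have "(LINT X|lborel. \<bar>X\<bar> * \<bar>h X\<bar>) \<le> (LINT X|lborel. \<bar>X\<bar> * \<bar>f X\<bar> + \<bar>X\<bar> * \<bar>g X\<bar>)"
    proof (rule integral_mono[OF hmom Bochner_Integration.integrable_add[OF F(3) G(3)]])
      show "\<bar>X\<bar> * \<bar>h X\<bar> \<le> \<bar>X\<bar> * \<bar>f X\<bar> + \<bar>X\<bar> * \<bar>g X\<bar>" for X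
        using mult_left_mono[OF conjunct1[OF hb[of X]], of "\<bar>X\<bar>"] by (simp add: distrib_left)
    qed
    also have "\<dots> \<le> M" using F(3,5) G(3,5) by (simp add: M_def)
    finally show ?thesis .
  qed
  have gint: "\<bar>LINT X|lborel. g X\<bar> \<le> M" "(LINT X|lborel. \<bar>g X\<bar>) \<le> M"
  proof -
    have "0 \<le> (LINT X|lborel. \<bar>(1 + \<bar>X\<bar>) * f X\<bar>)" by simp
    then show A: "(LINT X|lborel. \<bar>g X\<bar>) \<le> M" using G(4) unfolding M_def by linarith
    show "\<bar>LINT X|lborel. g X\<bar> \<le> M" using integral_abs_bound[of lborel g] A by linarith
  qed
  have parts: "M / k0 * \<tau> \<le> \<eta>" "M / (k0 * c) \<le> \<eta>"
  proof -
    have "0 \<le> M / k0 * \<tau>" using Mn k0(1) \<tau>(1) by (intro mult_nonneg_nonneg divide_nonneg_pos) simp_all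
    moreover have "0 \<le> M / (k0 * c)" using Mn k0(1) c by (intro divide_nonneg_pos mult_pos_pos)
    ultimately show "M / k0 * \<tau> \<le> \<eta>" "M / (k0 * c) \<le> \<eta>" using small(1) by linarith+
  qed
  show ?thesis unfolding v_def[symmetric]
  proof
    show "loc_bounded v"
    proof (rule loc_bounded_bounded)
      show "v \<in> borel_measurable borel" unfolding v using hm by measurable
      fix z
      have "\<bar>h (c * z)\<bar> \<le> B + B" using hb[of "c * z"] bdd(1)[of "c * z"] bdd(2)[of "c * z"] by linarith
      then have "\<bar>c * h (c * z)\<bar> \<le> c * (B + B)" using c by (intro abs_mult_le) auto
      then show "\<bar>v z\<bar> \<le> 1 / k0 * (c * (B + B))" unfolding v by (rule abs_mult_le[rotated]) (use k0 in simp)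
    qed
    show "integrable lborel v" unfolding v using contracted_integral(1)[OF hi c] by simp
    have mom: "\<bar>z\<bar> * \<bar>v z\<bar> = 1 / (k0 * c) * (c * (\<bar>c * z\<bar> * \<bar>h (c * z)\<bar>))" for z
      using c k0 by (simp add: v abs_mult)
    show "integrable lborel (\<lambda>s. \<bar>s\<bar> * \<bar>v s\<bar>)" unfolding mom by (rule integrable_mult_right, rule contracted_integral(1)[OF hmom c])
    have "(LINT s|lborel. \<bar>s\<bar> * \<bar>v s\<bar>) = 1 / (k0 * c) * (LINT s|lborel. c * (\<bar>c * s\<bar> * \<bar>h (c * s)\<bar>))"
      unfolding mom by (rule integral_mult_right_zero)
    also have "\<dots> = 1 / (k0 * c) * (LINT X|lborel. \<bar>X\<bar> * \<bar>h X\<bar>)"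
      unfolding contracted_integral(2)[OF hmom c] ..
    also have "\<dots> \<le> 1 / (k0 * c) * M" using hmomle k0 c by (intro mult_left_mono) auto
    finally show "(LINT s|lborel. \<bar>s\<bar> * \<bar>v s\<bar>) \<le> \<eta>" using parts(2) by simp
    have "(LINT s|lborel. v s) = 1 / k0 * (LINT s|lborel. c * h (c * s))" unfolding v by (rule integral_mult_right_zero)
    also have "\<dots> = 1 / k0 * (LINT X|lborel. h X)" unfolding contracted_integral(2)[OF hi c] ..
    also have "(LINT X|lborel. h X) = - (2 * k0) + \<tau> * (LINT X|lborel. g X)" unfolding h_def using F(2) G(2) k0 by simp
    finally have "(LINT s|lborel. v s) + 2 = (1 / k0 * \<tau>) * (LINT X|lborel. g X)" using k0 by (simp add: field_simps)
    moreover have "\<bar>(1 / k0 * \<tau>) * (LINT X|lborel. g X)\<bar> \<le> (1 / k0 * \<tau>) * M" using k0 \<tau> gint(1) by (intro abs_mult_le) auto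
    moreover have "(1 / k0 * \<tau>) * M = M / k0 * \<tau>" by simp
    ultimately show "\<bar>(LINT s|lborel. v s) + 2\<bar> \<le> \<eta>" using parts(1) by (simp only:)
    have vabs: "\<bar>v s\<bar> = 1 / k0 * (c * \<bar>h (c * s)\<bar>)" for s using c k0 by (simp add: v abs_mult)
    have "(LINT s|lborel. \<bar>v s\<bar>) = 1 / k0 * (LINT s|lborel. c * \<bar>h (c * s)\<bar>)" unfolding vabs by (rule integral_mult_right_zero)
    also have "\<dots> = 1 / k0 * (LINT X|lborel. \<bar>h X\<bar>)" unfolding contracted_integral(2)[OF integrable_abs[OF hi] c] ..
    also have "\<dots> \<le> 1 / k0 * (2 * k0 + \<tau> * M)"
    proof (rule mult_left_mono)
      have "(LINT X|lborel. \<bar>h X\<bar>) \<le> (LINT X|lborel. \<bar>f X\<bar> + \<tau> * \<bar>g X\<bar>)"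
        using hi F(2) G(2) hb by (intro integral_mono) auto
      also have "\<dots> = (LINT X|lborel. \<bar>f X\<bar>) + \<tau> * (LINT X|lborel. \<bar>g X\<bar>)" using F(2) G(2) by simp
      also have "(LINT X|lborel. \<bar>f X\<bar>) = (LINT X|lborel. - f X)" using neg by (intro Bochner_Integration.integral_cong) (simp_all add: abs_of_nonpos)
      also have "\<dots> = 2 * k0" using k0 by simp
      also have "2 * k0 + \<tau> * (LINT X|lborel. \<bar>g X\<bar>) \<le> 2 * k0 + \<tau> * M" using gint(2) \<tau> by simp
      finally show "(LINT X|lborel. \<bar>h X\<bar>) \<le> 2 * k0 + \<tau> * M" .
    qed (use k0 in simp)
    also have "\<dots> = 2 + M / k0 * \<tau>" using k0 by (simp add: field_simps)
    finally show "(LINT s|lborel. \<bar>v s\<bar>) \<le> 3" using parts(1) small(2) by simp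
    show "\<eta> \<le> 1 / 10 ^ 6" by (rule small(2))
  qed
qed

context regular_potential
begin

text \<open>With \<open>p = \<epsilon>\<^sup>\<alpha>\<close> all scales are rational functions of \<open>\<epsilon>\<close> and \<open>p\<close>; the inverse length \<open>\<kappa>\<close> is
\<open>k0 \<epsilon>\<^sup>2/p\<close>.\<close>

definition rescales_to_well :: "real \<Rightarrow> real \<Rightarrow> real \<Rightarrow> real \<Rightarrow> real \<Rightarrow> bool" where
  "rescales_to_well k0 C M \<epsilon> p \<longleftrightarrow>
    (\<exists>v W \<beta> b a d B. factorized_well v (M * (\<epsilon> * p + (\<epsilon> / p)\<^sup>2)) W \<beta> b a d (C * p\<^sup>2) B \<and>
      (\<forall>x. (k0 * \<epsilon>\<^sup>2 / p)\<^sup>2 * W (k0 * \<epsilon>\<^sup>2 / p * x) = D 0 (p * x) (x / \<epsilon>)) \<and>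
      (\<forall>x. (k0 * \<epsilon>\<^sup>2 / p)\<^sup>2 * v (k0 * \<epsilon>\<^sup>2 / p * x) = \<epsilon>\<^sup>2 * U0 (p * x) + \<epsilon> ^ 3 * p * U1 (p * x)))"

text \<open>The corrector lives in the variable \<open>v = x/\<epsilon>\<close>. It is transported to \<open>z = \<kappa> x\<close> with \<open>\<sigma> = 1/(\<kappa> \<epsilon>)\<close>, and
its bounds turn into multiples of \<open>p\<^sup>2\<close> because \<open>\<epsilon> \<le> p\<close>.\<close>

lemma rescaled_wells:
  assumes int: "integrable lborel (\<lambda>X. (1 + \<bar>X\<bar>) * U0 X)" "integrable lborel (\<lambda>X. (1 + \<bar>X\<bar>) * U1 X)"
    and k0: "k0 > 0" "(LINT X|lborel. U0 X) = - (2 * k0)"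
  shows "\<exists>C\<ge>0. \<exists>M\<ge>0. \<forall>\<epsilon> p. 0 < \<epsilon> \<and> \<epsilon> \<le> p \<and> p < 1 \<and> C * p\<^sup>2 \<le> 1 / 10 ^ 6 \<and> M * (\<epsilon> * p + (\<epsilon> / p)\<^sup>2) \<le> 1 / 10 ^ 6 \<longrightarrow>
    rescales_to_well k0 C M \<epsilon> p"
proof -
  obtain K where K: "K > 0" and cor: "\<And>\<epsilon> \<tau>. 0 < \<epsilon> \<and> \<epsilon> \<le> 1 \<and> 0 < \<tau> \<and> \<tau> \<le> \<epsilon> \<Longrightarrow> has_corrector K \<epsilon> \<tau>"
    using corrector by blast
  obtain BU where BU: "\<And>X. \<bar>U0 X\<bar> \<le> BU" "\<And>X. \<bar>U1 X\<bar> \<le> BU" using U_bounded by metis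
  obtain BD where BD: "\<And>X y. \<bar>D 0 X y\<bar> \<le> BD" using slowE[OF slow_D'(1)] by metis
  define C where "C = K * (1 + 2 / k0 + 1 / k0\<^sup>2)"
  define M0 where "M0 = (LINT X|lborel. \<bar>(1 + \<bar>X\<bar>) * U0 X\<bar>) + (LINT X|lborel. \<bar>(1 + \<bar>X\<bar>) * U1 X\<bar>)"
  define M where "M = M0 / k0 + M0"
  have M0: "0 \<le> M0" by (simp add: M0_def)
  have C0: "0 \<le> C" using K k0 by (simp add: C_def)
  have Mn: "0 \<le> M" using M0 k0 by (simp add: M_def)
  have Cge: "K \<le> C" "K * 2 / k0 \<le> C" "K / k0\<^sup>2 \<le> C"
    using K k0 by (simp_all add: C_def distrib_left add_nonneg_nonneg)
  show ?thesis
  proof (rule exI[of _ C], intro conjI C0, rule exI[of _ M], intro conjI Mn allI impI, elim conjE)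
    fix \<epsilon> p :: real
    assume e: "0 < \<epsilon>" and ep: "\<epsilon> \<le> p" and p1: "p < 1" and Cs: "C * p\<^sup>2 \<le> 1 / 10 ^ 6" and Ms: "M * (\<epsilon> * p + (\<epsilon> / p)\<^sup>2) \<le> 1 / 10 ^ 6"
    have p: "0 < p" using e ep by simp
    define \<kappa> \<tau> \<sigma> c where "\<kappa> = k0 * \<epsilon>\<^sup>2 / p" and "\<tau> = \<epsilon> * p" and "\<sigma> = p / (k0 * \<epsilon> ^ 3)" and "c = p\<^sup>2 / (k0 * \<epsilon>\<^sup>2)"
    have pos: "0 < \<kappa>" "0 < \<tau>" "0 < \<sigma>" "0 < c" using e p k0 by (simp_all add: \<kappa>_def \<tau>_def \<sigma>_def c_def)
    have \<tau>e: "\<tau> \<le> \<epsilon>" using e p p1 by (simp add: \<tau>_def mult_left_le)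
    have \<tau>1: "\<tau> \<le> 1" using \<tau>e ep p1 by simp
    have id: "\<tau> * \<sigma> = c" "\<sigma>\<^sup>2 * \<epsilon> ^ 4 = c / k0" "\<kappa> * \<sigma> = 1 / \<epsilon>" "c * \<kappa> = p" "\<kappa>\<^sup>2 * (\<sigma>\<^sup>2 * \<epsilon>\<^sup>2) = 1" "\<kappa>\<^sup>2 * (c / k0) = \<epsilon>\<^sup>2" "k0 * c = (p / \<epsilon>)\<^sup>2"
      using e p k0 by (simp_all add: \<kappa>_def \<tau>_def \<sigma>_def c_def field_simps power2_eq_square power3_eq_cube power4_eq_xxxx)
    obtain \<beta> a b d where B: "primitive \<beta> (\<lambda>v. b v - a v)"
     "primitive b (\<lambda>v. \<epsilon>\<^sup>2 * D 0 (\<tau> * v) v - (b v)\<^sup>2 - \<epsilon> ^ 4 * (U0 (\<tau> * v) + \<tau> * U1 (\<tau> * v)) - d v)"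
     "a \<in> borel_measurable borel" "d \<in> borel_measurable borel"
     and bd': "\<forall>v. \<bar>\<beta> v\<bar> \<le> K * \<epsilon>\<^sup>2 \<and> \<bar>a v\<bar> \<le> K * (\<epsilon>\<^sup>2 * \<tau> + \<epsilon> ^ 4) \<and> \<bar>d v\<bar> \<le> K * \<epsilon> ^ 6 \<and> \<bar>b v\<bar> \<le> K"
    proof -
      have c: "0 < \<epsilon> \<and> \<epsilon> \<le> 1 \<and> 0 < \<tau> \<and> \<tau> \<le> \<epsilon>" using e ep p1 pos(2) \<tau>e by simp
      show thesis by (insert cor[OF c, unfolded has_corrector_def], elim exE conjE) (rule that)
    qed
    have bd: "\<bar>\<beta> v\<bar> \<le> K * \<epsilon>\<^sup>2" "\<bar>a v\<bar> \<le> K * (\<epsilon>\<^sup>2 * \<tau> + \<epsilon> ^ 4)" "\<bar>d v\<bar> \<le> K * \<epsilon> ^ 6" "\<bar>b v\<bar> \<le> K" for v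
      using bd' by blast+
    define v where "v = (\<lambda>z. c / k0 * (U0 (c * z) + \<tau> * U1 (c * z)))"
    define W where "W z = \<sigma>\<^sup>2 * \<epsilon>\<^sup>2 * D 0 (c * z) (\<sigma> * z)" for z
    have ct: "\<tau> * (\<sigma> * z) = c * z" for z using id(1) by (simp flip: mult.assoc)
    have dw: "delta_well v (M * (\<epsilon> * p + (\<epsilon> / p)\<^sup>2))" unfolding v_def
    proof (rule concentrated_delta_well[OF int BU U0_nonpos k0 pos(2) \<tau>1 pos(4)])
      have 1: "M0 / (k0 * c) = M0 * (\<epsilon> / p)\<^sup>2" unfolding id(7) using e p by (simp add: power_divide)
      have m: "M0 / k0 \<le> M" "M0 \<le> M" using M0 k0(1) by (simp_all add: M_def)
      have 2: "M0 / k0 * \<tau> \<le> M * \<tau>" by (rule mult_right_mono[OF m(1)]) (use pos(2) in simp)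
      have 3: "M0 * (\<epsilon> / p)\<^sup>2 \<le> M * (\<epsilon> / p)\<^sup>2" by (rule mult_right_mono[OF m(2)]) simp
      show "((LINT X|lborel. \<bar>(1 + \<bar>X\<bar>) * U0 X\<bar>) + (LINT X|lborel. \<bar>(1 + \<bar>X\<bar>) * U1 X\<bar>)) / k0 * \<tau> +
         ((LINT X|lborel. \<bar>(1 + \<bar>X\<bar>) * U0 X\<bar>) + (LINT X|lborel. \<bar>(1 + \<bar>X\<bar>) * U1 X\<bar>)) / (k0 * c) \<le> M * (\<epsilon> * p + (\<epsilon> / p)\<^sup>2)"
        unfolding M0_def[symmetric] 1 distrib_left \<tau>_def[symmetric] by (rule add_mono[OF 2 3])
    qed (rule Ms)
    have e2: "\<epsilon>\<^sup>2 \<le> p\<^sup>2" using e ep by (intro power_mono) auto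
    define BB where "BB = \<sigma>\<^sup>2 * \<epsilon>\<^sup>2 * BD + \<sigma> * K + c / k0 * (BU + BU)"
    have n: "0 \<le> \<sigma>\<^sup>2 * \<epsilon>\<^sup>2 * BD" "0 \<le> \<sigma> * K" "0 \<le> c / k0 * (BU + BU)"
      using order_trans[OF abs_ge_zero BD[of 0 0]] order_trans[OF abs_ge_zero BU(1)[of 0]] K pos k0 by auto
    have fw: "factorized_well v (M * (\<epsilon> * p + (\<epsilon> / p)\<^sup>2)) W (\<lambda>z. \<beta> (\<sigma> * z)) (\<lambda>z. \<sigma> * b (\<sigma> * z)) (\<lambda>z. \<sigma> * a (\<sigma> * z)) (\<lambda>z. \<sigma>\<^sup>2 * d (\<sigma> * z)) (C * p\<^sup>2) BB"
    proof (intro factorized_well.intro dw factorized_well_axioms.intro)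
      have ps: "primitive (\<lambda>z. \<beta> (\<sigma> * z)) (\<lambda>z. \<sigma> * (b (\<sigma> * z) - a (\<sigma> * z)))" by (rule primitive_scale[OF B(1) pos(3)])
      then show "primitive (\<lambda>z. \<beta> (\<sigma> * z)) (\<lambda>z. \<sigma> * b (\<sigma> * z) - \<sigma> * a (\<sigma> * z))" by (simp only: right_diff_distrib)
      have "primitive (\<lambda>z. \<sigma> * b (\<sigma> * z)) (\<lambda>z. \<sigma> * (\<sigma> * (\<epsilon>\<^sup>2 * D 0 (\<tau> * (\<sigma> * z)) (\<sigma> * z) - (b (\<sigma> * z))\<^sup>2
         - \<epsilon> ^ 4 * (U0 (\<tau> * (\<sigma> * z)) + \<tau> * U1 (\<tau> * (\<sigma> * z))) - d (\<sigma> * z))))"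
        by (intro primitive_cmult primitive_scale[OF B(2) pos(3)])
      moreover have "\<sigma> * (\<sigma> * (\<epsilon>\<^sup>2 * D 0 (\<tau> * (\<sigma> * z)) (\<sigma> * z) - (b (\<sigma> * z))\<^sup>2
         - \<epsilon> ^ 4 * (U0 (\<tau> * (\<sigma> * z)) + \<tau> * U1 (\<tau> * (\<sigma> * z))) - d (\<sigma> * z)))
         = W z - (\<sigma> * b (\<sigma> * z))\<^sup>2 - v z - \<sigma>\<^sup>2 * d (\<sigma> * z)" for z
        unfolding W_def v_def ct id(2)[symmetric] by algebra
      ultimately show "primitive (\<lambda>z. \<sigma> * b (\<sigma> * z)) (\<lambda>z. W z - (\<sigma> * b (\<sigma> * z))\<^sup>2 - v z - \<sigma>\<^sup>2 * d (\<sigma> * z))" by (simp only:)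
      show "W \<in> borel_measurable borel"
      proof -
        have "(\<lambda>z. D 0 (c * z) (\<sigma> * z)) \<in> borel_measurable borel" by (rule measurable_compose2[OF slowD(1)[OF slow_D'(1)]]) auto
        then show ?thesis unfolding W_def by measurable
      qed
      show "\<bar>W z\<bar> \<le> BB" for z
      proof -
        have "\<bar>W z\<bar> \<le> \<sigma>\<^sup>2 * \<epsilon>\<^sup>2 * BD" unfolding W_def by (rule abs_mult_le[OF _ BD]) simp
        then show ?thesis using n unfolding BB_def by linarith
      qed
      show "\<bar>\<sigma> * b (\<sigma> * z)\<bar> \<le> BB" for z
      proof -
        have "\<bar>\<sigma> * b (\<sigma> * z)\<bar> \<le> \<sigma> * K" by (rule abs_mult_le[OF _ bd(4)]) (use pos in simp)
        then show ?thesis using n unfolding BB_def by linarith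
      qed
      show "\<bar>v z\<bar> \<le> BB" for z
      proof -
        have "\<bar>\<tau> * U1 (c * z)\<bar> \<le> 1 * BU" by (rule abs_mult_le[OF _ BU(2)]) (use pos \<tau>1 in simp)
        then have "\<bar>\<tau> * U1 (c * z)\<bar> \<le> BU" by simp
        from abs_add_le[OF BU(1) this] have "\<bar>U0 (c * z) + \<tau> * U1 (c * z)\<bar> \<le> BU + BU" .
        then have "\<bar>v z\<bar> \<le> c / k0 * (BU + BU)" unfolding v_def by (rule abs_mult_le[rotated]) (use pos(4) k0(1) in simp)
        then show ?thesis using n unfolding BB_def by linarith
      qed
      show "small_corrector (C * p\<^sup>2) (\<lambda>z. \<beta> (\<sigma> * z)) (\<lambda>z. \<sigma> * a (\<sigma> * z)) (\<lambda>z. \<sigma>\<^sup>2 * d (\<sigma> * z))"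
        unfolding small_corrector_def
      proof (intro conjI allI Cs)
        show "0 \<le> C * p\<^sup>2" using C0 by simp
        show "continuous_on UNIV (\<lambda>z. \<beta> (\<sigma> * z))" by (rule primitive_continuous[OF ps])
        show "(\<lambda>z. \<sigma> * a (\<sigma> * z)) \<in> borel_measurable borel" "(\<lambda>z. \<sigma>\<^sup>2 * d (\<sigma> * z)) \<in> borel_measurable borel" using B(3,4) by measurable
        fix z
        have "K * \<epsilon>\<^sup>2 \<le> C * p\<^sup>2" using Cge(1) e2 K C0 by (intro mult_mono) auto
        then show "\<bar>\<beta> (\<sigma> * z)\<bar> \<le> C * p\<^sup>2" using bd(1) order_trans by blast
        have "\<bar>\<sigma> * a (\<sigma> * z)\<bar> \<le> \<sigma> * (K * (\<epsilon>\<^sup>2 * \<tau> + \<epsilon> ^ 4))" by (rule abs_mult_le[OF _ bd(2)]) (use pos in simp)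
        also have "\<dots> = K / k0 * (p\<^sup>2 + p * \<epsilon>)" unfolding \<sigma>_def \<tau>_def using e k0 by (simp add: field_simps power2_eq_square power3_eq_cube power4_eq_xxxx)
        also have "\<dots> \<le> K / k0 * (2 * p\<^sup>2)" using K k0 ep p by (intro mult_left_mono) (auto simp: power2_eq_square)
        also have "\<dots> = K * 2 / k0 * p\<^sup>2" by simp
        also have "\<dots> \<le> C * p\<^sup>2" by (rule mult_right_mono[OF Cge(2)]) simp
        finally show "\<bar>\<sigma> * a (\<sigma> * z)\<bar> \<le> C * p\<^sup>2" .
        have "\<bar>\<sigma>\<^sup>2 * d (\<sigma> * z)\<bar> \<le> \<sigma>\<^sup>2 * (K * \<epsilon> ^ 6)" by (rule abs_mult_le[OF _ bd(3)]) simp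
        also have "\<dots> = K / k0\<^sup>2 * p\<^sup>2" unfolding \<sigma>_def using e k0 by (simp add: power_divide power_mult_distrib flip: power_mult)
        also have "\<dots> \<le> C * p\<^sup>2" by (rule mult_right_mono[OF Cge(3)]) simp
        finally show "\<bar>\<sigma>\<^sup>2 * d (\<sigma> * z)\<bar> \<le> C * p\<^sup>2" .
      qed
    qed
    have s1: "\<sigma> * (\<kappa> * x) = x / \<epsilon>" for x using id(3) by (simp add: mult.commute[of \<sigma>] flip: mult.assoc)
    have s2: "c * (\<kappa> * x) = p * x" for x using id(4) by (simp flip: mult.assoc)
    have W: "\<kappa>\<^sup>2 * W (\<kappa> * x) = D 0 (p * x) (x / \<epsilon>)" for x
    proof -
      have "\<kappa>\<^sup>2 * W (\<kappa> * x) = (\<kappa>\<^sup>2 * (\<sigma>\<^sup>2 * \<epsilon>\<^sup>2)) * D 0 (p * x) (x / \<epsilon>)" unfolding W_def s1 s2 by (simp only: mult.assoc)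
      then show ?thesis unfolding id(5) by simp
    qed
    have v: "\<kappa>\<^sup>2 * v (\<kappa> * x) = \<epsilon>\<^sup>2 * U0 (p * x) + \<epsilon> ^ 3 * p * U1 (p * x)" for x
    proof -
      have "\<kappa>\<^sup>2 * v (\<kappa> * x) = (\<kappa>\<^sup>2 * (c / k0)) * (U0 (p * x) + \<tau> * U1 (p * x))" unfolding v_def s2 by (simp only: mult.assoc)
      then show ?thesis unfolding id(6) \<tau>_def by (simp add: power2_eq_square power3_eq_cube algebra_simps)
    qed
    show "rescales_to_well k0 C M \<epsilon> p"
      unfolding rescales_to_well_def \<kappa>_def[symmetric]
      by (rule exI[of _ v], rule exI[of _ W], intro exI conjI, rule fw, rule allI, rule W, rule allI, rule v)
  qed
qed

end

lemma powr_eventually_small: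
  fixes K r s :: real
  assumes "0 \<le> K" "0 < r" "0 < s"
  shows "\<exists>\<epsilon>\<^sub>0>0. \<forall>\<epsilon>. 0 < \<epsilon> \<and> \<epsilon> < \<epsilon>\<^sub>0 \<longrightarrow> K * \<epsilon> powr s \<le> r"
proof (intro exI conjI allI impI)
  let ?e = "(r / (K + 1)) powr (1 / s)"
  have pos: "0 < r / (K + 1)" using assms by simp
  then show "0 < ?e" using assms by simp
  fix \<epsilon> assume e: "0 < \<epsilon> \<and> \<epsilon> < ?e"
  then have "\<epsilon> powr s \<le> ?e powr s" using assms by (intro powr_mono2) auto
  also have "\<dots> = r / (K + 1)" using pos assms by (simp add: powr_powr)
  finally have "K * \<epsilon> powr s \<le> (K + 1) * (r / (K + 1))" using assms by (intro mult_mono) auto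
  then show "K * \<epsilon> powr s \<le> r" using assms by simp
qed

text \<open>For almost every \<open>x\<close> the fast variable \<open>x/\<epsilon>\<close> avoids the exceptional set of \<open>y\<close>.\<close>

lemma null_set_preimage_scale:
  assumes N: "N \<in> null_sets lborel" and c: "c \<noteq> (0::real)"
  shows "AE x in lborel. c * x \<notin> N"
proof -
  have m: "N \<in> sets borel" using null_setsD2[OF N] by simp
  have "AE x in lborel. 0 + c * x \<notin> N"
    by (rule AE_borel_affine[OF c]) (use m AE_not_in[OF N] in auto)
  then show ?thesis by simp
qed

theorem proposition1p9:
  fixes q :: "real \<Rightarrow> real \<Rightarrow> real" and \<alpha> :: real
  assumes "0 < \<alpha>" and "\<alpha> < 1"
    and "standing_assumptions q"
    and "\<not> (AE X in lborel. V0 q X = 0)"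
    and "integrable lborel (\<lambda>X. (1 + \<bar>X\<bar>) * V0 q X)"
    and "integrable lborel (\<lambda>X. (1 + \<bar>X\<bar>) * V1 q X)"
  shows "\<exists>\<epsilon>\<^sub>0>0. \<exists>C. \<forall>\<epsilon>\<in>{0<..<\<epsilon>\<^sub>0}. \<exists>lam \<psi> \<mu> \<phi>.
     lam < 0 \<and>
     simple_eigenvalue (osc_potential q \<alpha> \<epsilon>) lam \<and>
     \<bar>lam - (- (1/4) * \<epsilon> powr (4 - 2 * \<alpha>) * (LINT X|lborel. V0 q X)\<^sup>2)\<bar>
       \<le> C * \<epsilon> powr (min 4 (6 - 4 * \<alpha>)) \<and>
     normalized_eigenfunction (osc_potential q \<alpha> \<epsilon>) lam \<psi> \<and>
     {\<nu>. \<nu> < 0 \<and> eigenvalue (eff_potential q \<alpha> \<epsilon>) \<nu>} = {\<mu>} \<and>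
     simple_eigenvalue (eff_potential q \<alpha> \<epsilon>) \<mu> \<and>
     normalized_eigenfunction (eff_potential q \<alpha> \<epsilon>) \<mu> \<phi> \<and>
     L2_norm (\<lambda>x. \<psi> x - \<phi> x) \<le> C * \<epsilon> powr (2 * \<alpha>) \<and>
     L2_norm (\<lambda>x. \<phi> x -
         (\<epsilon> powr (2 - \<alpha>) / 2 * (LINT X|lborel. \<bar>V0 q X\<bar>)) powr (1/2) *
         exp (\<bar>x\<bar> * (\<epsilon> powr (2 - \<alpha>) / 2) * (LINT X|lborel. V0 q X)))
       \<le> C * \<epsilon> powr (min (4/3 * (1 - \<alpha>)) (1 + \<alpha>)) \<and>
     (\<forall>\<nu>. \<nu> < 0 \<and> \<nu> \<noteq> lam \<and> eigenvalue (osc_potential q \<alpha> \<epsilon>) \<nu> \<longrightarrow> \<bar>\<nu>\<bar> \<le> C * \<epsilon> ^ 4)"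
proof -
  have q: "q \<in> W_inf (Suc 4)" and mz: "\<And>X. (LINT y:{0..1}|lborel. q X y) = 0"
    using assms(3) by (simp_all add: standing_assumptions_def)
  obtain D N where N: "N \<in> null_sets lborel" and q_eq: "\<And>X y. y \<notin> N \<Longrightarrow> q X y = D 0 X y"
    and slow: "\<And>j. j < 4 \<Longrightarrow> slow (D j) (D (Suc j))"
    using W_inf_regular_representative[OF q] by metis
  have qm: "(\<lambda>(X, y). q X y) \<in> borel_measurable borel" using q by (simp add: W_inf_def)
  have q_meas: "(\<lambda>y. q X y) \<in> borel_measurable borel" for X by (rule measurable_compose2[OF qm]) auto
  interpret regular_potential D
  proof
    show "slow (D j) (D (Suc j))" if "j < 4" for j by (rule slow[OF that])
    fix X
    have dm: "(\<lambda>y. D 0 X y) \<in> borel_measurable borel" by (rule slow_measurable_slice[OF slow[of 0]]) simp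
    have "conv (\<lambda>_. 1) (D 0) X 0 = (LINT y:{0..1}|lborel. D 0 X y)" by (simp add: conv_def)
    also have "\<dots> = (LINT y:{0..1}|lborel. q X y)"
      unfolding set_lebesgue_integral_def
    proof (rule integral_cong_AE)
      show "AE y in lborel. indicat_real {0..1} y *\<^sub>R D 0 X y = indicat_real {0..1} y *\<^sub>R q X y"
        using AE_not_in[OF N] by eventually_elim (simp add: q_eq)
    qed (use dm q_meas in measurable)
    finally show "conv (\<lambda>_. 1) (D 0) X 0 = 0" by (simp only: mz)
  qed
  have V0: "V0 q = U0" by (rule ext, rule V0_eq[OF N q_eq q_meas])
  have V1: "V1 q = U1" by (rule ext, rule V1_eq[OF N q_eq q_meas])
  note int = assms(5,6)[unfolded V0 V1]
  note iU0 = weighted_integrableD(2)[OF int(1)]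
  \<comment> \<open>\<open>k0 \<epsilon>\<^sup>2\<^sup>-\<^sup>\<alpha>\<close> is the decay rate of the limiting eigenfunction.\<close>
  define k0 where "k0 = - (LINT X|lborel. U0 X) / 2"
  have I: "(LINT X|lborel. U0 X) = - (2 * k0)" by (simp add: k0_def)
  have abs0: "(LINT X|lborel. \<bar>U0 X\<bar>) = 2 * k0"
  proof -
    have "(LINT X|lborel. \<bar>U0 X\<bar>) = (LINT X|lborel. - U0 X)" by (simp add: abs_of_nonpos U0_nonpos)
    then show ?thesis by (simp add: I)
  qed
  have k0: "k0 > 0"
  proof -
    have "(LINT X|lborel. \<bar>U0 X\<bar>) \<noteq> 0"
    proof
      assume "(LINT X|lborel. \<bar>U0 X\<bar>) = 0"
      then have "AE X in lborel. \<bar>U0 X\<bar> = 0"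
        using integral_nonneg_eq_0_iff_AE[OF integrable_abs[OF iU0]] by simp
      then have "AE X in lborel. V0 q X = 0" unfolding V0 by eventually_elim simp
      then show False using assms(4) by contradiction
    qed
    moreover have "0 \<le> (LINT X|lborel. \<bar>U0 X\<bar>)" by simp
    ultimately show ?thesis unfolding abs0 by linarith
  qed
  obtain C M where C: "0 \<le> C" and M: "0 \<le> M"
    and wells: "\<And>\<epsilon> p. 0 < \<epsilon> \<and> \<epsilon> \<le> p \<and> p < 1 \<and> C * p\<^sup>2 \<le> 1 / 10 ^ 6 \<and> M * (\<epsilon> * p + (\<epsilon> / p)\<^sup>2) \<le> 1 / 10 ^ 6 \<Longrightarrow> rescales_to_well k0 C M \<epsilon> p"
    using rescaled_wells[OF int k0 I] by blast
  have sm: "0 < 1 / (2 * 10 ^ 6 :: real)" by simp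
  obtain e1 where e1: "e1 > 0" "\<And>\<epsilon>. 0 < \<epsilon> \<Longrightarrow> \<epsilon> < e1 \<Longrightarrow> C * \<epsilon> powr (2 * \<alpha>) \<le> 1 / (2 * 10 ^ 6)"
    using powr_eventually_small[OF C sm, of "2 * \<alpha>"] assms(1) by auto
  obtain e2 where e2: "e2 > 0" "\<And>\<epsilon>. 0 < \<epsilon> \<Longrightarrow> \<epsilon> < e2 \<Longrightarrow> M * \<epsilon> powr (1 + \<alpha>) \<le> 1 / (2 * 10 ^ 6)"
    using powr_eventually_small[OF M sm, of "1 + \<alpha>"] assms(1) by auto
  obtain e3 where e3: "e3 > 0" "\<And>\<epsilon>. 0 < \<epsilon> \<Longrightarrow> \<epsilon> < e3 \<Longrightarrow> M * \<epsilon> powr (2 - 2 * \<alpha>) \<le> 1 / (2 * 10 ^ 6)"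
    using powr_eventually_small[OF M sm, of "2 - 2 * \<alpha>"] assms(2) by auto
  define \<epsilon>\<^sub>0 where "\<epsilon>\<^sub>0 = min 1 (min e1 (min e2 e3))"
  define K1 K2 K3 K4 where "K1 = 1500 * k0\<^sup>2 * (C + 2 * M)" and "K2 = 500000 * C" and "K3 = 1000000 * M" and "K4 = 2 * C * k0\<^sup>2"
  have Kn: "0 \<le> K1" "0 \<le> K2" "0 \<le> K3" "0 \<le> K4" using C M by (simp_all add: K1_def K2_def K3_def K4_def)
  define K where "K = K1 + K2 + K3 + K4"
  have Kle: "K1 * r \<le> K * r" "K2 * r \<le> K * r" "K3 * r \<le> K * r" "K4 * r \<le> K * r" if "0 \<le> r" for r
    by (rule mult_right_mono; use Kn that in \<open>simp add: K_def\<close>)+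
  show ?thesis
  proof (rule exI[of _ \<epsilon>\<^sub>0], rule conjI, goal_cases)
    case 1
    show ?case using e1 e2 e3 by (simp add: \<epsilon>\<^sub>0_def)
  next
    case 2
    show ?case
    proof (rule exI[of _ K], rule ballI, goal_cases)
      case (1 \<epsilon>)
      then have e: "0 < \<epsilon>" "\<epsilon> < 1" "\<epsilon> < e1" "\<epsilon> < e2" "\<epsilon> < e3" by (simp_all add: \<epsilon>\<^sub>0_def)
      define p where "p = \<epsilon> powr \<alpha>"
      have p: "0 < p" using e by (simp add: p_def)
      have ep: "\<epsilon> \<le> p" using powr_mono'[of \<alpha> 1 \<epsilon>] assms(2) e by (simp add: p_def)
      have p1: "p < 1" using powr_less_mono2[of \<alpha> \<epsilon> 1] assms(1) e by (simp add: p_def)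
      have p2: "p\<^sup>2 = \<epsilon> powr (2 * \<alpha>)" unfolding p_def power2_eq_square by (simp flip: powr_add)
      have epp: "\<epsilon> * p = \<epsilon> powr (1 + \<alpha>)" using e by (simp add: p_def powr_add)
      have "\<epsilon> / p = \<epsilon> powr (1 - \<alpha>)" using e by (simp add: p_def powr_diff)
      then have dp: "(\<epsilon> / p)\<^sup>2 = \<epsilon> powr (2 - 2 * \<alpha>)" unfolding power2_eq_square by (simp flip: powr_add)
      have e3p: "\<epsilon> ^ 3 * p = \<epsilon> powr (3 + \<alpha>)" using e by (simp add: p_def powr_add)
      define \<kappa> where "\<kappa> = k0 * \<epsilon>\<^sup>2 / p"
      have \<kappa>: "0 < \<kappa>" using k0 e p by (simp add: \<kappa>_def)
      have \<kappa>_powr: "\<kappa> = k0 * \<epsilon> powr (2 - \<alpha>)" using e by (simp add: \<kappa>_def p_def powr_diff)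
      have \<kappa>2: "\<kappa>\<^sup>2 = k0\<^sup>2 * \<epsilon> powr (4 - 2 * \<alpha>)" unfolding \<kappa>_powr power_mult_distrib power2_eq_square[of "_ powr _"] by (simp flip: powr_add)
      define t \<eta> where "t = C * p\<^sup>2" and "\<eta> = M * (\<epsilon> * p + (\<epsilon> / p)\<^sup>2)"
      have ts: "t \<le> 1 / 10 ^ 6" unfolding t_def p2 by (rule order_trans[OF e1(2)[OF e(1,3)]]) simp
      have \<eta>s: "\<eta> \<le> 1 / 10 ^ 6" unfolding \<eta>_def epp dp distrib_left
        by (rule order_trans[OF add_mono[OF e2(2)[OF e(1,4)] e3(2)[OF e(1,5)]]]) simp
      have pre: "0 < \<epsilon> \<and> \<epsilon> \<le> p \<and> p < 1 \<and> C * p\<^sup>2 \<le> 1 / 10 ^ 6 \<and> M * (\<epsilon> * p + (\<epsilon> / p)\<^sup>2) \<le> 1 / 10 ^ 6"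
        using e(1) ep p1 ts \<eta>s unfolding t_def \<eta>_def by (intro conjI)
      obtain v W \<beta> b a d B where fw: "factorized_well v \<eta> W \<beta> b a d t B"
        and W: "\<forall>x. \<kappa>\<^sup>2 * W (\<kappa> * x) = D 0 (p * x) (x / \<epsilon>)"
        and v: "\<forall>x. \<kappa>\<^sup>2 * v (\<kappa> * x) = \<epsilon>\<^sup>2 * U0 (p * x) + \<epsilon> ^ 3 * p * U1 (p * x)"
        by (insert wells[OF pre, unfolded rescales_to_well_def, folded \<kappa>_def t_def \<eta>_def], elim exE conjE) (rule that)
      have osc: "AE x in lborel. osc_potential q \<alpha> \<epsilon> x = \<kappa>\<^sup>2 * W (\<kappa> * x)"
      proof -
        have "AE x in lborel. 1 / \<epsilon> * x \<notin> N" by (rule null_set_preimage_scale[OF N]) (use e in simp)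
        then show ?thesis
        proof eventually_elim
          case (elim x)
          then have "q (p * x) (x / \<epsilon>) = D 0 (p * x) (x / \<epsilon>)" by (intro q_eq) simp
          then show ?case using W by (simp add: osc_potential_def p_def)
        qed
      qed
      have eff: "eff_potential q \<alpha> \<epsilon> x = \<kappa>\<^sup>2 * v (\<kappa> * x)" for x
        unfolding eff_potential_def V0 V1 using v by (simp add: p_def[symmetric] e3p)
      from factorized_well.comparison_with_reduced_well[OF fw \<kappa> osc eff]
      obtain lam \<psi> \<mu> \<phi> where R: "lam < 0" "simple_eigenvalue (osc_potential q \<alpha> \<epsilon>) lam" "\<bar>lam + \<kappa>\<^sup>2\<bar> \<le> 1500 * (t + \<eta>) * \<kappa>\<^sup>2"
        "normalized_eigenfunction (osc_potential q \<alpha> \<epsilon>) lam \<psi>" "{\<nu>. \<nu> < 0 \<and> eigenvalue (eff_potential q \<alpha> \<epsilon>) \<nu>} = {\<mu>}"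
        "simple_eigenvalue (eff_potential q \<alpha> \<epsilon>) \<mu>" "normalized_eigenfunction (eff_potential q \<alpha> \<epsilon>) \<mu> \<phi>"
        "L2_norm (\<lambda>x. \<psi> x - \<phi> x) \<le> 500000 * t"
        "L2_norm (\<lambda>x. \<phi> x - sqrt \<kappa> * exp (- (\<kappa> * \<bar>x\<bar>))) \<le> 500000 * \<eta>"
        "\<forall>\<nu>. \<nu> < 0 \<and> \<nu> \<noteq> lam \<and> eigenvalue (osc_potential q \<alpha> \<epsilon>) \<nu> \<longrightarrow> \<bar>\<nu>\<bar> \<le> 2 * t * \<kappa>\<^sup>2"
        by (elim exE conjE) (rule that)
      have mono: "\<epsilon> powr r \<le> \<epsilon> powr s" if "s \<le> r" for r s using powr_mono'[OF that, of \<epsilon>] e by simp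
      have t\<kappa>: "t * \<kappa>\<^sup>2 = C * k0\<^sup>2 * \<epsilon> ^ 4"
      proof -
        have "\<epsilon> powr (2 * \<alpha>) * \<epsilon> powr (4 - 2 * \<alpha>) = \<epsilon> powr 4" by (simp flip: powr_add)
        also have "\<dots> = \<epsilon> ^ 4" using e by simp
        finally show ?thesis unfolding t_def p2 \<kappa>2 by (simp add: mult_ac)
      qed
      have 1: "\<bar>lam - (- (1/4) * \<epsilon> powr (4 - 2 * \<alpha>) * (LINT X|lborel. V0 q X)\<^sup>2)\<bar> \<le> K * \<epsilon> powr (min 4 (6 - 4 * \<alpha>))"
      proof -
        let ?E = "\<epsilon> powr (min 4 (6 - 4 * \<alpha>))"
        have "(1/4) * \<epsilon> powr (4 - 2 * \<alpha>) * (LINT X|lborel. V0 q X)\<^sup>2 = \<kappa>\<^sup>2" unfolding V0 I \<kappa>2 by (simp add: power2_eq_square)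
        then have eq: "lam - (- (1/4) * \<epsilon> powr (4 - 2 * \<alpha>) * (LINT X|lborel. V0 q X)\<^sup>2) = lam + \<kappa>\<^sup>2" by simp
        have "\<epsilon> ^ 4 = \<epsilon> powr 4" using e by simp
        also have "\<dots> \<le> ?E" by (rule mono) simp
        finally have a: "\<epsilon> ^ 4 \<le> ?E" .
        \<comment> \<open>\<open>\<kappa>\<^sup>2 \<eta>\<close> has the two contributions \<open>\<epsilon>\<^sup>5\<^sup>-\<^sup>\<alpha>\<close>, which is absorbed by \<open>\<epsilon>\<^sup>4\<close>, and \<open>\<epsilon>\<^sup>6\<^sup>-\<^sup>4\<^sup>\<alpha>\<close>.\<close>
        have b: "\<epsilon> powr (5 - \<alpha>) \<le> ?E" "\<epsilon> powr (6 - 4 * \<alpha>) \<le> ?E" using assms(2) by (auto intro!: mono)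
        have "(\<epsilon> powr (1 + \<alpha>) + \<epsilon> powr (2 - 2 * \<alpha>)) * \<epsilon> powr (4 - 2 * \<alpha>) = \<epsilon> powr (5 - \<alpha>) + \<epsilon> powr (6 - 4 * \<alpha>)"
          unfolding distrib_right by (simp flip: powr_add)
        then have "\<eta> * \<kappa>\<^sup>2 = M * k0\<^sup>2 * (\<epsilon> powr (5 - \<alpha>) + \<epsilon> powr (6 - 4 * \<alpha>))"
          unfolding \<eta>_def epp dp \<kappa>2 by (metis (no_types, opaque_lifting) mult.assoc mult.left_commute)
        also have "\<dots> \<le> M * k0\<^sup>2 * (2 * ?E)" using b M by (intro mult_left_mono) auto
        finally have c: "\<eta> * \<kappa>\<^sup>2 \<le> M * k0\<^sup>2 * (2 * ?E)" .
        have d: "t * \<kappa>\<^sup>2 \<le> C * k0\<^sup>2 * ?E" unfolding t\<kappa> using a C by (intro mult_left_mono) auto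
        have "1500 * (t + \<eta>) * \<kappa>\<^sup>2 = 1500 * (t * \<kappa>\<^sup>2 + \<eta> * \<kappa>\<^sup>2)" by algebra
        also have "\<dots> \<le> 1500 * (C * k0\<^sup>2 * ?E + M * k0\<^sup>2 * (2 * ?E))" using c d by simp
        also have "\<dots> = K1 * ?E" unfolding K1_def by algebra
        also have "\<dots> \<le> K * ?E" by (rule Kle) simp
        finally show ?thesis unfolding eq using R(3) by (rule order_trans[rotated])
      qed
      have 2: "L2_norm (\<lambda>x. \<psi> x - \<phi> x) \<le> K * \<epsilon> powr (2 * \<alpha>)"
      proof -
        have "500000 * t = K2 * \<epsilon> powr (2 * \<alpha>)" by (simp add: t_def p2 K2_def)
        then show ?thesis using R(8) Kle(2)[of "\<epsilon> powr (2 * \<alpha>)"] by simp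
      qed
      have 3: "L2_norm (\<lambda>x. \<phi> x - (\<epsilon> powr (2 - \<alpha>) / 2 * (LINT X|lborel. \<bar>V0 q X\<bar>)) powr (1/2) *
         exp (\<bar>x\<bar> * (\<epsilon> powr (2 - \<alpha>) / 2) * (LINT X|lborel. V0 q X))) \<le> K * \<epsilon> powr (min (4/3 * (1 - \<alpha>)) (1 + \<alpha>))"
      proof -
        let ?E = "\<epsilon> powr (min (4/3 * (1 - \<alpha>)) (1 + \<alpha>))"
        have "\<epsilon> powr (2 - \<alpha>) / 2 * (LINT X|lborel. \<bar>V0 q X\<bar>) = \<kappa>" unfolding V0 abs0 \<kappa>_powr by simp
        then have s: "(\<epsilon> powr (2 - \<alpha>) / 2 * (LINT X|lborel. \<bar>V0 q X\<bar>)) powr (1/2) = sqrt \<kappa>" using \<kappa> by (simp add: powr_half_sqrt)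
        have x: "\<bar>x\<bar> * (\<epsilon> powr (2 - \<alpha>) / 2) * (LINT X|lborel. V0 q X) = - (\<kappa> * \<bar>x\<bar>)" for x :: real unfolding V0 I \<kappa>_powr by simp
        have "\<epsilon> powr (1 + \<alpha>) \<le> ?E" by (rule mono) simp
        moreover have "\<epsilon> powr (2 - 2 * \<alpha>) \<le> ?E"
        proof (rule mono)
          have "4/3 * (1 - \<alpha>) \<le> 2 - 2 * \<alpha>" using assms(2) by simp
          then show "min (4/3 * (1 - \<alpha>)) (1 + \<alpha>) \<le> 2 - 2 * \<alpha>" by (rule min.coboundedI1)
        qed
        ultimately have "\<eta> \<le> M * (2 * ?E)" unfolding \<eta>_def epp dp using M by (intro mult_left_mono) auto
        then have "500000 * \<eta> \<le> K3 * ?E" by (simp add: K3_def)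
        also have "\<dots> \<le> K * ?E" by (rule Kle) simp
        finally show ?thesis unfolding s x using R(9) by (rule order_trans[rotated])
      qed
      have 4: "\<forall>\<nu>. \<nu> < 0 \<and> \<nu> \<noteq> lam \<and> eigenvalue (osc_potential q \<alpha> \<epsilon>) \<nu> \<longrightarrow> \<bar>\<nu>\<bar> \<le> K * \<epsilon> ^ 4"
      proof (intro allI impI)
        fix \<nu> assume "\<nu> < 0 \<and> \<nu> \<noteq> lam \<and> eigenvalue (osc_potential q \<alpha> \<epsilon>) \<nu>"
        then have "\<bar>\<nu>\<bar> \<le> 2 * t * \<kappa>\<^sup>2" using R(10) by blast
        also have "2 * t * \<kappa>\<^sup>2 = K4 * \<epsilon> ^ 4" using t\<kappa> by (simp add: K4_def)
        also have "\<dots> \<le> K * \<epsilon> ^ 4" by (rule Kle) (use e in simp)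
        finally show "\<bar>\<nu>\<bar> \<le> K * \<epsilon> ^ 4" .
      qed
      show ?case
        by (rule exI[of _ lam], rule exI[of _ \<psi>], rule exI[of _ \<mu>], rule exI[of _ \<phi>], intro conjI R(1,2,4,5,6,7) 1 2 3 4)
    qed
  qed
qed

end
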